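(* Up to projective transformation (equivalently, up to equisingular deformation), there are exactly $18$ maximal reducible plane sextics $B\subset\mathbb{P}^2$ that have only simple singularities and have a singular point of type $\mathbf{E}_8$. They realize exactly $17$ sets of singularities, namely: $\mathbf{E}_8\oplus\mathbf{A}_5\oplus2\mathbf{A}_3$, $\mathbf{E}_8\oplus\mathbf{A}_7\oplus\mathbf{A}_3\oplus\mathbf{A}_1$, $\mathbf{E}_8\oplus\mathbf{A}_7\oplus\mathbf{A}_2\oplus2\mathbf{A}_1$, $\mathbf{E}_8\oplus\mathbf{A}_5\oplus\mathbf{A}_4\oplus2\mathbf{A}_1$, $\mathbf{E}_8\oplus\mathbf{A}_5\oplus\mathbf{A}_3\oplus\mathbf{A}_2\oplus\mathbf{A}_1$, $\mathbf{E}_8\oplus\mathbf{A}_4\oplus2\mathbf{A}_3\oplus\mathbf{A}_1$, $\mathbf{E}_8\oplus\mathbf{A}_9\oplus\mathbf{A}_2$, $\mathbf{E}_8\oplus\mathbf{A}_9\oplus2\mathbf{A}_1$, $\mathbf{E}_8\oplus\mathbf{D}_8\oplus\mathbf{A}_2\oplus\mathbf{A}_1$, $\mathbf{E}_8\oplus\mathbf{D}_7\oplus\mathbf{A}_3\oplus\mathbf{A}_1$, $\mathbf{E}_8\oplus\mathbf{D}_6\oplus\mathbf{A}_3\oplus\mathbf{A}_2$, $\mathbf{E}_8\oplus\mathbf{D}_{10}\oplus\mathbf{A}_1$, $\mathbf{E}_8\oplus\mathbf{D}_6\oplus\mathbf{A}_5$, $\mathbf{E}_8\oplus\mathbf{D}_5\oplus\mathbf{A}_5\oplus\mathbf{A}_1$,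 $\mathbf{E}_8\oplus\mathbf{E}_7\oplus\mathbf{A}_3\oplus\mathbf{A}_1$, $\mathbf{E}_8\oplus\mathbf{D}_6\oplus\mathbf{D}_5$, $\mathbf{E}_8\oplus\mathbf{E}_7\oplus\mathbf{D}_4$.
   Context: All varieties are over $\mathbb{C}$. A plane sextic is a reduced curve $B\subset\mathbb{P}^2$ of degree $6$. Simple singularities are the ADE singularities $\mathbf{A}_n,\mathbf{D}_n,\mathbf{E}_6,\mathbf{E}_7,\mathbf{E}_8$; a set of singularities is written as a direct sum, $k\mathbf{X}$ meaning $k$ points of type $\mathbf{X}$. For a sextic with simple singularities only, the total Milnor number $\mu(B)$ satisfies $\mu(B)\le19$; $B$ is maximal if $\mu(B)=19$. Maximal sextics are rigid: two of them are equisingular deformation equivalent iff they are related by a projective transformation. *)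

theory Defs
  imports "HOL-Analysis.Analysis" "HOL-Library.Multiset"
begin

definition pt3 :: "complex \<Rightarrow> complex \<Rightarrow> complex \<Rightarrow> complex^3" where
  "pt3 a b c = (\<chi> i. if i = 1 then a else if i = 2 then b else c)"

definition hom_poly_fun :: "nat \<Rightarrow> (complex^3 \<Rightarrow> complex) \<Rightarrow> bool" where
  "hom_poly_fun d F \<longleftrightarrow> (\<exists>c :: nat \<Rightarrow> nat \<Rightarrow> complex. \<forall>x.
      F x = (\<Sum>i\<le>d. \<Sum>j\<le>d - i. c i j * (x$1)^i * (x$2)^j * (x$3)^(d - i - j)))"

text \<open>A plane sextic is given by a nonzero homogeneous polynomial of degree 6 (its equation,
  determined by the reduced curve up to a nonzero scalar).\<close>
definition sextic_eq :: "(complex^3 \<Rightarrow> complex) \<Rightarrow> bool" where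
  "sextic_eq F \<longleftrightarrow> hom_poly_fun 6 F \<and> F \<noteq> (\<lambda>_. 0)"

definition reduced_eq :: "(complex^3 \<Rightarrow> complex) \<Rightarrow> bool" where
  "reduced_eq F \<longleftrightarrow> \<not> (\<exists>a b G H. a \<ge> 1 \<and> 2 * a + b = 6 \<and> hom_poly_fun a G \<and> G \<noteq> (\<lambda>_. 0)
      \<and> hom_poly_fun b H \<and> (\<forall>x. F x = (G x)^2 * H x))"

definition reducible_eq :: "(complex^3 \<Rightarrow> complex) \<Rightarrow> bool" where
  "reducible_eq F \<longleftrightarrow> (\<exists>a b G H. a \<ge> 1 \<and> b \<ge> 1 \<and> a + b = 6 \<and> hom_poly_fun a G
      \<and> hom_poly_fun b H \<and> (\<forall>x. F x = G x * H x))"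

definition proj_pt :: "complex^3 \<Rightarrow> (complex^3) set" where
  "proj_pt p = {c *s p | c. True}"

definition sing_pts :: "(complex^3 \<Rightarrow> complex) \<Rightarrow> (complex^3) set set" where
  "sing_pts F = {proj_pt p | p. p \<noteq> 0 \<and> F p = 0 \<and> (F has_derivative (\<lambda>_. 0)) (at p)}"

definition holo2_on :: "(complex \<times> complex) set \<Rightarrow> (complex \<times> complex \<Rightarrow> complex) \<Rightarrow> bool" where
  "holo2_on U f \<longleftrightarrow> open U \<and> (\<forall>z\<in>U. \<exists>a b.
      (f has_derivative (\<lambda>(w1, w2). a * w1 + b * w2)) (at z))"

definition germ_equiv :: "(complex \<times> complex \<Rightarrow> complex) \<Rightarrow> (complex \<times> complex \<Rightarrow> complex) \<Rightarrow> bool" where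
  "germ_equiv f g \<longleftrightarrow> (\<exists>U \<phi>1 \<phi>2 \<psi>1 \<psi>2 u.
      (0, 0) \<in> U \<and> holo2_on U \<phi>1 \<and> holo2_on U \<phi>2 \<and> holo2_on U u \<and>
      (\<phi>1 (0, 0), \<phi>2 (0, 0)) = (0, 0) \<and> u (0, 0) \<noteq> 0 \<and>
      inj_on (\<lambda>z. (\<phi>1 z, \<phi>2 z)) U \<and>
      holo2_on ((\<lambda>z. (\<phi>1 z, \<phi>2 z)) ` U) \<psi>1 \<and> holo2_on ((\<lambda>z. (\<phi>1 z, \<phi>2 z)) ` U) \<psi>2 \<and>
      (\<forall>z\<in>U. (\<psi>1 (\<phi>1 z, \<phi>2 z), \<psi>2 (\<phi>1 z, \<phi>2 z)) = z) \<and>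
      (\<forall>z\<in>U. f (\<phi>1 z, \<phi>2 z) = u z * g z))"

datatype sing_type = A nat | D nat | E6 | E7 | E8

fun valid_type :: "sing_type \<Rightarrow> bool" where
  "valid_type (A n) = (n \<ge> 1)"
| "valid_type (D n) = (n \<ge> 4)"
| "valid_type E6 = True"
| "valid_type E7 = True"
| "valid_type E8 = True"

fun normal_form :: "sing_type \<Rightarrow> complex \<times> complex \<Rightarrow> complex" where
  "normal_form (A n) = (\<lambda>(x, y). x^2 + y^(n + 1))"
| "normal_form (D n) = (\<lambda>(x, y). x^2 * y + y^(n - 1))"
| "normal_form E6 = (\<lambda>(x, y). x^3 + y^4)"
| "normal_form E7 = (\<lambda>(x, y). x^3 + x * y^3)"
| "normal_form E8 = (\<lambda>(x, y). x^3 + y^5)"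

fun milnor :: "sing_type \<Rightarrow> nat" where
  "milnor (A n) = n"
| "milnor (D n) = n"
| "milnor E6 = 6"
| "milnor E7 = 7"
| "milnor E8 = 8"

text \<open>The point P of the curve F = 0 has type t: in an affine chart centred at P the local
  equation is contact equivalent to the normal form of t.\<close>
definition has_type :: "(complex^3 \<Rightarrow> complex) \<Rightarrow> (complex^3) set \<Rightarrow> sing_type \<Rightarrow> bool" where
  "has_type F P t \<longleftrightarrow> valid_type t \<and> (\<exists>p\<in>P. p \<noteq> 0 \<and> (\<exists>M :: complex^3^3.
      invertible M \<and> M *v pt3 1 0 0 = p \<and>
      germ_equiv (\<lambda>(u, v). F (M *v pt3 1 u v)) (normal_form t)))"

definition simple_sings :: "(complex^3 \<Rightarrow> complex) \<Rightarrow> bool" where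
  "simple_sings F \<longleftrightarrow> (\<forall>P\<in>sing_pts F. \<exists>t. has_type F P t)"

definition sing_set :: "(complex^3 \<Rightarrow> complex) \<Rightarrow> sing_type multiset" where
  "sing_set F = image_mset (\<lambda>P. THE t. has_type F P t) (mset_set (sing_pts F))"

definition total_milnor :: "(complex^3 \<Rightarrow> complex) \<Rightarrow> nat" where
  "total_milnor F = (\<Sum>t\<in>#sing_set F. milnor t)"

definition proj_equiv :: "((complex^3 \<Rightarrow> complex) \<times> (complex^3 \<Rightarrow> complex)) set" where
  "proj_equiv = {(F, G). \<exists>(M :: complex^3^3) c. invertible M \<and> c \<noteq> 0 \<and>
      (\<forall>x. G x = c * F (M *v x))}"

definition maximal_reducible_E8_sextics :: "(complex^3 \<Rightarrow> complex) set" where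
  "maximal_reducible_E8_sextics = {F. sextic_eq F \<and> reduced_eq F \<and> reducible_eq F \<and>
      simple_sings F \<and> total_milnor F = 19 \<and> E8 \<in># sing_set F}"

end

theory Submission
  imports Defs "HOL-Complex_Analysis.Complex_Analysis" "HOL-Computational_Algebra.Fundamental_Theorem_Algebra"
begin

text \<open>
The germ \<open>x^3 + y^5\<close> is irreducible and meets its tangent with multiplicity 5. Hence a reducible sextic
with an E8 point consists of a quintic through that point and a line that misses it. In homogeneous
coordinates \<open>(y : z : x)\<close> with the E8 point at \<open>(1 : 0 : 0)\<close> and the line \<open>y = 0\<close> the equation becomes
\<open>y (z^3 y^2 + 2 z^2 q(x, z) y + h(x, z)) = 0\<close> with \<open>deg q \<le> 2\<close> and \<open>deg h = 5\<close>. The other singular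
points lie over the roots of \<open>h\<close> (intersections with the line) and over the multiple roots of the
discriminant \<open>g = q^2 - h\<close>; their types depend only on the multiplicities of these roots, and the total Milnor
number is 23 minus the number of distinct roots of \<open>g\<close> and of \<open>h\<close>. Maximality therefore means that the
quintics \<open>g\<close> and \<open>h\<close>, whose sum is a square, have four distinct roots altogether (a common root counting
twice), and comparing coefficients for every distribution of multiplicities leaves the eighteen models.
A projective equivalence of two normal forms fixes the unique E8 point and the line, so it comes from an
affine change of \<open>x\<close> and a rescaling of \<open>y\<close>; this separates the two conjugate models with singularities
E8, A7, A3, A1.

The type of a singular point is well defined because the normal forms are told apart by how fast the
gradient decays along the zero set at the origin, by whether the germ vanishes to third order,
and by whether its zero set has a single tangent direction.
\<close>

section \<open>Local analytic tools\<close>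

text \<open>Germs here are functions, not power series, and \<open>germ_equiv\<close> only supplies
  complex differentiable maps. Every invariant of a singularity is therefore an estimate near the
  origin that survives a biholomorphic change and a unit factor; Cauchy's inequality on complex
  lines gives the bounds on derivatives. The same estimates exclude non-simple points: where
  \<open>h\<close> and \<open>q^2 - h\<close> both vanish to order 4, the gradient decays with
  exponent at least 24 in the scale in which E6, E7, E8 have 16, 18, 20. Irreducibility of E8 enters
  through the arc \<open>(-t^5, t^3)\<close>. With weights 5 and 3 for the two local coordinates,
  monomials of degree at most 4 have distinct weights, so no nonzero polynomial of degree at most 4
  vanishes on the arc; in degree 5 the only coincidence is 15 = 5 * 3 = 3 * 5. The constant 23 is 8
  + 10 + 5: besides the 8 of E8, the Milnor number at a point is twice the order of \<open>h\<close>
  plus the order of \<open>q^2 - h\<close>, minus one for each of the two quintics that vanishes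
  there.\<close>

text \<open>Holomorphic germs at the origin. Continuity of the partial derivatives is built in
  because the inverse function theorem is applied to pairs of such germs.\<close>

definition hg :: "(complex \<times> complex \<Rightarrow> complex) \<Rightarrow> bool" where
  "hg f \<longleftrightarrow> (\<exists>a b. \<forall>\<^sub>F z in nhds 0. (f has_derivative (\<lambda>w. a z * fst w + b z * snd w)) (at z)
      \<and> isCont a z \<and> isCont b z)"

lemma hgI:
  assumes "\<forall>\<^sub>F z in nhds 0. (f has_derivative (\<lambda>w. a z * fst w + b z * snd w)) (at z)
      \<and> isCont a z \<and> isCont b z"
  shows "hg f"
  using assms unfolding hg_def by blast

lemma hg_const [simp, intro]: "hg (\<lambda>z. c)"
  by (rule hgI[where a="\<lambda>z. 0" and b="\<lambda>z. 0"]) auto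

lemma hg_fst [simp, intro]: "hg fst"
  by (rule hgI[where a="\<lambda>z. 1" and b="\<lambda>z. 0"]) (auto intro!: always_eventually has_derivative_fst derivative_eq_intros)

lemma hg_snd [simp, intro]: "hg snd"
  by (rule hgI[where a="\<lambda>z. 0" and b="\<lambda>z. 1"]) (auto intro!: always_eventually derivative_eq_intros)

lemma hg_mult [intro]:
  assumes "hg f" "hg g" shows "hg (\<lambda>z. f z * g z)"
proof -
  obtain a b where f: "\<forall>\<^sub>F z in nhds 0. (f has_derivative (\<lambda>w. a z * fst w + b z * snd w)) (at z)
      \<and> isCont a z \<and> isCont b z" using assms(1) unfolding hg_def by blast
  obtain c d where g: "\<forall>\<^sub>F z in nhds 0. (g has_derivative (\<lambda>w. c z * fst w + d z * snd w)) (at z)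
      \<and> isCont c z \<and> isCont d z" using assms(2) unfolding hg_def by blast
  show ?thesis
  proof (rule hgI[where a="\<lambda>z. f z * c z + a z * g z" and b="\<lambda>z. f z * d z + b z * g z"])
    show "\<forall>\<^sub>F z in nhds 0. ((\<lambda>z. f z * g z) has_derivative
           (\<lambda>w. (f z * c z + a z * g z) * fst w + (f z * d z + b z * g z) * snd w)) (at z) \<and>
          isCont (\<lambda>z. f z * c z + a z * g z) z \<and> isCont (\<lambda>z. f z * d z + b z * g z) z"
      using f g
    proof eventually_elim
      case (elim z)
      then have "isCont f z" "isCont g z" by (auto intro: has_derivative_continuous)
      moreover have "((\<lambda>z. f z * g z) has_derivative
           (\<lambda>w. (f z * c z + a z * g z) * fst w + (f z * d z + b z * g z) * snd w)) (at z)"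
        by (rule has_derivative_eq_rhs[OF has_derivative_mult]) (use elim in \<open>auto simp: algebra_simps\<close>)
      ultimately show ?case using elim by (auto intro!: continuous_intros)
    qed
  qed
qed

lemma hg_add [intro]:
  assumes "hg f" "hg g" shows "hg (\<lambda>z. f z + g z)"
proof -
  obtain a b where f: "\<forall>\<^sub>F z in nhds 0. (f has_derivative (\<lambda>w. a z * fst w + b z * snd w)) (at z)
      \<and> isCont a z \<and> isCont b z" using assms(1) unfolding hg_def by blast
  obtain c d where g: "\<forall>\<^sub>F z in nhds 0. (g has_derivative (\<lambda>w. c z * fst w + d z * snd w)) (at z)
      \<and> isCont c z \<and> isCont d z" using assms(2) unfolding hg_def by blast
  show ?thesis
  proof (rule hgI[where a="\<lambda>z. c z + a z" and b="\<lambda>z. d z + b z"])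
    show "\<forall>\<^sub>F z in nhds 0. ((\<lambda>z. f z + g z) has_derivative
           (\<lambda>w. (c z + a z) * fst w + (d z + b z) * snd w)) (at z) \<and>
          isCont (\<lambda>z. c z + a z) z \<and> isCont (\<lambda>z. d z + b z) z"
      using f g
    proof eventually_elim
      case (elim z)
      moreover have "((\<lambda>z. f z + g z) has_derivative
           (\<lambda>w. (c z + a z) * fst w + (d z + b z) * snd w)) (at z)"
        by (rule has_derivative_eq_rhs[OF has_derivative_add[OF conjunct1[OF elim(1)] conjunct1[OF elim(2)]]])
          (auto simp: algebra_simps)
      ultimately show ?case by (auto intro!: continuous_intros)
    qed
  qed
qed

lemma hg_uminus [intro]: "hg f \<Longrightarrow> hg (\<lambda>z. - f z)"
  using hg_mult[of "\<lambda>_. -1" f] by simp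

lemma hg_diff [intro]: "hg f \<Longrightarrow> hg g \<Longrightarrow> hg (\<lambda>z. f z - g z)"
  using hg_add[of f "\<lambda>z. - g z"] hg_uminus[of g] by simp

lemma hg_power [intro]: "hg f \<Longrightarrow> hg (\<lambda>z. f z ^ n)"
  by (induction n) auto

lemma hg_poly [intro]: "hg f \<Longrightarrow> hg (\<lambda>z. poly p (f z))"
  by (induction p) (auto simp: poly_pCons)

lemma hg_cong:
  assumes "hg f" "\<forall>\<^sub>F z in nhds 0. f z = g z" shows "hg g"
proof -
  obtain a b where f: "\<forall>\<^sub>F z in nhds 0. (f has_derivative (\<lambda>w. a z * fst w + b z * snd w)) (at z)
      \<and> isCont a z \<and> isCont b z" using assms(1) unfolding hg_def by blast
  \<comment> \<open>A derivative at \<open>z\<close> depends on the values near \<open>z\<close>, so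
    the eventual equality is first spread to neighbourhoods of all nearby points.\<close>
  have "\<forall>\<^sub>F z in nhds 0. \<forall>\<^sub>F z in nhds z. f z = g z"
    using assms(2) by (simp add: eventually_eventually)
  then have "\<forall>\<^sub>F z in nhds 0. (g has_derivative (\<lambda>w. a z * fst w + b z * snd w)) (at z)
      \<and> isCont a z \<and> isCont b z"
    using f
  proof eventually_elim
    case (elim z)
    then have "eventually (\<lambda>z. f z = g z) (at z)" "f z = g z"
      by (auto simp: eventually_nhds_conv_at)
    then show ?case using elim has_derivative_transform_eventually[of f _ z UNIV g] by auto
  qed
  then show ?thesis by (rule hgI)
qed

lemma hg_isCont: "hg f \<Longrightarrow> isCont f 0"
  unfolding hg_def by (auto dest!: eventually_nhds_x_imp_x intro: has_derivative_continuous)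

lemma hg_tendsto: "hg f \<Longrightarrow> (f \<longlongrightarrow> f 0) (nhds 0)"
  using hg_isCont isCont_def tendsto_at_iff_tendsto_nhds by blast

lemma hg_nonzero: "hg f \<Longrightarrow> f 0 \<noteq> 0 \<Longrightarrow> \<forall>\<^sub>F z in nhds 0. f z \<noteq> 0"
  using hg_tendsto tendsto_imp_eventually_ne by blast

lemma hg_compose:
  assumes "hg f" "\<phi> holomorphic_on S" "open S" "f 0 \<in> S" shows "hg (\<lambda>z. \<phi> (f z))"
proof -
  obtain a b where f: "\<forall>\<^sub>F z in nhds 0. (f has_derivative (\<lambda>w. a z * fst w + b z * snd w)) (at z)
      \<and> isCont a z \<and> isCont b z" using assms(1) unfolding hg_def by blast
  have S: "\<forall>\<^sub>F z in nhds 0. f z \<in> S"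
    using hg_tendsto[OF assms(1)] assms(3,4) topological_tendstoD by blast
  show ?thesis
  proof (rule hgI[where a="\<lambda>z. deriv \<phi> (f z) * a z" and b="\<lambda>z. deriv \<phi> (f z) * b z"])
    show "\<forall>\<^sub>F z in nhds 0. ((\<lambda>z. \<phi> (f z)) has_derivative
           (\<lambda>w. deriv \<phi> (f z) * a z * fst w + deriv \<phi> (f z) * b z * snd w)) (at z) \<and>
          isCont (\<lambda>z. deriv \<phi> (f z) * a z) z \<and> isCont (\<lambda>z. deriv \<phi> (f z) * b z) z"
      using f S
    proof eventually_elim
      case (elim z)
      have D: "(\<phi> has_derivative (*) (deriv \<phi> (f z))) (at (f z))"
        using holomorphic_derivI[OF assms(2,3)] elim by (simp add: has_field_derivative_def)
      have 1: "((\<lambda>z. \<phi> (f z)) has_derivative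
           (\<lambda>w. deriv \<phi> (f z) * a z * fst w + deriv \<phi> (f z) * b z * snd w)) (at z)"
        by (rule has_derivative_eq_rhs[OF has_derivative_compose[OF conjunct1[OF elim(1)] D]])
           (simp add: algebra_simps)
      have C: "isCont (deriv \<phi>) (f z)"
        using holomorphic_deriv[OF assms(2,3)] assms(3) elim
        by (meson continuous_on_eq_continuous_at holomorphic_on_imp_continuous_on)
      have "isCont f z" using elim by (auto intro: has_derivative_continuous)
      from isCont_o2[OF this C] have "isCont (\<lambda>z. deriv \<phi> (f z)) z" .
      then show ?case using elim 1 by (auto intro!: continuous_intros)
    qed
  qed
qed

lemma hg_inverse [intro]: "hg f \<Longrightarrow> f 0 \<noteq> 0 \<Longrightarrow> hg (\<lambda>z. inverse (f z))"
  by (rule hg_compose[of f inverse "-{0}"]) (auto intro!: holomorphic_intros)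

lemma hg_divide [intro]: "hg f \<Longrightarrow> hg g \<Longrightarrow> g 0 \<noteq> 0 \<Longrightarrow> hg (\<lambda>z. f z / g z)"
  using hg_mult[of f "\<lambda>z. inverse (g z)"] by (auto simp: divide_inverse)

lemma complex_root_exists: "n > 0 \<Longrightarrow> \<exists>c::complex. c ^ n = w"
  by (cases "w = 0") (auto intro: exI[of _ "exp (Ln w / of_nat n)"] simp flip: exp_of_nat_mult)

text \<open>Near \<open>f 0\<close> the quotient \<open>w / f 0\<close> stays in the right half
  plane, where \<open>Ln\<close> is holomorphic. A fixed root \<open>c\<close> of \<open>f 0\<close>
  times \<open>exp (Ln (w / f 0) / n)\<close> is then a branch of the root, whatever the argument of
  \<open>f 0\<close>.\<close>

lemma hg_root:
  assumes "hg f" "f 0 \<noteq> 0" "n > 0"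
  obtains e where "hg e" "e 0 \<noteq> 0" "\<forall>\<^sub>F z in nhds 0. e z ^ n = f z"
proof -
  obtain c where c: "c ^ n = f 0" using complex_root_exists[OF assms(3)] by blast
  then have "c \<noteq> 0" using assms by (auto simp: power_0_left)
  define S where "S = {w. 0 < Re (w / f 0)}"
  have S: "open S" unfolding S_def by (intro open_Collect_less continuous_intros) (use assms in auto)
  have S0: "f 0 \<in> S" using assms by (simp add: S_def)
  define \<phi> where "\<phi> w = c * exp (Ln (w / f 0) / of_nat n)" for w
  have hol: "\<phi> holomorphic_on S" unfolding \<phi>_def
    using assms by (auto intro!: holomorphic_intros simp: S_def complex_nonpos_Reals_iff)
  have pow: "\<phi> w ^ n = w" if "w \<in> S" for w
  proof -
    have "w / f 0 \<noteq> 0" using that by (auto simp: S_def)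
    then show ?thesis using assms(3) c unfolding \<phi>_def
      by (simp add: power_mult_distrib flip: exp_of_nat_mult)
  qed
  have ev: "\<forall>\<^sub>F z in nhds 0. f z \<in> S"
    using hg_tendsto[OF assms(1)] S S0 topological_tendstoD by blast
  show thesis
  proof (rule that[of "\<lambda>z. \<phi> (f z)"])
    show "hg (\<lambda>z. \<phi> (f z))" by (rule hg_compose[OF assms(1) hol S S0])
    show "\<phi> (f 0) \<noteq> 0" using \<open>c \<noteq> 0\<close> by (simp add: \<phi>_def)
    show "\<forall>\<^sub>F z in nhds 0. \<phi> (f z) ^ n = f z" using ev by eventually_elim (rule pow)
  qed
qed

section \<open>Local coordinates and the inverse function theorem\<close>

text \<open>Only the Jacobian at the origin is recorded; shears and multiplication by units visibly
  keep it nonzero, and these are the only coordinate changes made below.\<close>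

definition coords :: "(complex \<times> complex \<Rightarrow> complex) \<Rightarrow> (complex \<times> complex \<Rightarrow> complex) \<Rightarrow> bool" where
  "coords X Y \<longleftrightarrow> hg X \<and> hg Y \<and> X 0 = 0 \<and> Y 0 = 0 \<and> (\<exists>a b c d. a * d - b * c \<noteq> 0 \<and>
      (X has_derivative (\<lambda>w. a * fst w + b * snd w)) (at 0) \<and>
      (Y has_derivative (\<lambda>w. c * fst w + d * snd w)) (at 0))"

lemma coordsI:
  assumes "hg X" "hg Y" "X 0 = 0" "Y 0 = 0" "a * d - b * c \<noteq> 0"
    "(X has_derivative (\<lambda>w. a * fst w + b * snd w)) (at 0)"
    "(Y has_derivative (\<lambda>w. c * fst w + d * snd w)) (at 0)"
  shows "coords X Y"
  using assms unfolding coords_def by blast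

lemma coords_base: "coords fst snd"
  by (rule coordsI[of _ _ 1 1 0 0]) (auto intro!: derivative_eq_intros)

lemma coordsD: "coords X Y \<Longrightarrow> hg X" "coords X Y \<Longrightarrow> hg Y" "coords X Y \<Longrightarrow> X 0 = 0" "coords X Y \<Longrightarrow> Y 0 = 0"
  by (auto simp: coords_def)

lemma coords_swap: "coords X Y \<Longrightarrow> coords Y X"
  unfolding coords_def
proof safe
  fix a b c d :: complex
  assume h: "a * d - b * c \<noteq> 0" "(X has_derivative (\<lambda>w. a * fst w + b * snd w)) (at 0)"
    "(Y has_derivative (\<lambda>w. c * fst w + d * snd w)) (at 0)"
  have "c * b - d * a \<noteq> 0" using h(1) by (simp add: algebra_simps)
  then show "\<exists>a b c d. a * d - b * c \<noteq> 0 \<and>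
      (Y has_derivative (\<lambda>w. a * fst w + b * snd w)) (at 0) \<and>
      (X has_derivative (\<lambda>w. c * fst w + d * snd w)) (at 0)"
    using h by blast
qed

lemma hg_deriv0: "hg f \<Longrightarrow> \<exists>a b. (f has_derivative (\<lambda>w. a * fst w + b * snd w)) (at 0)"
  unfolding hg_def by (auto dest!: eventually_nhds_x_imp_x)

lemma coords_shear:
  assumes "coords X Y" "hg k" shows "coords (\<lambda>z. X z + k z * Y z) Y"
proof -
  obtain a b c d where h: "a * d - b * c \<noteq> 0" "(X has_derivative (\<lambda>w. a * fst w + b * snd w)) (at 0)"
    "(Y has_derivative (\<lambda>w. c * fst w + d * snd w)) (at 0)"
    using assms unfolding coords_def by blast
  obtain p q where k: "(k has_derivative (\<lambda>w. p * fst w + q * snd w)) (at 0)"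
    using hg_deriv0[OF assms(2)] by blast
  note c = coordsD[OF assms(1)]
  have "((\<lambda>z. X z + k z * Y z) has_derivative (\<lambda>w. (a + k 0 * c) * fst w + (b + k 0 * d) * snd w)) (at 0)"
    by (rule has_derivative_eq_rhs[OF has_derivative_add[OF h(2) has_derivative_mult[OF k h(3)]]])
       (auto simp: algebra_simps c)
  moreover have "(a + k 0 * c) * d - (b + k 0 * d) * c \<noteq> 0" using h(1) by (simp add: algebra_simps)
  ultimately show ?thesis using c assms(2) h(3) by (intro coordsI) auto
qed

lemma coords_scale:
  assumes "coords X Y" "hg e" "e 0 \<noteq> 0" shows "coords X (\<lambda>z. e z * Y z)"
proof -
  obtain a b c d where h: "a * d - b * c \<noteq> 0" "(X has_derivative (\<lambda>w. a * fst w + b * snd w)) (at 0)"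
    "(Y has_derivative (\<lambda>w. c * fst w + d * snd w)) (at 0)"
    using assms unfolding coords_def by blast
  obtain p q where k: "(e has_derivative (\<lambda>w. p * fst w + q * snd w)) (at 0)"
    using hg_deriv0[OF assms(2)] by blast
  note c = coordsD[OF assms(1)]
  have "((\<lambda>z. e z * Y z) has_derivative (\<lambda>w. (e 0 * c) * fst w + (e 0 * d) * snd w)) (at 0)"
    by (rule has_derivative_eq_rhs[OF has_derivative_mult[OF k h(3)]])
       (auto simp: algebra_simps c)
  moreover have "a * (e 0 * d) - b * (e 0 * c) \<noteq> 0"
  proof -
    have "a * (e 0 * d) - b * (e 0 * c) = e 0 * (a * d - b * c)" by (simp add: algebra_simps)
    then show ?thesis using h(1) assms(3) by simp
  qed
  ultimately show ?thesis using c assms(2) h(2) by (intro coordsI) auto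
qed

text \<open>The inverse function theorem turns coordinates into the biholomorphism that
  \<open>germ_equiv\<close> asks for. The directions are reversed: the map substituted into
  \<open>f\<close> is the inverse \<open>\<Psi>\<close> of \<open>(X, Y)\<close>, while
  \<open>X\<close> and \<open>Y\<close> serve as the inverse maps in the definition.\<close>

lemma coords_germ_equiv:
  assumes "coords X Y" "hg u" "u 0 \<noteq> 0" "\<forall>\<^sub>F z in nhds 0. f z = u z * g (X z, Y z)"
  shows "germ_equiv f g"
proof -
  obtain a b where X: "\<forall>\<^sub>F z in nhds 0. (X has_derivative (\<lambda>w. a z * fst w + b z * snd w)) (at z)
      \<and> isCont a z \<and> isCont b z" using coordsD[OF assms(1)] unfolding hg_def by blast
  obtain c d where Y: "\<forall>\<^sub>F z in nhds 0. (Y has_derivative (\<lambda>w. c z * fst w + d z * snd w)) (at z)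
      \<and> isCont c z \<and> isCont d z" using coordsD[OF assms(1)] unfolding hg_def by blast
  obtain p q where u: "\<forall>\<^sub>F z in nhds 0. (u has_derivative (\<lambda>w. p z * fst w + q z * snd w)) (at z)
      \<and> isCont p z \<and> isCont q z" using assms(2) unfolding hg_def by blast
  define J where "J z = a z * d z - b z * c z" for z
  have J0: "J 0 \<noteq> 0"
  proof -
    obtain a' b' c' d' where h: "a' * d' - b' * c' \<noteq> 0" "(X has_derivative (\<lambda>w. a' * fst w + b' * snd w)) (at 0)"
      "(Y has_derivative (\<lambda>w. c' * fst w + d' * snd w)) (at 0)"
      using assms unfolding coords_def by blast
    have "(\<lambda>w. a' * fst w + b' * snd w) = (\<lambda>w. a 0 * fst w + b 0 * snd w)"
      using h(2) eventually_nhds_x_imp_x[OF X] has_derivative_unique by blast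
    from fun_cong[OF this, of "(1,0)"] fun_cong[OF this, of "(0,1)"]
    have 1: "a' = a 0" "b' = b 0" by auto
    have "(\<lambda>w. c' * fst w + d' * snd w) = (\<lambda>w. c 0 * fst w + d 0 * snd w)"
      using h(3) eventually_nhds_x_imp_x[OF Y] has_derivative_unique by blast
    from fun_cong[OF this, of "(1,0)"] fun_cong[OF this, of "(0,1)"]
    have "c' = c 0" "d' = d 0" by auto
    then show ?thesis using h(1) 1 by (simp add: J_def)
  qed
  have "isCont J 0" unfolding J_def
    using eventually_nhds_x_imp_x[OF X] eventually_nhds_x_imp_x[OF Y] by (auto intro!: continuous_intros)
  then have "\<forall>\<^sub>F z in nhds 0. J z \<noteq> 0"
    using J0 isCont_def tendsto_at_iff_tendsto_nhds tendsto_imp_eventually_ne by blast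
  then have "\<forall>\<^sub>F z in nhds 0. J z \<noteq> 0 \<and> f z = u z * g (X z, Y z) \<and>
      (X has_derivative (\<lambda>w. a z * fst w + b z * snd w)) (at z) \<and> isCont a z \<and> isCont b z \<and>
      (Y has_derivative (\<lambda>w. c z * fst w + d z * snd w)) (at z) \<and> isCont c z \<and> isCont d z \<and>
      (u has_derivative (\<lambda>w. p z * fst w + q z * snd w)) (at z)"
    using assms(4) X Y u by eventually_elim auto
  then obtain U where U: "open U" "0 \<in> U" and Uz: "\<And>z. z \<in> U \<Longrightarrow> J z \<noteq> 0 \<and> f z = u z * g (X z, Y z) \<and>
      (X has_derivative (\<lambda>w. a z * fst w + b z * snd w)) (at z) \<and> isCont a z \<and> isCont b z \<and>
      (Y has_derivative (\<lambda>w. c z * fst w + d z * snd w)) (at z) \<and> isCont c z \<and> isCont d z \<and>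
      (u has_derivative (\<lambda>w. p z * fst w + q z * snd w)) (at z)"
    unfolding eventually_nhds by auto
  define \<Phi> where "\<Phi> z = (X z, Y z)" for z
  define L where "L z = (\<lambda>w. (a z * fst w + b z * snd w, c z * fst w + d z * snd w))" for z
  \<comment> \<open>\<open>K z\<close> inverts the Jacobian matrix by Cramer's rule. The explicit
    form shows that the derivative of \<open>\<Psi>\<close> is again complex linear.\<close>
  define K where "K z = (\<lambda>w. ((d z * fst w - b z * snd w) / J z, (a z * snd w - c z * fst w) / J z))" for z
  have dPhi: "(\<Phi> has_derivative L z) (at z)" if "z \<in> U" for z
    unfolding \<Phi>_def L_def using Uz[OF that] by (intro has_derivative_Pair) auto
  have bl: "bounded_linear (L z)" for z
    unfolding L_def by (intro bounded_linear_Pair bounded_linear_add bounded_linear_const_mult bounded_linear_fst bounded_linear_snd)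
  have blK: "bounded_linear (K z)" for z
    unfolding K_def divide_inverse
    by (intro bounded_linear_Pair bounded_linear_add bounded_linear_sub bounded_linear_mult_const
      bounded_linear_const_mult bounded_linear_fst bounded_linear_snd)
  have KL: "K z (L z w) = w" "L z (K z w) = w" if "J z \<noteq> 0" for z w
  proof -
    have "d z * (a z * p + b z * q) - b z * (c z * p + d z * q) = J z * p"
      "a z * (c z * p + d z * q) - c z * (a z * p + b z * q) = J z * q"
      "a z * (d z * p - b z * q) + b z * (a z * q - c z * p) = J z * p"
      "c z * (d z * p - b z * q) + d z * (a z * q - c z * p) = J z * q" for p q
      by (auto simp: J_def algebra_simps)
    note e = this
    show "K z (L z w) = w" using that by (simp add: K_def L_def e)
    have "L z (K z w) = ((a z * (d z * fst w - b z * snd w) + b z * (a z * snd w - c z * fst w)) / J z,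
       (c z * (d z * fst w - b z * snd w) + d z * (a z * snd w - c z * fst w)) / J z)"
      by (simp add: K_def L_def add_divide_distrib)
    then show "L z (K z w) = w" using that by (simp add: e)
  qed
  define F where "F z = Blinfun (L z)" for z
  have FL: "blinfun_apply (F z) = L z" for z
    unfolding F_def using bl bounded_linear_Blinfun_apply by blast
  have contF: "continuous_on U F"
  proof (rule continuous_on_blinfun_componentwise)
    fix i :: "complex \<times> complex"
    have "isCont (\<lambda>z. (a z * fst i + b z * snd i, c z * fst i + d z * snd i)) z" if "z \<in> U" for z
      using Uz[OF that] by (auto intro!: continuous_intros)
    then show "continuous_on U (\<lambda>x. blinfun_apply (F x) i)"
      by (auto simp: FL L_def intro!: continuous_at_imp_continuous_on)
  qed
  have dF: "(\<Phi> has_derivative blinfun_apply (F z)) (at z)" if "z \<in> U" for z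
    using dPhi[OF that] FL by simp
  have inv0: "Blinfun (K 0) o\<^sub>L F 0 = id_blinfun"
    by (rule blinfun_eqI) (simp add: FL bounded_linear_Blinfun_apply[OF blK] KL[OF J0])
  obtain U' V \<Psi> \<Psi>' where IFT: "open U'" "U' \<subseteq> U" "0 \<in> U'" "open V" "\<Phi> 0 \<in> V" "homeomorphism U' V \<Phi> \<Psi>"
    "\<And>y. y \<in> V \<Longrightarrow> (\<Psi> has_derivative (\<Psi>' y)) (at y)"
    "\<And>y. y \<in> V \<Longrightarrow> \<Psi>' y = inv (blinfun_apply (F (\<Psi> y)))"
    apply (rule inverse_function_theorem[OF U(1) dF contF U(2) inv0])
     apply assumption
    apply (rule that; assumption)
    done
  have Phi0: "\<Phi> 0 = 0" using coordsD[OF assms(1)] by (simp add: \<Phi>_def zero_prod_def)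
  have im: "\<Psi> ` V = U'" "\<And>y. y \<in> V \<Longrightarrow> \<Phi> (\<Psi> y) = y" "\<And>y. y \<in> V \<Longrightarrow> \<Psi> y \<in> U'"
    "\<And>x. x \<in> U' \<Longrightarrow> \<Psi> (\<Phi> x) = x"
    using IFT(6) by (auto simp: homeomorphism_def)
  have Psi0: "\<Psi> 0 = 0" using im(4)[OF IFT(3)] Phi0 by simp
  have dPsi: "(\<Psi> has_derivative K (\<Psi> y)) (at y)" if "y \<in> V" for y
  proof -
    have J: "J (\<Psi> y) \<noteq> 0" using Uz[of "\<Psi> y"] im(3)[OF that] IFT(2) by (metis subsetD)
    have "inv (L (\<Psi> y)) = K (\<Psi> y)"
      using KL[OF J] by (intro inv_equality) auto
    then show ?thesis using IFT(7,8)[OF that] FL by simp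
  qed
  have holX: "holo2_on U' X" unfolding holo2_on_def
  proof (intro conjI ballI IFT(1))
    fix z assume "z \<in> U'"
    then have "z \<in> U" using IFT(2) by blast
    from Uz[OF this] show "\<exists>a b. (X has_derivative (\<lambda>(w1, w2). a * w1 + b * w2)) (at z)"
      by (intro exI[of _ "a z"] exI[of _ "b z"]) (simp add: case_prod_beta')
  qed
  have holY: "holo2_on U' Y" unfolding holo2_on_def
  proof (intro conjI ballI IFT(1))
    fix z assume "z \<in> U'"
    then have "z \<in> U" using IFT(2) by blast
    from Uz[OF this] show "\<exists>a b. (Y has_derivative (\<lambda>(w1, w2). a * w1 + b * w2)) (at z)"
      by (intro exI[of _ "c z"] exI[of _ "d z"]) (simp add: case_prod_beta')
  qed
  have pair: "(\<lambda>z. (fst (\<Psi> z), snd (\<Psi> z))) = \<Psi>" by auto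
  show ?thesis unfolding germ_equiv_def
  proof (rule exI[of _ V], rule exI[of _ "\<lambda>z. fst (\<Psi> z)"], rule exI[of _ "\<lambda>z. snd (\<Psi> z)"],
      rule exI[of _ X], rule exI[of _ Y], rule exI[of _ "\<lambda>z. u (\<Psi> z)"], intro conjI)
    show "(0,0) \<in> V" using IFT(5) Phi0 by (simp add: zero_prod_def)
    show "holo2_on V (\<lambda>z. fst (\<Psi> z))" unfolding holo2_on_def
    proof (intro conjI ballI IFT(4))
      fix z assume "z \<in> V"
      then have "((\<lambda>z. fst (\<Psi> z)) has_derivative (\<lambda>w. fst (K (\<Psi> z) w))) (at z)"
        using dPsi by (intro has_derivative_fst)
      then have "((\<lambda>z. fst (\<Psi> z)) has_derivative (\<lambda>(w1,w2). (d (\<Psi> z) / J (\<Psi> z)) * w1 + (- b (\<Psi> z) / J (\<Psi> z)) * w2)) (at z)"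
        by (rule has_derivative_eq_rhs) (simp add: K_def case_prod_beta' diff_divide_distrib)
      then show "\<exists>a b. ((\<lambda>z. fst (\<Psi> z)) has_derivative (\<lambda>(w1, w2). a * w1 + b * w2)) (at z)" by blast
    qed
    show "holo2_on V (\<lambda>z. snd (\<Psi> z))" unfolding holo2_on_def
    proof (intro conjI ballI IFT(4))
      fix z assume "z \<in> V"
      then have "((\<lambda>z. snd (\<Psi> z)) has_derivative (\<lambda>w. snd (K (\<Psi> z) w))) (at z)"
        using dPsi by (intro has_derivative_snd)
      then have "((\<lambda>z. snd (\<Psi> z)) has_derivative (\<lambda>(w1,w2). (- c (\<Psi> z) / J (\<Psi> z)) * w1 + (a (\<Psi> z) / J (\<Psi> z)) * w2)) (at z)"
        by (rule has_derivative_eq_rhs) (simp add: K_def case_prod_beta' diff_divide_distrib)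
      then show "\<exists>a b. ((\<lambda>z. snd (\<Psi> z)) has_derivative (\<lambda>(w1, w2). a * w1 + b * w2)) (at z)" by blast
    qed
    show "holo2_on V (\<lambda>z. u (\<Psi> z))" unfolding holo2_on_def
    proof (intro conjI ballI IFT(4))
      fix z assume z: "z \<in> V"
      then have "\<Psi> z \<in> U" using im IFT(2) by auto
      then have "(u has_derivative (\<lambda>w. p (\<Psi> z) * fst w + q (\<Psi> z) * snd w)) (at (\<Psi> z))" using Uz by blast
      from has_derivative_compose[OF dPsi[OF z] this]
      have "((\<lambda>z. u (\<Psi> z)) has_derivative (\<lambda>(w1,w2). (p (\<Psi> z) * (d (\<Psi> z) / J (\<Psi> z)) + q (\<Psi> z) * (- c (\<Psi> z) / J (\<Psi> z))) * w1
          + (p (\<Psi> z) * (- b (\<Psi> z) / J (\<Psi> z)) + q (\<Psi> z) * (a (\<Psi> z) / J (\<Psi> z))) * w2)) (at z)"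
        by (rule has_derivative_eq_rhs) (simp add: K_def case_prod_beta' divide_inverse algebra_simps)
      then show "\<exists>a b. ((\<lambda>z. u (\<Psi> z)) has_derivative (\<lambda>(w1, w2). a * w1 + b * w2)) (at z)" by blast
    qed
    show "(fst (\<Psi> (0,0)), snd (\<Psi> (0,0))) = (0,0)" using Psi0 by (simp add: zero_prod_def)
    show "u (\<Psi> (0,0)) \<noteq> 0" using Psi0 assms(3) by (simp add: zero_prod_def)
    show "inj_on (\<lambda>z. (fst (\<Psi> z), snd (\<Psi> z))) V" unfolding pair using im(2) by (metis inj_on_def)
    show "holo2_on ((\<lambda>z. (fst (\<Psi> z), snd (\<Psi> z))) ` V) X" "holo2_on ((\<lambda>z. (fst (\<Psi> z), snd (\<Psi> z))) ` V) Y"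
      using holX holY unfolding pair im(1) by auto
    show "\<forall>z\<in>V. (X (fst (\<Psi> z), snd (\<Psi> z)), Y (fst (\<Psi> z), snd (\<Psi> z))) = z"
      using im(2) by (simp add: \<Phi>_def)
    show "\<forall>z\<in>V. f (fst (\<Psi> z), snd (\<Psi> z)) = u (\<Psi> z) * g z"
    proof
      fix z assume z: "z \<in> V"
      then have "\<Psi> z \<in> U" using im IFT(2) by auto
      then have "f (\<Psi> z) = u (\<Psi> z) * g (\<Phi> (\<Psi> z))" using Uz by (auto simp: \<Phi>_def)
      then show "f (fst (\<Psi> z), snd (\<Psi> z)) = u (\<Psi> z) * g z" using im(2)[OF z] by simp
    qed
  qed
qed

section \<open>Recognition of simple singularities\<close>

lemmas hg_intros = hg_const hg_fst hg_snd hg_add hg_diff hg_uminus hg_mult hg_power hg_divide hg_poly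

text \<open>The unit \<open>e / a\<close> has a root of order \<open>n + 1\<close>, which is
  absorbed into \<open>Y\<close>; \<open>a\<close> remains as the unit in front.\<close>

lemma recognize_A:
  assumes c: "coords X Y" and h: "hg a" "hg e" "a 0 \<noteq> 0" "e 0 \<noteq> 0"
    and f: "\<forall>\<^sub>F z in nhds 0. f z = a z * X z ^ 2 + e z * Y z ^ Suc n"
  shows "germ_equiv f (normal_form (A n))"
proof -
  obtain r where r: "hg r" "r 0 \<noteq> 0" "\<forall>\<^sub>F z in nhds 0. r z ^ Suc n = e z / a z"
    by (rule hg_root[of "\<lambda>z. e z / a z" "Suc n"]) (use h in auto)
  show ?thesis
  proof (rule coords_germ_equiv[OF coords_scale[OF c r(1,2)] h(1,3)])
    show "\<forall>\<^sub>F z in nhds 0. f z = a z * normal_form (A n) (X z, r z * Y z)"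
      using f r(3) hg_nonzero[OF h(1,3)]
    proof eventually_elim
      case (elim z)
      have "a z * normal_form (A n) (X z, r z * Y z) = a z * X z ^ 2 + a z * r z ^ Suc n * Y z ^ Suc n"
        by (simp add: power_mult_distrib ring_distribs)
      also have "a z * r z ^ Suc n = e z" using elim by simp
      finally show ?case using elim by simp
    qed
  qed
qed

text \<open>Rescaling \<open>Y\<close> by the root \<open>r\<close> also rescales the outer factor
  \<open>Y\<close>, hence the unit \<open>a / r\<close>.\<close>

lemma recognize_D:
  assumes c: "coords X Y" and h: "hg a" "hg e" "a 0 \<noteq> 0" "e 0 \<noteq> 0" and n: "n > 0"
    and f: "\<forall>\<^sub>F z in nhds 0. f z = Y z * (a z * X z ^ 2 + e z * Y z ^ n)"
  shows "germ_equiv f (normal_form (D (n + 2)))"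
proof -
  obtain r where r: "hg r" "r 0 \<noteq> 0" "\<forall>\<^sub>F z in nhds 0. r z ^ n = e z / a z"
    by (rule hg_root[of "\<lambda>z. e z / a z" n]) (use h n in auto)
  show ?thesis
  proof (rule coords_germ_equiv[OF coords_scale[OF c r(1,2)], of "\<lambda>z. a z / r z"])
    show "\<forall>\<^sub>F z in nhds 0. f z = a z / r z * normal_form (D (n + 2)) (X z, r z * Y z)"
      using f r(3) hg_nonzero[OF h(1,3)] hg_nonzero[OF r(1,2)]
    proof eventually_elim
      case (elim z)
      have "a z / r z * normal_form (D (n+2)) (X z, r z * Y z) = a z / r z * (X z ^ 2 * (r z * Y z) + (r z * Y z) ^ Suc n)"
        by simp
      also have "\<dots> = a z * X z ^ 2 * Y z + a z * r z ^ n * Y z ^ Suc n"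
        using elim by (simp add: field_simps power_mult_distrib)
      also have "a z * r z ^ n = e z" using elim by simp
      finally show ?case using elim by (simp add: algebra_simps)
    qed
  qed (use h r in auto)
qed

lemma recognize_E7:
  assumes c: "coords X Y" and h: "hg a" "hg e" "a 0 \<noteq> 0" "e 0 \<noteq> 0"
    and f: "\<forall>\<^sub>F z in nhds 0. f z = X z * (a z * X z ^ 2 + e z * Y z ^ 3)"
  shows "germ_equiv f (normal_form E7)"
proof -
  obtain r where r: "hg r" "r 0 \<noteq> 0" "\<forall>\<^sub>F z in nhds 0. r z ^ 3 = e z / a z"
    by (rule hg_root[of "\<lambda>z. e z / a z" 3]) (use h in auto)
  show ?thesis
  proof (rule coords_germ_equiv[OF coords_scale[OF c r(1,2)] h(1,3)])
    show "\<forall>\<^sub>F z in nhds 0. f z = a z * normal_form E7 (X z, r z * Y z)"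
      using f r(3) hg_nonzero[OF h(1,3)]
    proof eventually_elim
      case (elim z)
      have "a z * normal_form E7 (X z, r z * Y z) = a z * X z ^ 3 + a z * r z ^ 3 * X z * Y z ^ 3"
        by (simp add: power_mult_distrib ring_distribs)
      also have "a z * r z ^ 3 = e z" using elim by simp
      finally show ?case using elim by (simp add: power2_eq_square power3_eq_cube algebra_simps)
    qed
  qed
qed

lemma recognize_E8:
  assumes c: "coords X Y" and h: "hg a" "hg e" "a 0 \<noteq> 0" "e 0 \<noteq> 0"
    and f: "\<forall>\<^sub>F z in nhds 0. f z = a z * X z ^ 3 + e z * Y z ^ 5"
  shows "germ_equiv f (normal_form E8)"
proof -
  obtain r where r: "hg r" "r 0 \<noteq> 0" "\<forall>\<^sub>F z in nhds 0. r z ^ 5 = e z / a z"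
    by (rule hg_root[of "\<lambda>z. e z / a z" 5]) (use h in auto)
  show ?thesis
  proof (rule coords_germ_equiv[OF coords_scale[OF c r(1,2)] h(1,3)])
    show "\<forall>\<^sub>F z in nhds 0. f z = a z * normal_form E8 (X z, r z * Y z)"
      using f r(3) hg_nonzero[OF h(1,3)]
    proof eventually_elim
      case (elim z)
      have "a z * normal_form E8 (X z, r z * Y z) = a z * X z ^ 3 + a z * r z ^ 5 * Y z ^ 5"
        by (simp add: power_mult_distrib ring_distribs)
      also have "a z * r z ^ 5 = e z" using elim by simp
      finally show ?case using elim by simp
    qed
  qed
qed

text \<open>Completing the square turns the mixed term into a unit times \<open>Y^(2m)\<close>: two
  smooth branches with contact of order \<open>m\<close> form the singularity A(2m-1).\<close>

lemma recognize_A_odd: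
  assumes c: "coords X Y" and h: "hg a" "hg b" "a 0 \<noteq> 0" "b 0 \<noteq> 0" and m: "m > 0"
    and f: "\<forall>\<^sub>F z in nhds 0. f z = a z * X z ^ 2 + b z * X z * Y z ^ m"
  shows "germ_equiv f (normal_form (A (2 * m - 1)))"
proof -
  note hg = coordsD[OF c]
  define k where "k z = b z / (2 * a z)" for z
  have k: "hg k" unfolding k_def by (intro hg_intros) (use h in simp_all)
  have "coords (\<lambda>z. X z + (k z * Y z ^ (m - 1)) * Y z) Y"
    by (rule coords_shear[OF c]) (intro hg_intros; use k hg in simp)
  then show ?thesis
  proof (rule recognize_A[where a=a and e="\<lambda>z. - (a z * k z ^ 2)"])
    show "hg (\<lambda>z. - (a z * (k z)\<^sup>2))" by (intro hg_intros) (use h k in simp_all)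
    show "- (a 0 * (k 0)\<^sup>2) \<noteq> 0" using h by (simp add: k_def)
    show "\<forall>\<^sub>F z in nhds 0. f z = a z * (X z + k z * Y z ^ (m - 1) * Y z)\<^sup>2 + - (a z * (k z)\<^sup>2) * Y z ^ Suc (2 * m - 1)"
      using f hg_nonzero[OF h(1,3)]
    proof eventually_elim
      case (elim z)
      have 1: "Y z ^ (m - 1) * Y z = Y z ^ m" using m by (cases m) auto
      have 2: "Suc (2 * m - 1) = m * 2" using m by simp
      have 3: "b z = 2 * a z * k z" using elim by (simp add: k_def)
      show ?case unfolding elim(1) 3 2 power_mult mult.assoc[of "k z"] 1
        by (simp add: power2_eq_square algebra_simps)
    qed
  qed (use h in auto)
qed

text \<open>\<open>X Y\<close> is the difference of the squares of \<open>(X + Y) / 2\<close> and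
  \<open>(Y - X) / 2\<close>.\<close>

lemma recognize_A1:
  assumes c: "coords X Y" and f: "\<forall>\<^sub>F z in nhds 0. f z = X z * Y z"
  shows "germ_equiv f (normal_form (A 1))"
proof -
  note hg = coordsD[OF c]
  have "coords (\<lambda>z. X z + 1 * Y z) Y" by (rule coords_shear[OF c]) auto
  then have "coords Y (\<lambda>z. X z + Y z)" using coords_swap by auto
  then have "coords (\<lambda>z. Y z + (-(1/2)) * (X z + Y z)) (\<lambda>z. X z + Y z)"
    by (rule coords_shear) auto
  then show ?thesis
    by (rule recognize_A[where a="\<lambda>_. -1" and e="\<lambda>_. 1/4"])
      (use f in \<open>auto elim!: eventually_mono simp: power2_eq_square field_simps\<close>)
qed

text \<open>Completing the square inside the bracket creates \<open>Y^(2n-2)\<close>. For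
  \<open>n > 2\<close> this is \<open>Y^n\<close> times a positive power of \<open>Y\<close>, so the
  coefficient of \<open>Y^n\<close> remains a unit.\<close>

lemma recognize_D_square:
  assumes c: "coords X Y" and h: "hg a" "hg b" "hg d" "a 0 \<noteq> 0" "d 0 \<noteq> 0" and n: "n > 2"
    and f: "\<forall>\<^sub>F z in nhds 0. f z = Y z * (a z * X z ^ 2 + b z * X z * Y z ^ (n - 1) + d z * Y z ^ n)"
  shows "germ_equiv f (normal_form (D (n + 2)))"
proof -
  note hg = coordsD[OF c]
  define k where "k z = b z / (2 * a z)" for z
  have k: "hg k" unfolding k_def by (intro hg_intros) (use h in simp_all)
  have "coords (\<lambda>z. X z + (k z * Y z ^ (n - 2)) * Y z) Y"
    by (rule coords_shear[OF c]) (intro hg_intros; use k hg in simp)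
  then show ?thesis
  proof (rule recognize_D[where a=a and e="\<lambda>z. d z - a z * k z ^ 2 * Y z ^ (n - 2)"])
    show "hg (\<lambda>z. d z - a z * (k z)\<^sup>2 * Y z ^ (n - 2))" by (intro hg_intros) (use h k hg in simp_all)
    show "d 0 - a 0 * (k 0)\<^sup>2 * Y 0 ^ (n - 2) \<noteq> 0" using h hg n by (simp add: power_0_left)
    show "\<forall>\<^sub>F z in nhds 0. f z = Y z * (a z * (X z + k z * Y z ^ (n - 2) * Y z)\<^sup>2
        + (d z - a z * (k z)\<^sup>2 * Y z ^ (n - 2)) * Y z ^ n)"
      using f hg_nonzero[OF h(1,4)]
    proof eventually_elim
      case (elim z)
      have 3: "b z = 2 * a z * k z" using elim by (simp add: k_def)
      obtain p where p: "n = Suc (Suc p)" using n by (metis Suc_lessD less_natE numeral_2_eq_2 add_2_eq_Suc less_iff_Suc_add add_Suc)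
      show ?case unfolding elim(1) 3 p
        by (simp add: power2_eq_square algebra_simps)
    qed
  qed (use h n in auto)
qed

text \<open>Two branches with contact of order \<open>m\<close> as in
  \<open>recognize_A_odd\<close>, together with the branch \<open>Y = 0\<close> that crosses
  \<open>X = 0\<close> transversally.\<close>

lemma recognize_D_even:
  assumes c: "coords X Y" and h: "hg a" "hg b" "a 0 \<noteq> 0" "b 0 \<noteq> 0" and m: "m > 0"
    and f: "\<forall>\<^sub>F z in nhds 0. f z = Y z * (a z * X z ^ 2 + b z * X z * Y z ^ m)"
  shows "germ_equiv f (normal_form (D (2 * m + 2)))"
proof -
  note hg = coordsD[OF c]
  define k where "k z = b z / (2 * a z)" for z
  have k: "hg k" unfolding k_def by (intro hg_intros) (use h in simp_all)
  have "coords (\<lambda>z. X z + (k z * Y z ^ (m - 1)) * Y z) Y"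
    by (rule coords_shear[OF c]) (intro hg_intros; use k hg in simp)
  then show ?thesis
  proof (rule recognize_D[where a=a and e="\<lambda>z. - (a z * k z ^ 2)"])
    show "hg (\<lambda>z. - (a z * (k z)\<^sup>2))" by (intro hg_intros) (use h k in simp_all)
    show "- (a 0 * (k 0)\<^sup>2) \<noteq> 0" using h by (simp add: k_def)
    show "\<forall>\<^sub>F z in nhds 0. f z = Y z * (a z * (X z + k z * Y z ^ (m - 1) * Y z)\<^sup>2 + - (a z * (k z)\<^sup>2) * Y z ^ (2 * m))"
      using f hg_nonzero[OF h(1,3)]
    proof eventually_elim
      case (elim z)
      have 1: "Y z ^ (m - 1) * Y z = Y z ^ m" using m by (cases m) auto
      have 2: "2 * m = m * 2" by simp
      have 3: "b z = 2 * a z * k z" using elim by (simp add: k_def)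
      show ?case unfolding elim(1) 3 2 power_mult mult.assoc[of "k z"] 1
        by (simp add: power2_eq_square algebra_simps)
    qed
  qed (use h m in auto)
qed

text \<open>The mixed term is removed by completing the cube of \<open>Y\<close> instead of a square
  in \<open>X\<close>: the surplus of \<open>e (Y + k X)^3\<close> is divisible by
  \<open>X^2\<close> with a cofactor vanishing at 0, so it only perturbs the coefficient 1 of
  \<open>X^2\<close>.\<close>

lemma recognize_E7_cube:
  assumes c: "coords X Y" and h: "hg b" "hg e" "e 0 \<noteq> 0"
    and f: "\<forall>\<^sub>F z in nhds 0. f z = X z * (X z ^ 2 + b z * X z * Y z ^ 2 + e z * Y z ^ 3)"
  shows "germ_equiv f (normal_form E7)"
proof -
  note hg = coordsD[OF c]
  define k where "k z = b z / (3 * e z)" for z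
  have k: "hg k" unfolding k_def by (intro hg_intros) (use h in simp_all)
  have "coords X (\<lambda>z. Y z + k z * X z)"
    by (rule coords_swap[OF coords_shear[OF coords_swap[OF c] k]])
  then show ?thesis
  proof (rule recognize_E7[where e=e and a="\<lambda>z. 1 - 3 * e z * k z ^ 2 * Y z - e z * k z ^ 3 * X z"])
    show "hg (\<lambda>z. 1 - 3 * e z * k z ^ 2 * Y z - e z * k z ^ 3 * X z)" by (intro hg_intros) (use h k hg in simp_all)
    show "1 - 3 * e 0 * k 0 ^ 2 * Y 0 - e 0 * k 0 ^ 3 * X 0 \<noteq> 0" using hg by simp
    show "\<forall>\<^sub>F z in nhds 0. f z = X z * ((1 - 3 * e z * k z ^ 2 * Y z - e z * k z ^ 3 * X z) * (X z)\<^sup>2 + e z * (Y z + k z * X z) ^ 3)"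
      using f hg_nonzero[OF h(2,3)]
    proof eventually_elim
      case (elim z)
      have 3: "b z = 3 * e z * k z" using elim by (simp add: k_def)
      show ?case unfolding elim(1) 3
        by (simp add: power2_eq_square power3_eq_cube algebra_simps)
    qed
  qed (use h in auto)
qed

lemma power5_expand: "(x::complex) ^ 5 = x * x * x * x * x" "x ^ 4 = x * x * x * x"
  by (simp_all add: eval_nat_numeral)

text \<open>Tschirnhaus transformations remove the three intermediate terms one after the other; the error
  terms produced by the last one are divisible by the fifth power and can be absorbed into a unit.\<close>
lemma recognize_E8_general:
  assumes co: "coords Z X" and h: "hg a" "hg b" "hg c" "hg d" "a 0 \<noteq> 0" "d 0 \<noteq> 0"
    and f: "\<forall>\<^sub>F w in nhds 0. f w = a w * Z w ^ 3 + b w * Z w ^ 2 * X w ^ 2 + c w * Z w * X w ^ 4 + d w * X w ^ 5"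
  shows "germ_equiv f (normal_form E8)"
proof -
  note hg = coordsD[OF co]
  define k where "k w = b w / (3 * a w)" for w
  have k: "hg k" unfolding k_def by (intro hg_intros) (use h in simp_all)
  define Z1 where "Z1 w = Z w + (k w * X w) * X w" for w
  have co1: "coords Z1 X" unfolding Z1_def by (rule coords_shear[OF co]) (use k hg in auto)
  note hg1 = coordsD[OF co1]
  define c1 where "c1 w = c w - 3 * a w * k w ^ 2" for w
  define d1 where "d1 w = d w - a w * k w ^ 3 * X w - k w * c1 w * X w" for w
  have c1: "hg c1" unfolding c1_def by (intro hg_intros) (use h k in simp_all)
  have d1: "hg d1" unfolding d1_def by (intro hg_intros) (use h k c1 hg in simp_all)
  have d10: "d1 0 \<noteq> 0" using h hg by (simp add: d1_def)
  have f1: "\<forall>\<^sub>F w in nhds 0. f w = a w * Z1 w ^ 3 + c1 w * Z1 w * X w ^ 4 + d1 w * X w ^ 5"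
    using f hg_nonzero[OF h(1,5)]
  proof eventually_elim
    case (elim w)
    have 3: "b w = 3 * a w * k w" using elim by (simp add: k_def)
    show ?case unfolding elim(1) 3 d1_def c1_def Z1_def
      by (simp add: power2_eq_square power3_eq_cube power5_expand algebra_simps)
  qed
  \<comment> \<open>The term \<open>c1 Z1 X^4\<close> is the first-order part of
    \<open>d1 (X + l Z1)^5\<close>, so it is removed by a shear of \<open>X\<close>. Of the higher
    terms those divisible by \<open>Z1^3\<close> join \<open>a2\<close>, and only
    \<open>X1^3 Z1^2\<close> is left over.\<close>
  define l where "l w = c1 w / (5 * d1 w)" for w
  have l: "hg l" unfolding l_def by (intro hg_intros) (use c1 d1 d10 in simp_all)
  define X1 where "X1 w = X w + l w * Z1 w" for w
  have co2: "coords Z1 X1" unfolding X1_def by (rule coords_swap[OF coords_shear[OF coords_swap[OF co1] l]])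
  note hg2 = coordsD[OF co2]
  define e2 where "e2 w = - 10 * d1 w * l w ^ 2" for w
  define a2 where "a2 w = a w - 10 * d1 w * l w ^ 3 * X w ^ 2 - 5 * d1 w * l w ^ 4 * X w * Z1 w - d1 w * l w ^ 5 * Z1 w ^ 2
     + e2 w * (- 3 * X1 w ^ 2 * l w + 3 * X1 w * l w ^ 2 * Z1 w - l w ^ 3 * Z1 w ^ 2)" for w
  have e2: "hg e2" unfolding e2_def by (intro hg_mult hg_const hg_power d1 l)
  have a2: "hg a2" unfolding a2_def by (intro hg_mult hg_const hg_power hg_add hg_diff d1 l e2 h hg hg1 hg2)
  have a20: "a2 0 \<noteq> 0" using h hg hg1 hg2 by (simp add: a2_def)
  have f2: "\<forall>\<^sub>F w in nhds 0. f w = a2 w * Z1 w ^ 3 + e2 w * X1 w ^ 3 * Z1 w ^ 2 + d1 w * X1 w ^ 5"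
    using f1 hg_nonzero[OF d1 d10]
  proof eventually_elim
    case (elim w)
    have 3: "c1 w = 5 * d1 w * l w" using elim by (simp add: l_def)
    have 4: "X w = X1 w - l w * Z1 w" by (simp add: X1_def)
    show ?case unfolding elim(1) 3 e2_def a2_def 4
      by (simp add: power2_eq_square power3_eq_cube power5_expand algebra_simps)
  qed
  \<comment> \<open>The leftover term is completed to the cube of \<open>Z1 + m X1^3\<close>;
    everything else in this cube is divisible by \<open>X1^5\<close>.\<close>
  define m where "m w = e2 w / (3 * a2 w)" for w
  have m: "hg m" unfolding m_def by (intro hg_intros) (use e2 a2 a20 in simp_all)
  have "coords (\<lambda>w. Z1 w + (m w * X1 w ^ 2) * X1 w) X1"
    by (rule coords_shear[OF co2]) (intro hg_intros; use m hg2 in simp)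
  then show ?thesis
  proof (rule recognize_E8[where a=a2 and e="\<lambda>w. d1 w - 3 * a2 w * m w ^ 2 * Z1 w * X1 w - a2 w * m w ^ 3 * X1 w ^ 4"])
    show "hg (\<lambda>w. d1 w - 3 * a2 w * m w ^ 2 * Z1 w * X1 w - a2 w * m w ^ 3 * X1 w ^ 4)"
      by (intro hg_mult hg_const hg_power hg_add hg_diff d1 a2 m hg1 hg2)
    show "d1 0 - 3 * a2 0 * m 0 ^ 2 * Z1 0 * X1 0 - a2 0 * m 0 ^ 3 * X1 0 ^ 4 \<noteq> 0"
      using d10 hg2 by simp
    show "\<forall>\<^sub>F w in nhds 0. f w = a2 w * (Z1 w + m w * (X1 w)\<^sup>2 * X1 w) ^ 3 +
        (d1 w - 3 * a2 w * (m w)\<^sup>2 * Z1 w * X1 w - a2 w * m w ^ 3 * X1 w ^ 4) * X1 w ^ 5"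
      using f2 hg_nonzero[OF a2 a20]
    proof eventually_elim
      case (elim w)
      have 3: "e2 w = 3 * a2 w * m w" using elim by (simp add: m_def)
      show ?case unfolding elim(1) 3
        by (simp add: power2_eq_square power3_eq_cube power5_expand algebra_simps)
    qed
  qed (use a2 a20 in auto)
qed

section \<open>Types of the local equations\<close>

text \<open>Here \<open>k\<close> and \<open>m\<close> are the orders of \<open>q^2 - h\<close> and
  \<open>h\<close> at a common abscissa. As \<open>y^2 + 2 q y + h = (y + q)^2 - (q^2 - h)\<close>,
  the order \<open>k\<close> governs the residual curve itself and \<open>m\<close> is its
  intersection multiplicity with the line \<open>y = 0\<close>. At a root of \<open>h\<close>,
  \<open>k = 1\<close> forces \<open>m = 1\<close>, and simplicity with \<open>k \<ge> 3\<close>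
  forces \<open>m = 2\<close> or \<open>k = m = 3\<close>.\<close>

definition line_type :: "nat \<Rightarrow> nat \<Rightarrow> sing_type" where
  "line_type k m = (if k \<le> 1 then A (2 * m - 1) else if k = 2 then D (2 * m)
     else if k = 3 \<and> m = 3 then E7 else D (k + 2))"

definition affine_chart :: "complex poly \<Rightarrow> complex poly \<Rightarrow> complex \<Rightarrow> complex \<Rightarrow> complex \<times> complex \<Rightarrow> complex" where
  "affine_chart q h x y z = (y + snd z) * ((y + snd z)\<^sup>2 + 2 * poly q (x + fst z) * (y + snd z) + poly h (x + fst z))"

lemma order_factor:
  fixes p :: "complex poly"
  assumes "p \<noteq> 0"
  obtains r where "p = [:-x, 1:] ^ order x p * r" "poly r x \<noteq> 0"
  using order_decomp[OF assms, of x] by (metis poly_eq_0_iff_dvd)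

lemma poly_factor_shift: "poly ([:-x, 1:] ^ n * r) (x + t) = t ^ n * poly r (x + t)" for x :: complex
  by (simp add: poly_power)

lemma poly_root_factor: "poly p x = 0 \<Longrightarrow> \<exists>r. p = [:-x, 1:] * r" for x :: complex
  by (metis poly_eq_0_iff_dvd dvdE)

lemma hg_poly_shift [intro!]: "hg (\<lambda>z. poly p (x + fst z))"
  by (intro hg_intros)

lemma coords_line_slope:
  assumes "hg a" "a 0 \<noteq> 0" "hg b"
  shows "coords (\<lambda>z. fst z * a z + b z * snd z) snd"
proof -
  have "coords snd (\<lambda>z. a z * fst z)"
    by (rule coords_scale[OF coords_swap[OF coords_base] assms(1,2)])
  from coords_shear[OF coords_swap[OF this] assms(3)] show ?thesis by (simp add: mult.commute)
qed

text \<open>The factor \<open>y + 2 q\<close> is a unit here, so the residual curve is one smooth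
  branch whose contact with the line is the order of \<open>h\<close>.\<close>

lemma type_line_transversal:
  assumes "h \<noteq> 0" "poly h x = 0" "poly q x \<noteq> 0"
  shows "germ_equiv (affine_chart q h x 0) (normal_form (A (2 * order x h - 1)))"
proof -
  obtain r where r: "h = [:-x, 1:] ^ order x h * r" "poly r x \<noteq> 0" using order_factor assms by blast
  define m where "m = order x h"
  have m: "m > 0" using assms by (simp add: m_def order_gt_0_iff)
  show ?thesis unfolding m_def[symmetric]
  proof (rule recognize_A_odd[OF coords_swap[OF coords_base], where a="\<lambda>z. snd z + 2 * poly q (x + fst z)" and b="\<lambda>z. poly r (x + fst z)"])
    show "\<forall>\<^sub>F z in nhds 0. affine_chart q h x 0 z = (snd z + 2 * poly q (x + fst z)) * (snd z)\<^sup>2 +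
       poly r (x + fst z) * snd z * fst z ^ m"
      unfolding affine_chart_def by (subst r(1)) (simp add: m_def poly_factor_shift power2_eq_square algebra_simps)
  qed (use r m assms in \<open>auto intro!: hg_intros\<close>)
qed

text \<open>A simple root of \<open>h\<close> contributes a term linear in \<open>fst z\<close>, so
  the residual curve is smooth and crosses the line, although \<open>q\<close> vanishes.\<close>

lemma type_line_simple:
  assumes "order x h = 1" "poly q x = 0" "h \<noteq> 0"
  shows "germ_equiv (affine_chart q h x 0) (normal_form (A 1))"
proof -
  obtain r where r: "h = [:-x, 1:] ^ order x h * r" "poly r x \<noteq> 0" using order_factor assms by blast
  have "coords (\<lambda>z. fst z * poly r (x + fst z) + (snd z + 2 * poly q (x + fst z)) * snd z) snd"
    by (rule coords_line_slope) (use r in \<open>auto intro!: hg_intros\<close>)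
  then show ?thesis
  proof (rule recognize_A1)
    show "\<forall>\<^sub>F z in nhds 0. affine_chart q h x 0 z = (fst z * poly r (x + fst z) + (snd z + 2 * poly q (x + fst z)) * snd z) * snd z"
      unfolding affine_chart_def by (subst r(1)) (simp add: assms(1) power2_eq_square algebra_simps)
  qed
qed

text \<open>An expansion modulo \<open>W\<close>. The value of the cofactor at the origin is
  recorded because for exponent 1 it enters a leading coefficient in
  \<open>type_line_node\<close>.\<close>

lemma binomial_first_order:
  assumes "hg Y" "hg W" "Y 0 = 0" "W 0 = 0"
  shows "\<exists>R. hg R \<and> (\<forall>z. (Y z - W z) ^ Suc n = Y z ^ Suc n + W z * R z) \<and> R 0 = (if n = 0 then -1 else 0)"
proof (induction n)
  case 0
  show ?case by (intro exI[of _ "\<lambda>_. -1"]) auto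
next
  case (Suc n)
  then obtain R where R: "hg R" "\<And>z. (Y z - W z) ^ Suc n = Y z ^ Suc n + W z * R z" by blast
  show ?case
  proof (intro exI[of _ "\<lambda>z. Y z * R z - Y z ^ Suc n - W z * R z"] conjI allI)
    show "hg (\<lambda>z. Y z * R z - Y z ^ Suc n - W z * R z)" by (intro hg_intros R assms)
    show "(Y z - W z) ^ Suc (Suc n) = Y z ^ Suc (Suc n) + W z * (Y z * R z - Y z ^ Suc n - W z * R z)" for z
      unfolding power_Suc[of "Y z - W z" "Suc n"] R(2) by (simp add: algebra_simps)
  qed (use assms in auto)
qed

text \<open>An expansion modulo \<open>w^2\<close>. Except for the exponent 2 the cofactor vanishes
  at the origin and cannot spoil the leading coefficient in \<open>type_line_cusp\<close>.\<close>

lemma binomial_second_order: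
  assumes "hg w" "hg W" "w 0 = 0" "W 0 = 0"
  shows "\<exists>R. hg R \<and> (\<forall>z. (w z - W z) ^ Suc n = (- W z) ^ Suc n + of_nat (Suc n) * (- W z) ^ n * w z + w z ^ 2 * R z)
     \<and> R 0 = (if n = 1 then 1 else 0)"
proof (induction n)
  case 0
  show ?case by (intro exI[of _ "\<lambda>_. 0"]) auto
next
  case (Suc n)
  then obtain R where R: "hg R" "\<And>z. (w z - W z) ^ Suc n = (- W z) ^ Suc n + of_nat (Suc n) * (- W z) ^ n * w z + w z ^ 2 * R z" by blast
  show ?case
  proof (intro exI[of _ "\<lambda>z. (w z - W z) * R z + of_nat (Suc n) * (- W z) ^ n"] conjI allI)
    show "hg (\<lambda>z. (w z - W z) * R z + of_nat (Suc n) * (- W z) ^ n)" by (intro hg_intros R assms)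
    show "(w z - W z) ^ Suc (Suc n) = (- W z) ^ Suc (Suc n) + of_nat (Suc (Suc n)) * (- W z) ^ Suc n * w z
        + w z ^ 2 * ((w z - W z) * R z + of_nat (Suc n) * (- W z) ^ n)" for z
      unfolding power_Suc[of "w z - W z" "Suc n"] R(2) by (simp add: power2_eq_square algebra_simps)
  qed (use assms in \<open>auto simp: power_0_left\<close>)
qed

text \<open>The residual curve splits into \<open>y = snd + fst (Q + s)\<close> and
  \<open>W = snd + fst (Q - s)\<close> with \<open>s^2 = g0\<close>. The product
  \<open>Q^2 - s^2\<close> has order \<open>m - 2\<close>, and the sign of \<open>s\<close> is
  chosen so that \<open>Q - s\<close> carries all of it. Then \<open>W = 0\<close> has contact
  \<open>m - 1\<close> with the line and \<open>y = 0\<close> crosses both.\<close>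

lemma type_line_node:
  assumes h: "h \<noteq> 0" "order x h = m" "m \<ge> 2" and q: "poly q x = 0"
    and g: "q\<^sup>2 - h \<noteq> 0" "order x (q\<^sup>2 - h) = 2"
  shows "germ_equiv (affine_chart q h x 0) (normal_form (D (2 * m)))"
proof -
  obtain h0 where h0: "h = [:-x, 1:] ^ m * h0" "poly h0 x \<noteq> 0" using order_factor[OF h(1), of x] h by metis
  obtain g0 where g0: "q\<^sup>2 - h = [:-x, 1:] ^ 2 * g0" "poly g0 x \<noteq> 0" using order_factor[OF g(1), of x] g by metis
  obtain q0 where q0: "q = [:-x, 1:] * q0" using poly_root_factor q by blast
  obtain p where p: "m = p + 2" using h(3) by (metis le_add_diff_inverse2)
  have "[:-x, 1:] ^ 2 * (q0\<^sup>2 - g0) = [:-x, 1:] ^ 2 * ([:-x, 1:] ^ p * h0)"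
  proof -
    have "[:-x, 1:] ^ 2 * (q0\<^sup>2 - g0) = q\<^sup>2 - (q\<^sup>2 - h)" unfolding g0(1) unfolding q0 by (simp only: power_mult_distrib right_diff_distrib)
    also have "\<dots> = h" by simp
    also have "h = [:-x, 1:] ^ 2 * ([:-x, 1:] ^ p * h0)" unfolding h0(1) p by (simp only: power_add mult_ac)
    finally show ?thesis .
  qed
  then have qg: "q0\<^sup>2 - g0 = [:-x, 1:] ^ p * h0" by (subst (asm) mult_left_cancel) auto
  define Q where "Q z = poly q0 (x + fst z)" for z :: "complex \<times> complex"
  define H where "H z = poly h0 (x + fst z)" for z :: "complex \<times> complex"
  have Q: "hg Q" and H: "hg H" unfolding Q_def H_def by auto
  obtain s0 where s0: "hg s0" "s0 0 \<noteq> 0" "\<forall>\<^sub>F z in nhds 0. s0 z ^ 2 = poly g0 (x + fst z)"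
    by (rule hg_root[of "\<lambda>z. poly g0 (x + fst z)" 2]) (use g0 in auto)
  \<comment> \<open>The two candidates for \<open>Q + s\<close> differ by \<open>2 s0\<close> at the
    origin, so at most one of them vanishes there.\<close>
  obtain s where s: "hg s" "s 0 \<noteq> 0" "\<forall>\<^sub>F z in nhds 0. s z ^ 2 = poly g0 (x + fst z)" "Q 0 + s 0 \<noteq> 0"
  proof (cases "Q 0 + s0 0 = 0")
    case True
    show ?thesis
    proof (rule that[of "\<lambda>z. - s0 z"])
      have "(Q 0 + s0 0) - (Q 0 + - s0 0) = 2 * s0 0" by simp
      then show "Q 0 + - s0 0 \<noteq> 0" using True s0(2) by auto
    qed (use s0 in \<open>auto intro!: hg_intros\<close>)
  qed (use s0 that in blast)
  define v where "v z = H z / (Q z + s z)" for z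
  have v: "hg v" unfolding v_def by (intro hg_intros H Q s)
  define t where "t z = 1 / (2 * s z)" for z
  have t: "hg t" unfolding t_def by (intro hg_intros s) (use s in auto)
  have ev: "\<forall>\<^sub>F z in nhds 0. Q z - s z = fst z ^ p * v z \<and> s z ^ 2 = Q z ^ 2 - fst z ^ p * H z"
    using s(3) hg_nonzero[OF hg_add[OF Q s(1)] s(4)]
  proof eventually_elim
    case (elim z)
    have "poly (q0\<^sup>2 - g0) (x + fst z) = fst z ^ p * H z" unfolding qg by (simp add: H_def)
    then have 1: "s z ^ 2 = Q z ^ 2 - fst z ^ p * H z" using elim by (auto simp: Q_def algebra_simps)
    have "(Q z - s z) * (Q z + s z) = Q z ^ 2 - s z ^ 2" by (simp add: power2_eq_square algebra_simps)
    then have "(Q z - s z) * (Q z + s z) = fst z ^ p * H z" using 1 by simp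
    then have "Q z - s z = fst z ^ p * v z" using elim by (simp add: v_def field_simps)
    then show ?case using 1 by simp
  qed
  define y where "y z = fst z * (Q z + s z) + 1 * snd z" for z
  define W where "W z = y z + (- 2 * s z) * fst z" for z
  have y: "coords y snd" unfolding y_def by (rule coords_line_slope) (use Q s in \<open>auto intro!: hg_intros\<close>)
  have "coords y (\<lambda>z. (- 2 * s z) * fst z)"
  proof (rule coords_scale)
    have "coords (\<lambda>z. fst z * (Q z + s z)) snd"
      using coords_line_slope[of "\<lambda>z. Q z + s z" "\<lambda>_. 0"] Q s by (auto intro!: hg_intros)
    have "coords (\<lambda>z. snd z + (Q z + s z) * fst z) fst"
      by (rule coords_shear[OF coords_swap[OF coords_base]]) (intro hg_intros Q s)
    then show "coords y fst" by (simp add: y_def[abs_def] algebra_simps)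
  qed (use s in \<open>auto intro!: hg_intros\<close>)
  from coords_shear[OF coords_swap[OF this] hg_const[of 1]] have c: "coords W y"
    by (simp add: W_def[abs_def] algebra_simps)
  note hgs = coordsD[OF c]
  obtain R where R: "hg R" "\<And>z. (y z - W z) ^ Suc p = y z ^ Suc p + W z * R z" "R 0 = (if p = 0 then -1 else 0)"
    using binomial_first_order[OF hgs(2,1,4,3), of p] by blast
  have "germ_equiv (affine_chart q h x 0) (normal_form (D (2 * Suc p + 2)))"
  proof (rule recognize_D_even[OF c, where a="\<lambda>z. 1 - v z * t z ^ Suc p * R z" and b="\<lambda>z. - (v z * t z ^ Suc p)"])
    show "hg (\<lambda>z. 1 - v z * t z ^ Suc p * R z)" "hg (\<lambda>z. - (v z * t z ^ Suc p))"
      by (intro hg_intros v t R)+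
    have 1: "Q 0 - s 0 = 0 ^ p * v 0" using eventually_nhds_x_imp_x[OF ev] by (simp add: fst_zero)
    \<comment> \<open>For \<open>p = 0\<close> the three branches have distinct tangents and the
      correction does not vanish at the origin; the coefficient is then
      \<open>(Q + s) / (2 s)\<close>.\<close>
    show "1 - v 0 * t 0 ^ Suc p * R 0 \<noteq> 0"
    proof (cases "p = 0")
      case True
      then have "v 0 = Q 0 - s 0" using 1 by simp
      moreover have "1 - (Q 0 - s 0) * t 0 * (-1) = (Q 0 + s 0) / (2 * s 0)" using s by (simp add: t_def field_simps)
      moreover have "(Q 0 + s 0) / (2 * s 0) \<noteq> 0" using s by simp
      ultimately show ?thesis using True R(3) by simp
    qed (use R in simp)
    show "- (v 0 * t 0 ^ Suc p) \<noteq> 0" using s h0 by (simp add: v_def t_def H_def fst_zero)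
    show "\<forall>\<^sub>F z in nhds 0. affine_chart q h x 0 z =
        y z * ((1 - v z * t z ^ Suc p * R z) * (W z)\<^sup>2 + - (v z * t z ^ Suc p) * W z * y z ^ Suc p)"
      using ev hg_nonzero[OF s(1,2)]
    proof eventually_elim
      case (elim z)
      \<comment> \<open>In the coordinates \<open>W\<close>, \<open>y\<close> the old variable
        \<open>fst z\<close> is \<open>(y - W) / (2 s)\<close>; substituting this eliminates both
        old variables.\<close>
      have x: "fst z = t z * (y z - W z)" using elim by (simp add: W_def t_def field_simps)
      have "snd z = y z - fst z * (Q z + s z)" by (simp add: y_def)
      also have "\<dots> = W z - fst z * (Q z - s z)" by (simp add: W_def algebra_simps)
      also have "\<dots> = W z - fst z ^ Suc p * v z" using elim by simp
      also have "\<dots> = W z - v z * t z ^ Suc p * (y z ^ Suc p + W z * R z)" unfolding x power_mult_distrib R(2) by (simp only: mult_ac)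
      finally have sn: "snd z = W z - v z * t z ^ Suc p * (y z ^ Suc p + W z * R z)" .
      have ph: "poly h (x + fst z) = fst z ^ 2 * (fst z ^ p * H z)" unfolding h0(1) poly_factor_shift p H_def by (simp add: power_add power2_eq_square)
      have pq: "poly q (x + fst z) = fst z * Q z"
        using poly_factor_shift[of x 1 q0 "fst z"] by (simp add: q0 Q_def)
      have "affine_chart q h x 0 z = snd z * ((snd z)\<^sup>2 + 2 * (fst z * Q z) * snd z + fst z ^ 2 * (fst z ^ p * H z))"
        unfolding affine_chart_def ph pq by simp
      also have "fst z ^ p * H z = Q z ^ 2 - s z ^ 2" using elim by simp
      also have "snd z * ((snd z)\<^sup>2 + 2 * (fst z * Q z) * snd z + fst z ^ 2 * (Q z ^ 2 - s z ^ 2))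
          = snd z * y z * W z" by (simp add: y_def W_def power2_eq_square algebra_simps)
      also have "\<dots> = y z * (snd z * W z)" by (simp only: mult_ac)
      also have "snd z * W z = ((1 - v z * t z ^ Suc p * R z) * (W z)\<^sup>2 + - (v z * t z ^ Suc p) * W z * y z ^ Suc p)"
        unfolding sn by (simp add: power2_eq_square algebra_simps)
      finally show ?case .
    qed
  qed simp
  then show ?thesis by (simp add: p)
qed

text \<open>A simple zero of \<open>q\<close> makes \<open>w = snd + q\<close> and
  \<open>snd\<close> coordinates, and \<open>fst = (w - snd) / Q\<close> there. The line is
  transversal to the tangent \<open>w = 0\<close> of the residual curve
  \<open>w^2 = fst^k G\<close>, whose right-hand side is expanded modulo \<open>w^2\<close>.\<close>

lemma type_line_cusp:
  assumes q: "q = [:-x, 1:] * q0" "poly q0 x \<noteq> 0"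
    and g: "q\<^sup>2 - h \<noteq> 0" "order x (q\<^sup>2 - h) = k" "k \<ge> 3"
  shows "germ_equiv (affine_chart q h x 0) (normal_form (D (k + 2)))"
proof -
  obtain g0 where g0: "q\<^sup>2 - h = [:-x, 1:] ^ k * g0" "poly g0 x \<noteq> 0" using order_factor[OF g(1), of x] g by metis
  define Q where "Q z = poly q0 (x + fst z)" for z :: "complex \<times> complex"
  define G where "G z = poly g0 (x + fst z)" for z :: "complex \<times> complex"
  have Q: "hg Q" "Q 0 \<noteq> 0" and G: "hg G" "G 0 \<noteq> 0" using q g0 unfolding Q_def G_def by (auto simp: fst_zero)
  define w where "w z = fst z * Q z + 1 * snd z" for z
  have c: "coords w snd" unfolding w_def by (rule coords_line_slope) (use Q in auto)
  note hgs = coordsD[OF c]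
  define v where "v z = G z / Q z ^ k" for z
  have v: "hg v" "v 0 \<noteq> 0" unfolding v_def using Q G by (auto intro!: hg_intros)
  obtain n where n: "k = Suc n" "n \<ge> 2" using g(3) by (cases k) auto
  obtain R where R: "hg R" "\<And>z. (w z - snd z) ^ Suc n = (- snd z) ^ Suc n + of_nat (Suc n) * (- snd z) ^ n * w z + w z ^ 2 * R z" "R 0 = 0"
    using binomial_second_order[OF hgs(1,2,3,4), of n] n by auto
  show ?thesis
  proof (rule recognize_D_square[OF c, where a="\<lambda>z. 1 - v z * R z" and b="\<lambda>z. - v z * of_nat k * (-1) ^ n" and d="\<lambda>z. - v z * (-1) ^ k"])
    show "hg (\<lambda>z. 1 - v z * R z)" "hg (\<lambda>z. - v z * of_nat k * (-1) ^ n)" "hg (\<lambda>z. - v z * (-1) ^ k)" by (intro hg_intros v R)+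
    show "1 - v 0 * R 0 \<noteq> 0" "- v 0 * (-1) ^ k \<noteq> 0" using v R by auto
    show "2 < k" using g by simp
    show "\<forall>\<^sub>F z in nhds 0. affine_chart q h x 0 z = snd z * ((1 - v z * R z) * (w z)\<^sup>2
       + - v z * of_nat k * (-1) ^ n * w z * snd z ^ (k - 1) + - v z * (-1) ^ k * snd z ^ k)"
      using hg_nonzero[OF Q]
    proof eventually_elim
      case (elim z)
      have "h = q\<^sup>2 - [:-x, 1:] ^ k * g0" using g0(1) by (metis diff_diff_eq2 add_diff_cancel_left' diff_add_cancel)
      then have ph: "poly h (x + fst z) = (poly q (x + fst z))\<^sup>2 - fst z ^ k * G z"
        using poly_factor_shift[of x k g0 "fst z"] by (simp add: G_def)
      have pq: "poly q (x + fst z) = fst z * Q z"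
        using poly_factor_shift[of x 1 q0 "fst z"] by (simp add: q(1) Q_def)
      have 1: "affine_chart q h x 0 z = snd z * (w z ^ 2 - fst z ^ k * G z)"
        unfolding affine_chart_def ph pq w_def by (simp add: power2_eq_square algebra_simps)
      have "fst z * Q z = w z - snd z" by (simp add: w_def)
      then have "(fst z * Q z) ^ k = (w z - snd z) ^ k" by simp
      then have "fst z ^ k * Q z ^ k = (w z - snd z) ^ k" by (simp add: power_mult_distrib)
      then have "fst z ^ k = (w z - snd z) ^ k / Q z ^ k" using elim by (simp add: nonzero_eq_divide_eq)
      then have 2: "fst z ^ k * G z = v z * (w z - snd z) ^ Suc n" by (simp add: v_def n(1))
      show ?case unfolding 1 2 R(2) unfolding n(1)
        by (simp add: power_minus[of "snd z"] algebra_simps)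
    qed
  qed
qed

text \<open>Now the line is the tangent of a cusp: \<open>q\<close> vanishes doubly, so its term is
  of the kind removed by \<open>recognize_E7_cube\<close>.\<close>

lemma type_line_cusp_tangent:
  assumes q: "q = [:-x, 1:] ^ 2 * r" and h: "h \<noteq> 0" "order x h = 3"
  shows "germ_equiv (affine_chart q h x 0) (normal_form E7)"
proof -
  obtain h0 where h0: "h = [:-x, 1:] ^ 3 * h0" "poly h0 x \<noteq> 0" using order_factor[OF h(1), of x] h by metis
  show ?thesis
  proof (rule recognize_E7_cube[OF coords_swap[OF coords_base], where b="\<lambda>z. 2 * poly r (x + fst z)" and e="\<lambda>z. poly h0 (x + fst z)"])
    show "\<forall>\<^sub>F z in nhds 0. affine_chart q h x 0 z =
       snd z * ((snd z)\<^sup>2 + 2 * poly r (x + fst z) * snd z * (fst z)\<^sup>2 + poly h0 (x + fst z) * fst z ^ 3)"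
      unfolding affine_chart_def q h0(1) poly_factor_shift by (simp add: algebra_simps)
  qed (use h0 in \<open>auto intro!: hg_intros\<close>)
qed

text \<open>Since \<open>q^2 - h\<close> vanishes at \<open>x\<close> and \<open>h\<close> does not,
  \<open>y = - q x\<close> is nonzero; the factor \<open>y\<close> is a unit and
  \<open>(y + q)^2 - (q^2 - h)\<close> is already in the form of an A singularity.\<close>

lemma type_off_line:
  assumes "poly h x \<noteq> 0" "order x (q\<^sup>2 - h) = k" "k \<ge> 2" "q\<^sup>2 - h \<noteq> 0"
  shows "germ_equiv (affine_chart q h x (- poly q x)) (normal_form (A (k - 1)))"
proof -
  obtain g0 where g0: "q\<^sup>2 - h = [:-x, 1:] ^ k * g0" "poly g0 x \<noteq> 0" using order_factor[OF assms(4), of x] assms by metis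
  have "poly (q\<^sup>2 - h) x = 0" using assms(2,3) by (metis order_root not_numeral_le_zero)
  then have q0: "poly q x \<noteq> 0" using assms(1) by auto
  obtain q1 where q1: "q - [:poly q x:] = [:-x, 1:] * q1" using poly_root_factor[of "q - [:poly q x:]" x] by auto
  then have "q = [:poly q x:] + [:-x, 1:] * q1" by (metis add.commute diff_add_cancel)
  then have q1': "poly q (x + t) = poly q x + t * poly q1 (x + t)" for t
  proof -
    have "poly q (x + t) = poly ([:poly q x:] + [:-x, 1:] * q1) (x + t)"
      using arg_cong[OF \<open>q = [:poly q x:] + [:-x, 1:] * q1\<close>, of "\<lambda>p. poly p (x + t)"] .
    then show ?thesis using poly_factor_shift[of x 1 q1 t] by simp
  qed
  have "coords (\<lambda>z. snd z + poly q1 (x + fst z) * fst z) fst"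
    by (rule coords_shear[OF coords_swap[OF coords_base]]) auto
  then show ?thesis
  proof (rule recognize_A[where a="\<lambda>z. - poly q x + snd z" and e="\<lambda>z. - (- poly q x + snd z) * poly g0 (x + fst z)"])
    show "\<forall>\<^sub>F z in nhds 0. affine_chart q h x (- poly q x) z =
       (- poly q x + snd z) * (snd z + poly q1 (x + fst z) * fst z)\<^sup>2
       + - (- poly q x + snd z) * poly g0 (x + fst z) * fst z ^ Suc (k - 1)"
    proof (rule always_eventually, rule allI)
      fix z :: "complex \<times> complex"
      have "h = q\<^sup>2 - [:-x, 1:] ^ k * g0" using g0(1) by (metis diff_diff_eq2 add_diff_cancel_left' diff_add_cancel)
      then have 1: "poly h (x + fst z) = (poly q (x + fst z))\<^sup>2 - fst z ^ k * poly g0 (x + fst z)"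
        using poly_factor_shift[of x k g0 "fst z"] by simp
      have 2: "Suc (k - 1) = k" using assms(3) by simp
      show "affine_chart q h x (- poly q x) z =
       (- poly q x + snd z) * (snd z + poly q1 (x + fst z) * fst z)\<^sup>2
       + - (- poly q x + snd z) * poly g0 (x + fst z) * fst z ^ Suc (k - 1)"
        unfolding affine_chart_def 1 2 q1' by (simp add: power2_eq_square algebra_simps)
    qed
  qed (use q0 g0 in \<open>auto intro!: hg_intros\<close>)
qed

section \<open>Invariants of simple singularities\<close>

abbreviation lin2 :: "complex \<Rightarrow> complex \<Rightarrow> complex \<times> complex \<Rightarrow> complex" where
  "lin2 a b \<equiv> (\<lambda>w. a * fst w + b * snd w)"

lemma holo2_onD:
  assumes "holo2_on U f" "z \<in> U"
  obtains a b where "(f has_derivative lin2 a b) (at z)"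
  using assms unfolding holo2_on_def case_prod_beta' by blast

lemma lin2_cong: "(f has_derivative lin2 a b) (at z) \<Longrightarrow> (f has_derivative lin2 c d) (at z) \<Longrightarrow> a = c \<and> b = d"
proof -
  assume "(f has_derivative lin2 a b) (at z)" "(f has_derivative lin2 c d) (at z)"
  then have e: "lin2 a b = lin2 c d" by (rule has_derivative_unique)
  show ?thesis using fun_cong[OF e, of "(1,0)"] fun_cong[OF e, of "(0,1)"] by simp
qed

lemma norm_fst_le': "norm (fst z) \<le> norm z" and norm_snd_le': "norm (snd z) \<le> norm z"
  for z :: "complex \<times> complex"
  by (metis norm_fst_le prod.collapse) (metis norm_snd_le prod.collapse)

lemma germ_equivE:
  assumes "germ_equiv f g"
  obtains U V \<Phi> \<Psi> u where "open U" "0 \<in> U" "open V" "0 \<in> V" "\<Phi> 0 = 0" "\<Psi> 0 = 0"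
    "\<Phi> ` U = V" "\<And>z. z \<in> U \<Longrightarrow> \<Psi> (\<Phi> z) = z" "\<And>y. y \<in> V \<Longrightarrow> \<Psi> y \<in> U \<and> \<Phi> (\<Psi> y) = y"
    "holo2_on U (\<lambda>z. fst (\<Phi> z))" "holo2_on U (\<lambda>z. snd (\<Phi> z))" "holo2_on U u" "u 0 \<noteq> 0"
    "holo2_on V (\<lambda>z. fst (\<Psi> z))" "holo2_on V (\<lambda>z. snd (\<Psi> z))"
    "\<And>z. z \<in> U \<Longrightarrow> f (\<Phi> z) = u z * g z"
proof -
  obtain U \<phi>1 \<phi>2 \<psi>1 \<psi>2 u where h: "(0, 0) \<in> U" "holo2_on U \<phi>1" "holo2_on U \<phi>2" "holo2_on U u"
      "(\<phi>1 (0, 0), \<phi>2 (0, 0)) = (0, 0)" "u (0, 0) \<noteq> 0"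
      "inj_on (\<lambda>z. (\<phi>1 z, \<phi>2 z)) U"
      "holo2_on ((\<lambda>z. (\<phi>1 z, \<phi>2 z)) ` U) \<psi>1" "holo2_on ((\<lambda>z. (\<phi>1 z, \<phi>2 z)) ` U) \<psi>2"
      "\<forall>z\<in>U. (\<psi>1 (\<phi>1 z, \<phi>2 z), \<psi>2 (\<phi>1 z, \<phi>2 z)) = z"
      "\<forall>z\<in>U. f (\<phi>1 z, \<phi>2 z) = u z * g z"
    using assms unfolding germ_equiv_def by blast
  show thesis
  proof (rule that[of U "(\<lambda>z. (\<phi>1 z, \<phi>2 z)) ` U" "\<lambda>z. (\<phi>1 z, \<phi>2 z)" "\<lambda>z. (\<psi>1 z, \<psi>2 z)" u])
    show "open U" "open ((\<lambda>z. (\<phi>1 z, \<phi>2 z)) ` U)" using h(2,8) by (auto simp: holo2_on_def)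
    show z: "0 \<in> U" "(\<phi>1 0, \<phi>2 0) = 0" "u 0 \<noteq> 0" using h by (auto simp: zero_prod_def)
    show "0 \<in> (\<lambda>z. (\<phi>1 z, \<phi>2 z)) ` U" by (rule image_eqI[of _ _ 0]) (use z in auto)
    have "(\<psi>1 (\<phi>1 0, \<phi>2 0), \<psi>2 (\<phi>1 0, \<phi>2 0)) = 0" using h(10) z(1) by blast
    then show "(\<psi>1 0, \<psi>2 0) = 0" unfolding z(2) .
    show "\<And>y. y \<in> (\<lambda>z. (\<phi>1 z, \<phi>2 z)) ` U \<Longrightarrow>
         (\<psi>1 y, \<psi>2 y) \<in> U \<and> (\<phi>1 (\<psi>1 y, \<psi>2 y), \<phi>2 (\<psi>1 y, \<psi>2 y)) = y" using h(10) by auto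
  qed (use h in auto)
qed

text \<open>The factor \<open>u\<close> is only known to be nonzero at the origin, so the domains
  are shrunk to where it has an inverse.\<close>

lemma germ_equiv_sym:
  assumes "germ_equiv f g" shows "germ_equiv g f"
proof -
  obtain U V \<Phi> \<Psi> u where h: "open U" "0 \<in> U" "open V" "0 \<in> V" "\<Phi> 0 = 0" "\<Psi> 0 = 0"
    "\<Phi> ` U = V" "\<And>z. z \<in> U \<Longrightarrow> \<Psi> (\<Phi> z) = z" "\<And>y. y \<in> V \<Longrightarrow> \<Psi> y \<in> U \<and> \<Phi> (\<Psi> y) = y"
    "holo2_on U (\<lambda>z. fst (\<Phi> z))" "holo2_on U (\<lambda>z. snd (\<Phi> z))" "holo2_on U u" "u 0 \<noteq> 0"
    "holo2_on V (\<lambda>z. fst (\<Psi> z))" "holo2_on V (\<lambda>z. snd (\<Psi> z))"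
    "\<And>z. z \<in> U \<Longrightarrow> f (\<Phi> z) = u z * g z"
    using germ_equivE[OF assms] by blast
  have contPsi: "continuous_on V \<Psi>"
  proof -
    have "continuous_on V (\<lambda>y. (fst (\<Psi> y), snd (\<Psi> y)))"
    proof (intro continuous_on_Pair continuous_at_imp_continuous_on ballI)
      fix y assume "y \<in> V"
      then show "isCont (\<lambda>y. fst (\<Psi> y)) y" "isCont (\<lambda>y. snd (\<Psi> y)) y"
        using h(14,15) by (meson holo2_onD has_derivative_continuous)+
    qed
    then show ?thesis by simp
  qed
  have contu: "continuous_on U u"
    using h(12) by (meson continuous_at_imp_continuous_on holo2_onD has_derivative_continuous)
  define U' where "U' = {z \<in> U. u z \<noteq> 0}"
  have U': "open U'" 
  proof -
    have "U' = U \<inter> u -` (- {0})" by (auto simp: U'_def)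
    then show ?thesis using continuous_open_preimage[OF contu h(1), of "-{0}"] by auto
  qed
  define V' where "V' = V \<inter> \<Psi> -` U'"
  have V': "open V'" unfolding V'_def by (rule continuous_open_preimage[OF contPsi h(3) U'])
  have im: "\<Psi> ` V' = U'"
  proof (intro equalityI subsetI)
    fix z assume "z \<in> U'"
    then have "\<Phi> z \<in> V'" "z = \<Psi> (\<Phi> z)" using h(7,8) by (auto simp: V'_def U'_def)
    then show "z \<in> \<Psi> ` V'" by blast
  qed (auto simp: V'_def)
  have pr: "(\<lambda>z. (fst (\<Psi> z), snd (\<Psi> z))) = \<Psi>" by auto
  have sub: "holo2_on V' k" if "holo2_on V k" for k using that V' by (auto simp: holo2_on_def V'_def)
  have sub': "holo2_on U' k" if "holo2_on U k" for k using that U' by (auto simp: holo2_on_def U'_def)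
  show ?thesis unfolding germ_equiv_def
  proof (rule exI[of _ V'], rule exI[of _ "\<lambda>z. fst (\<Psi> z)"], rule exI[of _ "\<lambda>z. snd (\<Psi> z)"],
      rule exI[of _ "\<lambda>z. fst (\<Phi> z)"], rule exI[of _ "\<lambda>z. snd (\<Phi> z)"], rule exI[of _ "\<lambda>y. inverse (u (\<Psi> y))"], intro conjI)
    show "(0,0) \<in> V'" using h U'_def by (simp add: V'_def flip: zero_prod_def)
    show "holo2_on V' (\<lambda>z. fst (\<Psi> z))" "holo2_on V' (\<lambda>z. snd (\<Psi> z))" using h sub by auto
    show "(fst (\<Psi> (0, 0)), snd (\<Psi> (0, 0))) = (0, 0)" using h(6) by (simp add: zero_prod_def)
    show "inverse (u (\<Psi> (0, 0))) \<noteq> 0" using h(6,13) by (simp add: zero_prod_def)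
    show "inj_on (\<lambda>z. (fst (\<Psi> z), snd (\<Psi> z))) V'" unfolding pr V'_def using h(9) by (metis Int_iff inj_on_def)
    show "holo2_on ((\<lambda>z. (fst (\<Psi> z), snd (\<Psi> z))) ` V') (\<lambda>z. fst (\<Phi> z))"
         "holo2_on ((\<lambda>z. (fst (\<Psi> z), snd (\<Psi> z))) ` V') (\<lambda>z. snd (\<Phi> z))" unfolding pr im using h sub' by auto
    show "\<forall>z\<in>V'. (fst (\<Phi> (fst (\<Psi> z), snd (\<Psi> z))), snd (\<Phi> (fst (\<Psi> z), snd (\<Psi> z)))) = z"
      using h(9) by (simp add: V'_def)
    show "\<forall>z\<in>V'. g (fst (\<Psi> z), snd (\<Psi> z)) = inverse (u (\<Psi> z)) * f z"
    proof
      fix z assume z: "z \<in> V'"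
      have "\<Psi> z \<in> U" "u (\<Psi> z) \<noteq> 0" using z by (auto simp: V'_def U'_def)
      moreover from h(16)[OF this(1)] have "f (\<Phi> (\<Psi> z)) = u (\<Psi> z) * g (\<Psi> z)" .
      moreover have "\<Phi> (\<Psi> z) = z" using z h(9) by (simp add: V'_def)
      ultimately show "g (fst (\<Psi> z), snd (\<Psi> z)) = inverse (u (\<Psi> z)) * f z" by simp
    qed
    show "holo2_on V' (\<lambda>y. inverse (u (\<Psi> y)))" unfolding holo2_on_def
    proof (intro conjI V' ballI)
      fix y assume "y \<in> V'"
      then have y: "y \<in> V" "\<Psi> y \<in> U" "u (\<Psi> y) \<noteq> 0" by (auto simp: V'_def U'_def)
      obtain a b where ab: "((\<lambda>z. fst (\<Psi> z)) has_derivative lin2 a b) (at y)" using holo2_onD[OF h(14) y(1)] .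
      obtain c d where cd: "((\<lambda>z. snd (\<Psi> z)) has_derivative lin2 c d) (at y)" using holo2_onD[OF h(15) y(1)] .
      have P: "(\<Psi> has_derivative (\<lambda>w. (lin2 a b w, lin2 c d w))) (at y)"
        using has_derivative_Pair[OF ab cd] by simp
      obtain p q where pq: "(u has_derivative lin2 p q) (at (\<Psi> y))" using holo2_onD[OF h(12) y(2)] .
      have "((\<lambda>y. u (\<Psi> y)) has_derivative lin2 (p * a + q * c) (p * b + q * d)) (at y)"
        by (rule has_derivative_eq_rhs[OF has_derivative_compose[OF P pq]]) (simp add: algebra_simps)
      from Deriv.has_derivative_inverse[OF y(3) this]
      have "((\<lambda>y. inverse (u (\<Psi> y))) has_derivative (\<lambda>(w1,w2). (- inverse (u (\<Psi> y)) * inverse (u (\<Psi> y)) * (p * a + q * c)) * w1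
          + (- inverse (u (\<Psi> y)) * inverse (u (\<Psi> y)) * (p * b + q * d)) * w2)) (at y)"
        by (rule has_derivative_eq_rhs) (simp add: algebra_simps case_prod_beta')
      then show "\<exists>a b. ((\<lambda>y. inverse (u (\<Psi> y))) has_derivative (\<lambda>(w1, w2). a * w1 + b * w2)) (at y)" by blast
    qed
  qed
qed

lemma has_derivative_linear_bound:
  fixes f :: "'a::real_normed_vector \<Rightarrow> 'b::real_normed_vector"
  assumes "(f has_derivative f') (at 0)" "f 0 = 0"
  shows "\<exists>K>0. \<forall>\<^sub>F z in nhds 0. norm (f z) \<le> K * norm z"
proof -
  obtain K where K: "K > 0" "\<And>w. norm (f' w) \<le> norm w * K"
    using assms(1) bounded_linear.pos_bounded has_derivative_bounded_linear by blast
  obtain d where d: "d > 0" "\<And>y. norm (y - 0) < d \<Longrightarrow> norm (f y - f 0 - f' (y - 0)) \<le> 1 * norm (y - 0)"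
    using assms(1) unfolding has_derivative_at_alt by (metis zero_less_one)
  have "\<forall>\<^sub>F z in nhds 0. norm (f z) \<le> (K + 1) * norm z"
    unfolding eventually_nhds_metric
  proof (intro exI[of _ d] conjI d allI impI)
    fix z :: 'a assume "dist z 0 < d"
    then have "norm (f z - f' z) \<le> norm z" using d(2)[of z] assms(2) by simp
    moreover have "norm (f z) \<le> norm (f z - f' z) + norm (f' z)" by (metis norm_triangle_sub add.commute)
    ultimately show "norm (f z) \<le> (K + 1) * norm z" using K(2)[of z] by (simp add: algebra_simps)
  qed
  then show ?thesis using K(1) by (intro exI[of _ "K + 1"]) auto
qed

text \<open>Pointwise complex differentiability makes the restriction to every complex line
  holomorphic, and Cauchy's inequality bounds its derivative by the maximum of \<open>f\<close>. The
  coordinate directions give the two partial derivatives.\<close>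

lemma holo2_partials_bounded:
  assumes "holo2_on U f" "0 \<in> U"
  shows "\<exists>K>0. \<forall>\<^sub>F z in nhds 0. \<forall>a b. (f has_derivative lin2 a b) (at z) \<longrightarrow> norm a \<le> K \<and> norm b \<le> K"
proof -
  \<comment> \<open>The radius \<open>2 * r\<close> leaves room for discs of radius \<open>r\<close>
    around all points of norm below \<open>r\<close>.\<close>
  obtain r where r: "r > 0" "cball 0 (2 * r) \<subseteq> U"
  proof -
    obtain e where "e > 0" "cball 0 e \<subseteq> U" using assms open_contains_cball unfolding holo2_on_def by blast
    then show ?thesis using that[of "e / 2"] by auto
  qed
  have cont: "continuous_on U f"
    using assms(1) by (meson continuous_at_imp_continuous_on holo2_onD has_derivative_continuous)
  have "compact (f ` cball 0 (2 * r))"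
    by (rule compact_continuous_image[OF continuous_on_subset[OF cont r(2)]]) simp
  then obtain B where B: "\<And>z. z \<in> cball 0 (2*r) \<Longrightarrow> norm (f z) \<le> B"
    by (metis compact_imp_bounded bounded_iff image_eqI)
  have "norm (f 0) \<le> B" using B[of 0] r by simp
  then have B0: "B \<ge> 0" using norm_ge_zero[of "f 0"] by linarith
  define K where "K = B / r + 1"
  have K: "K > 0" unfolding K_def using B0 r by (simp add: add_nonneg_pos)
  have key: "norm (a * fst e + b * snd e) \<le> K"
    if z: "norm z < r" and d: "(f has_derivative lin2 a b) (at z)" and e: "norm e = 1" for z a b and e :: "complex \<times> complex"
  proof -
    define k where "k t = f (z + (t * fst e, t * snd e))" for t
    have ne: "norm (t * fst e, t * snd e) = norm t" for t :: complex
    proof -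
      have "norm (t * fst e, t * snd e) = norm t * norm (fst e, snd e)"
        by (simp add: norm_prod_def norm_mult power_mult_distrib real_sqrt_mult flip: distrib_left)
      then show ?thesis using e by simp
    qed
    have inU: "z + (t * fst e, t * snd e) \<in> cball 0 (2 * r)" if "norm t \<le> r" for t
      using norm_triangle_ineq[of z "(t * fst e, t * snd e)"] ne[of t] that z by simp
    have D: "(k has_field_derivative (a' * fst e + b' * snd e)) (at t)"
      if "(f has_derivative lin2 a' b') (at (z + (t * fst e, t * snd e)))" for t a' b'
    proof -
      have "((\<lambda>t. z + (t * fst e, t * snd e)) has_derivative (\<lambda>t. (t * fst e, t * snd e))) (at t)"
        by (auto intro!: derivative_eq_intros)
      from has_derivative_compose[OF this that] show ?thesis
        unfolding has_field_derivative_def k_def by (rule has_derivative_eq_rhs) (auto simp: algebra_simps)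
    qed
    have hol: "\<exists>D. (k has_field_derivative D) (at t)" if t: "norm t \<le> r" for t
    proof -
      have "z + (t * fst e, t * snd e) \<in> U" using inU[OF t] r by auto
      then obtain a' b' where "(f has_derivative lin2 a' b') (at (z + (t * fst e, t * snd e)))"
        by (rule holo2_onD[OF assms(1)])
      then show ?thesis using D by blast
    qed
    have "norm ((deriv ^^ 1) k 0) \<le> fact 1 * B / r ^ 1"
    proof (rule Cauchy_inequality)
      show "k holomorphic_on ball 0 r"
      proof (rule holomorphic_onI)
        fix t :: complex assume "t \<in> ball 0 r"
        then obtain d where "(k has_field_derivative d) (at t)" using hol[of t] by auto
        then show "k field_differentiable at t within ball 0 r"
          unfolding field_differentiable_def by (blast intro: has_field_derivative_at_within)
      qed
      show "continuous_on (cball 0 r) k"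
      proof (intro continuous_at_imp_continuous_on ballI)
        fix t :: complex assume "t \<in> cball 0 r"
        then obtain d where "(k has_field_derivative d) (at t)" using hol[of t] by auto
        then show "isCont k t" by (rule DERIV_isCont)
      qed
      show "norm (k t) \<le> B" if "norm (0 - t) = r" for t
        unfolding k_def by (rule B, rule inU) (use that in simp)
    qed (use r in simp)
    moreover have "deriv k 0 = a * fst e + b * snd e"
      by (rule DERIV_imp_deriv, rule D) (use d in \<open>simp flip: zero_prod_def\<close>)
    ultimately show ?thesis by (simp add: K_def)
  qed
  show ?thesis
  proof (intro exI[of _ K] conjI K)
    show "\<forall>\<^sub>F z in nhds 0. \<forall>a b. (f has_derivative lin2 a b) (at z) \<longrightarrow> norm a \<le> K \<and> norm b \<le> K"
      unfolding eventually_nhds_metric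
      using r(1) key[of _ _ _ "(1,0)"] key[of _ _ _ "(0,1)"]
      by (intro exI[of _ r]) (auto simp: norm_Pair)
  qed
qed

text \<open>Multiplicity at least 3, phrased as an estimate; it separates the A series from D and
  E.\<close>

definition cubic_bound :: "(complex \<times> complex \<Rightarrow> complex) \<Rightarrow> bool" where
  "cubic_bound f \<longleftrightarrow> (\<exists>C. \<forall>\<^sub>F z in nhds 0. norm (f z) \<le> C * norm z ^ 3)"

definition wedge :: "complex \<times> complex \<Rightarrow> complex \<times> complex \<Rightarrow> complex" where
  "wedge z w = fst z * snd w - snd z * fst w"

text \<open>Up to the norms, \<open>wedge z w\<close> measures the angle between the complex lines
  through \<open>z\<close> and \<open>w\<close>. Comparing two zeros with each other avoids naming
  the tangent, which keeps the notion invariant under coordinate changes.\<close>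

definition unitangent :: "(complex \<times> complex \<Rightarrow> complex) \<Rightarrow> bool" where
  "unitangent f \<longleftrightarrow> (\<forall>e>0. \<exists>d>0. \<forall>z w. norm z < d \<longrightarrow> norm w < d \<longrightarrow> f z = 0 \<longrightarrow> f w = 0 \<longrightarrow>
     norm (wedge z w) \<le> e * norm z * norm w)"

text \<open>The sixth power clears the denominators 2 and 3 of the exponents that occur for the normal forms.\<close>
definition grad_bound :: "nat \<Rightarrow> (complex \<times> complex \<Rightarrow> complex) \<Rightarrow> bool" where
  "grad_bound k f \<longleftrightarrow> (\<exists>c>0. \<forall>\<^sub>F z in nhds 0. f z = 0 \<longrightarrow> (\<forall>a b. (f has_derivative lin2 a b) (at z) \<longrightarrow>
     c * norm z ^ k \<le> (norm a + norm b) ^ 6))"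

lemma norm_wedge_le: "norm (wedge z w) \<le> 2 * norm z * norm w"
proof -
  have "norm (wedge z w) \<le> norm (fst z) * norm (snd w) + norm (snd z) * norm (fst w)"
    unfolding wedge_def by (metis norm_mult norm_triangle_ineq4)
  also have "\<dots> \<le> norm z * norm w + norm z * norm w"
    by (intro add_mono mult_mono norm_fst_le' norm_snd_le') auto
  finally show ?thesis by linarith
qed

text \<open>Collects the estimates shared by the transfer lemmas: norms are distorted by at most the
  factor \<open>K\<close>, and the unit stays between \<open>c\<close> and \<open>K\<close>.\<close>

lemma germ_equiv_setup:
  assumes "germ_equiv g f"
  obtains U V \<Phi> \<Psi> u \<Psi>' K c where "open U" "0 \<in> U" "open V" "0 \<in> V" "\<Phi> 0 = 0" "\<Psi> 0 = 0"
    "\<Phi> ` U = V" "\<And>z. z \<in> U \<Longrightarrow> \<Psi> (\<Phi> z) = z" "\<And>y. y \<in> V \<Longrightarrow> \<Psi> y \<in> U \<and> \<Phi> (\<Psi> y) = y"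
    "holo2_on V (\<lambda>z. fst (\<Psi> z))" "holo2_on V (\<lambda>z. snd (\<Psi> z))" "holo2_on U u"
    "\<And>z. z \<in> U \<Longrightarrow> g (\<Phi> z) = u z * f z"
    "(\<Phi> \<longlongrightarrow> 0) (nhds 0)" "K > 0" "c > 0"
    "\<forall>\<^sub>F z in nhds 0. z \<in> U \<and> norm (\<Phi> z) \<le> K * norm z \<and> norm z \<le> K * norm (\<Phi> z) \<and> c \<le> norm (u z) \<and> norm (u z) \<le> K"
proof -
  obtain U V \<Phi> \<Psi> u where h: "open U" "0 \<in> U" "open V" "0 \<in> V" "\<Phi> 0 = 0" "\<Psi> 0 = 0"
    "\<Phi> ` U = V" "\<And>z. z \<in> U \<Longrightarrow> \<Psi> (\<Phi> z) = z" "\<And>y. y \<in> V \<Longrightarrow> \<Psi> y \<in> U \<and> \<Phi> (\<Psi> y) = y"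
    "holo2_on U (\<lambda>z. fst (\<Phi> z))" "holo2_on U (\<lambda>z. snd (\<Phi> z))" "holo2_on U u" "u 0 \<noteq> 0"
    "holo2_on V (\<lambda>z. fst (\<Psi> z))" "holo2_on V (\<lambda>z. snd (\<Psi> z))"
    "\<And>z. z \<in> U \<Longrightarrow> g (\<Phi> z) = u z * f z"
    using germ_equivE[OF assms] by blast
  have "\<exists>D. (\<Phi> has_derivative D) (at 0)"
  proof -
    obtain a b where ab: "((\<lambda>z. fst (\<Phi> z)) has_derivative lin2 a b) (at 0)" using holo2_onD[OF h(10,2)] .
    obtain c d where cd: "((\<lambda>z. snd (\<Phi> z)) has_derivative lin2 c d) (at 0)" using holo2_onD[OF h(11,2)] .
    show ?thesis using has_derivative_Pair[OF ab cd] by auto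
  qed
  then obtain D where D: "(\<Phi> has_derivative D) (at 0)" ..
  have "\<exists>D. (\<Psi> has_derivative D) (at 0)"
  proof -
    obtain a b where ab: "((\<lambda>z. fst (\<Psi> z)) has_derivative lin2 a b) (at 0)" using holo2_onD[OF h(14,4)] .
    obtain c d where cd: "((\<lambda>z. snd (\<Psi> z)) has_derivative lin2 c d) (at 0)" using holo2_onD[OF h(15,4)] .
    show ?thesis using has_derivative_Pair[OF ab cd] by auto
  qed
  then obtain E where E: "(\<Psi> has_derivative E) (at 0)" ..
  have lim: "(\<Phi> \<longlongrightarrow> 0) (nhds 0)"
    using has_derivative_continuous[OF D] h(5) by (metis isCont_def tendsto_at_iff_tendsto_nhds)
  obtain K1 where K1: "K1 > 0" "\<forall>\<^sub>F z in nhds 0. norm (\<Phi> z) \<le> K1 * norm z"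
    using has_derivative_linear_bound[OF D h(5)] by blast
  obtain K2 where K2: "K2 > 0" "\<forall>\<^sub>F z in nhds 0. norm (\<Psi> z) \<le> K2 * norm z"
    using has_derivative_linear_bound[OF E h(6)] by blast
  have K2': "\<forall>\<^sub>F z in nhds 0. norm (\<Psi> (\<Phi> z)) \<le> K2 * norm (\<Phi> z)"
    using eventually_compose_filterlim[OF K2(2) lim] .
  have "isCont u 0" using h(2,12) by (meson holo2_onD has_derivative_continuous)
  then have "((\<lambda>z. norm (u z)) \<longlongrightarrow> norm (u 0)) (nhds 0)"
    by (metis isCont_def tendsto_at_iff_tendsto_nhds tendsto_norm)
  from order_tendstoD(1)[OF this, of "norm (u 0) / 2"] order_tendstoD(2)[OF this, of "norm (u 0) + 1"]
  have u1: "\<forall>\<^sub>F z in nhds 0. norm (u z) > norm (u 0) / 2" "\<forall>\<^sub>F z in nhds 0. norm (u z) < norm (u 0) + 1"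
    using h(13) by simp_all
  define K where "K = max (max K1 K2) (norm (u 0) + 1)"
  have K: "K \<ge> K1" "K \<ge> K2" "K \<ge> norm (u 0) + 1" by (auto simp: K_def)
  have "\<forall>\<^sub>F z in nhds 0. z \<in> U" using h(1,2) by (rule eventually_nhds_in_open)
  then have "\<forall>\<^sub>F z in nhds 0. z \<in> U \<and> norm (\<Phi> z) \<le> K * norm z \<and> norm z \<le> K * norm (\<Phi> z) \<and> norm (u 0) / 2 \<le> norm (u z) \<and> norm (u z) \<le> K"
    using K1(2) K2' u1
  proof eventually_elim
    case (elim z)
    have "K1 * norm z \<le> K * norm z" "K2 * norm (\<Phi> z) \<le> K * norm (\<Phi> z)" using K by (auto intro: mult_right_mono)
    then show ?case using elim h(8)[of z] K(3) by auto
  qed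
  moreover have "K > 0" using K(1) K1(1) by simp
  ultimately show thesis using that[OF h(1-9,14,15,12,16) lim, of K "norm (u 0) / 2"] h(13) by simp
qed

lemma cubic_bound_transfer:
  assumes "germ_equiv g f" "cubic_bound g" shows "cubic_bound f"
proof -
  obtain C where C: "\<forall>\<^sub>F z in nhds 0. norm (g z) \<le> C * norm z ^ 3" using assms(2) unfolding cubic_bound_def by blast
  show ?thesis
  proof (rule germ_equiv_setup[OF assms(1)])
    fix U V \<Phi> \<Psi> u K c
    assume gf: "\<And>z. z \<in> U \<Longrightarrow> g (\<Phi> z) = u z * f z" and lim: "(\<Phi> \<longlongrightarrow> 0) (nhds 0)" and Kc: "K > (0::real)" "c > (0::real)"
      and ev: "\<forall>\<^sub>F z in nhds 0. z \<in> U \<and> norm (\<Phi> z) \<le> K * norm z \<and> norm z \<le> K * norm (\<Phi> z) \<and> c \<le> norm (u z) \<and> norm (u z) \<le> K"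
    have "\<forall>\<^sub>F z in nhds 0. norm (f z) \<le> (\<bar>C\<bar> * K ^ 3 / c) * norm z ^ 3"
      using ev eventually_compose_filterlim[OF C lim]
    proof eventually_elim
      case (elim z)
      have "c * norm (f z) \<le> norm (u z) * norm (f z)" using elim by (intro mult_right_mono) auto
      also have "\<dots> = norm (g (\<Phi> z))" using gf elim by (simp add: norm_mult)
      also have "\<dots> \<le> C * norm (\<Phi> z) ^ 3" using elim by simp
      also have "\<dots> \<le> \<bar>C\<bar> * norm (\<Phi> z) ^ 3" by (intro mult_right_mono) auto
      also have "\<dots> \<le> \<bar>C\<bar> * (K * norm z) ^ 3" using elim by (intro mult_left_mono power_mono) auto
      finally show ?case using Kc by (simp add: field_simps)
    qed
    then show ?thesis unfolding cubic_bound_def by blast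
  qed
qed

text \<open>At a zero of \<open>f\<close> the derivative of \<open>u f\<close> is \<open>u\<close>
  times that of \<open>f\<close>. The gradient of \<open>g\<close> at \<open>\<Phi> z\<close> is
  thus \<open>u\<close> times the gradient of \<open>f\<close> composed with the derivative of
  \<open>\<Psi>\<close>, and both factors are bounded.\<close>

lemma grad_bound_transfer:
  assumes "germ_equiv g f" "grad_bound k g" shows "grad_bound k f"
proof -
  obtain c0 where c0: "c0 > 0" "\<forall>\<^sub>F z in nhds 0. g z = 0 \<longrightarrow> (\<forall>a b. (g has_derivative lin2 a b) (at z) \<longrightarrow>
     c0 * norm z ^ k \<le> (norm a + norm b) ^ 6)" using assms(2) unfolding grad_bound_def by blast
  show ?thesis
  proof (rule germ_equiv_setup[OF assms(1)])
    fix U V \<Phi> \<Psi> u K c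
    assume op: "open U" "0 \<in> U" "open V" "0 \<in> V" "\<Phi> 0 = 0" "\<Psi> 0 = 0" "\<Phi> ` U = V"
      and inv: "\<And>z. z \<in> U \<Longrightarrow> \<Psi> (\<Phi> z) = z" "\<And>y. y \<in> V \<Longrightarrow> \<Psi> y \<in> U \<and> \<Phi> (\<Psi> y) = y"
      and hol: "holo2_on V (\<lambda>z. fst (\<Psi> z))" "holo2_on V (\<lambda>z. snd (\<Psi> z))" "holo2_on U u"
      and gf: "\<And>z. z \<in> U \<Longrightarrow> g (\<Phi> z) = u z * f z" and lim: "(\<Phi> \<longlongrightarrow> 0) (nhds 0)" and Kc: "K > (0::real)" "c > (0::real)"
      and ev: "\<forall>\<^sub>F z in nhds 0. z \<in> U \<and> norm (\<Phi> z) \<le> K * norm z \<and> norm z \<le> K * norm (\<Phi> z) \<and> c \<le> norm (u z) \<and> norm (u z) \<le> K"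
    obtain K1 where K1: "K1 > 0" "\<forall>\<^sub>F z in nhds 0. \<forall>a b. ((\<lambda>z. fst (\<Psi> z)) has_derivative lin2 a b) (at z) \<longrightarrow> norm a \<le> K1 \<and> norm b \<le> K1"
      using holo2_partials_bounded[OF hol(1) op(4)] by blast
    obtain K2 where K2: "K2 > 0" "\<forall>\<^sub>F z in nhds 0. \<forall>a b. ((\<lambda>z. snd (\<Psi> z)) has_derivative lin2 a b) (at z) \<longrightarrow> norm a \<le> K2 \<and> norm b \<le> K2"
      using holo2_partials_bounded[OF hol(2) op(4)] by blast
    define L where "L = 2 * K * (K1 + K2)"
    have L: "L > 0" using Kc K1 K2 by (simp add: L_def add_pos_pos)
    have "\<forall>\<^sub>F z in nhds 0. f z = 0 \<longrightarrow> (\<forall>a b. (f has_derivative lin2 a b) (at z) \<longrightarrow>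
     (c0 / (K ^ k * L ^ 6)) * norm z ^ k \<le> (norm a + norm b) ^ 6)"
      using ev eventually_compose_filterlim[OF c0(2) lim] eventually_compose_filterlim[OF K1(2) lim] eventually_compose_filterlim[OF K2(2) lim]
    proof eventually_elim
      case (elim z)
      show ?case
      proof (intro impI allI)
        fix a b assume fz: "f z = 0" and fd: "(f has_derivative lin2 a b) (at z)"
        define y where "y = \<Phi> z"
        have zU: "z \<in> U" and yV: "y \<in> V" and zy: "\<Psi> y = z" using elim op(7) inv by (auto simp: y_def)
        obtain p1 p2 where p: "((\<lambda>z. fst (\<Psi> z)) has_derivative lin2 p1 p2) (at y)" using holo2_onD[OF hol(1) yV] .
        obtain q1 q2 where q: "((\<lambda>z. snd (\<Psi> z)) has_derivative lin2 q1 q2) (at y)" using holo2_onD[OF hol(2) yV] .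
        have P: "(\<Psi> has_derivative (\<lambda>w. (lin2 p1 p2 w, lin2 q1 q2 w))) (at y)"
          using has_derivative_Pair[OF p q] by simp
        obtain r1 r2 where r: "(u has_derivative lin2 r1 r2) (at z)" using holo2_onD[OF hol(3) zU] .
        have "((\<lambda>z. u z * f z) has_derivative lin2 (u z * a) (u z * b)) (at (\<Psi> y))"
          unfolding zy by (rule has_derivative_eq_rhs[OF has_derivative_mult[OF r fd]]) (simp add: fz algebra_simps)
        from has_derivative_compose[OF P this]
        have "((\<lambda>y. u (\<Psi> y) * f (\<Psi> y)) has_derivative lin2 (u z * (a * p1 + b * q1)) (u z * (a * p2 + b * q2))) (at y)"
          by (rule has_derivative_eq_rhs) (simp add: algebra_simps)
        then have gd: "(g has_derivative lin2 (u z * (a * p1 + b * q1)) (u z * (a * p2 + b * q2))) (at y)"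
        proof (rule has_derivative_transform_within_open[OF _ op(3) yV])
          show "u (\<Psi> w) * f (\<Psi> w) = g w" if "w \<in> V" for w using gf inv(2)[OF that] by metis
        qed
        have "g y = 0" using gf[OF zU] fz by (simp add: y_def)
        then have 1: "c0 * norm y ^ k \<le> (norm (u z * (a * p1 + b * q1)) + norm (u z * (a * p2 + b * q2))) ^ 6"
          using elim(2) gd by (simp add: y_def)
        have pb: "norm p1 \<le> K1" "norm p2 \<le> K1" "norm q1 \<le> K2" "norm q2 \<le> K2"
          using elim(3,4) p q by (auto simp: y_def)
        have bd: "norm (u z * (a * p + b * q)) \<le> K * (K1 + K2) * (norm a + norm b)"
          if "norm p \<le> K1" "norm q \<le> K2" for p q
        proof -
          have "norm (a * p + b * q) \<le> norm a * norm p + norm b * norm q" by (metis norm_mult norm_triangle_ineq)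
          also have "\<dots> \<le> norm a * (K1 + K2) + norm b * (K1 + K2)"
            using that K1(1) K2(1) by (intro add_mono mult_left_mono) auto
          finally have 2: "norm (a * p + b * q) \<le> (K1 + K2) * (norm a + norm b)" by (simp add: algebra_simps)
          have "norm (u z) * norm (a * p + b * q) \<le> K * ((K1 + K2) * (norm a + norm b))"
            using elim 2 Kc by (intro mult_mono) auto
          then show ?thesis by (simp add: norm_mult mult.assoc)
        qed
        have "norm (u z * (a * p1 + b * q1)) + norm (u z * (a * p2 + b * q2)) \<le> L * (norm a + norm b)"
          using bd[OF pb(1,3)] bd[OF pb(2,4)] by (simp add: L_def algebra_simps)
        then have 2: "(norm (u z * (a * p1 + b * q1)) + norm (u z * (a * p2 + b * q2))) ^ 6 \<le> (L * (norm a + norm b)) ^ 6"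
          by (intro power_mono) auto
        have "norm z ^ k \<le> (K * norm y) ^ k" using elim by (intro power_mono) (auto simp: y_def)
        then have "c0 * norm z ^ k \<le> c0 * (K ^ k * norm y ^ k)" using c0(1) by (simp add: power_mult_distrib)
        also have "\<dots> = K ^ k * (c0 * norm y ^ k)" by simp
        also have "\<dots> \<le> K ^ k * (L * (norm a + norm b)) ^ 6" using 1 2 Kc by (intro mult_left_mono) auto
        finally have "c0 * norm z ^ k \<le> (K ^ k * L ^ 6) * (norm a + norm b) ^ 6" by (simp add: power_mult_distrib mult.assoc)
        moreover have "K ^ k * L ^ 6 > 0" using Kc L by simp
        ultimately show "(c0 / (K ^ k * L ^ 6)) * norm z ^ k \<le> (norm a + norm b) ^ 6"
          by (simp add: pos_divide_le_eq mult.commute)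
      qed
    qed
    moreover have "c0 / (K ^ k * L ^ 6) > 0" using c0 Kc L by simp
    ultimately show ?thesis unfolding grad_bound_def by blast
  qed
qed

text \<open>The differential of \<open>\<Psi>\<close> at the origin multiplies wedges by its
  determinant, and the remainder of \<open>\<Psi>\<close> is small relative to the norm.\<close>

lemma unitangent_transfer:
  assumes "germ_equiv g f" "unitangent g" shows "unitangent f"
proof (rule germ_equiv_setup[OF assms(1)])
  fix U V \<Phi> \<Psi> u K c
  assume op: "open U" "0 \<in> U" "open V" "0 \<in> V" "\<Phi> 0 = 0" "\<Psi> 0 = 0" "\<Phi> ` U = V"
    and inv: "\<And>z. z \<in> U \<Longrightarrow> \<Psi> (\<Phi> z) = z" "\<And>y. y \<in> V \<Longrightarrow> \<Psi> y \<in> U \<and> \<Phi> (\<Psi> y) = y"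
    and hol: "holo2_on V (\<lambda>z. fst (\<Psi> z))" "holo2_on V (\<lambda>z. snd (\<Psi> z))" "holo2_on U u"
    and gf: "\<And>z. z \<in> U \<Longrightarrow> g (\<Phi> z) = u z * f z" and lim: "(\<Phi> \<longlongrightarrow> 0) (nhds 0)" and Kc: "K > (0::real)" "c > (0::real)"
    and ev: "\<forall>\<^sub>F z in nhds 0. z \<in> U \<and> norm (\<Phi> z) \<le> K * norm z \<and> norm z \<le> K * norm (\<Phi> z) \<and> c \<le> norm (u z) \<and> norm (u z) \<le> K"
  obtain a b where ab: "((\<lambda>z. fst (\<Psi> z)) has_derivative lin2 a b) (at 0)" using holo2_onD[OF hol(1) op(4)] .
  obtain c' d where cd: "((\<lambda>z. snd (\<Psi> z)) has_derivative lin2 c' d) (at 0)" using holo2_onD[OF hol(2) op(4)] .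
  define D where "D w = (lin2 a b w, lin2 c' d w)" for w
  have P: "(\<Psi> has_derivative D) (at 0)" using has_derivative_Pair[OF ab cd] by (simp add: D_def[abs_def])
  obtain N where N: "N > 0" "\<And>w. norm (D w) \<le> norm w * N"
    using P bounded_linear.pos_bounded has_derivative_bounded_linear by blast
  define J where "J = norm (a * d - b * c')"
  have wD: "norm (wedge (D y) (D w)) = J * norm (wedge y w)" for y w
  proof -
    have "wedge (D y) (D w) = (a * d - b * c') * wedge y w" by (simp add: wedge_def D_def algebra_simps)
    then show ?thesis by (simp add: J_def norm_mult)
  qed
  show ?thesis unfolding unitangent_def
  proof (intro allI impI)
    fix e :: real assume e: "e > 0"
    \<comment> \<open>\<open>M\<close> bounds the sum of the coefficients of the four wedge terms
      below; \<open>K ^ 2\<close> pays for passing from the norms of the images back to those of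
      \<open>z\<close> and \<open>w\<close>.\<close>
    define M where "M = K ^ 2 * (J + 1 + 4 * N + 2)"
    have J0: "J \<ge> 0" by (simp add: J_def)
    have M: "M > 0" unfolding M_def using Kc J0 N(1) by (intro mult_pos_pos) auto
    define \<eta> where "\<eta> = min 1 (e / M)"
    have \<eta>: "\<eta> > 0" "\<eta> \<le> 1" "\<eta> * M \<le> e" using e M by (auto simp: \<eta>_def min_def field_simps)
    obtain d1 where d1: "d1 > 0" "\<And>z w. norm z < d1 \<Longrightarrow> norm w < d1 \<Longrightarrow> g z = 0 \<Longrightarrow> g w = 0 \<Longrightarrow>
     norm (wedge z w) \<le> \<eta> * norm z * norm w" using assms(2) \<eta>(1) unfolding unitangent_def by blast
    obtain d2 where d2: "d2 > 0" "\<And>y. norm (y - 0) < d2 \<Longrightarrow> norm (\<Psi> y - \<Psi> 0 - D (y - 0)) \<le> \<eta> * norm (y - 0)"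
      using P \<eta>(1) unfolding has_derivative_at_alt by blast
    have "\<forall>\<^sub>F y in nhds (0 :: complex \<times> complex). norm y < min d1 d2"
      using d1(1) d2(1) unfolding eventually_nhds_metric by (intro exI[of _ "min d1 d2"]) auto
    from eventually_compose_filterlim[OF this lim] ev
    have "\<forall>\<^sub>F z in nhds 0. norm (\<Phi> z) < min d1 d2 \<and> z \<in> U \<and> norm (\<Phi> z) \<le> K * norm z"
      by eventually_elim auto
    then obtain d3 where d3: "d3 > 0" "\<And>z. norm z < d3 \<Longrightarrow> norm (\<Phi> z) < min d1 d2 \<and> z \<in> U \<and> norm (\<Phi> z) \<le> K * norm z"
      unfolding eventually_nhds_metric by (metis dist_0_norm dist_commute)
    show "\<exists>d>0. \<forall>z w. norm z < d \<longrightarrow> norm w < d \<longrightarrow> f z = 0 \<longrightarrow> f w = 0 \<longrightarrow> norm (wedge z w) \<le> e * norm z * norm w"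
    proof (intro exI[of _ d3] conjI d3 allI impI)
      fix z w assume zw: "norm z < d3" "norm w < d3" "f z = 0" "f w = 0"
      define y x where "y = \<Phi> z" and "x = \<Phi> w"
      note dz = d3(2)[OF zw(1)] and dw = d3(2)[OF zw(2)]
      have "g y = 0" "g x = 0" using gf dz dw zw by (auto simp: y_def x_def)
      then have 1: "norm (wedge y x) \<le> \<eta> * norm y * norm x" using d1(2) dz dw by (auto simp: y_def x_def)
      define r s where "r = z - D y" and "s = w - D x"
      have r: "norm r \<le> \<eta> * norm y" using d2(2)[of y] dz inv(1) op(6) by (simp add: r_def y_def)
      have s: "norm s \<le> \<eta> * norm x" using d2(2)[of x] dw inv(1) op(6) by (simp add: s_def x_def)
      have z: "z = D y + r" "w = D x + s" by (auto simp: r_def s_def)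
      have "wedge z w = wedge (D y) (D x) + wedge (D y) s + wedge r (D x) + wedge r s"
        unfolding z by (simp add: wedge_def algebra_simps)
      then have "norm (wedge z w) \<le> norm (wedge (D y) (D x)) + norm (wedge (D y) s) + norm (wedge r (D x)) + norm (wedge r s)"
        by (metis (no_types, lifting) norm_triangle_mono norm_triangle_ineq order_refl)
      also have "\<dots> \<le> J * (\<eta> * norm y * norm x) + 2 * (norm y * N) * (\<eta> * norm x) + 2 * (\<eta> * norm y) * (norm x * N) + 2 * (\<eta> * norm y) * (\<eta> * norm x)"
      proof (intro add_mono)
        have bound: "norm (wedge p p') \<le> 2 * P * P'" if "norm p \<le> P" "norm p' \<le> P'" for p p' P P'
        proof -
          have "norm p * norm p' \<le> P * P'" using that by (intro mult_mono) (auto intro: order_trans[OF norm_ge_zero])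
          then show ?thesis using norm_wedge_le[of p p'] by linarith
        qed
        show "norm (wedge (D y) (D x)) \<le> J * (\<eta> * norm y * norm x)" unfolding wD using 1 J0 by (rule mult_left_mono)
        show "norm (wedge (D y) s) \<le> 2 * (norm y * N) * (\<eta> * norm x)" using N(2) s by (rule bound)
        show "norm (wedge r (D x)) \<le> 2 * (\<eta> * norm y) * (norm x * N)" using r N(2) by (rule bound)
        show "norm (wedge r s) \<le> 2 * (\<eta> * norm y) * (\<eta> * norm x)" using r s by (rule bound)
      qed
      also have "\<dots> = (\<eta> * (J + 4 * N + 2 * \<eta>)) * (norm y * norm x)" by (simp add: algebra_simps)
      also have "\<dots> \<le> (\<eta> * (J + 1 + 4 * N + 2)) * ((K * norm z) * (K * norm w))"
        using dz dw \<eta> J0 N Kc by (intro mult_mono) (auto simp: y_def x_def)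
      also have "\<dots> = (\<eta> * M) * (norm z * norm w)" by (simp add: M_def power2_eq_square algebra_simps)
      also have "\<dots> \<le> e * (norm z * norm w)" using \<eta>(3) by (intro mult_right_mono) auto
      finally show "norm (wedge z w) \<le> e * norm z * norm w" by (simp add: mult.assoc)
    qed
  qed
qed

section \<open>The normal form of a sextic with an E8 point\<close>

declare normal_form.simps [simp del]

no_notation fps_nth (infixl "$" 75)

definition homog :: "nat \<Rightarrow> complex poly \<Rightarrow> complex \<Rightarrow> complex \<Rightarrow> complex" where
  "homog n p x z = (\<Sum>i\<le>n. coeff p i * x ^ i * z ^ (n - i))"

text \<open>Homogenisation of \<open>y (y^2 + 2 q y + h)\<close>, with \<open>v$1\<close>,
  \<open>v$2\<close>, \<open>v$3\<close> in the roles of \<open>y\<close>, \<open>z\<close>,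
  \<open>x\<close>. The factor 2 makes \<open>q^2 - h\<close> the reduced discriminant of the
  quadratic factor.\<close>

definition nform :: "complex poly \<Rightarrow> complex poly \<Rightarrow> complex^3 \<Rightarrow> complex" where
  "nform q h v = v$1 * ((v$2)^3 * (v$1)^2 + 2 * (v$2)^2 * homog 2 q (v$3) (v$2) * v$1 + homog 5 h (v$3) (v$2))"

lemma homog_1: "degree p \<le> n \<Longrightarrow> homog n p x 1 = poly p x"
  unfolding homog_def poly_altdef
  by (rule sum.mono_neutral_cong_right) (auto simp: coeff_eq_0)

lemma homog_2: "homog 2 p x z = coeff p 0 * z^2 + coeff p 1 * x * z + coeff p 2 * x^2"
  by (simp add: homog_def numeral_2_eq_2)

lemma homog_5: "homog 5 p x z = coeff p 0 * z^5 + coeff p 1 * x * z^4 + coeff p 2 * x^2 * z^3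
    + coeff p 3 * x^3 * z^2 + coeff p 4 * x^4 * z + coeff p 5 * x^5"
proof -
  have "{..5} = {0, 1, 2, 3, 4, 5 :: nat}" by auto
  then show ?thesis by (simp add: homog_def)
qed

lemma pt3_nth [simp]: "pt3 a b c $ 1 = a" "pt3 a b c $ 2 = b" "pt3 a b c $ 3 = c"
  by (simp_all add: pt3_def)

lemma has_typeI:
  fixes M :: "complex^3^3"
  assumes "invertible M" "M *v pt3 1 0 0 = p" "p \<noteq> 0" "valid_type t"
    "germ_equiv (\<lambda>(u, v). F (M *v pt3 1 u v)) (normal_form t)"
  shows "has_type F (proj_pt p) t"
  unfolding has_type_def using assms
  by (intro conjI bexI[of _ p] exI[of _ M]) (auto simp: proj_pt_def intro: exI[of _ 1])

text \<open>Moves the standard chart \<open>(1 : u : v)\<close> of \<open>has_type\<close> to the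
  affine chart \<open>z = 1\<close> centred at \<open>(x, y)\<close>, with \<open>u\<close> along
  \<open>x\<close> and \<open>v\<close> along \<open>y\<close>.\<close>

definition affine_matrix :: "complex \<Rightarrow> complex \<Rightarrow> complex^3^3" where
  "affine_matrix x y = vector [vector [y, 0, 1], vector [1, 0, 0], vector [x, 1, 0]]"

lemma affine_matrix_mult: "affine_matrix x y *v pt3 a b c = pt3 (y * a + c) a (x * a + b)"
  by (simp add: vec_eq_iff forall_3 matrix_vector_mult_def sum_3 affine_matrix_def vector_3)

lemma invertible_affine_matrix: "invertible (affine_matrix x y)"
  by (simp add: invertible_det_nz det_3 affine_matrix_def vector_3)

lemma nform_affine:
  assumes "degree q \<le> 2" "degree h \<le> 5"
  shows "nform q h (pt3 y 1 x) = y * (y\<^sup>2 + 2 * poly q x * y + poly h x)"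
  using assms by (simp add: nform_def homog_1)

lemma has_type_affine:
  assumes "degree q \<le> 2" "degree h \<le> 5" "valid_type t" "germ_equiv (affine_chart q h x y) (normal_form t)"
  shows "has_type (nform q h) (proj_pt (pt3 y 1 x)) t"
proof (rule has_typeI[OF invertible_affine_matrix])
  show "affine_matrix x y *v pt3 1 0 0 = pt3 y 1 x" by (simp add: affine_matrix_mult)
  have "pt3 y 1 x $ 2 \<noteq> 0 $ 2" by simp
  then show "pt3 y 1 x \<noteq> 0" by metis
  have "(\<lambda>(u, v). nform q h (affine_matrix x y *v pt3 1 u v)) = affine_chart q h x y"
    using assms by (auto simp: affine_matrix_mult nform_affine affine_chart_def fun_eq_iff)
  then show "germ_equiv (\<lambda>(u, v). nform q h (affine_matrix x y *v pt3 1 u v)) (normal_form t)"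
    using assms(4) by simp
qed (use assms in auto)

text \<open>At \<open>(1 : 0 : 0)\<close> the equation begins with \<open>z^3\<close> and
  \<open>coeff h 5 * x^5\<close>; all other monomials are divisible by \<open>z^3\<close>,
  \<open>z^2 x^2\<close> or \<open>z x^4\<close>, the shape treated in
  \<open>recognize_E8_general\<close>.\<close>

lemma has_type_infinity:
  assumes "degree q \<le> 2" "degree h = 5"
  shows "has_type (nform q h) (proj_pt (pt3 1 0 0)) E8"
proof (rule has_typeI[of "mat 1"])
  have "pt3 1 0 0 $ 1 \<noteq> 0 $ 1" by simp
  then show "pt3 1 0 0 \<noteq> 0" by metis
  have l: "coeff h 5 \<noteq> 0" using assms(2) by (metis leading_coeff_0_iff degree_0 zero_neq_numeral)
  show "germ_equiv (\<lambda>(u, v). nform q h (mat 1 *v pt3 1 u v)) (normal_form E8)"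
  proof (rule recognize_E8_general[OF coords_base,
        where a="\<lambda>z. 1 + 2 * coeff q 0 * fst z + 2 * coeff q 1 * snd z + coeff h 2 * snd z ^ 2 + coeff h 1 * fst z * snd z + coeff h 0 * fst z ^ 2"
        and b="\<lambda>z. 2 * coeff q 2 + coeff h 3 * snd z" and c="\<lambda>_. coeff h 4" and d="\<lambda>_. coeff h 5"])
    show "\<forall>\<^sub>F w in nhds 0. (case w of (u, v) \<Rightarrow> nform q h (mat 1 *v pt3 1 u v)) =
        (1 + 2 * coeff q 0 * fst w + 2 * coeff q 1 * snd w + coeff h 2 * (snd w)\<^sup>2 + coeff h 1 * fst w * snd w + coeff h 0 * (fst w)\<^sup>2) * fst w ^ 3 +
        (2 * coeff q 2 + coeff h 3 * snd w) * (fst w)\<^sup>2 * (snd w)\<^sup>2 + coeff h 4 * fst w * snd w ^ 4 + coeff h 5 * snd w ^ 5"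
      by (intro always_eventually allI) (simp add: case_prod_beta nform_def homog_2 homog_5 matrix_vector_mul_lid power2_eq_square power3_eq_cube power5_expand algebra_simps)
  qed (use l in \<open>auto intro!: hg_intros simp: fst_zero snd_zero\<close>)
qed (auto simp: matrix_vector_mul_lid invertible_def intro: exI[of _ "mat 1"])

lemma order_ge_iff: "p \<noteq> 0 \<Longrightarrow> n \<le> order x p \<longleftrightarrow> [:-x, 1:] ^ n dvd p"
  by (simp add: order_divides)

text \<open>The two quintics add up to \<open>q^2\<close>. At a common root \<open>q\<close>
  vanishes, so they are opposite modulo the second power of the linear factor, and modulo the fourth
  if \<open>q\<close> vanishes doubly. Below these powers their orders must agree, which leaves
  exactly the cases of \<open>line_type\<close>.\<close>

lemma type_line:
  assumes h: "h \<noteq> 0" "poly h x = 0" and g: "q\<^sup>2 - h \<noteq> 0"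
    and simple: "\<not> (order x (q\<^sup>2 - h) \<ge> 4 \<and> order x h \<ge> 4)"
  defines "t \<equiv> line_type (order x (q\<^sup>2 - h)) (order x h)"
  shows "valid_type t \<and> germ_equiv (affine_chart q h x 0) (normal_form t)"
proof -
  define k m g where "k = order x (q\<^sup>2 - h)" and "m = order x h" and "g = q\<^sup>2 - h"
  have m: "m \<ge> 1" using h order_root[of h x] unfolding m_def by auto
  have g0: "g \<noteq> 0" and k_def': "k = order x g" using g by (auto simp: g_def k_def)
  have t: "t = line_type k m" by (simp add: t_def k_def m_def)
  show ?thesis
  proof (cases "poly q x = 0")
    case False
    then have "poly g x \<noteq> 0" using h by (simp add: g_def)
    then have "k = 0" unfolding k_def' by (rule order_0I)
    then show ?thesis using type_line_transversal[OF h False] m by (simp add: t line_type_def m_def)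
  next
    case True
    then have gx: "poly g x = 0" using h by (simp add: g_def)
    then have k: "k \<ge> 1" using g0 order_root[of g x] unfolding k_def' by auto
    obtain q0 where q0: "q = [:-x, 1:] * q0" using poly_root_factor True by blast
    have X2: "[:-x, 1:] ^ 2 dvd q\<^sup>2" unfolding q0 power_mult_distrib by simp
    have hg: "h = q\<^sup>2 - g" "g = q\<^sup>2 - h" by (auto simp: g_def)
    have k1: "k = 1 \<longleftrightarrow> m = 1"
    proof -
      have "2 \<le> k \<longleftrightarrow> 2 \<le> m"
        unfolding k_def' m_def order_ge_iff[OF g0] order_ge_iff[OF h(1)]
        using X2 by (metis dvd_diff hg)
      then show ?thesis using k m by auto
    qed
    consider "m = 1" | "m \<ge> 2" "k = 2" | "k \<ge> 3" "poly q0 x \<noteq> 0" | "k \<ge> 3" "poly q0 x = 0"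
      using k k1 m by force
    then show ?thesis
    proof cases
      case 1
      then have "k = 1" using k1 by simp
      then show ?thesis using type_line_simple[of x h q] 1 True h by (simp add: t line_type_def m_def)
    next
      case 2
      then show ?thesis using type_line_node[OF h(1) m_def[symmetric] 2(1) True] g k_def
        by (auto simp: t line_type_def)
    next
      case 3
      \<comment> \<open>If both orders were 3, then \<open>q^2\<close> would have order at least 3
        and \<open>q\<close> a double root, against the choice of the case.\<close>
      have "\<not> (k = 3 \<and> m = 3)"
      proof
        assume a: "k = 3 \<and> m = 3"
        then have "[:-x, 1:] ^ 3 dvd g" "[:-x, 1:] ^ 3 dvd h"
          using order_ge_iff[OF g0, of 3 x] order_ge_iff[OF h(1), of 3 x] by (auto simp: k_def' m_def)
        then have "[:-x, 1:] ^ 3 dvd g + h" by (rule dvd_add)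
        then have "[:-x, 1:] ^ 3 dvd q\<^sup>2" by (simp add: g_def)
        then have "[:-x, 1:] ^ 2 * [:-x, 1:] dvd [:-x, 1:] ^ 2 * q0\<^sup>2"
          unfolding q0 power_mult_distrib by (simp only: power3_eq_cube power2_eq_square)
        then have "[:-x, 1:] dvd q0\<^sup>2" by (subst (asm) dvd_mult_cancel_left) auto
        then have "poly (q0\<^sup>2) x = 0" using poly_eq_0_iff_dvd[of "q0\<^sup>2" x] by blast
        then show False using 3 by simp
      qed
      then have "t = D (k + 2)" using 3 by (auto simp: t line_type_def)
      then show ?thesis using type_line_cusp[OF q0 3(2) g k_def[symmetric] 3(1)] 3 by auto
    next
      case 4
      then obtain r where r: "q0 = [:-x, 1:] * r" using poly_root_factor by blast
      have q: "q = [:-x, 1:] ^ 2 * r" unfolding q0 r by (simp only: power2_eq_square mult.assoc)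
      have "[:-x, 1:] ^ 4 dvd q\<^sup>2" unfolding q power_mult_distrib power_mult[symmetric] by simp
      then have X: "[:-x, 1:] ^ n dvd q\<^sup>2" if "n \<le> 4" for n using that power_le_dvd by blast
      have le: "n \<le> k \<longleftrightarrow> n \<le> m" if "n \<le> 4" for n
        unfolding k_def' m_def order_ge_iff[OF g0] order_ge_iff[OF h(1)]
        using X[OF that] by (metis dvd_diff hg)
      have "\<not> 4 \<le> k" using le[of 4] simple by (auto simp: k_def m_def)
      then have "k = 3" using 4 by simp
      moreover have "m = 3" using le[of 3] le[of 4] \<open>\<not> 4 \<le> k\<close> 4 by simp
      ultimately show ?thesis using type_line_cusp_tangent[OF q h(1)] by (simp add: t line_type_def m_def)
    qed
  qed
qed

section \<open>Decay of the gradient along the zero set of a normal form\<close>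

fun partials :: "sing_type \<Rightarrow> complex \<times> complex \<Rightarrow> complex \<times> complex" where
  "partials (A n) (x, y) = (2 * x, of_nat (n + 1) * y ^ n)"
| "partials (D n) (x, y) = (2 * x * y, x\<^sup>2 + of_nat (n - 1) * y ^ (n - 2))"
| "partials E6 (x, y) = (3 * x\<^sup>2, 4 * y ^ 3)"
| "partials E7 (x, y) = (3 * x\<^sup>2 + y ^ 3, 3 * x * y\<^sup>2)"
| "partials E8 (x, y) = (3 * x\<^sup>2, 5 * y ^ 4)"

text \<open>Six times the exponent with which the gradient decays on its fastest branch: on
  \<open>x^2 + y^(n+1) = 0\<close> it has size \<open>|y|^((n+1)/2)\<close>, for D(n) the size
  \<open>|y|^(n/2)\<close>, for E6, E7, E8 the exponents are 8/3, 3, 10/3.\<close>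

fun grad_index :: "sing_type \<Rightarrow> nat" where
  "grad_index (A n) = 3 * n + 3"
| "grad_index (D n) = 3 * n"
| "grad_index E6 = 16"
| "grad_index E7 = 18"
| "grad_index E8 = 20"

lemma normal_form_deriv:
  "(normal_form t has_derivative lin2 (fst (partials t z)) (snd (partials t z))) (at z)"
proof (cases z)
  case (Pair x y)
  show ?thesis
  proof (cases t)
    case (A n)
    show ?thesis unfolding A Pair normal_form.simps case_prod_beta
      by (rule has_derivative_eq_rhs, (rule derivative_intros)+) (auto simp: fun_eq_iff algebra_simps)
  next
    case (D n)
    show ?thesis unfolding D Pair normal_form.simps case_prod_beta
      by (rule has_derivative_eq_rhs, (rule derivative_intros)+) (auto simp: fun_eq_iff algebra_simps diff_diff_eq numeral_2_eq_2)
  next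
    case E6
    show ?thesis unfolding E6 Pair normal_form.simps case_prod_beta
      by (rule has_derivative_eq_rhs, (rule derivative_intros)+) (auto simp: fun_eq_iff algebra_simps)
  next
    case E7
    show ?thesis unfolding E7 Pair normal_form.simps case_prod_beta
      by (rule has_derivative_eq_rhs, (rule derivative_intros)+) (auto simp: fun_eq_iff algebra_simps)
  next
    case E8
    show ?thesis unfolding E8 Pair normal_form.simps case_prod_beta
      by (rule has_derivative_eq_rhs, (rule derivative_intros)+) (auto simp: fun_eq_iff algebra_simps)
  qed
qed

lemma power_sixth: "(x::real) ^ 6 = (x\<^sup>2) ^ 3" "x ^ 12 = (x ^ 3) ^ 4" by (simp_all flip: power_mult)

text \<open>On the zero set \<open>|x| \<le> |y|\<close>, except on the branch \<open>y = 0\<close>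
  of D(n), so \<open>|z|\<close> is at most \<open>2 |y|\<close>, and the partial derivative in
  \<open>x\<close> alone gives the bound.\<close>

lemma normal_form_grad_lower:
  assumes v: "valid_type t" and z: "norm z < 1" "normal_form t z = 0"
  shows "(norm z / 2) ^ grad_index t \<le> (norm (fst (partials t z)) + norm (snd (partials t z))) ^ 6"
proof -
  obtain x y where xy: "z = (x, y)" by (cases z)
  define X Y where "X = norm x" and "Y = norm y"
  have XY: "0 \<le> X" "0 \<le> Y" "X < 1" "Y < 1" "norm z \<le> X + Y"
    using norm_fst_le'[of z] norm_snd_le'[of z] z(1) norm_Pair_le[of x y] by (auto simp: X_def Y_def xy)
  have main: ?thesis
    if "X \<le> Y" and n: "norm a ^ 6 = c * Y ^ k" and a: "fst (partials t z) = a" "grad_index t = k" "1 \<le> c" for a c k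
  proof -
    have "(norm z / 2) ^ k \<le> Y ^ k" using that(1) XY by (intro power_mono) auto
    also have "\<dots> = 1 * Y ^ k" by simp
    also have "\<dots> \<le> norm a ^ 6" unfolding n using XY a by (intro mult_right_mono) auto
    also have "\<dots> \<le> (norm a + norm (snd (partials t z))) ^ 6" by (intro power_mono) auto
    finally show ?thesis by (simp only: a)
  qed
  have le: "Y ^ m \<le> Y ^ n" if "n \<le> m" for m n using that XY by (intro power_decreasing) auto
  show ?thesis
  proof (cases t)
    case (A n)
    have "x\<^sup>2 = - (y ^ (n + 1))" using z(2) by (simp add: A xy normal_form.simps add_eq_0_iff2)
    then have e: "X\<^sup>2 = Y ^ (n + 1)" by (metis X_def Y_def norm_minus_cancel norm_power)
    also have "\<dots> \<le> Y\<^sup>2" using v by (intro le) (auto simp: A)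
    finally have "X \<le> Y" using XY power_mono_iff[of X Y 2] by simp
    moreover have "norm (2 * x) ^ 6 = 64 * Y ^ (3 * n + 3)"
    proof -
      have "norm (2 * x) ^ 6 = 64 * X ^ 6" by (simp add: norm_mult power_mult_distrib X_def)
      then show ?thesis unfolding power_sixth(1) e power_mult[symmetric] by (simp add: algebra_simps)
    qed
    ultimately show ?thesis by (rule main) (simp_all add: A xy)
  next
    case (D n)
    have n: "n \<ge> 4" using v by (simp add: D)
    have "n - 1 = Suc (n - 2)" using n by simp
    then have "y * (x\<^sup>2 + y ^ (n - 2)) = 0" using z(2) by (simp add: D xy normal_form.simps algebra_simps)
    then consider "y = 0" | "y \<noteq> 0" "x\<^sup>2 = - (y ^ (n - 2))" by (auto simp: add_eq_0_iff2)
    then show ?thesis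
    proof cases
      case 1
      \<comment> \<open>On the exceptional branch the gradient is \<open>x^2\<close>, of exponent
        12, and \<open>12 \<le> 3 * n\<close>.\<close>
      have "(norm z / 2) ^ (3 * n) \<le> X ^ (3 * n)" using 1 XY by (intro power_mono) (auto simp: Y_def)
      also have "\<dots> \<le> X ^ 12" using n XY by (intro power_decreasing) auto
      also have "\<dots> = norm (x\<^sup>2) ^ 6" by (simp add: X_def norm_power flip: power_mult)
      finally show ?thesis using 1 n by (simp add: D xy power_0_left)
    next
      case 2
      then have e: "X\<^sup>2 = Y ^ (n - 2)" by (metis X_def Y_def norm_minus_cancel norm_power)
      also have "\<dots> \<le> Y\<^sup>2" using n by (intro le) auto
      finally have "X \<le> Y" using XY power_mono_iff[of X Y 2] by simp
      moreover have "norm (2 * x * y) ^ 6 = 64 * Y ^ (3 * n)"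
      proof -
        have "norm (2 * x * y) ^ 6 = 64 * (X ^ 6 * Y ^ 6)" by (simp add: norm_mult power_mult_distrib X_def Y_def)
        also have "X ^ 6 * Y ^ 6 = Y ^ (3 * (n - 2) + 6)" unfolding power_sixth(1)[of X] e power_mult[symmetric] power_add[symmetric] by (simp add: mult.commute)
        also have "3 * (n - 2) + 6 = 3 * n" using n by simp
        finally show ?thesis .
      qed
      ultimately show ?thesis by (rule main) (simp_all add: D xy)
    qed
  next
    case E6
    have "x ^ 3 = - (y ^ 4)" using z(2) by (simp add: E6 xy normal_form.simps add_eq_0_iff2)
    then have e: "X ^ 3 = Y ^ 4" by (metis X_def Y_def norm_minus_cancel norm_power)
    also have "\<dots> \<le> Y ^ 3" by (intro le) auto
    finally have "X \<le> Y" using XY power_mono_iff[of X Y 3] by simp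
    moreover have "norm (3 * x\<^sup>2) ^ 6 = 729 * Y ^ 16"
    proof -
      have "norm (3 * x\<^sup>2) ^ 6 = 729 * X ^ 12" by (simp add: norm_mult norm_power power_mult_distrib X_def flip: power_mult)
      then show ?thesis unfolding power_sixth(2) e by (simp flip: power_mult)
    qed
    ultimately show ?thesis by (rule main) (simp_all add: E6 xy)
  next
    case E8
    have "x ^ 3 = - (y ^ 5)" using z(2) by (simp add: E8 xy normal_form.simps add_eq_0_iff2)
    then have e: "X ^ 3 = Y ^ 5" by (metis X_def Y_def norm_minus_cancel norm_power)
    also have "\<dots> \<le> Y ^ 3" by (intro le) auto
    finally have "X \<le> Y" using XY power_mono_iff[of X Y 3] by simp
    moreover have "norm (3 * x\<^sup>2) ^ 6 = 729 * Y ^ 20"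
    proof -
      have "norm (3 * x\<^sup>2) ^ 6 = 729 * X ^ 12" by (simp add: norm_mult norm_power power_mult_distrib X_def flip: power_mult)
      then show ?thesis unfolding power_sixth(2) e by (simp flip: power_mult)
    qed
    ultimately show ?thesis by (rule main) (simp_all add: E8 xy)
  next
    case E7
    have "x * (x\<^sup>2 + y ^ 3) = 0" using z(2) by (simp add: E7 xy normal_form.simps algebra_simps power2_eq_square power3_eq_cube)
    then consider "x = 0" | "x\<^sup>2 = - (y ^ 3)" by (auto simp: add_eq_0_iff2)
    then show ?thesis
    proof cases
      case 1
      then have "X \<le> Y" using XY by (simp add: X_def)
      moreover have "norm (3 * x\<^sup>2 + y ^ 3) ^ 6 = 1 * Y ^ 18" using 1 by (simp add: norm_power Y_def flip: power_mult)
      ultimately show ?thesis by (rule main) (simp_all add: E7 xy)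
    next
      case 2
      then have "X\<^sup>2 = Y ^ 3" by (metis X_def Y_def norm_minus_cancel norm_power)
      also have "\<dots> \<le> Y\<^sup>2" by (intro le) auto
      finally have "X \<le> Y" using XY power_mono_iff[of X Y 2] by simp
      moreover have "norm (3 * x\<^sup>2 + y ^ 3) ^ 6 = 64 * Y ^ 18"
      proof -
        have "3 * x\<^sup>2 + y ^ 3 = - 2 * y ^ 3" using 2 by simp
        then have "norm (3 * x\<^sup>2 + y ^ 3) = 2 * Y ^ 3" by (simp only: norm_mult norm_power Y_def) simp
        then show ?thesis by (simp add: power_mult_distrib flip: power_mult)
      qed
      ultimately show ?thesis by (rule main) (simp_all add: E7 xy)
    qed
  qed
qed

lemma grad_bound_normal_form: "valid_type t \<Longrightarrow> grad_bound (grad_index t) (normal_form t)"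
  unfolding grad_bound_def
proof (intro exI[of _ "(1/2) ^ grad_index t"] conjI)
  assume v: "valid_type t"
  have "\<forall>\<^sub>F z in nhds 0. norm (z :: complex \<times> complex) < 1"
    unfolding eventually_nhds_metric by (intro exI[of _ 1]) auto
  then show "\<forall>\<^sub>F z in nhds 0. normal_form t z = 0 \<longrightarrow> (\<forall>a b. (normal_form t has_derivative lin2 a b) (at z) \<longrightarrow>
     (1/2) ^ grad_index t * norm z ^ grad_index t \<le> (norm a + norm b) ^ 6)"
  proof eventually_elim
    case (elim z)
    show ?case
    proof (intro impI allI)
      fix a b assume h: "normal_form t z = 0" "(normal_form t has_derivative lin2 a b) (at z)"
      have "a = fst (partials t z) \<and> b = snd (partials t z)" using lin2_cong[OF h(2) normal_form_deriv] .
      then show "(1/2) ^ grad_index t * norm z ^ grad_index t \<le> (norm a + norm b) ^ 6"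
        using normal_form_grad_lower[OF v elim h(1)] by (simp add: power_divide)
    qed
  qed
qed simp

text \<open>Along the witnesses a gradient bound would read
  \<open>c s^(p j) \<le> C^6 s^(6 r)\<close>, which fails for small \<open>s\<close> once
  \<open>p j < 6 r\<close>.\<close>

lemma not_grad_boundI:
  assumes e: "\<And>s. 0 < s \<Longrightarrow> s < 1 \<Longrightarrow> \<exists>z a b. f z = 0 \<and> (f has_derivative lin2 a b) (at z) \<and> s ^ p \<le> norm z \<and>
      norm z \<le> 2 * s \<and> norm a + norm b \<le> C * s ^ r"
    and j: "p * j < 6 * r" 
  shows "\<not> grad_bound j f"
proof
  assume "grad_bound j f"
  then obtain c where c: "c > 0" and ev: "\<forall>\<^sub>F z in nhds 0. f z = 0 \<longrightarrow> (\<forall>a b. (f has_derivative lin2 a b) (at z) \<longrightarrow>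
     c * norm z ^ j \<le> (norm a + norm b) ^ 6)"
    unfolding grad_bound_def by blast
  from ev obtain d where d: "d > 0" "\<And>z a b. norm z < d \<Longrightarrow> f z = 0 \<Longrightarrow> (f has_derivative lin2 a b) (at z) \<Longrightarrow>
     c * norm z ^ j \<le> (norm a + norm b) ^ 6"
    unfolding eventually_nhds_metric by auto
  define K where "K = C ^ 6 + 1"
  have K: "K \<ge> 1" "C ^ 6 \<ge> 0" "C ^ 6 \<le> K" by (simp_all add: K_def)
  define s where "s = min (min (d / 4) (1 / 2)) (c / (2 * K))"
  have "0 < c / (2 * K)" using c K by simp
  then have s: "0 < s" "s < 1" "2 * s < d" "s \<le> c / (2 * K)"
    using d(1) unfolding s_def by linarith+
  obtain z a b where z: "f z = 0" "(f has_derivative lin2 a b) (at z)" "s ^ p \<le> norm z" "norm z \<le> 2 * s" "norm a + norm b \<le> C * s ^ r"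
    using e[OF s(1,2)] by blast
  have "c * s ^ (p * j) \<le> c * norm z ^ j"
    unfolding power_mult using z(3) c s by (intro mult_left_mono power_mono) auto
  also have "\<dots> \<le> (norm a + norm b) ^ 6" using d(2)[OF _ z(1,2)] z(4) s(3) by simp
  also have "\<dots> \<le> (C * s ^ r) ^ 6" using z(5) by (intro power_mono) auto
  also have "\<dots> = C ^ 6 * s ^ (6 * r)" by (simp add: power_mult_distrib mult.commute flip: power_mult)
  also have "\<dots> \<le> C ^ 6 * s ^ (p * j + 1)" using j s K by (intro mult_left_mono power_decreasing) auto
  finally have "c * s ^ (p * j) \<le> (C ^ 6 * s) * s ^ (p * j)" by simp
  then have "c \<le> C ^ 6 * s" using s by simp
  also have "\<dots> \<le> K * s" using s K by (intro mult_right_mono) auto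
  also have "\<dots> \<le> K * (c / (2 * K))" using s K by (intro mult_left_mono) auto
  also have "\<dots> = c / 2" using K by simp
  finally show False using c by simp
qed

lemma norm_pair_bounds:
  fixes x y :: complex
  assumes "0 < s" "s < 1" "norm x \<le> s" "norm y \<le> s" "s ^ p \<le> norm y"
  shows "s ^ p \<le> norm (x, y)" "norm (x, y) \<le> 2 * s"
  using assms norm_snd_le'[of "(x, y)"] norm_Pair_le[of x y] by auto

text \<open>The witnesses parametrise a branch by powers of \<open>s\<close> that clear the
  fractional exponents: \<open>(\<i> s^(n+1), s^2)\<close> for A(n),
  \<open>(\<i> s^(n-2), s^2)\<close> for D(n), \<open>(- s^4, s^3)\<close> for E6,
  \<open>(- s^5, s^3)\<close> for E8, and the smooth branch \<open>x = 0\<close> for E7.\<close>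

lemma not_grad_bound_normal_form:
  assumes v: "valid_type t" and j: "j < grad_index t"
  shows "\<not> grad_bound j (normal_form t)"
proof -
  have pow: "s ^ n \<le> s ^ m" if "0 < s" "s < 1" "m \<le> n" for s :: real and m n using that by (intro power_decreasing) auto
  have pow1: "s ^ n \<le> s" if "0 < s" "s < 1" "1 \<le> n" for s :: real and n using pow[OF that] by simp
  have wit: "\<exists>z a b. normal_form t z = 0 \<and> (normal_form t has_derivative lin2 a b) (at z) \<and> s ^ p \<le> norm z \<and>
      norm z \<le> 2 * s \<and> norm a + norm b \<le> R"
    if "normal_form t (x, y) = 0" "0 < s" "s < 1" "norm x \<le> s" "norm y \<le> s" "s ^ p \<le> norm y"
      "norm (fst (partials t (x, y))) + norm (snd (partials t (x, y))) \<le> R" for x y s p R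
    using that norm_pair_bounds[of s x y p] normal_form_deriv[of t "(x, y)"] by blast
  show ?thesis
  proof (cases t)
    case (A n)
    have n: "n \<ge> 1" using v by (simp add: A)
    show ?thesis
    proof (rule not_grad_boundI[where p=2 and r="n + 1" and C="real n + 3"])
      fix s :: real assume s: "0 < s" "s < 1"
      define x y where "x = \<i> * complex_of_real s ^ (n + 1)" and "y = complex_of_real s ^ 2"
      have z: "normal_form t (x, y) = 0"
        by (simp add: A normal_form.simps x_def y_def power_mult_distrib mult.commute flip: power_mult power_Suc)
      have nx: "norm x = s ^ (n + 1)" and ny: "norm y = s ^ 2" using s by (simp_all add: x_def y_def norm_mult norm_power)
      have "norm (of_nat (n + 1) * y ^ n) = (real n + 1) * s ^ (2 * n)"
        unfolding norm_mult norm_power ny by (simp add: power_mult norm_of_nat del: of_nat_Suc of_nat_add) 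
      also have "\<dots> \<le> (real n + 1) * s ^ (n + 1)" using n s by (intro mult_left_mono pow) auto
      finally have "norm (fst (partials t (x, y))) + norm (snd (partials t (x, y))) \<le> (real n + 3) * s ^ (n + 1)"
        using nx by (simp add: A norm_mult algebra_simps)
      then show "\<exists>z a b. normal_form t z = 0 \<and> (normal_form t has_derivative lin2 a b) (at z) \<and> s ^ 2 \<le> norm z \<and>
        norm z \<le> 2 * s \<and> norm a + norm b \<le> (real n + 3) * s ^ (n + 1)"
        by (intro wit[OF z s]) (use s nx ny in \<open>auto intro!: pow1 simp del: power_Suc\<close>)
    qed (use j A in auto)
  next
    case (D n)
    have n: "n \<ge> 4" using v by (simp add: D)
    show ?thesis
    proof (rule not_grad_boundI[where p=2 and r="n" and C="real n"])
      fix s :: real assume s: "0 < s" "s < 1"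
      define x y where "x = \<i> * complex_of_real s ^ (n - 2)" and "y = complex_of_real s ^ 2"
      have x2: "x ^ 2 = - (y ^ (n - 2))" by (simp add: x_def y_def power_mult_distrib mult.commute flip: power_mult)
      have z: "normal_form t (x, y) = 0"
      proof -
        have "n - 1 = Suc (n - 2)" using n by simp
        then show ?thesis by (simp add: D normal_form.simps x2)
      qed
      have nx: "norm x = s ^ (n - 2)" and ny: "norm y = s ^ 2" using s by (simp_all add: x_def y_def norm_mult norm_power)
      have "x\<^sup>2 + of_nat (n - 1) * y ^ (n - 2) = of_nat (n - 2) * y ^ (n - 2)"
      proof -
        have "(of_nat (n - 1) :: complex) = of_nat (n - 2) + 1" using n by (simp add: of_nat_diff)
        then show ?thesis unfolding x2 by (simp add: algebra_simps)
      qed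
      then have "norm (x\<^sup>2 + of_nat (n - 1) * y ^ (n - 2)) = real (n - 2) * s ^ (2 * (n - 2))"
        by (simp only: norm_mult norm_power ny norm_of_nat power_mult)
      also have "\<dots> \<le> real (n - 2) * s ^ n" using n s by (intro mult_left_mono pow) auto
      finally have 1: "norm (x\<^sup>2 + of_nat (n - 1) * y ^ (n - 2)) \<le> real (n - 2) * s ^ n" .
      have 2: "norm (2 * x * y) = 2 * s ^ n"
      proof -
        have "n - 2 + 2 = n" using n by simp
        then have "s ^ (n - 2) * s ^ 2 = s ^ n" by (metis power_add)
        then show ?thesis unfolding norm_mult nx ny by simp
      qed
      have "norm (fst (partials t (x, y))) + norm (snd (partials t (x, y))) \<le> real n * s ^ n"
        using 1 n unfolding D partials.simps fst_conv snd_conv 2 by (simp add: of_nat_diff algebra_simps)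
      then show "\<exists>z a b. normal_form t z = 0 \<and> (normal_form t has_derivative lin2 a b) (at z) \<and> s ^ 2 \<le> norm z \<and>
        norm z \<le> 2 * s \<and> norm a + norm b \<le> real n * s ^ n"
        by (intro wit[OF z s]) (use s n nx ny in \<open>auto intro!: pow1\<close>)
    qed (use j D in auto)
  next
    case E6
    show ?thesis
    proof (rule not_grad_boundI[where p=3 and r=8 and C=7])
      fix s :: real assume s: "0 < s" "s < 1"
      define x y where "x = - (complex_of_real s ^ 4)" and "y = complex_of_real s ^ 3"
      have z: "normal_form t (x, y) = 0" by (simp add: E6 normal_form.simps x_def y_def flip: power_mult)
      have nx: "norm x = s ^ 4" and ny: "norm y = s ^ 3" using s by (simp_all add: x_def y_def norm_mult norm_power)
      have "s ^ 9 \<le> s ^ 8" using s by (intro pow) auto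
      then have "norm (fst (partials t (x, y))) + norm (snd (partials t (x, y))) \<le> 7 * s ^ 8"
        by (simp add: E6 norm_mult norm_power nx ny flip: power_mult)
      then show "\<exists>z a b. normal_form t z = 0 \<and> (normal_form t has_derivative lin2 a b) (at z) \<and> s ^ 3 \<le> norm z \<and>
        norm z \<le> 2 * s \<and> norm a + norm b \<le> 7 * s ^ 8"
        by (intro wit[OF z s]) (use s nx ny in \<open>auto intro!: pow1\<close>)
    qed (use j E6 in auto)
  next
    case E7
    show ?thesis
    proof (rule not_grad_boundI[where p=1 and r=3 and C=1])
      fix s :: real assume s: "0 < s" "s < 1"
      have z: "normal_form t (0, complex_of_real s) = 0" by (simp add: E7 normal_form.simps)
      show "\<exists>z a b. normal_form t z = 0 \<and> (normal_form t has_derivative lin2 a b) (at z) \<and> s ^ 1 \<le> norm z \<and>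
        norm z \<le> 2 * s \<and> norm a + norm b \<le> 1 * s ^ 3"
        by (intro wit[OF z s]) (use s in \<open>auto simp: E7 norm_power\<close>)
    qed (use j E7 in auto)
  next
    case E8
    show ?thesis
    proof (rule not_grad_boundI[where p=3 and r=10 and C=8])
      fix s :: real assume s: "0 < s" "s < 1"
      define x y where "x = - (complex_of_real s ^ 5)" and "y = complex_of_real s ^ 3"
      have z: "normal_form t (x, y) = 0" by (simp add: E8 normal_form.simps x_def y_def flip: power_mult)
      have nx: "norm x = s ^ 5" and ny: "norm y = s ^ 3" using s by (simp_all add: x_def y_def norm_mult norm_power)
      have "s ^ 12 \<le> s ^ 10" using s by (intro pow) auto
      then have "norm (fst (partials t (x, y))) + norm (snd (partials t (x, y))) \<le> 8 * s ^ 10"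
        by (simp add: E8 norm_mult norm_power nx ny flip: power_mult)
      then show "\<exists>z a b. normal_form t z = 0 \<and> (normal_form t has_derivative lin2 a b) (at z) \<and> s ^ 3 \<le> norm z \<and>
        norm z \<le> 2 * s \<and> norm a + norm b \<le> 8 * s ^ 10"
        by (intro wit[OF z s]) (use s nx ny in \<open>auto intro!: pow1\<close>)
    qed (use j E8 in auto)
  qed
qed

text \<open>For A(n) the points \<open>(s, 0)\<close> see only \<open>x^2\<close>; in all other
  types every monomial has degree at least 3.\<close>

lemma cubic_bound_normal_form:
  assumes v: "valid_type t"
  shows "cubic_bound (normal_form t) \<longleftrightarrow> (\<forall>n. t \<noteq> A n)"
proof (cases "\<exists>n. t = A n")
  case True
  then obtain n where t: "t = A n" by blast
  have "\<not> cubic_bound (normal_form t)"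
  proof
    assume "cubic_bound (normal_form t)"
    then obtain C where "\<forall>\<^sub>F z in nhds 0. norm (normal_form t z) \<le> C * norm z ^ 3"
      unfolding cubic_bound_def by blast
    then obtain d where d: "d > 0" "\<And>z. norm z < d \<Longrightarrow> norm (normal_form t z) \<le> C * norm z ^ 3"
      unfolding eventually_nhds_metric by auto
    define s where "s = min (d / 2) (1 / (2 * (\<bar>C\<bar> + 1)))"
    have "0 < 1 / (2 * (\<bar>C\<bar> + 1))" by (intro divide_pos_pos) auto
    then have s: "0 < s" "s < d" "s \<le> 1 / (2 * (\<bar>C\<bar> + 1))" using d(1) unfolding s_def by linarith+
    have "s ^ 2 \<le> C * s ^ 3" using d(2)[of "(complex_of_real s, 0)"] s by (simp add: t normal_form.simps norm_power)
    also have "\<dots> \<le> ((\<bar>C\<bar> + 1) * s) * s ^ 2" using s by (simp add: power2_eq_square power3_eq_cube)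
    also have "(\<bar>C\<bar> + 1) * s \<le> (\<bar>C\<bar> + 1) * (1 / (2 * (\<bar>C\<bar> + 1)))" using s by (intro mult_left_mono) auto
    also have "\<dots> = 1 / 2" by (simp add: field_simps)
    finally show False using s by simp
  qed
  then show ?thesis using t by blast
next
  case False
  have "\<forall>\<^sub>F z in nhds 0. norm (z :: complex \<times> complex) < 1"
    unfolding eventually_nhds_metric by (intro exI[of _ 1]) auto
  then have "\<forall>\<^sub>F z in nhds 0. norm (normal_form t z) \<le> 2 * norm z ^ 3"
  proof eventually_elim
    case (elim z)
    obtain x y where z: "z = (x, y)" by (cases z)
    define N where "N = norm z"
    have xy: "norm x \<le> N" "norm y \<le> N" using norm_fst_le'[of z, folded N_def] norm_snd_le'[of z, folded N_def] by (auto simp: z)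
    have mon: "norm (x ^ i * y ^ j) \<le> N ^ 3" if "3 \<le> i + j" for i j
    proof -
      have "norm (x ^ i * y ^ j) \<le> N ^ i * N ^ j"
        unfolding norm_mult norm_power using xy by (intro mult_mono power_mono) (auto simp: N_def)
      also have "\<dots> \<le> N ^ 3" using that elim N_def by (simp add: power_decreasing flip: power_add)
      finally show ?thesis .
    qed
    have two: "norm (p + q) \<le> 2 * N ^ 3" if "norm p \<le> N ^ 3" "norm q \<le> N ^ 3" for p q :: complex
      using that norm_triangle_ineq[of p q] by linarith
    have "norm (normal_form t z) \<le> 2 * N ^ 3"
    proof (cases t)
      case (D n)
      then have "3 \<le> 0 + (n - 1)" using v by simp
      then show ?thesis using mon[of 2 1] mon[of 0 "n - 1"] D
        by (auto simp: normal_form.simps z intro!: two)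
    next
      case E6 then show ?thesis using mon[of 3 0] mon[of 0 4] by (auto simp: normal_form.simps z intro!: two)
    next
      case E7 then show ?thesis using mon[of 3 0] mon[of 1 3] by (auto simp: normal_form.simps z intro!: two)
    next
      case E8 then show ?thesis using mon[of 3 0] mon[of 0 5] by (auto simp: normal_form.simps z intro!: two)
    qed (use False in blast)
    then show ?case by (simp add: N_def)
  qed
  then show ?thesis using False unfolding cubic_bound_def by blast
qed

lemma unitangentI:
  assumes "\<And>e. e > 0 \<Longrightarrow> \<exists>d>0. \<forall>z. norm z < d \<longrightarrow> f z = 0 \<longrightarrow> norm (fst z) \<le> e * norm (snd z)"
  shows "unitangent f"
  unfolding unitangent_def
proof (intro allI impI)
  fix e :: real assume e: "e > 0"
  then obtain d where d: "d > 0" "\<And>z. norm z < d \<Longrightarrow> f z = 0 \<Longrightarrow> norm (fst z) \<le> e / 2 * norm (snd z)"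
    using assms[of "e / 2"] by auto
  show "\<exists>d>0. \<forall>z w. norm z < d \<longrightarrow> norm w < d \<longrightarrow> f z = 0 \<longrightarrow> f w = 0 \<longrightarrow> norm (wedge z w) \<le> e * norm z * norm w"
  proof (intro exI[of _ d] conjI d allI impI)
    fix z w assume h: "norm z < d" "norm w < d" "f z = 0" "f w = 0"
    have "norm (wedge z w) \<le> norm (fst z) * norm (snd w) + norm (snd z) * norm (fst w)"
      unfolding wedge_def by (metis norm_mult norm_triangle_ineq4)
    also have "\<dots> \<le> (e / 2 * norm (snd z)) * norm (snd w) + norm (snd z) * (e / 2 * norm (snd w))"
      using d(2)[of z] d(2)[of w] h by (intro add_mono mult_mono) (use e in auto)
    also have "\<dots> = e * (norm (snd z) * norm (snd w))" by (simp add: algebra_simps)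
    also have "\<dots> \<le> e * (norm z * norm w)" using e by (intro mult_left_mono mult_mono norm_snd_le') auto
    finally show "norm (wedge z w) \<le> e * norm z * norm w" by (simp add: mult.assoc)
  qed
qed

text \<open>On every branch either \<open>x = 0\<close> or \<open>|x|\<close> is a power of
  \<open>|y|\<close> with exponent 4/3, 3/2 or 5/3, so all zeros approach the direction
  \<open>x = 0\<close>.\<close>

lemma unitangent_E:
  assumes "t \<in> {E6, E7, E8}" shows "unitangent (normal_form t)"
proof (rule unitangentI)
  fix e :: real assume e: "e > 0"
  define d where "d = min 1 (e ^ 3)"
  have d: "d > 0" "d \<le> 1" "d \<le> e ^ 3" using e by (auto simp: d_def)
  have cube: "a \<le> e * b" if "a ^ 3 \<le> e ^ 3 * b ^ 3" "a \<ge> 0" "b \<ge> 0" for a b :: real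
    using that e power_mono_iff[of a "e * b" 3] by (simp add: power_mult_distrib)
  define d' where "d' = min d (e ^ 2)"
  have d': "d' > 0" "d' \<le> 1" "d' \<le> e ^ 3" "d' \<le> e ^ 2" using d e by (auto simp: d'_def)
  show "\<exists>d>0. \<forall>z. norm z < d \<longrightarrow> normal_form t z = 0 \<longrightarrow> norm (fst z) \<le> e * norm (snd z)"
  proof (intro exI[of _ d'] conjI d' allI impI)
    fix z assume z: "norm z < d'" "normal_form t z = 0"
    obtain x y where xy: "z = (x, y)" by (cases z)
    define X Y where "X = norm x" and "Y = norm y"
    have Y: "0 \<le> X" "0 \<le> Y" "Y \<le> e ^ 3" "Y \<le> e ^ 2" "Y \<le> 1"
      using norm_snd_le'[of z] z(1) d' by (auto simp: X_def Y_def xy)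
    consider "X ^ 3 = Y ^ 4" | "X = 0" | "X ^ 2 = Y ^ 3" | "X ^ 3 = Y ^ 5"
    proof -
      consider "t = E6" | "t = E7" | "t = E8" using assms by auto
      then show ?thesis
      proof cases
        case 1
        then have "x ^ 3 = - (y ^ 4)" using z(2) by (simp add: xy normal_form.simps add_eq_0_iff2)
        then show ?thesis using that(1) by (metis X_def Y_def norm_minus_cancel norm_power)
      next
        case 2
        then have "x * (x\<^sup>2 + y ^ 3) = 0" using z(2) by (simp add: xy normal_form.simps algebra_simps power2_eq_square power3_eq_cube)
        then have "x = 0 \<or> x\<^sup>2 = - (y ^ 3)" by (auto simp: add_eq_0_iff2)
        then show ?thesis using that(2,3) by (metis X_def Y_def norm_minus_cancel norm_power norm_zero)
      next
        case 3
        then have "x ^ 3 = - (y ^ 5)" using z(2) by (simp add: xy normal_form.simps add_eq_0_iff2)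
        then show ?thesis using that(4) by (metis X_def Y_def norm_minus_cancel norm_power)
      qed
    qed
    then have "X \<le> e * Y"
    proof cases
      case 1
      have "X ^ 3 = Y * Y ^ 3" unfolding 1 by (simp add: eval_nat_numeral)
      also have "\<dots> \<le> e ^ 3 * Y ^ 3" using Y by (intro mult_right_mono) auto
      finally show ?thesis using cube Y by blast
    next
      case 2 then show ?thesis using Y e by simp
    next
      case 3
      have "X ^ 2 = Y * Y ^ 2" unfolding 3 by (simp add: eval_nat_numeral)
      also have "\<dots> \<le> e ^ 2 * Y ^ 2" using Y by (intro mult_right_mono) auto
      finally have "X ^ 2 \<le> (e * Y) ^ 2" by (simp add: power_mult_distrib)
      then show ?thesis by (rule power2_le_imp_le) (use e Y in simp)
    next
      case 4
      have "X ^ 3 = Y\<^sup>2 * Y ^ 3" unfolding 4 by (simp flip: power_add)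
      also have "\<dots> \<le> e ^ 3 * Y ^ 3"
      proof (rule mult_right_mono)
        have "Y\<^sup>2 \<le> Y * 1" unfolding power2_eq_square using Y by (intro mult_left_mono) auto
        then show "Y\<^sup>2 \<le> e ^ 3" using Y by simp
      qed (use Y in simp)
      finally show ?thesis using cube Y by blast
    qed
    then show "norm (fst z) \<le> e * norm (snd z)" by (simp add: xy X_def Y_def)
  qed
qed

text \<open>The zeros \<open>(s, 0)\<close> and \<open>(\<i> s^(n-2), s^2)\<close> have a wedge of
  norm \<open>s^3\<close>, comparable with the product of their norms.\<close>

lemma not_unitangent_D:
  assumes "n \<ge> 4" shows "\<not> unitangent (normal_form (D n))"
proof
  assume "unitangent (normal_form (D n))"
  then obtain d where d: "d > 0" "\<And>z w. norm z < d \<Longrightarrow> norm w < d \<Longrightarrow> normal_form (D n) z = 0 \<Longrightarrow> normal_form (D n) w = 0 \<Longrightarrow>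
     norm (wedge z w) \<le> (1/4) * norm z * norm w" unfolding unitangent_def by (metis zero_less_divide_1_iff zero_less_numeral)
  define s where "s = min (d / 4) (1 / 2)"
  have s: "0 < s" "s < 1" "2 * s < d" using d by (auto simp: s_def min_less_iff_disj)
  define x y where "x = \<i> * complex_of_real s ^ (n - 2)" and "y = complex_of_real s ^ 2"
  have nx: "norm x = s ^ (n - 2)" and ny: "norm y = s ^ 2" using s by (simp_all add: x_def y_def norm_mult norm_power)
  have x2: "x ^ 2 = - (y ^ (n - 2))" by (simp add: x_def y_def power_mult_distrib mult.commute flip: power_mult)
  have z: "normal_form (D n) (x, y) = 0"
  proof -
    have "n - 1 = Suc (n - 2)" using assms by simp
    then show ?thesis by (simp add: normal_form.simps x2)
  qed
  have z': "normal_form (D n) (complex_of_real s, 0) = 0" using assms by (simp add: normal_form.simps)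
  have "norm x \<le> s ^ 2" unfolding nx using assms s by (intro power_decreasing) auto
  then have nz: "norm (x, y) \<le> 2 * s ^ 2" using norm_Pair_le[of x y] ny by simp
  have "s ^ 2 \<le> s ^ 1" using s by (intro power_decreasing) auto
  then have "norm (x, y) < d" using nz s by simp
  moreover have "norm (complex_of_real s, 0::complex) = s" using s by simp
  ultimately have "norm (wedge (complex_of_real s, 0) (x, y)) \<le> (1/4) * s * norm (x, y)"
    using d(2)[OF _ _ z' z] s by simp
  also have "\<dots> \<le> (1/4) * s * (2 * s ^ 2)" using nz s by (intro mult_left_mono) auto
  finally have "s * s ^ 2 \<le> (1/4) * s * (2 * s ^ 2)" using s ny by (simp add: wedge_def norm_mult)
  then show False using s by simp
qed

lemma unitangent_normal_form:
  assumes "valid_type t" "\<And>n. t \<noteq> A n"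
  shows "unitangent (normal_form t) \<longleftrightarrow> (\<forall>n. t \<noteq> D n)"
  using assms not_unitangent_D unitangent_E[of t] by (cases t) auto

text \<open>\<open>grad_index\<close> is injective within the A series, within the D series and on
  the three E types. Coincidences between them, such as 18 for A5, D6 and E7, are resolved by the
  two other invariants.\<close>

lemma normal_form_unique:
  assumes "germ_equiv f (normal_form s)" "germ_equiv g (normal_form t)" "valid_type s" "valid_type t" "germ_equiv f g"
  shows "s = t"
proof -
  have P: "P (normal_form s) = P (normal_form t)"
    if "\<And>f g. germ_equiv g f \<Longrightarrow> P g \<Longrightarrow> P f" for P
    using that germ_equiv_sym assms(1,2,5) by meson
  have cb: "cubic_bound (normal_form s) = cubic_bound (normal_form t)" by (rule P) (rule cubic_bound_transfer)
  have gb: "grad_bound k (normal_form s) = grad_bound k (normal_form t)" for k by (rule P) (rule grad_bound_transfer)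
  have u: "unitangent (normal_form s) = unitangent (normal_form t)" by (rule P) (rule unitangent_transfer)
  have c: "(\<forall>n. s \<noteq> A n) = (\<forall>n. t \<noteq> A n)"
    using cb cubic_bound_normal_form[OF assms(3)] cubic_bound_normal_form[OF assms(4)] by blast
  have g: "grad_index s = grad_index t"
  proof (rule ccontr)
    assume ne: "grad_index s \<noteq> grad_index t"
    have "grad_bound (grad_index s) (normal_form t)" "grad_bound (grad_index t) (normal_form s)"
      using gb grad_bound_normal_form[OF assms(3)] grad_bound_normal_form[OF assms(4)] by blast+
    then show False using not_grad_bound_normal_form assms(3,4) ne by (metis linorder_neqE_nat)
  qed
  show ?thesis
  proof (cases "\<exists>n. s = A n")
    case True
    then show ?thesis using c g by auto
  next
    case False
    then have "(\<forall>n. s \<noteq> D n) = (\<forall>n. t \<noteq> D n)"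
      using u c unitangent_normal_form[OF assms(3)] unitangent_normal_form[OF assms(4)] by blast
    then show ?thesis using g c False by (cases s; cases t) auto
  qed
qed

text \<open>Multiplicity 3 with a single tangent leaves only E6, E7 and E8, whose gradient index is
  at most 20.\<close>

lemma not_simple:
  assumes "cubic_bound f" "unitangent f" "\<And>j. j \<le> 20 \<Longrightarrow> \<not> grad_bound j f" "valid_type t"
  shows "\<not> germ_equiv f (normal_form t)"
proof
  assume e: "germ_equiv f (normal_form t)"
  have "cubic_bound (normal_form t)" "unitangent (normal_form t)"
    using cubic_bound_transfer[OF e] unitangent_transfer[OF e] assms by auto
  then have "t \<in> {E6, E7, E8}"
    using cubic_bound_normal_form[OF assms(4)] unitangent_normal_form[OF assms(4)] by (cases t) auto
  then have "grad_index t \<le> 20" by auto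
  moreover have "grad_bound (grad_index t) f"
    using grad_bound_transfer[OF germ_equiv_sym[OF e] grad_bound_normal_form[OF assms(4)]] .
  ultimately show False using assms(3) by blast
qed

section \<open>Projective transformations\<close>

lemma hom_poly_fun_add:
  assumes "hom_poly_fun d F" "hom_poly_fun d G" shows "hom_poly_fun d (\<lambda>x. F x + G x)"
proof -
  obtain a b where "\<And>x. F x = (\<Sum>i\<le>d. \<Sum>j\<le>d - i. a i j * (x$1)^i * (x$2)^j * (x$3)^(d - i - j))"
    "\<And>x. G x = (\<Sum>i\<le>d. \<Sum>j\<le>d - i. b i j * (x$1)^i * (x$2)^j * (x$3)^(d - i - j))"
    using assms unfolding hom_poly_fun_def by blast
  then show ?thesis unfolding hom_poly_fun_def
    by (intro exI[of _ "\<lambda>i j. a i j + b i j"]) (simp add: sum.distrib ring_distribs)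
qed

lemma hom_poly_fun_cmult:
  assumes "hom_poly_fun d F" shows "hom_poly_fun d (\<lambda>x. k * F x)"
proof -
  obtain a where "\<And>x. F x = (\<Sum>i\<le>d. \<Sum>j\<le>d - i. a i j * (x$1)^i * (x$2)^j * (x$3)^(d - i - j))"
    using assms unfolding hom_poly_fun_def by blast
  then show ?thesis unfolding hom_poly_fun_def
    by (intro exI[of _ "\<lambda>i j. k * a i j"]) (simp add: sum_distrib_left mult.assoc)
qed

lemma hom_poly_fun_0 [simp]: "hom_poly_fun d (\<lambda>x. 0)"
  unfolding hom_poly_fun_def by (intro exI[of _ "\<lambda>i j. 0"]) simp

lemma hom_poly_fun_const: "hom_poly_fun 0 (\<lambda>x. k)"
  unfolding hom_poly_fun_def by (intro exI[of _ "\<lambda>i j. k"]) simp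

lemma hom_poly_fun_sum: "finite S \<Longrightarrow> (\<And>i. i \<in> S \<Longrightarrow> hom_poly_fun d (F i)) \<Longrightarrow> hom_poly_fun d (\<lambda>x. \<Sum>i\<in>S. F i x)"
  by (induction rule: finite_induct) (auto intro: hom_poly_fun_add)

lemma hom_poly_fun_var:
  assumes "hom_poly_fun d F"
  shows "hom_poly_fun (Suc d) (\<lambda>x. x $ k * F x)"
proof -
  obtain a where F: "\<And>x. F x = (\<Sum>i\<le>d. \<Sum>j\<le>d - i. a i j * (x$1)^i * (x$2)^j * (x$3)^(d - i - j))"
    using assms unfolding hom_poly_fun_def by blast
  consider "k = 1" | "k = 2" | "k = 3" using exhaust_3 by blast
  then show ?thesis
  proof cases
    case 1
    show ?thesis unfolding hom_poly_fun_def F 1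
      by (intro exI[of _ "\<lambda>i j. case i of 0 \<Rightarrow> 0 | Suc i' \<Rightarrow> a i' j"] allI, subst sum.atMost_Suc_shift)
        (simp add: sum_distrib_left mult_ac)
  next
    case 2
    define b where "b i j = (case j of 0 \<Rightarrow> 0 | Suc j' \<Rightarrow> a i j')" for i j
    have "x $ 2 * (\<Sum>i\<le>d. \<Sum>j\<le>d - i. a i j * x $ 1 ^ i * x $ 2 ^ j * x $ 3 ^ (d - i - j)) =
        (\<Sum>i\<le>Suc d. \<Sum>j\<le>Suc d - i. b i j * x $ 1 ^ i * x $ 2 ^ j * x $ 3 ^ (Suc d - i - j))" for x :: "complex^3"
    proof -
      have "(\<Sum>j\<le>Suc d - i. b i j * x $ 1 ^ i * x $ 2 ^ j * x $ 3 ^ (Suc d - i - j))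
        = x $ 2 * (\<Sum>j\<le>d - i. a i j * x $ 1 ^ i * x $ 2 ^ j * x $ 3 ^ (d - i - j))" if "i \<le> d" for i
      proof -
        have "Suc d - i = Suc (d - i)" using that by simp
        then show ?thesis by (simp add: sum.atMost_Suc_shift b_def sum_distrib_left mult_ac del: sum.atMost_Suc)
      qed
      then show ?thesis by (simp add: sum_distrib_left b_def)
    qed
    then show ?thesis unfolding hom_poly_fun_def F 2 by blast
  next
    case 3
    \<comment> \<open>Multiplying by \<open>x$3\<close> raises the dependent exponent only, so the
      coefficient array is kept and extended by 0 on the new diagonal
      \<open>i + j = d + 1\<close>.\<close>
    define b where "b i j = (if i + j \<le> d then a i j else 0)" for i j
    have "x $ 3 * (\<Sum>i\<le>d. \<Sum>j\<le>d - i. a i j * x $ 1 ^ i * x $ 2 ^ j * x $ 3 ^ (d - i - j)) =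
        (\<Sum>i\<le>Suc d. \<Sum>j\<le>Suc d - i. b i j * x $ 1 ^ i * x $ 2 ^ j * x $ 3 ^ (Suc d - i - j))" for x :: "complex^3"
    proof -
      have "(\<Sum>j\<le>Suc d - i. b i j * x $ 1 ^ i * x $ 2 ^ j * x $ 3 ^ (Suc d - i - j))
        = x $ 3 * (\<Sum>j\<le>d - i. a i j * x $ 1 ^ i * x $ 2 ^ j * x $ 3 ^ (d - i - j))" if i: "i \<le> d" for i
      proof -
        have 1: "Suc d - i = Suc (d - i)" using i by simp
        have "(\<Sum>j\<le>d - i. b i j * x $ 1 ^ i * x $ 2 ^ j * x $ 3 ^ (Suc (d - i) - j))
          = (\<Sum>j\<le>d - i. x $ 3 * (a i j * x $ 1 ^ i * x $ 2 ^ j * x $ 3 ^ (d - i - j)))"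
          using i by (intro sum.cong) (auto simp: b_def Suc_diff_le)
        then show ?thesis unfolding 1 using i by (simp add: b_def sum_distrib_left)
      qed
      then show ?thesis by (simp add: sum_distrib_left b_def)
    qed
    then show ?thesis unfolding hom_poly_fun_def F 3 by blast
  qed
qed

lemma hom_poly_fun_linear_power:
  assumes "hom_poly_fun d G"
  shows "hom_poly_fun (n + d) (\<lambda>x. (a * x$1 + b * x$2 + c * x$3) ^ n * G x)"
proof (induction n)
  case (Suc n)
  let ?H = "\<lambda>x. (a * x$1 + b * x$2 + c * x$3) ^ n * G x"
  have "hom_poly_fun (Suc (n + d)) (\<lambda>x. a * (x$1 * ?H x) + b * (x$2 * ?H x) + c * (x$3 * ?H x))"
    by (intro hom_poly_fun_add hom_poly_fun_cmult hom_poly_fun_var Suc)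
  then show ?case by (simp add: algebra_simps)
qed (use assms in simp)

lemma matrix_vector_mult_nth3: "((M :: complex^3^3) *v x) $ i = M$i$1 * x$1 + M$i$2 * x$2 + M$i$3 * x$3"
  by (simp add: matrix_vector_mult_def sum_3)

lemma hom_poly_fun_matrix:
  assumes "hom_poly_fun d F" shows "hom_poly_fun d (\<lambda>x. F (M *v x))"
proof -
  obtain a where F: "\<And>x. F x = (\<Sum>i\<le>d. \<Sum>j\<le>d - i. a i j * (x$1)^i * (x$2)^j * (x$3)^(d - i - j))"
    using assms unfolding hom_poly_fun_def by blast
  define l where "l k x = M$k$1 * x$1 + M$k$2 * x$2 + M$k$3 * x$3" for k and x :: "complex^3"
  have pow: "hom_poly_fun (n + e) (\<lambda>x. l k x ^ n * G x)" if "hom_poly_fun e G" for n e k G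
    using hom_poly_fun_linear_power[OF that, of n "M$k$1" "M$k$2" "M$k$3"] by (simp only: l_def)
  have monomial: "hom_poly_fun d (\<lambda>x. a i j * l 1 x ^ i * l 2 x ^ j * l 3 x ^ (d - i - j))" if ij: "i \<le> d" "j \<le> d - i" for i j
  proof -
    have 1: "i + (j + ((d - i - j) + 0)) = d" using ij by simp
    have "hom_poly_fun (i + (j + ((d - i - j) + 0))) (\<lambda>x. l 1 x ^ i * (l 2 x ^ j * (l 3 x ^ (d - i - j) * a i j)))"
      by (rule pow[OF pow[OF pow[OF hom_poly_fun_const]]])
    then show ?thesis unfolding 1 by (simp add: mult_ac)
  qed
  have inner: "hom_poly_fun d (\<lambda>x. \<Sum>j\<le>d - i. a i j * l 1 x ^ i * l 2 x ^ j * l 3 x ^ (d - i - j))" if "i \<le> d" for i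
    using hom_poly_fun_sum[of "{..d - i}" d "\<lambda>j x. a i j * l 1 x ^ i * l 2 x ^ j * l 3 x ^ (d - i - j)"] monomial[OF that] by simp
  have "hom_poly_fun d (\<lambda>x. \<Sum>i\<le>d. \<Sum>j\<le>d - i. a i j * l 1 x ^ i * l 2 x ^ j * l 3 x ^ (d - i - j))"
    using hom_poly_fun_sum[of "{..d}" d "\<lambda>i x. \<Sum>j\<le>d - i. a i j * l 1 x ^ i * l 2 x ^ j * l 3 x ^ (d - i - j)"] inner by simp
  moreover have "l k x = (M *v x) $ k" for k x by (simp only: l_def matrix_vector_mult_nth3)
  ultimately show ?thesis by (simp only: F)
qed

lemma hom_poly_fun_scale:
  assumes "hom_poly_fun d F" shows "F (k *s x) = k ^ d * F x"
proof -
  obtain a where F: "\<And>x. F x = (\<Sum>i\<le>d. \<Sum>j\<le>d - i. a i j * (x$1)^i * (x$2)^j * (x$3)^(d - i - j))"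
    using assms unfolding hom_poly_fun_def by blast
  show ?thesis unfolding F sum_distrib_left
  proof (intro sum.cong refl)
    fix i j assume ij: "i \<in> {..d}" "j \<in> {..d - i}"
    then have "k ^ d = k ^ i * (k ^ j * k ^ (d - i - j))" by (simp flip: power_add)
    then show "a i j * (k *s x) $ 1 ^ i * (k *s x) $ 2 ^ j * (k *s x) $ 3 ^ (d - i - j) =
       k ^ d * (a i j * x $ 1 ^ i * x $ 2 ^ j * x $ 3 ^ (d - i - j))"
      by (simp add: power_mult_distrib)
  qed
qed

section \<open>Independence of the type from the chart\<close>

definition chart :: "(complex^3 \<Rightarrow> complex) \<Rightarrow> complex^3^3 \<Rightarrow> complex \<times> complex \<Rightarrow> complex" where
  "chart F M = (\<lambda>(u, v). F (M *v pt3 1 u v))"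

lemma invertibleE:
  assumes "invertible (M :: complex^3^3)"
  obtains N where "M ** N = mat 1" "N ** M = mat 1" "invertible N" "\<And>x. M *v (N *v x) = x" "\<And>x. N *v (M *v x) = x"
proof -
  obtain N where N: "M ** N = mat 1" "N ** M = mat 1" using assms unfolding invertible_def by blast
  show thesis
    by (rule that[OF N]) (use N in \<open>auto simp: matrix_vector_mul_assoc matrix_vector_mul_lid invertible_def\<close>)
qed

text \<open>The transition matrix fixes the base point up to the factor \<open>k\<close>. In affine
  coordinates it is the fractional linear map with components \<open>\<beta> / \<alpha>\<close> and
  \<open>\<gamma> / \<alpha>\<close>, where \<open>\<alpha>\<close> is \<open>k\<close> at the
  origin, and homogeneity turns the denominator into the unit \<open>\<alpha> ^ d\<close>.\<close>

lemma chart_change: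
  assumes F: "hom_poly_fun d F" and M: "invertible M" "invertible M'" and p: "M' *v pt3 1 0 0 = k *s (M *v pt3 1 0 0)" "k \<noteq> 0"
  shows "germ_equiv (chart F M') (chart F M)"
proof -
  obtain Mi where Mi: "M ** Mi = mat 1" "Mi ** M = mat 1" "invertible Mi" "\<And>x. M *v (Mi *v x) = x" "\<And>x. Mi *v (M *v x) = x"
    by (rule invertibleE[OF M(1)]) (rule that; assumption)
  define N where "N = Mi ** M'"
  have N: "M *v (N *v x) = M' *v x" for x by (simp add: N_def Mi(4) flip: matrix_vector_mul_assoc)
  have "invertible N" unfolding N_def using Mi(3) M(2) by (rule invertible_mult)
  then have dN: "det N \<noteq> 0" by (simp add: invertible_det_nz)
  have "N *v pt3 1 0 0 = Mi *v (M' *v pt3 1 0 0)" by (simp add: N_def flip: matrix_vector_mul_assoc)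
  also have "\<dots> = k *s pt3 1 0 0" unfolding p by (simp add: vector_scalar_commute Mi)
  finally have Ne: "N *v pt3 1 0 0 = k *s pt3 1 0 0" .
  have n: "N$1$1 = k" "N$2$1 = 0" "N$3$1 = 0"
    using arg_cong[OF Ne, of "\<lambda>v. v$1"] arg_cong[OF Ne, of "\<lambda>v. v$2"] arg_cong[OF Ne, of "\<lambda>v. v$3"]
    by (simp_all add: matrix_vector_mult_nth3)
  have det: "N$2$2 * N$3$3 - N$2$3 * N$3$2 \<noteq> 0"
  proof -
    have "det N = k * (N$2$2 * N$3$3 - N$2$3 * N$3$2)" by (simp add: det_3 n algebra_simps)
    then show ?thesis using dN by auto
  qed
  define \<alpha> where "\<alpha> z = k + N$1$2 * fst z + N$1$3 * snd z" for z
  define \<beta> where "\<beta> z = N$2$2 * fst z + N$2$3 * snd z" for z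
  define \<gamma> where "\<gamma> z = N$3$2 * fst z + N$3$3 * snd z" for z
  have hgs: "hg \<alpha>" "hg \<beta>" "hg \<gamma>" unfolding \<alpha>_def \<beta>_def \<gamma>_def by (intro hg_intros)+
  have a0: "\<alpha> 0 \<noteq> 0" using p by (simp add: \<alpha>_def fst_zero snd_zero)
  have c: "coords \<beta> \<gamma>"
    by (rule coordsI[OF hgs(2,3) _ _ det])
      (auto simp: \<beta>_def[abs_def] \<gamma>_def[abs_def] intro!: derivative_eq_intros)
  define i where "i z = inverse (\<alpha> z)" for z
  have i: "hg i" "i 0 \<noteq> 0" unfolding i_def using hgs a0 by auto
  have "coords (\<lambda>z. i z * \<beta> z) (\<lambda>z. i z * \<gamma> z)"
    by (rule coords_swap[OF coords_scale[OF coords_swap[OF coords_scale[OF c i]] i]])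
  then show ?thesis
  proof (rule coords_germ_equiv)
    show "hg (\<lambda>z. \<alpha> z ^ d)" "\<alpha> 0 ^ d \<noteq> 0" using hgs a0 by auto
    show "\<forall>\<^sub>F z in nhds 0. chart F M' z = \<alpha> z ^ d * chart F M (i z * \<beta> z, i z * \<gamma> z)"
      using hg_nonzero[OF hgs(1) a0]
    proof eventually_elim
      case (elim z)
      have "N *v pt3 1 (fst z) (snd z) = \<alpha> z *s pt3 1 (i z * \<beta> z) (i z * \<gamma> z)"
      proof -
        have e: "\<alpha> z * (i z * \<beta> z) = \<beta> z" "\<alpha> z * (i z * \<gamma> z) = \<gamma> z" using elim by (simp_all add: i_def)
        show ?thesis unfolding vec_eq_iff forall_3 matrix_vector_mult_nth3 n vector_smult_component pt3_nth e
          by (simp add: \<alpha>_def \<beta>_def \<gamma>_def)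
      qed
      then have "M' *v pt3 1 (fst z) (snd z) = \<alpha> z *s (M *v pt3 1 (i z * \<beta> z) (i z * \<gamma> z))"
        using N by (metis vector_scalar_commute)
      then show ?case by (simp add: chart_def case_prod_beta hom_poly_fun_scale[OF F])
    qed
  qed
qed

lemma has_typeE:
  assumes "has_type F (proj_pt p0) t"
  obtains p M c where "p = c *s p0" "c \<noteq> 0" "p \<noteq> 0" "invertible M" "M *v pt3 1 0 0 = p" "valid_type t"
    "germ_equiv (chart F M) (normal_form t)"
proof -
  obtain p M where h: "p \<in> proj_pt p0" "p \<noteq> 0" "invertible M" "M *v pt3 1 0 0 = p" "valid_type t"
    "germ_equiv (chart F M) (normal_form t)" using assms unfolding has_type_def chart_def by blast
  then obtain c where "p = c *s p0" unfolding proj_pt_def by blast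
  moreover from this h(2) have "c \<noteq> 0" by auto
  ultimately show thesis using that h by blast
qed

lemma has_type_chart:
  assumes F: "hom_poly_fun d F" and t: "has_type F (proj_pt p0) t" and M: "invertible M" "M *v pt3 1 0 0 = k *s p0" "k \<noteq> 0"
  shows "\<exists>f. germ_equiv f (normal_form t) \<and> germ_equiv f (chart F M) \<and> valid_type t"
proof (rule has_typeE[OF t])
  fix p M' c assume h: "p = c *s p0" "c \<noteq> 0" "p \<noteq> 0" "invertible M'" "M' *v pt3 1 0 0 = p" "valid_type t"
    "germ_equiv (chart F M') (normal_form t)"
  have "germ_equiv (chart F M') (chart F M)"
    by (rule chart_change[OF F M(1) h(4), of "c / k"]) (use h M in \<open>simp_all add: vector_smult_assoc\<close>)
  then show ?thesis using h by blast
qed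

text \<open>Different representatives and charts of one point give equivalent germs, so
  \<open>normal_form_unique\<close> applies; this is what allows the description operator in
  \<open>sing_set\<close> to be evaluated.\<close>

lemma has_type_unique:
  assumes F: "hom_poly_fun d F" and s: "has_type F (proj_pt p) s" and t: "has_type F (proj_pt p) t"
  shows "s = t"
proof (rule has_typeE[OF s])
  fix q M c assume h: "q = c *s p" "c \<noteq> 0" "q \<noteq> 0" "invertible M" "M *v pt3 1 0 0 = q" "valid_type s"
    "germ_equiv (chart F M) (normal_form s)"
  obtain f where f: "germ_equiv f (normal_form t)" "germ_equiv f (chart F M)" "valid_type t"
    using has_type_chart[OF F t h(4) _ h(2)] h(1,5) by auto
  show ?thesis using normal_form_unique[OF h(7) f(1) h(6) f(3) germ_equiv_sym[OF f(2)]] .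
qed

lemma the_has_type:
  assumes "hom_poly_fun d F" "has_type F (proj_pt p) t" shows "(THE t. has_type F (proj_pt p) t) = t"
  using assms has_type_unique by (intro the_equality) blast+

lemma germ_equiv_cmult:
  assumes "germ_equiv f g" "c \<noteq> 0" shows "germ_equiv (\<lambda>z. c * f z) g"
proof -
  obtain U \<phi>1 \<phi>2 \<psi>1 \<psi>2 u where h: "(0, 0) \<in> U" "holo2_on U \<phi>1" "holo2_on U \<phi>2" "holo2_on U u"
      "(\<phi>1 (0, 0), \<phi>2 (0, 0)) = (0, 0)" "u (0, 0) \<noteq> 0"
      "inj_on (\<lambda>z. (\<phi>1 z, \<phi>2 z)) U"
      "holo2_on ((\<lambda>z. (\<phi>1 z, \<phi>2 z)) ` U) \<psi>1" "holo2_on ((\<lambda>z. (\<phi>1 z, \<phi>2 z)) ` U) \<psi>2"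
      "\<forall>z\<in>U. (\<psi>1 (\<phi>1 z, \<phi>2 z), \<psi>2 (\<phi>1 z, \<phi>2 z)) = z"
      "\<forall>z\<in>U. f (\<phi>1 z, \<phi>2 z) = u z * g z"
    using assms unfolding germ_equiv_def by blast
  have hol: "holo2_on U (\<lambda>z. c * u z)" unfolding holo2_on_def
  proof (intro conjI ballI)
    fix z assume z: "z \<in> U"
    obtain a b where "(u has_derivative lin2 a b) (at z)" using holo2_onD[OF h(4) z] .
    then have "((\<lambda>z. c * u z) has_derivative (\<lambda>(w1,w2). (c * a) * w1 + (c * b) * w2)) (at z)"
      by (rule has_derivative_eq_rhs[OF has_derivative_mult_right]) (simp add: algebra_simps case_prod_beta')
    then show "\<exists>a b. ((\<lambda>z. c * u z) has_derivative (\<lambda>(w1, w2). a * w1 + b * w2)) (at z)" by blast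
  qed (use h in \<open>simp add: holo2_on_def\<close>)
  show ?thesis unfolding germ_equiv_def
    apply (rule exI[of _ U], rule exI[of _ \<phi>1], rule exI[of _ \<phi>2], rule exI[of _ \<psi>1], rule exI[of _ \<psi>2],
        rule exI[of _ "\<lambda>z. c * u z"])
    apply (intro conjI h(1-3) hol h(5) h(7-10))
    using h(6,11) assms(2) by auto
qed

lemma proj_pt_image: "(\<lambda>x. M *v x) ` proj_pt p = proj_pt (M *v p)"
  unfolding proj_pt_def by (auto simp: vector_scalar_commute image_iff) (metis vector_scalar_commute)

lemma proj_equivE:
  assumes "(F, G) \<in> proj_equiv"
  obtains M N c where "c \<noteq> 0" "\<And>x. G x = c * F (M *v x)" "\<And>x. F x = inverse c * G (N *v x)"
    "invertible M" "invertible N" "\<And>x. M *v (N *v x) = x" "\<And>x. N *v (M *v x) = x"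
proof -
  obtain M c where h: "invertible M" "c \<noteq> 0" "\<And>x. G x = c * F (M *v x)" using assms unfolding proj_equiv_def by blast
  obtain N where N: "M ** N = mat 1" "N ** M = mat 1" "invertible N" "\<And>x. M *v (N *v x) = x" "\<And>x. N *v (M *v x) = x"
    by (rule invertibleE[OF h(1)]) (rule that; assumption)
  show thesis by (rule that[OF h(2,3) _ h(1) N(3,4,5)]) (use h N in simp)
qed

lemma has_type_pullback:
  assumes G: "\<And>x. G x = c * F (M *v x)" "c \<noteq> 0" and M: "invertible M" and t: "has_type G P t"
  shows "has_type F ((\<lambda>x. M *v x) ` P) t"
proof -
  obtain p M' where h: "p \<in> P" "p \<noteq> 0" "invertible M'" "M' *v pt3 1 0 0 = p" "valid_type t"
    "germ_equiv (chart G M') (normal_form t)" using t unfolding has_type_def chart_def by blast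
  obtain N where "M ** N = mat 1" "N ** M = mat 1" "invertible N" "\<And>x. M *v (N *v x) = x" and N: "\<And>x. N *v (M *v x) = x"
    by (rule invertibleE[OF M]) (rule that; assumption)
  have "chart F (M ** M') = (\<lambda>z. inverse c * chart G M' z)"
    using G(2) by (auto simp: chart_def G(1) fun_eq_iff matrix_vector_mul_assoc)
  then have "germ_equiv (chart F (M ** M')) (normal_form t)" using germ_equiv_cmult[OF h(6), of "inverse c"] G(2) by simp
  moreover have "M *v p \<noteq> 0" using N h(2) by (metis matrix_vector_mult_0_right)
  moreover have "(M ** M') *v pt3 1 0 0 = M *v p" using h(4) by (simp flip: matrix_vector_mul_assoc)
  ultimately show ?thesis unfolding has_type_def chart_def[symmetric]
    using h(1,3,5) M invertible_mult by blast
qed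

lemma sing_pts_pullback:
  assumes G: "\<And>x. G x = c * F (M *v x)" "\<And>x. F x = inverse c * G (N *v x)" "c \<noteq> 0"
    and N: "\<And>x. M *v (N *v x) = x" "\<And>x. N *v (M *v x) = x" and P: "P \<in> sing_pts G"
  shows "(\<lambda>x. M *v x) ` P \<in> sing_pts F"
proof -
  obtain p where p: "P = proj_pt p" "p \<noteq> 0" "G p = 0" "(G has_derivative (\<lambda>_. 0)) (at p)"
    using P unfolding sing_pts_def by blast
  have "((\<lambda>x. N *v x) has_derivative (\<lambda>x. N *v x)) (at (M *v p))"
    by (rule bounded_linear_imp_has_derivative) (rule matrix_vector_mul_bounded_linear)
  from has_derivative_compose[OF this, of G "\<lambda>_. 0"] p(4) N
  have "((\<lambda>x. G (N *v x)) has_derivative (\<lambda>_. 0)) (at (M *v p))" by simp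
  from has_derivative_mult_right[OF this, of "inverse c"]
  moreover have "F = (\<lambda>x. inverse c * G (N *v x))" using G(2) by blast
  ultimately have "(F has_derivative (\<lambda>_. 0)) (at (M *v p))" by simp
  moreover have "F (M *v p) = 0" using G(1)[of p] G(3) p(3) by simp
  moreover have "M *v p \<noteq> 0" using N(2) p(2) by (metis matrix_vector_mult_0_right)
  ultimately show ?thesis unfolding sing_pts_def p(1) proj_pt_image by blast
qed

text \<open>The matrix maps singular points bijectively, and the predicates \<open>has_type\<close>
  at corresponding points are equal, so the values chosen by the description operator agree
  literally.\<close>

lemma proj_equiv_sing:
  assumes "(F, G) \<in> proj_equiv"
  shows "sing_set F = sing_set G" "simple_sings F \<Longrightarrow> simple_sings G"
proof -
  obtain M N c where h: "c \<noteq> 0" "\<And>x. G x = c * F (M *v x)" "\<And>x. F x = inverse c * G (N *v x)"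
    "invertible M" "invertible N" "\<And>x. M *v (N *v x) = x" "\<And>x. N *v (M *v x) = x"
    by (rule proj_equivE[OF assms]) (rule that; assumption)
  have c': "inverse c \<noteq> 0" using h by simp
  let ?m = "\<lambda>P. (\<lambda>x. M *v x) ` P" and ?n = "\<lambda>P. (\<lambda>x. N *v x) ` P"
  have G': "G x = inverse (inverse c) * F (M *v x)" for x using h by simp
  have mn: "?m (?n P) = P" "?n (?m P) = P" for P using h by (auto simp: image_image)
  have type: "has_type F (?m P) t \<longleftrightarrow> has_type G P t" for P t
  proof
    assume a: "has_type G P t"
    show "has_type F (?m P) t" by (rule has_type_pullback[where G=G and c=c, OF _ _ _ a]; (rule h)?)
  next
    assume a: "has_type F (?m P) t"
    have "has_type G (?n (?m P)) t" by (rule has_type_pullback[where G=F and c="inverse c", OF _ _ _ a]; (rule h c')?)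
    then show "has_type G P t" by (simp only: mn)
  qed
  then have type': "has_type F (?m P) = has_type G P" for P by blast
  have sub: "?m P \<in> sing_pts F" if "P \<in> sing_pts G" for P
    by (rule sing_pts_pullback[where G=G and c=c and N=N]; (rule h that)?)
  have sub': "?n P \<in> sing_pts G" if "P \<in> sing_pts F" for P
    by (rule sing_pts_pullback[where G=F and c="inverse c" and N=M]; (rule h(3) G' c' h(6) h(7) that)?)
  have im: "sing_pts F = ?m ` sing_pts G" 
  proof (intro equalityI subsetI)
    fix P assume "P \<in> sing_pts F"
    then show "P \<in> ?m ` sing_pts G" by (intro image_eqI[of _ ?m "?n P"] sub') (simp only: mn)
  qed (use sub in blast)
  have inj: "inj_on ?m (sing_pts G)" by (rule inj_on_inverseI[of _ ?n]) (rule mn(2))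
  show "sing_set F = sing_set G" unfolding sing_set_def im
    by (simp add: image_mset_mset_set[OF inj, symmetric] multiset.map_comp comp_def type')
  show "simple_sings G" if "simple_sings F" using that sub type unfolding simple_sings_def by blast
qed

lemma equiv_proj_equiv: "equiv UNIV proj_equiv"
proof (rule equivI)
  show "refl proj_equiv" unfolding refl_on_def proj_equiv_def
    by (auto intro!: exI[of _ "mat 1"] exI[of _ "1::complex"] simp: invertible_def)
  show "sym proj_equiv"
  proof (rule symI)
    fix F G assume "(F, G) \<in> proj_equiv"
    then obtain M N c where h: "c \<noteq> 0" "\<And>x. G x = c * F (M *v x)" "\<And>x. F x = inverse c * G (N *v x)"
      "invertible M" "invertible N" "\<And>x. M *v (N *v x) = x" "\<And>x. N *v (M *v x) = x"
      by (rule proj_equivE) (rule that; assumption)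
    then show "(G, F) \<in> proj_equiv" unfolding proj_equiv_def
      by (auto intro!: exI[of _ N] exI[of _ "inverse c"])
  qed
  show "trans proj_equiv"
  proof (rule transI)
    fix F G H assume "(F, G) \<in> proj_equiv" "(G, H) \<in> proj_equiv"
    then obtain M c M' c' where h: "invertible M" "c \<noteq> 0" "\<And>x. G x = c * F (M *v x)"
      "invertible M'" "c' \<noteq> 0" "\<And>x. H x = c' * G (M' *v x)" unfolding proj_equiv_def by auto
    then show "(F, H) \<in> proj_equiv" unfolding proj_equiv_def
      by (auto intro!: exI[of _ "M ** M'"] exI[of _ "c' * c"] invertible_mult simp: matrix_vector_mul_assoc)
  qed
qed auto

section \<open>Singular points of the normal form\<close>

abbreviation lin3 :: "complex \<Rightarrow> complex \<Rightarrow> complex \<Rightarrow> complex^3 \<Rightarrow> complex" where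
  "lin3 a b c \<equiv> (\<lambda>w. a * w$1 + b * w$2 + c * w$3)"

definition gradient_at :: "(complex^3 \<Rightarrow> complex) \<Rightarrow> complex^3 \<Rightarrow> bool" where
  "gradient_at F p \<longleftrightarrow> (\<exists>a b c. (F has_derivative lin3 a b c) (at p))"

lemma gradient_at_const: "gradient_at (\<lambda>_. k) p"
  unfolding gradient_at_def by (intro exI[of _ 0]) simp

lemma gradient_at_nth: "gradient_at (\<lambda>v. v $ k) p"
proof -
  have d: "((\<lambda>v. v $ k) has_derivative (\<lambda>v. v $ k)) (at p)"
    by (rule bounded_linear_imp_has_derivative) (rule bounded_linear_vec_nth)
  consider "k = 1" | "k = 2" | "k = 3" using exhaust_3 by blast
  then show ?thesis unfolding gradient_at_def
  proof cases
    case 1 show "\<exists>a b c. ((\<lambda>v. v $ k) has_derivative lin3 a b c) (at p)"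
      using d 1 by (rule_tac x=1 in exI, rule_tac x=0 in exI, rule_tac x=0 in exI) simp
  next
    case 2 show "\<exists>a b c. ((\<lambda>v. v $ k) has_derivative lin3 a b c) (at p)"
      using d 2 by (rule_tac x=0 in exI, rule_tac x=1 in exI, rule_tac x=0 in exI) simp
  next
    case 3 show "\<exists>a b c. ((\<lambda>v. v $ k) has_derivative lin3 a b c) (at p)"
      using d 3 by (rule_tac x=0 in exI, rule_tac x=0 in exI, rule_tac x=1 in exI) simp
  qed
qed

lemma gradient_at_add:
  assumes "gradient_at F p" "gradient_at G p" shows "gradient_at (\<lambda>v. F v + G v) p"
proof -
  obtain a b c a' b' c' where F: "(F has_derivative lin3 a b c) (at p)" and G: "(G has_derivative lin3 a' b' c') (at p)"
    using assms unfolding gradient_at_def by auto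
  have "((\<lambda>v. F v + G v) has_derivative lin3 (a + a') (b + b') (c + c')) (at p)"
    by (rule has_derivative_eq_rhs[OF has_derivative_add[OF F G]]) (simp add: algebra_simps)
  then show ?thesis unfolding gradient_at_def by blast
qed

lemma gradient_at_mult:
  assumes "gradient_at F p" "gradient_at G p" shows "gradient_at (\<lambda>v. F v * G v) p"
proof -
  obtain a b c a' b' c' where F: "(F has_derivative lin3 a b c) (at p)" and G: "(G has_derivative lin3 a' b' c') (at p)"
    using assms unfolding gradient_at_def by auto
  have "((\<lambda>v. F v * G v) has_derivative lin3 (F p * a' + a * G p) (F p * b' + b * G p) (F p * c' + c * G p)) (at p)"
    by (rule has_derivative_eq_rhs[OF has_derivative_mult[OF F G]]) (simp add: algebra_simps)
  then show ?thesis unfolding gradient_at_def by blast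
qed

lemma gradient_at_power: "gradient_at F p \<Longrightarrow> gradient_at (\<lambda>v. F v ^ n) p"
  by (induction n) (simp_all add: gradient_at_const gradient_at_mult)

lemma gradient_at_sum: "finite S \<Longrightarrow> (\<And>i. i \<in> S \<Longrightarrow> gradient_at (F i) p) \<Longrightarrow> gradient_at (\<lambda>v. \<Sum>i\<in>S. F i v) p"
  by (induction rule: finite_induct) (simp_all add: gradient_at_const gradient_at_add)

lemma hom_poly_fun_gradient:
  assumes "hom_poly_fun d F" shows "gradient_at F p"
proof -
  obtain a where F: "F = (\<lambda>x. \<Sum>i\<le>d. \<Sum>j\<le>d - i. a i j * (x$1)^i * (x$2)^j * (x$3)^(d - i - j))"
    using assms unfolding hom_poly_fun_def by blast
  have m: "gradient_at (\<lambda>x. a i j * (x$1)^i * (x$2)^j * (x$3)^(d - i - j)) p" for i j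
    by (rule gradient_at_mult[OF gradient_at_mult[OF gradient_at_mult[OF gradient_at_const gradient_at_power] gradient_at_power] gradient_at_power]; rule gradient_at_nth)
  have inner: "gradient_at (\<lambda>x. \<Sum>j\<le>d - i. a i j * (x$1)^i * (x$2)^j * (x$3)^(d - i - j)) p" for i
    using gradient_at_sum[of "{..d - i}" "\<lambda>j x. a i j * (x$1)^i * (x$2)^j * (x$3)^(d - i - j)"] m by simp
  show ?thesis unfolding F
    using gradient_at_sum[of "{..d}" "\<lambda>i x. \<Sum>j\<le>d - i. a i j * (x$1)^i * (x$2)^j * (x$3)^(d - i - j)"] inner by simp
qed

lemma line_derivative:
  assumes "(F has_derivative lin3 a b c) (at p)"
  shows "((\<lambda>t. F (p + t *s e)) has_field_derivative (a * e$1 + b * e$2 + c * e$3)) (at 0)"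
proof -
  have "((\<lambda>t. t *s e) has_derivative (\<lambda>t. t *s e)) (at 0)"
  proof (rule bounded_linear_imp_has_derivative)
    show "bounded_linear (\<lambda>t. t *s e)"
      by (rule linear_conv_bounded_linear[THEN iffD1], rule linearI) (simp_all add: vec_eq_iff algebra_simps)
  qed
  then have l: "((\<lambda>t. p + t *s e) has_derivative (\<lambda>t. t *s e)) (at 0)"
    by (auto intro!: derivative_eq_intros)
  have "(F has_derivative lin3 a b c) (at (p + 0 *s e))" using assms by simp
  from has_derivative_compose[OF l this] show ?thesis
    unfolding has_field_derivative_def by (rule has_derivative_eq_rhs) (simp add: fun_eq_iff algebra_simps)
qed

definition singular_at :: "(complex^3 \<Rightarrow> complex) \<Rightarrow> complex^3 \<Rightarrow> bool" where
  "singular_at F p \<longleftrightarrow> p \<noteq> 0 \<and> F p = 0 \<and> (F has_derivative (\<lambda>_. 0)) (at p)"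

lemma singular_at_line:
  assumes "singular_at F p" shows "((\<lambda>t. F (p + t *s e)) has_field_derivative 0) (at 0)"
  using line_derivative[of F 0 0 0 p e] assms by (simp add: singular_at_def)

text \<open>By homogeneity the derivative in the direction of \<open>p\<close> itself vanishes, so
  two further directions that complete \<open>p\<close> to a basis suffice.\<close>

lemma singular_atI:
  assumes F: "hom_poly_fun d F" and p: "p \<noteq> 0" "F p = 0"
    and e: "((\<lambda>t. F (p + t *s e)) has_field_derivative 0) (at 0)" "((\<lambda>t. F (p + t *s e')) has_field_derivative 0) (at 0)"
    and span: "\<And>a b c. a * p$1 + b * p$2 + c * p$3 = 0 \<Longrightarrow> a * e$1 + b * e$2 + c * e$3 = 0 \<Longrightarrow>
      a * e'$1 + b * e'$2 + c * e'$3 = 0 \<Longrightarrow> a = 0 \<and> b = 0 \<and> c = 0"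
  shows "singular_at F p"
proof -
  obtain a b c where D: "(F has_derivative lin3 a b c) (at p)" using hom_poly_fun_gradient[OF F] unfolding gradient_at_def by blast
  have "((\<lambda>t. F (p + t *s p)) has_field_derivative (a * p$1 + b * p$2 + c * p$3)) (at 0)" by (rule line_derivative[OF D])
  moreover have "(\<lambda>t. F (p + t *s p)) = (\<lambda>t. 0)"
  proof
    fix t
    have "p + t *s p = (1 + t) *s p" by (simp add: vec_eq_iff algebra_simps)
    then show "F (p + t *s p) = 0" by (simp only: hom_poly_fun_scale[OF F] p mult_zero_right)
  qed
  ultimately have 1: "a * p$1 + b * p$2 + c * p$3 = 0" using DERIV_unique DERIV_const by metis
  have "a * e$1 + b * e$2 + c * e$3 = 0" "a * e'$1 + b * e'$2 + c * e'$3 = 0"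
    using DERIV_unique[OF line_derivative[OF D]] e by blast+
  from span[OF 1 this] show ?thesis using D p by (simp add: singular_at_def)
qed

lemma singular_at_scale:
  assumes F: "hom_poly_fun d F" and s: "singular_at F p" and k: "k \<noteq> 0"
  shows "singular_at F (k *s p)"
proof -
  obtain a b c where D: "(F has_derivative lin3 a b c) (at (k *s p))" using hom_poly_fun_gradient[OF F] unfolding gradient_at_def by blast
  have z: "a * e$1 + b * e$2 + c * e$3 = 0" for e :: "complex^3"
  proof -
    have eq: "F (k *s p + t *s (k *s e)) = k ^ d * F (p + t *s e)" for t
    proof -
      have "k *s p + t *s (k *s e) = k *s (p + t *s e)" by (simp add: vec_eq_iff algebra_simps)
      then show ?thesis by (simp only: hom_poly_fun_scale[OF F])
    qed
    have "((\<lambda>t. k ^ d * F (p + t *s e)) has_field_derivative (k ^ d * 0)) (at 0)"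
      by (rule DERIV_cmult[OF singular_at_line[OF s]])
    then have "((\<lambda>t. F (k *s p + t *s (k *s e))) has_field_derivative 0) (at 0)" unfolding eq by simp
    then have "a * (k *s e)$1 + b * (k *s e)$2 + c * (k *s e)$3 = 0"
      using DERIV_unique[OF line_derivative[OF D]] by blast
    then have "k * (a * e$1 + b * e$2 + c * e$3) = 0" by (simp add: algebra_simps)
    then show ?thesis using k by simp
  qed
  have "k *s p \<noteq> 0" using k s by (auto simp: singular_at_def)
  then show ?thesis using D z s hom_poly_fun_scale[OF F, of k p] by (simp add: singular_at_def)
qed

lemma sing_pts_singular_at: "sing_pts F = proj_pt ` {p. singular_at F p}"
  unfolding sing_pts_def singular_at_def by auto

lemma proj_pt_scale: "k \<noteq> 0 \<Longrightarrow> proj_pt (k *s p) = proj_pt p"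
proof -
  assume k: "k \<noteq> 0"
  then have c: "c *s p = (c / k) *s (k *s p)" for c by (simp add: vector_smult_assoc)
  show ?thesis unfolding proj_pt_def
  proof (intro equalityI subsetI)
    fix v assume "v \<in> {c *s p |c. True}"
    then show "v \<in> {c *s (k *s p) |c. True}" using c by blast
  qed (auto simp: vector_smult_assoc)
qed

lemma proj_pt_eqD: "proj_pt p = proj_pt p' \<Longrightarrow> \<exists>k. p = k *s p'"
proof -
  assume "proj_pt p = proj_pt p'"
  moreover have "p \<in> proj_pt p" unfolding proj_pt_def by (auto intro: exI[of _ 1])
  ultimately show ?thesis unfolding proj_pt_def by blast
qed

lemma hom_poly_fun_cubic_var: "hom_poly_fun 5 (\<lambda>v. (v$2)^3 * (v$1)^2 + 2 * (v$2)^2 * homog 2 q (v$3) (v$2) * v$1 + homog 5 h (v$3) (v$2))"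
proof -
  have m: "hom_poly_fun (i + (j + (k + 0))) (\<lambda>v. (v$1)^i * ((v$2)^j * ((v$3)^k * c)))" for i j k c
    using hom_poly_fun_linear_power[OF hom_poly_fun_linear_power[OF hom_poly_fun_linear_power[OF hom_poly_fun_const[of c], of k 0 0 1], of j 0 1 0], of i 1 0 0]
    by simp
  have "hom_poly_fun 5 (\<lambda>v. (v$1)^2 * ((v$2)^3 * ((v$3)^0 * 1)) + (v$1)^1 * ((v$2)^4 * ((v$3)^0 * (2 * coeff q 0)))
     + (v$1)^1 * ((v$2)^3 * ((v$3)^1 * (2 * coeff q 1))) + (v$1)^1 * ((v$2)^2 * ((v$3)^2 * (2 * coeff q 2)))
     + (v$1)^0 * ((v$2)^5 * ((v$3)^0 * coeff h 0)) + (v$1)^0 * ((v$2)^4 * ((v$3)^1 * coeff h 1))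
     + (v$1)^0 * ((v$2)^3 * ((v$3)^2 * coeff h 2)) + (v$1)^0 * ((v$2)^2 * ((v$3)^3 * coeff h 3))
     + (v$1)^0 * ((v$2)^1 * ((v$3)^4 * coeff h 4)) + (v$1)^0 * ((v$2)^0 * ((v$3)^5 * coeff h 5)))"
    using m[of 2 3 0 1] m[of 1 4 0] m[of 1 3 1] m[of 1 2 2] m[of 0 5 0] m[of 0 4 1] m[of 0 3 2] m[of 0 2 3] m[of 0 1 4] m[of 0 0 5]
    by (intro hom_poly_fun_add) (simp_all add: eval_nat_numeral)
  then show ?thesis
    by (rule back_subst[of "hom_poly_fun 5"]) (simp add: fun_eq_iff homog_2 homog_5 power2_eq_square power3_eq_cube power5_expand algebra_simps)
qed

lemma hom_poly_fun_nform: "hom_poly_fun 6 (nform q h)"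
  using hom_poly_fun_var[OF hom_poly_fun_cubic_var[of q h], of 1] by (simp add: nform_def[abs_def])

lemma order_ge_2_iff:
  fixes g :: "complex poly"
  assumes "g \<noteq> 0" shows "2 \<le> order x g \<longleftrightarrow> poly g x = 0 \<and> poly (pderiv g) x = 0"
proof (cases "poly g x = 0")
  case True
  then obtain r where r: "g = [:-x, 1:] * r" using poly_root_factor by blast
  have "poly (pderiv g) x = poly r x" unfolding r pderiv_mult by (simp add: pderiv_pCons)
  moreover have "[:-x, 1:] ^ 2 dvd g \<longleftrightarrow> [:-x, 1:] dvd r" unfolding r power2_eq_square by (rule dvd_mult_cancel_left[THEN trans]) auto
  ultimately show ?thesis using order_ge_iff[OF assms, of 2 x] True by (simp add: poly_eq_0_iff_dvd)
next
  case False
  then show ?thesis using order_0I[of g x] by simp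
qed

lemma homog_0: "homog 5 h x 0 = coeff h 5 * x ^ 5"
  by (simp add: homog_5)

lemma pt3_eta: "v = pt3 (v$1) (v$2) (v$3)"
  by (simp add: vec_eq_iff forall_3)

lemma pt3_simps: "k *s pt3 a b c = pt3 (k * a) (k * b) (k * c)" "pt3 a b c + pt3 a' b' c' = pt3 (a + a') (b + b') (c + c')"
  "pt3 a b c = pt3 a' b' c' \<longleftrightarrow> a = a' \<and> b = b' \<and> c = c'" "pt3 a b c = 0 \<longleftrightarrow> a = 0 \<and> b = 0 \<and> c = 0"
  by (auto simp: vec_eq_iff forall_3)

text \<open>The exact degree 5 is what makes \<open>(1 : 0 : 0)\<close> an E8 point. It also forces
  \<open>q^2 - h\<close> to have degree 5, so the two quintics play similar roles.\<close>

locale nform_data =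
  fixes q h :: "complex poly"
  assumes deg_q: "degree q \<le> 2" and deg_h: "degree h = 5"
begin

abbreviation "g \<equiv> q\<^sup>2 - h"
abbreviation "F \<equiv> nform q h"

lemma h_nz: "h \<noteq> 0" using deg_h by auto

lemma deg_g: "degree g = 5"
proof -
  have "degree (q\<^sup>2) \<le> 4" using deg_q degree_power_le[of q 2] by linarith
  then have "degree (- h + q\<^sup>2) = 5" using deg_h by (subst degree_add_eq_left) auto
  then show ?thesis by simp
qed

lemma g_nz: "g \<noteq> 0" using deg_g by auto

lemma h5: "coeff h 5 \<noteq> 0" using deg_h h_nz by (metis leading_coeff_0_iff)

lemma F_affine: "F (pt3 y 1 x) = y * (y\<^sup>2 + 2 * poly q x * y + poly h x)"
  using nform_affine deg_q deg_h by simp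

lemma line_y: "((\<lambda>t. F (pt3 y 1 x + t *s pt3 1 0 0)) has_field_derivative (3 * y\<^sup>2 + 4 * poly q x * y + poly h x)) (at 0)"
proof -
  have eq: "F (pt3 y 1 x + t *s pt3 1 0 0) = (y + t) * ((y + t)\<^sup>2 + 2 * poly q x * (y + t) + poly h x)" for t
    by (simp add: pt3_simps F_affine)
  show ?thesis unfolding eq by (auto intro!: derivative_eq_intros simp: power2_eq_square algebra_simps)
qed

lemma line_x: "((\<lambda>t. F (pt3 y 1 x + t *s pt3 0 0 1)) has_field_derivative (y * (2 * poly (pderiv q) x * y + poly (pderiv h) x))) (at 0)"
proof -
  have eq: "F (pt3 y 1 x + t *s pt3 0 0 1) = y * (y\<^sup>2 + 2 * poly q (x + t) * y + poly h (x + t))" for t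
    by (simp add: pt3_simps F_affine)
  have d: "((\<lambda>t. poly p (x + t)) has_field_derivative poly (pderiv p) x) (at 0)" for p
    
    using DERIV_chain2[where f="poly p" and g="\<lambda>t. x + t" and x=0 and Db=1 and s=UNIV, OF poly_DERIV]
    by (auto intro!: derivative_eq_intros)
  show ?thesis unfolding eq by (auto intro!: derivative_eq_intros d simp: algebra_simps)
qed

text \<open>Off the line, the value and the \<open>y\<close>-derivative say that
  \<open>y^2 + 2 q y + h\<close> has a double root, hence \<open>y = - q\<close> and
  \<open>g = 0\<close>; the \<open>x\<close>-derivative then says that the derivative of
  \<open>g\<close> vanishes too.\<close>

lemma singular_affine:
  "singular_at F (pt3 y 1 x) \<longleftrightarrow> (y = 0 \<and> poly h x = 0) \<or> (y = - poly q x \<and> poly h x \<noteq> 0 \<and> 2 \<le> order x g)"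
proof
  assume s: "singular_at F (pt3 y 1 x)"
  have 1: "y * (y\<^sup>2 + 2 * poly q x * y + poly h x) = 0" using s by (simp add: singular_at_def F_affine)
  have 2: "3 * y\<^sup>2 + 4 * poly q x * y + poly h x = 0" using DERIV_unique[OF line_y singular_at_line[OF s]] .
  have 3: "y * (2 * poly (pderiv q) x * y + poly (pderiv h) x) = 0" using DERIV_unique[OF line_x singular_at_line[OF s]] .
  show "(y = 0 \<and> poly h x = 0) \<or> (y = - poly q x \<and> poly h x \<noteq> 0 \<and> 2 \<le> order x g)"
  proof (cases "y = 0")
    case True then show ?thesis using 2 by simp
  next
    case False
    then have 4: "y\<^sup>2 + 2 * poly q x * y + poly h x = 0" using 1 by simp
    then have "2 * y * (y + poly q x) = 0" using 2 by algebra
    then have y: "y = - poly q x" using False by (simp add: add_eq_0_iff2)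
    have h: "poly h x = y\<^sup>2" using 4 unfolding y by (simp add: power2_eq_square algebra_simps)
    have "2 * poly (pderiv q) x * y + poly (pderiv h) x = 0" using 3 False by simp
    then have "poly (pderiv g) x = 0" unfolding y by (simp add: pderiv_diff power2_eq_square pderiv_mult algebra_simps)
    moreover have "poly g x = 0" using h y by simp
    ultimately show ?thesis using y h False order_ge_2_iff[OF g_nz] by simp
  qed
next
  assume r: "(y = 0 \<and> poly h x = 0) \<or> (y = - poly q x \<and> poly h x \<noteq> 0 \<and> 2 \<le> order x g)"
  have "F (pt3 y 1 x) = 0 \<and> 3 * y\<^sup>2 + 4 * poly q x * y + poly h x = 0 \<and> y * (2 * poly (pderiv q) x * y + poly (pderiv h) x) = 0"
  proof (cases "y = 0")
    case True then show ?thesis using r order_ge_2_iff[OF g_nz, of x] by (auto simp: F_affine)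
  next
    case False
    then have y: "y = - poly q x" "poly g x = 0" "poly (pderiv g) x = 0" using r order_ge_2_iff[OF g_nz, of x] by auto
    then have h: "poly h x = (poly q x)\<^sup>2" by simp
    have "poly (pderiv h) x = 2 * poly q x * poly (pderiv q) x"
      using y(3) by (simp add: pderiv_diff power2_eq_square pderiv_mult algebra_simps)
    then show ?thesis using h by (simp add: y(1) F_affine power2_eq_square algebra_simps)
  qed
  then show "singular_at F (pt3 y 1 x)"
    using line_y[of y x] line_x[of y x]
    by (intro singular_atI[OF hom_poly_fun_nform, of _ _ _ "pt3 1 0 0" "pt3 0 0 1"]) (auto simp: pt3_simps)
qed

lemma singular_infinity: "singular_at F (pt3 1 0 0)"
proof (rule singular_atI[OF hom_poly_fun_nform, of _ _ _ "pt3 0 1 0" "pt3 0 0 1"])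
  have 1: "F (pt3 1 0 0 + t *s pt3 0 1 0) = t ^ 3 * (1 + 2 * coeff q 0 * t + coeff h 0 * t\<^sup>2)" for t
    by (simp add: pt3_simps nform_def homog_2 homog_5 power2_eq_square power3_eq_cube power5_expand algebra_simps)
  show "((\<lambda>t. F (pt3 1 0 0 + t *s pt3 0 1 0)) has_field_derivative 0) (at 0)"
    unfolding 1 by (auto intro!: derivative_eq_intros)
  have 2: "F (pt3 1 0 0 + t *s pt3 0 0 1) = coeff h 5 * t ^ 5" for t
    by (simp add: pt3_simps nform_def homog_2 homog_5)
  show "((\<lambda>t. F (pt3 1 0 0 + t *s pt3 0 0 1)) has_field_derivative 0) (at 0)"
    unfolding 2 by (auto intro!: derivative_eq_intros)
qed (auto simp: pt3_simps nform_def homog_2 homog_5)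

definition on_line :: "complex set" where "on_line = {x. poly h x = 0}"
definition off_line :: "complex set" where "off_line = {x. poly h x \<noteq> 0 \<and> 2 \<le> order x g}"

lemma sing_pts_nform:
  "sing_pts F = insert (proj_pt (pt3 1 0 0)) ((\<lambda>x. proj_pt (pt3 0 1 x)) ` on_line \<union> (\<lambda>x. proj_pt (pt3 (- poly q x) 1 x)) ` off_line)"
proof (intro equalityI subsetI)
  fix P assume "P \<in> sing_pts F"
  then obtain p where p: "P = proj_pt p" "singular_at F p" unfolding sing_pts_singular_at by blast
  define y z x where "y = p$1" and "z = p$2" and "x = p$3"
  have pe: "p = pt3 y z x" unfolding y_def z_def x_def by (rule pt3_eta)
  show "P \<in> insert (proj_pt (pt3 1 0 0)) ((\<lambda>x. proj_pt (pt3 0 1 x)) ` on_line \<union> (\<lambda>x. proj_pt (pt3 (- poly q x) 1 x)) ` off_line)"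
  proof (cases "z = 0")
    case True
    \<comment> \<open>On \<open>z = 0\<close> the sextic restricts to
      \<open>coeff h 5 * x^5 * y\<close>, whose derivative in \<open>y\<close> vanishes only for
      \<open>x = 0\<close>.\<close>
    have e: "F (pt3 y 0 x + t *s pt3 1 0 0) = (y + t) * (coeff h 5 * x ^ 5)" for t
      by (simp add: pt3_simps nform_def homog_0)
    have "((\<lambda>t. F (pt3 y 0 x + t *s pt3 1 0 0)) has_field_derivative (coeff h 5 * x ^ 5)) (at 0)"
      unfolding e by (auto intro!: derivative_eq_intros)
    moreover have "((\<lambda>t. F (pt3 y 0 x + t *s pt3 1 0 0)) has_field_derivative 0) (at 0)"
      using singular_at_line[OF p(2)] by (simp add: pe True)
    ultimately have "coeff h 5 * x ^ 5 = 0" using DERIV_unique by blast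
    then have x: "x = 0" using h5 by simp
    then have "y \<noteq> 0" using p(2) True by (auto simp: singular_at_def pe pt3_simps)
    moreover have "p = y *s pt3 1 0 0" by (simp add: pe pt3_simps True x)
    ultimately have "P = proj_pt (pt3 1 0 0)" unfolding p(1) using proj_pt_scale by blast
    then show ?thesis by simp
  next
    case False
    have "inverse z *s p = pt3 (y / z) 1 (x / z)" using False by (simp add: pe pt3_simps divide_inverse mult.commute)
    then have "singular_at F (pt3 (y / z) 1 (x / z))" "P = proj_pt (pt3 (y / z) 1 (x / z))"
      using singular_at_scale[OF hom_poly_fun_nform p(2), of "inverse z"] proj_pt_scale[of "inverse z" p] False p(1) by auto
    then show ?thesis unfolding singular_affine on_line_def off_line_def by auto
  qed
next
  fix P assume "P \<in> insert (proj_pt (pt3 1 0 0)) ((\<lambda>x. proj_pt (pt3 0 1 x)) ` on_line \<union> (\<lambda>x. proj_pt (pt3 (- poly q x) 1 x)) ` off_line)"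
  then show "P \<in> sing_pts F" unfolding sing_pts_singular_at on_line_def off_line_def
    using singular_infinity singular_affine by blast
qed

lemma proj_pt_affine_eq: "proj_pt (pt3 y 1 x) = proj_pt (pt3 y' 1 x') \<longleftrightarrow> y = y' \<and> x = x'"
  using proj_pt_eqD[of "pt3 y 1 x" "pt3 y' 1 x'"] by (auto simp: pt3_simps)

lemma proj_pt_affine_infinity: "proj_pt (pt3 y 1 x) \<noteq> proj_pt (pt3 1 0 0)"
  using proj_pt_eqD[of "pt3 y 1 x" "pt3 1 0 0"] by (auto simp: pt3_simps)

lemma finite_on_line: "finite on_line" unfolding on_line_def using h_nz by (rule poly_roots_finite)

lemma finite_off_line: "finite off_line"
  by (rule finite_subset[OF _ poly_roots_finite[OF g_nz]]) (auto simp: off_line_def order_ge_2_iff[OF g_nz])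

lemma finite_sing_pts: "finite (sing_pts F)"
  unfolding sing_pts_nform using finite_on_line finite_off_line by simp

text \<open>If both orders are at least 4, then \<open>q\<close> has a double root and the germ is
  \<open>y (y^2 + 2 t^2 R y + t^4 H)\<close>. By \<open>simple_data_iff\<close> this is the only way
  in which simplicity can fail.\<close>

definition simple_data :: bool where
  "simple_data \<longleftrightarrow> (\<forall>x. \<not> (order x g \<ge> 4 \<and> order x h \<ge> 4))"

lemma type_infinity: "has_type F (proj_pt (pt3 1 0 0)) E8"
  using has_type_infinity deg_q deg_h by blast

lemma type_on_line:
  assumes "simple_data" "x \<in> on_line"
  shows "has_type F (proj_pt (pt3 0 1 x)) (line_type (order x g) (order x h))"
proof -
  have "\<not> (order x g \<ge> 4 \<and> order x h \<ge> 4)" "poly h x = 0" using assms by (auto simp: simple_data_def on_line_def)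
  from type_line[OF h_nz this(2) g_nz this(1)] show ?thesis
    using has_type_affine[of q h] deg_q deg_h by simp
qed

lemma type_off_line':
  assumes "x \<in> off_line"
  shows "has_type F (proj_pt (pt3 (- poly q x) 1 x)) (A (order x g - 1))"
proof -
  have h: "poly h x \<noteq> 0" "2 \<le> order x g" using assms by (auto simp: off_line_def)
  show ?thesis
    by (rule has_type_affine[OF deg_q _ _ type_off_line[OF h(1) refl h(2) g_nz]]) (use deg_h h in auto)
qed

lemma simple_data_imp_simple_sings: "simple_data \<Longrightarrow> simple_sings F"
  unfolding simple_sings_def sing_pts_nform using type_infinity type_on_line type_off_line' by blast

lemma sing_set_nform:
  assumes "simple_data"
  shows "sing_set F = {#E8#} + image_mset (\<lambda>x. line_type (order x g) (order x h)) (mset_set on_line)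
     + image_mset (\<lambda>x. A (order x g - 1)) (mset_set off_line)"
proof -
  let ?t = "\<lambda>P. THE t. has_type F P t"
  let ?L = "\<lambda>x. proj_pt (pt3 0 1 x)" and ?O = "\<lambda>x. proj_pt (pt3 (- poly q x) 1 x)"
  have t: "?t (proj_pt (pt3 1 0 0)) = E8" "\<And>x. x \<in> on_line \<Longrightarrow> ?t (?L x) = line_type (order x g) (order x h)"
    "\<And>x. x \<in> off_line \<Longrightarrow> ?t (?O x) = A (order x g - 1)"
    using the_has_type[OF hom_poly_fun_nform] type_infinity type_on_line[OF assms] type_off_line' by blast+
  have inj: "inj_on ?L on_line" "inj_on ?O off_line" by (auto simp: inj_on_def proj_pt_affine_eq)
  have disj: "?L ` on_line \<inter> ?O ` off_line = {}"
    by (auto simp: proj_pt_affine_eq on_line_def off_line_def)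
  have nin: "proj_pt (pt3 1 0 0) \<notin> ?L ` on_line \<union> ?O ` off_line"
    using proj_pt_affine_infinity by (metis (no_types, lifting) UnE imageE)
  have "mset_set (sing_pts F) = add_mset (proj_pt (pt3 1 0 0)) (image_mset ?L (mset_set on_line) + image_mset ?O (mset_set off_line))"
    unfolding sing_pts_nform using nin finite_on_line finite_off_line
    by (simp add: mset_set_Union[OF _ _ disj] image_mset_mset_set inj)
  moreover have l: "image_mset (\<lambda>x. ?t (?L x)) (mset_set on_line) = image_mset (\<lambda>x. line_type (order x g) (order x h)) (mset_set on_line)"
    by (rule image_mset_cong) (use t(2) finite_on_line in simp)
  moreover have o: "image_mset (\<lambda>x. ?t (?O x)) (mset_set off_line) = image_mset (\<lambda>x. A (order x g - 1)) (mset_set off_line)"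
    by (rule image_mset_cong) (use t(3) finite_off_line in simp)
  ultimately show ?thesis unfolding sing_set_def
    by (simp add: t(1) l[symmetric] o[symmetric] multiset.map_comp comp_def)
qed

end

section \<open>Total Milnor number\<close>

lemma poly_bounded_disc: "\<exists>B\<ge>1. \<forall>x. norm x \<le> 1 \<longrightarrow> norm (poly p (c + x)) \<le> B" for c :: complex
proof -
  have "compact ((\<lambda>x. poly p (c + x)) ` cball 0 1)"
    by (intro compact_continuous_image continuous_intros) auto
  then obtain B where B: "\<And>x. x \<in> cball 0 1 \<Longrightarrow> norm (poly p (c + x)) \<le> B"
    by (metis compact_imp_bounded bounded_iff image_eqI)
  show ?thesis by (rule exI[of _ "max B 1"]) (use B in \<open>auto simp: le_max_iff_disj\<close>)
qed

text \<open>\<open>unitangentI\<close> is stated for the tangent \<open>fst = 0\<close>; the germ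
  treated next is tangent to \<open>snd = 0\<close>.\<close>

lemma unitangent_swap:
  assumes "unitangent (\<lambda>z. f (snd z, fst z))" shows "unitangent f"
  unfolding unitangent_def
proof (intro allI impI)
  fix e :: real assume "e > 0"
  then obtain d where d: "d > 0" "\<And>z w. norm z < d \<Longrightarrow> norm w < d \<Longrightarrow> f (snd z, fst z) = 0 \<Longrightarrow> f (snd w, fst w) = 0 \<Longrightarrow>
     norm (wedge z w) \<le> e * norm z * norm w" using assms unfolding unitangent_def by blast
  have n: "norm (snd z, fst z) = norm z" for z :: "complex \<times> complex" by (simp add: norm_prod_def add.commute)
  have w: "norm (wedge (snd z, fst z) (snd w, fst w)) = norm (wedge z w)" for z w
    unfolding wedge_def by (simp add: norm_minus_commute mult.commute)
  show "\<exists>d>0. \<forall>z w. norm z < d \<longrightarrow> norm w < d \<longrightarrow> f z = 0 \<longrightarrow> f w = 0 \<longrightarrow> norm (wedge z w) \<le> e * norm z * norm w"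
  proof (intro exI[of _ d] conjI d(1) allI impI)
    fix z w assume h: "norm z < d" "norm w < d" "f z = 0" "f w = 0"
    then show "norm (wedge z w) \<le> e * norm z * norm w"
      using d(2)[of "(snd z, fst z)" "(snd w, fst w)"] by (simp add: n w)
  qed
qed

section \<open>The germ at a non-simple point\<close>

context
  fixes c :: complex and R H :: "complex poly" and f
  defines "f \<equiv> \<lambda>z. snd z * ((snd z)\<^sup>2 + 2 * ((fst z)\<^sup>2 * poly R (c + fst z)) * snd z + fst z ^ 4 * poly H (c + fst z))"
begin

lemma tangent_branches_bound: "\<exists>B\<ge>1. \<forall>x. norm x \<le> 1 \<longrightarrow> norm (poly R (c + x)) \<le> B \<and> norm (poly H (c + x)) \<le> B"
proof -
  obtain B B' where B: "B \<ge> 1" "\<And>x. norm x \<le> 1 \<Longrightarrow> norm (poly R (c + x)) \<le> B"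
     "\<And>x. norm x \<le> 1 \<Longrightarrow> norm (poly H (c + x)) \<le> B'" using poly_bounded_disc by metis
  show ?thesis by (rule exI[of _ "max B B'"]) (use B in \<open>auto simp: le_max_iff_disj\<close>)
qed

lemma tangent_branches_cubic: "cubic_bound f"
proof -
  obtain B where B: "B \<ge> 1" "\<And>x. norm x \<le> 1 \<Longrightarrow> norm (poly R (c + x)) \<le> B" "\<And>x. norm x \<le> 1 \<Longrightarrow> norm (poly H (c + x)) \<le> B"
    using tangent_branches_bound by blast
  have "\<forall>\<^sub>F z in nhds 0. norm (z :: complex \<times> complex) < 1"
    unfolding eventually_nhds_metric by (intro exI[of _ 1]) auto
  then have "\<forall>\<^sub>F z in nhds 0. norm (f z) \<le> (1 + 3 * B) * norm z ^ 3"
  proof eventually_elim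
    case (elim z)
    define N x w where "N = norm z" and "x = fst z" and "w = snd z"
    have N: "0 \<le> N" "N \<le> 1" "norm x \<le> N" "norm w \<le> N" using elim norm_fst_le'[of z] norm_snd_le'[of z] by (auto simp: N_def x_def w_def)
    have b: "norm (poly R (c + x)) \<le> B" "norm (poly H (c + x)) \<le> B" using B N by auto
    have p: "N ^ m \<le> N ^ 2" if "m \<ge> 2" for m using N that by (intro power_decreasing) auto
    have 1: "norm (2 * (x\<^sup>2 * poly R (c + x)) * w) \<le> 2 * (N\<^sup>2 * B) * N"
      unfolding norm_mult norm_power using N b B by (intro mult_mono power_mono) auto
    also have "\<dots> = 2 * B * N ^ 3" by (simp add: power2_eq_square power3_eq_cube)
    also have "\<dots> \<le> 2 * B * N\<^sup>2" using p[of 3] B by (intro mult_left_mono) auto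
    finally have 1: "norm (2 * (x\<^sup>2 * poly R (c + x)) * w) \<le> 2 * B * N\<^sup>2" .
    have "norm (x ^ 4 * poly H (c + x)) \<le> N ^ 4 * B"
      unfolding norm_mult norm_power using N b B by (intro mult_mono power_mono) auto
    also have "\<dots> \<le> N\<^sup>2 * B" using p[of 4] B by (intro mult_right_mono) auto
    finally have 2: "norm (x ^ 4 * poly H (c + x)) \<le> B * N\<^sup>2" by (simp add: mult.commute)
    have "norm (w\<^sup>2) \<le> N\<^sup>2" unfolding norm_power using N by (intro power_mono) auto
    then have "norm (w\<^sup>2 + 2 * (x\<^sup>2 * poly R (c + x)) * w + x ^ 4 * poly H (c + x)) \<le> N\<^sup>2 + 2 * B * N\<^sup>2 + B * N\<^sup>2"
      using 1 2 by (meson add_mono norm_triangle_le)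
    then have "norm w * norm (w\<^sup>2 + 2 * (x\<^sup>2 * poly R (c + x)) * w + x ^ 4 * poly H (c + x)) \<le> N * (N\<^sup>2 + 2 * B * N\<^sup>2 + B * N\<^sup>2)"
      using N by (intro mult_mono) auto
    moreover have "f z = w * (w\<^sup>2 + 2 * (x\<^sup>2 * poly R (c + x)) * w + x ^ 4 * poly H (c + x))"
      by (simp add: f_def x_def w_def)
    moreover have "N * (N\<^sup>2 + 2 * B * N\<^sup>2 + B * N\<^sup>2) = (1 + 3 * B) * N ^ 3"
      by (simp add: power2_eq_square power3_eq_cube algebra_simps)
    ultimately show ?case by (simp only: norm_mult N_def)
  qed
  then show ?thesis unfolding cubic_bound_def by blast
qed

text \<open>Every small zero satisfies \<open>|w| \<le> 3 B |x|^2\<close>, since beyond that bound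
  \<open>w^2\<close> dominates the other two terms of the quadratic equation for
  \<open>w\<close>.\<close>

lemma tangent_branches_unitangent: "unitangent f"
proof (rule unitangent_swap, rule unitangentI)
  obtain B where B: "B \<ge> 1" "\<And>x. norm x \<le> 1 \<Longrightarrow> norm (poly R (c + x)) \<le> B" "\<And>x. norm x \<le> 1 \<Longrightarrow> norm (poly H (c + x)) \<le> B"
    using tangent_branches_bound by blast
  define K where "K = 3 * B"
  have K: "K \<ge> 1" "K > 0" using B by (auto simp: K_def)
  fix e :: real assume e: "e > 0"
  show "\<exists>d>0. \<forall>z. norm z < d \<longrightarrow> f (snd z, fst z) = 0 \<longrightarrow> norm (fst z) \<le> e * norm (snd z)"
  proof (intro exI[of _ "min 1 (e / K)"] conjI allI impI)
    show "0 < min 1 (e / K)" using e K by simp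
    fix z :: "complex \<times> complex" assume z: "norm z < min 1 (e / K)" "f (snd z, fst z) = 0"
    define x w where "x = snd z" and "w = fst z"
    define X W where "X = norm x" and "W = norm w"
    have X: "0 \<le> X" "0 \<le> W" "X < 1" "X < e / K" using z(1) norm_snd_le'[of z] by (auto simp: X_def W_def x_def)
    have b: "norm (poly R (c + x)) \<le> B" "norm (poly H (c + x)) \<le> B" using B X by (auto simp: X_def)
    have "W \<le> K * X\<^sup>2"
    proof (rule ccontr)
      assume "\<not> W \<le> K * X\<^sup>2"
      then have W: "W > K * X\<^sup>2" by simp
      then have "W > 0" using K X by (metis le_less_trans mult_nonneg_nonneg zero_le_power2 less_imp_le)
      then have "w \<noteq> 0" by (auto simp: W_def)
      then have "w\<^sup>2 = - (2 * (x\<^sup>2 * poly R (c + x)) * w + x ^ 4 * poly H (c + x))"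
        using z(2) by (simp add: f_def add.assoc add_eq_0_iff2 flip: x_def w_def)
      then have "W\<^sup>2 = norm (2 * (x\<^sup>2 * poly R (c + x)) * w + x ^ 4 * poly H (c + x))"
        by (metis W_def norm_minus_cancel norm_power)
      also have "\<dots> \<le> 2 * (X\<^sup>2 * B) * W + X ^ 4 * B"
      proof (rule norm_triangle_mono)
        show "norm (2 * (x\<^sup>2 * poly R (c + x)) * w) \<le> 2 * (X\<^sup>2 * B) * W"
          unfolding norm_mult norm_power X_def W_def using b B by (intro mult_mono) auto
        show "norm (x ^ 4 * poly H (c + x)) \<le> X ^ 4 * B"
          unfolding norm_mult norm_power X_def using b B by (intro mult_mono) auto
      qed
      also have "X ^ 4 * B \<le> (X\<^sup>2 * B) * W"
      proof -
        have "1 * X\<^sup>2 \<le> K * X\<^sup>2" using K by (intro mult_right_mono) auto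
        then have "X\<^sup>2 \<le> W" using W by simp
        then have "(X\<^sup>2 * B) * X\<^sup>2 \<le> (X\<^sup>2 * B) * W" using B by (intro mult_left_mono) auto
        then show ?thesis by (simp add: power2_eq_square eval_nat_numeral mult_ac)
      qed
      finally have "W * W \<le> (3 * B * X\<^sup>2) * W" by (simp add: power2_eq_square algebra_simps)
      then have 1: "W \<le> 3 * B * X\<^sup>2" using \<open>W > 0\<close> by simp
      show False using 1 W by (simp add: K_def)
    qed
    also have "K * X\<^sup>2 \<le> e * X"
    proof -
      have "K * X \<le> e" using X K by (simp add: field_simps)
      then have "(K * X) * X \<le> e * X" using X by (intro mult_right_mono) auto
      then show ?thesis by (simp add: power2_eq_square mult.assoc)
    qed
    finally show "norm (fst z) \<le> e * norm (snd z)" by (simp add: W_def X_def x_def w_def)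
  qed
qed

text \<open>On the branch \<open>snd = 0\<close> the gradient is \<open>s^4 H\<close>; its sixth
  power has exponent 24, above the largest index 20 of E6, E7, E8.\<close>

lemma tangent_branches_grad:
  assumes j: "j \<le> 20" shows "\<not> grad_bound j f"
proof -
  obtain B where B: "B \<ge> 1" "\<And>x. norm x \<le> 1 \<Longrightarrow> norm (poly R (c + x)) \<le> B" "\<And>x. norm x \<le> 1 \<Longrightarrow> norm (poly H (c + x)) \<le> B"
    using tangent_branches_bound by blast
  show ?thesis
  proof (rule not_grad_boundI[where p=1 and r=4 and C=B])
    fix s :: real assume s: "0 < s" "s < 1"
    let ?z = "(complex_of_real s, 0 :: complex)"
    have P: "(\<lambda>z. poly p (c + fst z)) differentiable (at ?z)" for p
    proof -
      have "((\<lambda>z. c + fst z) has_derivative fst) (at ?z)" by (auto intro!: derivative_eq_intros)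
      from has_derivative_compose[OF this poly_DERIV[of p, unfolded has_field_derivative_def]]
      have "((\<lambda>z. poly p (c + fst z)) has_derivative lin2 (poly (pderiv p) (c + complex_of_real s)) 0) (at ?z)"
        by (rule has_derivative_eq_rhs) simp
      then show ?thesis by (rule differentiableI)
    qed
    have "(fst :: complex \<times> complex \<Rightarrow> complex) differentiable (at ?z)" "(snd :: complex \<times> complex \<Rightarrow> complex) differentiable (at ?z)"
      by (auto intro!: bounded_linear_imp_differentiable bounded_linear_fst bounded_linear_snd)
    then have "(\<lambda>z. (snd z)\<^sup>2 + 2 * ((fst z)\<^sup>2 * poly R (c + fst z)) * snd z + fst z ^ 4 * poly H (c + fst z)) differentiable (at ?z)"
      by (intro differentiable_add differentiable_mult differentiable_power differentiable_const P)
    then obtain D where D: "((\<lambda>z. (snd z)\<^sup>2 + 2 * ((fst z)\<^sup>2 * poly R (c + fst z)) * snd z + fst z ^ 4 * poly H (c + fst z)) has_derivative D) (at ?z)"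
      unfolding differentiable_def by blast
    have "(snd has_derivative snd) (at ?z)" by (rule bounded_linear_imp_has_derivative[OF bounded_linear_snd])
    from has_derivative_mult[OF this D]
    have d: "(f has_derivative lin2 0 (complex_of_real s ^ 4 * poly H (c + complex_of_real s))) (at ?z)"
      unfolding f_def by (rule has_derivative_eq_rhs) (simp add: fun_eq_iff)
    have "norm (complex_of_real s ^ 4 * poly H (c + complex_of_real s)) \<le> s ^ 4 * B"
      unfolding norm_mult norm_power using B(3)[of "complex_of_real s"] s by (intro mult_mono) auto
    then show "\<exists>z a b. f z = 0 \<and> (f has_derivative lin2 a b) (at z) \<and> s ^ 1 \<le> norm z \<and> norm z \<le> 2 * s \<and> norm a + norm b \<le> B * s ^ 4"
      using s d
      by (rule_tac exI[of _ ?z], rule_tac exI[of _ 0], rule_tac exI[of _ "complex_of_real s ^ 4 * poly H (c + complex_of_real s)"])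
        (auto simp: f_def mult.commute)
  qed (use j in simp)
qed

end

context nform_data
begin

lemma nonsimple_point:
  assumes x: "order x g \<ge> 4" "order x h \<ge> 4"
  shows "\<not> has_type F (proj_pt (pt3 0 1 x)) t"
proof
  assume t: "has_type F (proj_pt (pt3 0 1 x)) t"
  have X: "[:-x, 1:] ^ 4 dvd g" "[:-x, 1:] ^ 4 dvd h"
    using x order_ge_iff[OF g_nz] order_ge_iff[OF h_nz] by blast+
  then obtain H where H: "h = [:-x, 1:] ^ 4 * H" by blast
  have "[:-x, 1:] ^ 4 dvd g + h" using X by (rule dvd_add)
  \<comment> \<open>The sum of the two quintics is \<open>q^2\<close>, so order 4 of both gives
    order 2 of \<open>q\<close>, which is the shape of the germ treated above.\<close>
  then have q4: "[:-x, 1:] ^ 4 dvd q\<^sup>2" by simp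
  obtain R where R: "q = [:-x, 1:] ^ 2 * R"
  proof (cases "q = 0")
    case False
    then have "4 \<le> order x (q * q)" using q4 order_ge_iff[of "q\<^sup>2" 4 x] by (simp add: power2_eq_square)
    then have "2 \<le> order x q" using False order_mult[of q q x] by simp
    then show ?thesis using order_ge_iff[OF False, of 2 x] that by blast
  qed (use that[of 0] in simp)
  define f where "f = (\<lambda>z. snd z * ((snd z)\<^sup>2 + 2 * ((fst z)\<^sup>2 * poly R (x + fst z)) * snd z + fst z ^ 4 * poly H (x + fst z)))"
  have "chart F (affine_matrix x 0) = affine_chart q h x 0"
    by (auto simp: chart_def fun_eq_iff affine_matrix_mult F_affine affine_chart_def)
  also have "\<dots> = f"
    unfolding affine_chart_def f_def using poly_factor_shift[of x 2 R] poly_factor_shift[of x 4 H]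
    by (subst H, subst R) (simp add: fun_eq_iff)
  finally have f: "chart F (affine_matrix x 0) = f" .
  have "affine_matrix x 0 *v pt3 1 0 0 = 1 *s pt3 0 1 x" by (simp add: affine_matrix_mult)
  from has_type_chart[OF hom_poly_fun_nform t invertible_affine_matrix this]
  obtain f' where f': "germ_equiv f' (normal_form t)" "germ_equiv f' f" "valid_type t" unfolding f by auto
  note s = germ_equiv_sym[OF f'(2)]
  have "\<not> germ_equiv f' (normal_form t)"
  proof (rule not_simple[OF _ _ _ f'(3)])
    show "cubic_bound f'" by (rule cubic_bound_transfer[OF s]) (unfold f_def, rule tangent_branches_cubic)
    show "unitangent f'" by (rule unitangent_transfer[OF s]) (unfold f_def, rule tangent_branches_unitangent)
    show "\<not> grad_bound j f'" if "j \<le> 20" for j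
      using grad_bound_transfer[OF f'(2)] tangent_branches_grad[OF that, of R x H] unfolding f_def by blast
  qed
  then show False using f'(1) by blast
qed

lemma simple_data_iff: "simple_sings F \<longleftrightarrow> simple_data"
proof
  assume s: "simple_sings F"
  show simple_data unfolding simple_data_def
  proof (intro allI notI)
    fix x assume a: "4 \<le> order x g \<and> 4 \<le> order x h"
    then have "x \<in> on_line" unfolding on_line_def using order_0I[of h x] by auto
    then have "proj_pt (pt3 0 1 x) \<in> sing_pts F" unfolding sing_pts_nform by blast
    then show False using s nonsimple_point a unfolding simple_sings_def by blast
  qed
qed (rule simple_data_imp_simple_sings)

text \<open>If \<open>h\<close> also had order at least 3, then \<open>q\<close> would have a double
  root and the quintics would be opposite modulo the fourth power: both orders are 3 or both are at
  least 4, and each is excluded.\<close>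

lemma order_on_line:
  assumes s: simple_data and x: "x \<in> on_line" and k: "order x g \<ge> 3" and n: "\<not> (order x g = 3 \<and> order x h = 3)"
  shows "order x h = 2"
proof -
  define k m where "k = order x g" and "m = order x h"
  have dg: "[:-x, 1:] ^ i dvd g \<longleftrightarrow> i \<le> k" and dh: "[:-x, 1:] ^ i dvd h \<longleftrightarrow> i \<le> m" for i
    using order_ge_iff[OF g_nz] order_ge_iff[OF h_nz] by (auto simp: k_def m_def)
  have gh: "g = q\<^sup>2 - h" "h = q\<^sup>2 - g" by auto
  have "poly h x = 0" using x by (simp add: on_line_def)
  moreover have "poly g x = 0" using k order_0I[of g x] by auto
  ultimately have "poly q x = 0" by auto
  then obtain q0 where q0: "q = [:-x, 1:] * q0" using poly_root_factor by blast
  have X2: "[:-x, 1:] ^ 2 dvd q\<^sup>2" unfolding q0 power_mult_distrib by simp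
  have "[:-x, 1:] ^ 2 dvd g" using dg k by (simp add: k_def)
  then have m2: "2 \<le> m" using X2 dh gh by (metis dvd_diff)
  show ?thesis
  proof (rule ccontr)
    assume "order x h \<noteq> 2"
    then have m3: "3 \<le> m" using m2 by (simp add: m_def)
    have "[:-x, 1:] ^ 3 dvd g + h" using dg dh m3 k by (intro dvd_add) (auto simp: k_def)
    then have "[:-x, 1:] ^ 3 dvd q\<^sup>2" by simp
    then have "[:-x, 1:] ^ 2 * [:-x, 1:] dvd [:-x, 1:] ^ 2 * q0\<^sup>2"
      unfolding q0 power_mult_distrib by (simp only: power3_eq_cube power2_eq_square)
    then have "[:-x, 1:] dvd q0\<^sup>2" by (subst (asm) dvd_mult_cancel_left) auto
    then have "poly (q0\<^sup>2) x = 0" using poly_eq_0_iff_dvd[of "q0\<^sup>2" x] by blast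
    then have "poly q0 x = 0" by simp
    then obtain r where r: "q0 = [:-x, 1:] * r" using poly_root_factor by blast
    have "q = [:-x, 1:] ^ 2 * r" unfolding q0 r by (simp only: power2_eq_square mult.assoc)
    then have X4: "[:-x, 1:] ^ 4 dvd q\<^sup>2" by (simp only: power_mult_distrib power_mult[symmetric]) simp
    have "4 \<le> k \<longleftrightarrow> 4 \<le> m" using X4 dg[of 4] dh[of 4] gh by (metis dvd_diff)
    moreover have "\<not> (4 \<le> k \<and> 4 \<le> m)" using s unfolding simple_data_def k_def m_def by blast
    ultimately show False using k n m3 unfolding k_def m_def by linarith
  qed
qed

text \<open>One formula for all cases of \<open>line_type\<close>; after summation only degrees and
  numbers of roots survive.\<close>

lemma milnor_line_type:
  assumes s: simple_data and x: "x \<in> on_line"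
  shows "milnor (line_type (order x g) (order x h)) + 1 + (if poly g x = 0 then 1 else 0) = 2 * order x h + order x g"
proof -
  have m: "order x h \<ge> 1" using x order_root[of h x] h_nz by (auto simp: on_line_def)
  have k: "order x g = 0 \<longleftrightarrow> poly g x \<noteq> 0" using order_root[of g x] g_nz by auto
  consider "order x g = 0" | "order x g = 1" | "order x g = 2" | "order x g = 3" "order x h = 3"
    | "order x g \<ge> 3" "\<not> (order x g = 3 \<and> order x h = 3)" by linarith
  then show ?thesis
  proof cases
    case 5
    then have "order x h = 2" using order_on_line[OF s x] by blast
    then show ?thesis using 5 k by (auto simp: line_type_def)
  qed (use m k in \<open>auto simp: line_type_def\<close>)
qed

lemma total_milnor_nform:
  assumes simple_data
  shows "total_milnor F + card {x. poly g x = 0} + card {x. poly h x = 0} = 23"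
proof -
  define G where "G = g"
  have G: "G \<noteq> 0" "degree G = 5" using g_nz deg_g by (simp_all only: G_def) auto
  define Rg Rh where "Rg = {x. poly G x = 0}" and "Rh = {x. poly h x = 0}"
  have fin: "finite Rg" "finite Rh" unfolding Rg_def Rh_def using poly_roots_finite[OF G(1)] poly_roots_finite[OF h_nz] by simp_all
  have sum_order: "(\<Sum>x | poly p x = 0. order x p) = degree p" if "p \<noteq> 0" for p :: "complex poly"
    using size_proots_complex[of p] that unfolding size_multiset_overloaded_eq by simp
  have ol: "on_line = Rh" by (simp add: on_line_def Rh_def)
  have pos: "order x G \<ge> 1 \<longleftrightarrow> x \<in> Rg" for x using order_root[of G x] G by (auto simp: Rg_def)
  have off: "off_line = {x \<in> Rg - Rh. 2 \<le> order x G}"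
    using pos unfolding off_line_def G_def[symmetric] Rh_def by fastforce
  have 1: "total_milnor F = 8 + (\<Sum>x\<in>Rh. milnor (line_type (order x G) (order x h))) + (\<Sum>x\<in>off_line. order x G - 1)"
    unfolding total_milnor_def sing_set_nform[OF assms] G_def[symmetric]
    by (simp add: multiset.map_comp comp_def sum_unfold_sum_mset ol)
  have 2: "(\<Sum>x\<in>Rh. milnor (line_type (order x G) (order x h))) + card Rh + card (Rg \<inter> Rh)
      = (\<Sum>x\<in>Rh. 2 * order x h) + (\<Sum>x\<in>Rh. order x G)"
  proof -
    have "(\<Sum>x\<in>Rh. milnor (line_type (order x G) (order x h)) + 1 + (if x \<in> Rg then 1 else 0)) = (\<Sum>x\<in>Rh. 2 * order x h + order x G)"
      by (rule sum.cong) (use milnor_line_type[OF assms, folded G_def] in \<open>simp_all only: ol Rg_def mem_Collect_eq\<close>)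
    moreover have "(\<Sum>x\<in>Rh. if x \<in> Rg then 1 else 0) = card (Rg \<inter> Rh)"
      using fin by (simp add: sum.If_cases Int_commute Int_def)
    ultimately show ?thesis by (simp only: sum.distrib card_eq_sum)
  qed
  have 3: "(\<Sum>x\<in>Rh. 2 * order x h) = 10" using sum_order[OF h_nz] deg_h by (simp add: Rh_def flip: sum_distrib_left)
  \<comment> \<open>Simple roots of \<open>g\<close> off the line are smooth points and contribute
    \<open>1 - 1 = 0\<close>, so the sum may run over all roots of \<open>g\<close> off the
    line.\<close>
  have 4: "(\<Sum>x\<in>off_line. order x G - 1) + card (Rg - Rh) = (\<Sum>x\<in>Rg - Rh. order x G)"
  proof -
    have "(\<Sum>x\<in>off_line. order x G - 1) = (\<Sum>x\<in>Rg - Rh. order x G - 1)"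
      by (rule sum.mono_neutral_left) (use fin in \<open>auto simp: off\<close>)
    moreover have "(\<Sum>x\<in>Rg - Rh. (order x G - 1) + 1) = (\<Sum>x\<in>Rg - Rh. order x G)"
    proof (rule sum.cong[OF refl])
      show "order x G - 1 + 1 = order x G" if "x \<in> Rg - Rh" for x using that pos[of x] by simp
    qed
    ultimately show ?thesis by (simp only: sum.distrib card_eq_sum)
  qed
  have 5: "(\<Sum>x\<in>Rg - Rh. order x G) + (\<Sum>x\<in>Rh. order x G) = 5"
  proof -
    have "(\<Sum>x\<in>Rh. order x G) = (\<Sum>x\<in>Rg \<inter> Rh. order x G)"
    proof (rule sum.mono_neutral_right)
      show "\<forall>i\<in>Rh - Rg \<inter> Rh. order i G = 0" using pos by (metis DiffD1 DiffD2 IntI not_less_eq_eq le0 One_nat_def le_antisym)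
    qed (use fin in auto)
    moreover have "(\<Sum>x\<in>Rg. order x G) = (\<Sum>x\<in>(Rg - Rh) \<union> (Rg \<inter> Rh). order x G)" by (rule sum.cong) auto
    moreover have "\<dots> = (\<Sum>x\<in>Rg - Rh. order x G) + (\<Sum>x\<in>Rg \<inter> Rh. order x G)"
      by (rule sum.union_disjoint) (use fin in auto)
    ultimately show ?thesis using sum_order[OF G(1)] G(2) by (simp add: Rg_def)
  qed
  have 6: "card Rg = card (Rg - Rh) + card (Rg \<inter> Rh)"
    using card_Diff_subset_Int[of Rg Rh] fin card_mono[of Rg "Rg \<inter> Rh"] by simp
  show ?thesis unfolding G_def[symmetric] Rg_def[symmetric] Rh_def[symmetric] using 1 2 3 4 5 6 by linarith
qed

end

section \<open>Reduction of a reducible sextic to the normal form\<close>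

text \<open>Differentiability gives an error \<open>o(|z|)\<close>, which is not enough: on the E8
  arc \<open>|z|\<close> has size \<open>|t|^3\<close> while the first coordinate has size
  \<open>|t|^5\<close>. The quadratic error is of size \<open>|t|^6\<close>. It comes from Taylor's
  formula on complex lines, with the second derivative bounded by Cauchy's inequality.\<close>

lemma holo2_second_order:
  assumes "holo2_on U f" "0 \<in> U" "(f has_derivative lin2 a b) (at 0)"
  shows "\<exists>K. \<forall>\<^sub>F z in nhds 0. norm (f z - f 0 - lin2 a b z) \<le> K * norm z ^ 2"
proof -
  obtain r where r: "r > 0" "cball 0 (2 * r) \<subseteq> U"
  proof -
    obtain e where "e > 0" "cball 0 e \<subseteq> U" using assms open_contains_cball unfolding holo2_on_def by blast
    then show ?thesis using that[of "e / 2"] by auto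
  qed
  have cont: "continuous_on U f"
    using assms(1) by (meson continuous_at_imp_continuous_on holo2_onD has_derivative_continuous)
  have "compact (f ` cball 0 (2 * r))"
    by (rule compact_continuous_image[OF continuous_on_subset[OF cont r(2)]]) simp
  then obtain B where B: "\<And>z. z \<in> cball 0 (2*r) \<Longrightarrow> norm (f z) \<le> B"
    by (metis compact_imp_bounded bounded_iff image_eqI)
  define C where "C = fact 2 * B / r ^ 2"
  have key: "norm (f (t * fst e, t * snd e) - f 0 - lin2 a b (t * fst e, t * snd e)) \<le> C * norm t ^ 2"
    if t: "norm t < r" and e: "norm e = 1" for t and e :: "complex \<times> complex"
  proof -
    define k where "k t = f (t * fst e, t * snd e)" for t
    have ne: "norm (t * fst e, t * snd e) = norm t" for t :: complex
    proof -
      have "norm (t * fst e, t * snd e) = norm t * norm (fst e, snd e)"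
        by (simp add: norm_prod_def norm_mult power_mult_distrib real_sqrt_mult flip: distrib_left)
      then show ?thesis using e by simp
    qed
    have D: "(k has_field_derivative (a' * fst e + b' * snd e)) (at t)"
      if "(f has_derivative lin2 a' b') (at (t * fst e, t * snd e))" for t a' b'
    proof -
      have "((\<lambda>t. (t * fst e, t * snd e)) has_derivative (\<lambda>t. (t * fst e, t * snd e))) (at t)"
        by (auto intro!: derivative_eq_intros)
      from has_derivative_compose[OF this that] show ?thesis
        unfolding has_field_derivative_def k_def by (rule has_derivative_eq_rhs) (auto simp: algebra_simps)
    qed
    have hol: "\<exists>D. (k has_field_derivative D) (at t)" if t: "norm t \<le> 2 * r" for t
    proof -
      have "(t * fst e, t * snd e) \<in> U" using ne[of t] t r by auto
      then obtain a' b' where "(f has_derivative lin2 a' b') (at (t * fst e, t * snd e))"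
        by (rule holo2_onD[OF assms(1)])
      then show ?thesis using D by blast
    qed
    have H: "k holomorphic_on ball 0 (2 * r)"
    proof (rule holomorphic_onI)
      fix t :: complex assume "t \<in> ball 0 (2 * r)"
      then obtain d where "(k has_field_derivative d) (at t)" using hol[of t] by auto
      then show "k field_differentiable at t within ball 0 (2 * r)"
        unfolding field_differentiable_def by (blast intro: has_field_derivative_at_within)
    qed
    have cont: "continuous_on (cball 0 (2 * r)) k"
    proof (intro continuous_at_imp_continuous_on ballI)
      fix t :: complex assume "t \<in> cball 0 (2 * r)"
      then obtain d where "(k has_field_derivative d) (at t)" using hol[of t] by auto
      then show "isCont k t" by (rule DERIV_isCont)
    qed
    have kB: "norm (k t) \<le> B" if "norm t \<le> 2 * r" for t
      unfolding k_def by (rule B) (use that ne[of t] in simp)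
    have second: "norm ((deriv ^^ 2) k x) \<le> C" if x: "x \<in> ball 0 r" for x
      unfolding C_def
    proof (rule Cauchy_inequality)
      have sub: "cball x r \<subseteq> cball 0 (2 * r)"
      proof
        fix w assume "w \<in> cball x r"
        then show "w \<in> cball 0 (2 * r)" using x norm_triangle_ineq2[of w x] by (simp add: dist_norm norm_minus_commute)
      qed
      have sub': "ball x r \<subseteq> ball 0 (2 * r)"
      proof
        fix w assume "w \<in> ball x r"
        then show "w \<in> ball 0 (2 * r)" using x norm_triangle_ineq2[of w x] by (simp add: dist_norm norm_minus_commute)
      qed
      show "k holomorphic_on ball x r" using H sub' by (rule holomorphic_on_subset)
      show "continuous_on (cball x r) k" using cont sub by (rule continuous_on_subset)
      show "norm (k w) \<le> B" if "norm (x - w) = r" for w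
        using that sub kB[of w] by (auto simp: subset_iff dist_norm)
    qed (use r in simp)
    define kk where "kk n = (deriv ^^ n) k" for n
    have "norm (kk 0 t - (\<Sum>i\<le>1. kk i 0 * (t - 0) ^ i / fact i)) \<le> C * norm (t - 0) ^ Suc 1 / fact 1"
    proof (rule complex_Taylor[where S="ball 0 r"])
      show "(kk i has_field_derivative kk (Suc i) x) (at x within ball 0 r)" if "x \<in> ball 0 r" "i \<le> 1" for i x
      proof -
        have "kk i holomorphic_on ball 0 (2 * r)" unfolding kk_def by (rule holomorphic_higher_deriv[OF H]) simp
        then have "(kk i has_field_derivative deriv (kk i) x) (at x)"
          by (rule holomorphic_derivI) (use that r in auto)
        then show ?thesis by (simp add: kk_def has_field_derivative_at_within)
      qed
      show "norm (kk (Suc 1) x) \<le> C" if "x \<in> ball 0 r" for x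
        using second[OF that] by (simp add: kk_def numeral_2_eq_2)
    qed (use t r in auto)
    moreover have "kk 1 0 = a * fst e + b * snd e"
      unfolding kk_def using D[of a b 0] assms(3) by (simp add: DERIV_imp_deriv flip: zero_prod_def)
    ultimately have "norm (k t - (k 0 + (a * fst e + b * snd e) * t)) \<le> C * norm t ^ 2"
      by (simp add: kk_def power2_eq_square)
    then show ?thesis by (simp add: k_def algebra_simps flip: zero_prod_def)
  qed
  have "\<forall>\<^sub>F z in nhds 0. norm (f z - f 0 - lin2 a b z) \<le> C * norm z ^ 2"
    unfolding eventually_nhds_metric
  proof (intro exI[of _ r] conjI r(1) allI impI)
    fix z :: "complex \<times> complex" assume "dist z 0 < r"
    then have z: "norm z < r" by simp
    show "norm (f z - f 0 - lin2 a b z) \<le> C * norm z ^ 2"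
    proof (cases "z = 0")
      case False
      define t e where "t = complex_of_real (norm z)" and "e = (fst z / t, snd z / t)"
      have t: "t \<noteq> 0" "norm t = norm z" using False by (auto simp: t_def)
      have "e = z /\<^sub>R norm z" by (simp add: e_def t_def prod_eq_iff scaleR_conv_of_real divide_inverse mult.commute of_real_inverse)
      then have "norm e = 1" using False by simp
      moreover have "(t * fst e, t * snd e) = z" using t by (simp add: e_def)
      ultimately show ?thesis using key[of t e] z t by (simp only: t)
    qed simp
  qed
  then show ?thesis by blast
qed

section \<open>Polynomials along the parametrised E8 branch\<close>

definition E8_arc :: "complex \<Rightarrow> complex \<times> complex" where "E8_arc t = (- (t ^ 5), t ^ 3)"

text \<open>With weights 5 and 3 only the leading terms of \<open>p\<close> and \<open>r\<close>
  matter. After division by \<open>t ^ N\<close> the monomials of weight \<open>N\<close> survive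
  with the sign \<open>(-1) ^ i\<close>, heavier ones tend to 0 and lighter ones are absent.\<close>

lemma arc_limit:
  fixes p r :: "complex \<Rightarrow> complex"
  assumes p: "((\<lambda>t. p t / t ^ 5) \<longlongrightarrow> -1) (at 0)" and r: "((\<lambda>t. r t / t ^ 3) \<longlongrightarrow> 1) (at 0)"
    and low: "\<And>i j. i + j \<le> n \<Longrightarrow> 5 * i + 3 * j < N \<Longrightarrow> c i j = 0"
  shows "((\<lambda>t. (\<Sum>i\<le>n. \<Sum>j\<le>n - i. c i j * p t ^ i * r t ^ j) / t ^ N) \<longlongrightarrow>
    (\<Sum>i\<le>n. \<Sum>j\<le>n - i. if 5 * i + 3 * j = N then c i j * (-1) ^ i else 0)) (at 0)"
  unfolding sum_divide_distrib
proof (intro tendsto_sum)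
  fix i j assume ij: "i \<in> {..n}" "j \<in> {..n - i}"
  consider "5 * i + 3 * j < N" | "5 * i + 3 * j = N" | "5 * i + 3 * j > N" by linarith
  then show "((\<lambda>t. c i j * p t ^ i * r t ^ j / t ^ N) \<longlongrightarrow> (if 5 * i + 3 * j = N then c i j * (-1) ^ i else 0)) (at 0)"
  proof cases
    case 1
    then show ?thesis using low[of i j] ij by simp
  next
    case 2
    have "((\<lambda>t. c i j * (p t / t ^ 5) ^ i * (r t / t ^ 3) ^ j) \<longlongrightarrow> c i j * (-1) ^ i * 1 ^ j) (at 0)"
      by (intro tendsto_intros p r)
    moreover have "c i j * (p t / t ^ 5) ^ i * (r t / t ^ 3) ^ j = c i j * p t ^ i * r t ^ j / t ^ N" for t
      by (simp add: power_divide flip: power_mult power_add 2)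
    ultimately show ?thesis using 2 by simp
  next
    case 3
    then obtain m where m: "5 * i + 3 * j = N + Suc m" using less_imp_Suc_add by fastforce
    have lim: "((\<lambda>t. c i j * (p t / t ^ 5) ^ i * (r t / t ^ 3) ^ j * t ^ Suc m) \<longlongrightarrow> c i j * (-1) ^ i * 1 ^ j * 0 ^ Suc m) (at 0)"
      by (intro tendsto_intros p r)
    have ev: "\<forall>\<^sub>F t in at 0. c i j * (p t / t ^ 5) ^ i * (r t / t ^ 3) ^ j * t ^ Suc m = c i j * p t ^ i * r t ^ j / t ^ N"
      using eventually_neq_at_within[of "0::complex" 0 UNIV]
    proof eventually_elim
      case (elim t)
      have "c i j * (p t / t ^ 5) ^ i * (r t / t ^ 3) ^ j * t ^ Suc m = c i j * p t ^ i * r t ^ j * t ^ Suc m / t ^ (5 * i + 3 * j)"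
        by (simp add: power_divide power_add power_mult del: power_Suc)
      also have "\<dots> = c i j * p t ^ i * r t ^ j / t ^ N" using elim unfolding m power_add by simp
      finally show ?case .
    qed
    from Lim_transform_eventually[OF lim ev] show ?thesis using 3 by simp
  qed
qed

text \<open>Equal weights mean that \<open>i\<close> changes by a multiple of 3 and \<open>j\<close>
  by the corresponding multiple of 5; in degree at most 5 this leaves only the pair
  \<open>(3, 0)\<close>, \<open>(0, 5)\<close> of weight 15.\<close>

lemma level_unique:
  assumes "i + j \<le> 5" "i' + j' \<le> 5" "5 * i + 3 * j = 5 * i' + 3 * (j'::nat)" "(i + j \<le> 4 \<and> i' + j' \<le> 4) \<or> 5 * i + 3 * j \<noteq> 15"
  shows "i = i' \<and> j = j'"
proof -
  have less: False if lt: "i < i'" and "i + j \<le> 5" "i' + j' \<le> 5" "5 * i + 3 * j = 5 * i' + 3 * j'"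
    "(i + j \<le> 4 \<and> i' + j' \<le> 4) \<or> 5 * i + 3 * j \<noteq> 15" for i j i' j' :: nat
  proof -
    obtain k where k: "i' = i + k" "k > 0" using less_imp_add_positive[OF lt] by metis
    have e: "3 * j = 5 * k + 3 * j'" using that(4) by (simp add: k)
    then have "3 dvd 5 * k" by (metis dvd_add_left_iff dvd_triv_left)
    then have "3 dvd k" by presburger
    then obtain l where l: "k = 3 * l" ..
    then have "l = 1" using k that(3) by linarith
    then have "i + j \<ge> 5" "j = j' + 5" "k = 3" using e l by auto
    then show False using that(2,5) k by linarith
  qed
  have "\<not> i < i'" "\<not> i' < i" using less[of i i' j j'] less[of i' i j' j] assms by auto
  then show ?thesis using assms(3) by simp
qed

lemma level_sum_single:
  assumes ij: "i0 + j0 \<le> n" and u: "\<And>i j. i + j \<le> n \<Longrightarrow> 5 * i + 3 * j = 5 * i0 + 3 * j0 \<Longrightarrow> i = i0 \<and> j = j0"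
  shows "(\<Sum>i\<le>n. \<Sum>j\<le>n - i. if 5 * i + 3 * j = 5 * i0 + 3 * j0 then c i j * (-1) ^ i else 0) = (c i0 j0 :: complex) * (-1) ^ i0"
proof -
  have "(\<Sum>i\<le>n. \<Sum>j\<le>n - i. if 5 * i + 3 * j = 5 * i0 + 3 * j0 then c i j * (-1) ^ i else 0)
     = (\<Sum>i\<le>n. if i = i0 then c i0 j0 * (-1) ^ i0 else 0)"
  proof (rule sum.cong[OF refl])
    fix i assume i: "i \<in> {..n}"
    have "(\<Sum>j\<le>n - i. if 5 * i + 3 * j = 5 * i0 + 3 * j0 then c i j * (-1) ^ i else 0)
      = (\<Sum>j\<le>n - i. if j = j0 then (if i = i0 then c i0 j0 * (-1) ^ i0 else 0) else 0)"
    proof (rule sum.cong[OF refl])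
      fix j assume "j \<in> {..n - i}"
      then have "5 * i + 3 * j = 5 * i0 + 3 * j0 \<longleftrightarrow> i = i0 \<and> j = j0" using u[of i j] i by auto
      then show "(if 5 * i + 3 * j = 5 * i0 + 3 * j0 then c i j * (-1) ^ i else 0) = (if j = j0 then (if i = i0 then c i0 j0 * (-1) ^ i0 else 0) else 0)"
        by simp
    qed
    also have "\<dots> = (if i = i0 then c i0 j0 * (-1) ^ i0 else 0)" using ij i by auto
    finally show "(\<Sum>j\<le>n - i. if 5 * i + 3 * j = 5 * i0 + 3 * j0 then c i j * (-1) ^ i else 0) = (if i = i0 then c i0 j0 * (-1) ^ i0 else 0)" .
  qed
  then show ?thesis using ij by simp
qed

text \<open>Renames the variables so that the dependent exponent belongs to \<open>x$1\<close>, the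
  coordinate that is 1 in the chart at the E8 point.\<close>

lemma cyclic_coefficients:
  assumes "hom_poly_fun d F"
  shows "\<exists>c. \<forall>x. F x = (\<Sum>i\<le>d. \<Sum>j\<le>d - i. c i j * (x$2)^i * (x$3)^j * (x$1)^(d - i - j))"
proof -
  define T :: "complex^3^3" where "T = vector [vector [0, 0, 1], vector [1, 0, 0], vector [0, 1, 0]]"
  define S :: "complex^3^3" where "S = vector [vector [0, 1, 0], vector [0, 0, 1], vector [1, 0, 0]]"
  have TS: "T *v (S *v x) = x" "(S *v x)$1 = x$2" "(S *v x)$2 = x$3" "(S *v x)$3 = x$1" for x
    by (simp_all add: vec_eq_iff forall_3 matrix_vector_mult_nth3 T_def S_def vector_3)
  obtain c where c: "\<And>x. F (T *v x) = (\<Sum>i\<le>d. \<Sum>j\<le>d - i. c i j * (x$1)^i * (x$2)^j * (x$3)^(d - i - j))"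
    using hom_poly_fun_matrix[OF assms, of T] unfolding hom_poly_fun_def by blast
  have "F x = (\<Sum>i\<le>d. \<Sum>j\<le>d - i. c i j * (x$2)^i * (x$3)^j * (x$1)^(d - i - j))" for x
    using c[of "S *v x"] by (simp only: TS)
  then show ?thesis by blast
qed

text \<open>The nonzero monomial of least weight is alone at its weight and dominates along the
  arc.\<close>

lemma arc_nonzero:
  assumes F: "hom_poly_fun d F" "d \<le> 4" "F \<noteq> (\<lambda>_. 0)"
    and p: "((\<lambda>t. p t / t ^ 5) \<longlongrightarrow> -1) (at 0)" and r: "((\<lambda>t. r t / t ^ 3) \<longlongrightarrow> 1) (at 0)"
  shows "\<forall>\<^sub>F t in at 0. F (pt3 1 (p t) (r t)) \<noteq> 0"
proof -
  obtain c where c: "\<And>x. F x = (\<Sum>i\<le>d. \<Sum>j\<le>d - i. c i j * (x$2)^i * (x$3)^j * (x$1)^(d - i - j))"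
    using cyclic_coefficients[OF F(1)] by blast
  have "\<exists>i j. i + j \<le> d \<and> c i j \<noteq> 0"
  proof (rule ccontr)
    assume "\<not> ?thesis"
    then have "F x = 0" for x unfolding c by (intro sum.neutral ballI) auto
    then show False using F(3) by blast
  qed
  then have ex: "\<exists>N i j. i + j \<le> d \<and> c i j \<noteq> 0 \<and> 5 * i + 3 * j = N" by blast
  define N where "N = (LEAST N. \<exists>i j. i + j \<le> d \<and> c i j \<noteq> 0 \<and> 5 * i + 3 * j = N)"
  obtain i0 j0 where ij: "i0 + j0 \<le> d" "c i0 j0 \<noteq> 0" "5 * i0 + 3 * j0 = N"
    using LeastI_ex[OF ex] unfolding N_def by blast
  have low: "c i j = 0" if "i + j \<le> d" "5 * i + 3 * j < N" for i j
    using that not_less_Least[of "5 * i + 3 * j" "\<lambda>N. \<exists>i j. i + j \<le> d \<and> c i j \<noteq> 0 \<and> 5 * i + 3 * j = N"] unfolding N_def by blast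
  have "(\<Sum>i\<le>d. \<Sum>j\<le>d - i. if 5 * i + 3 * j = N then c i j * (-1) ^ i else 0) = c i0 j0 * (-1) ^ i0"
    unfolding ij(3)[symmetric]
  proof (rule level_sum_single[OF ij(1)])
    fix i j assume "i + j \<le> d" "5 * i + 3 * j = 5 * i0 + 3 * j0"
    then show "i = i0 \<and> j = j0" using level_unique[of i j i0 j0] ij(1) F(2) by linarith
  qed
  moreover have "((\<lambda>t. F (pt3 1 (p t) (r t)) / t ^ N) \<longlongrightarrow> (\<Sum>i\<le>d. \<Sum>j\<le>d - i. if 5 * i + 3 * j = N then c i j * (-1) ^ i else 0)) (at 0)"
    using arc_limit[OF p r low] by (simp add: c)
  ultimately have "((\<lambda>t. F (pt3 1 (p t) (r t)) / t ^ N) \<longlongrightarrow> c i0 j0 * (-1) ^ i0) (at 0)" by (simp only:)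
  then have "\<forall>\<^sub>F t in at 0. F (pt3 1 (p t) (r t)) / t ^ N \<noteq> 0"
    by (rule tendsto_imp_eventually_ne) (use ij(2) in simp)
  then show ?thesis by eventually_elim auto
qed

text \<open>Vanishing on the arc kills the coefficients of weight below 15 one weight at a time. At
  weight 15 the two monomials must cancel, so \<open>c 0 5 = c 3 0\<close>; were both 0, the
  elimination would continue through all weights.\<close>

lemma arc_quintic:
  assumes F: "hom_poly_fun 5 F" "F \<noteq> (\<lambda>_. 0)"
    and p: "((\<lambda>t. p t / t ^ 5) \<longlongrightarrow> -1) (at 0)" and r: "((\<lambda>t. r t / t ^ 3) \<longlongrightarrow> 1) (at 0)"
    and z: "\<forall>\<^sub>F t in at 0. F (pt3 1 (p t) (r t)) = 0"
  shows "\<exists>k (b :: nat \<Rightarrow> complex) (c :: nat \<Rightarrow> complex). k \<noteq> 0 \<and> (\<forall>x. F x = k * ((x$1)^2 * (x$2)^3 + (x$3)^5) + x$1 * (x$2)^2 * (b 0 * (x$2)^2 + b 1 * x$2 * x$3 + b 2 * (x$3)^2)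
     + (c 0 * (x$2)^5 + c 1 * (x$2)^4 * x$3 + c 2 * (x$2)^3 * (x$3)^2 + c 3 * (x$2)^2 * (x$3)^3 + c 4 * x$2 * (x$3)^4))"
proof -
  obtain c where c: "\<And>x. F x = (\<Sum>i\<le>5. \<Sum>j\<le>5 - i. c i j * (x$2)^i * (x$3)^j * (x$1)^(5 - i - j))"
    using cyclic_coefficients[OF F(1)] by blast
  have lvl: "(\<Sum>i\<le>5. \<Sum>j\<le>5 - i. if 5 * i + 3 * j = N then c i j * (-1) ^ i else 0) = 0"
    if "\<And>i j. i + j \<le> 5 \<Longrightarrow> 5 * i + 3 * j < N \<Longrightarrow> c i j = 0" for N
  proof -
    have "((\<lambda>t. F (pt3 1 (p t) (r t)) / t ^ N) \<longlongrightarrow> (\<Sum>i\<le>5. \<Sum>j\<le>5 - i. if 5 * i + 3 * j = N then c i j * (-1) ^ i else 0)) (at 0)"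
      using arc_limit[OF p r that] by (simp add: c)
    moreover have "((\<lambda>t. F (pt3 1 (p t) (r t)) / t ^ N) \<longlongrightarrow> 0) (at 0)"
    proof (rule tendsto_eventually)
      show "\<forall>\<^sub>F t in at 0. F (pt3 1 (p t) (r t)) / t ^ N = 0" using z by eventually_elim simp
    qed
    ultimately show ?thesis using tendsto_unique[OF at_neq_bot] by blast
  qed
  have step: "c i0 j0 = 0" if "i0 + j0 \<le> 5" "5 * i0 + 3 * j0 \<noteq> 15" "\<And>i j. i + j \<le> 5 \<Longrightarrow> 5 * i + 3 * j < 5 * i0 + 3 * j0 \<Longrightarrow> c i j = 0" for i0 j0
  proof -
    have u: "i = i0 \<and> j = j0" if "i + j \<le> 5" "5 * i + 3 * j = 5 * i0 + 3 * j0" for i j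
      by (rule level_unique) (use that \<open>i0 + j0 \<le> 5\<close> \<open>5 * i0 + 3 * j0 \<noteq> 15\<close> in simp_all)
    have "(\<Sum>i\<le>5. \<Sum>j\<le>5 - i. if 5 * i + 3 * j = 5 * i0 + 3 * j0 then c i j * (-1) ^ i else 0) = c i0 j0 * (-1) ^ i0"
      by (rule level_sum_single[OF that(1) u])
    moreover have "(\<Sum>i\<le>5. \<Sum>j\<le>5 - i. if 5 * i + 3 * j = 5 * i0 + 3 * j0 then c i j * (-1) ^ i else 0) = 0"
      by (rule lvl[OF that(3)])
    ultimately show ?thesis by simp
  qed
  have low: "5 * i + 3 * j < 15 \<Longrightarrow> i + j \<le> 5 \<Longrightarrow> c i j = 0" for i j
  proof (induction "5 * i + 3 * j" arbitrary: i j rule: less_induct)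
    case less
    show ?case by (rule step) (use less in auto)
  qed
  have five: "{..5} = {0, 1, 2, 3, 4, 5 :: nat}" "{..4} = {0, 1, 2, 3, 4 :: nat}" "{..3} = {0, 1, 2, 3 :: nat}" "{..2} = {0, 1, 2 :: nat}" by auto
  have 15: "c 0 5 = c 3 0"
  proof -
    have "(\<Sum>i\<le>5. \<Sum>j\<le>5 - i. if 5 * i + 3 * j = 15 then c i j * (-1) ^ i else 0) = 0" by (rule lvl) (use low in auto)
    then show ?thesis by (simp add: five)
  qed
  have nz: "c 3 0 \<noteq> 0"
  proof
    assume 0: "c 3 0 = 0"
    have "i + j \<le> 5 \<Longrightarrow> c i j = 0" for i j
    proof (induction "5 * i + 3 * j" arbitrary: i j rule: less_induct)
      case less
      show ?case
      proof (cases "5 * i + 3 * j = 15")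
        case True
        then have "(i = 3 \<and> j = 0) \<or> (i = 0 \<and> j = 5)" using less.prems by presburger
        then show ?thesis using 0 15 by auto
      qed (rule step, use less in auto)
    qed
    then have "F x = 0" for x unfolding c by (intro sum.neutral ballI) auto
    then show False using F(2) by blast
  qed
  have zeros: "c 0 0 = 0" "c 0 1 = 0" "c 0 2 = 0" "c 0 3 = 0" "c 0 4 = 0" "c 1 0 = 0" "c 1 1 = 0" "c 1 2 = 0" "c 1 3 = 0" "c 2 0 = 0" "c 2 1 = 0"
    by (rule low; simp)+
  have "F x = c 3 0 * ((x$1)^2 * (x$2)^3 + (x$3)^5) + x$1 * (x$2)^2 * (c 4 0 * (x$2)^2 + c 3 1 * x$2 * x$3 + c 2 2 * (x$3)^2)
     + (c 5 0 * (x$2)^5 + c 4 1 * (x$2)^4 * x$3 + c 3 2 * (x$2)^3 * (x$3)^2 + c 2 3 * (x$2)^2 * (x$3)^3 + c 1 4 * x$2 * (x$3)^4)" for x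
    unfolding c by (simp add: five zeros 15 zeros[unfolded One_nat_def] power2_eq_square power3_eq_cube power5_expand algebra_simps)
  note Fx = this
  show ?thesis
    by (rule exI[of _ "c 3 0"], rule exI[of _ "\<lambda>i. c (4 - i) i"], rule exI[of _ "\<lambda>i. c (5 - i) i"], rule conjI[OF nz])
      (simp add: Fx)
qed

text \<open>Splits off the differential at the origin, leaving \<open>p\<close> and \<open>r\<close>
  tangent to the coordinate functions; the matrix can then be moved into a projective
  transformation.\<close>

lemma germ_equiv_linear_part:
  assumes "germ_equiv f k"
  obtains a b c d p r u where "a * d - b * c \<noteq> 0" "u 0 \<noteq> 0" "isCont u 0"
    "\<exists>K. \<forall>\<^sub>F z in nhds 0. norm (p z - fst z) \<le> K * norm z ^ 2" "\<exists>K. \<forall>\<^sub>F z in nhds 0. norm (r z - snd z) \<le> K * norm z ^ 2"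
    "\<forall>\<^sub>F z in nhds 0. f (a * p z + b * r z, c * p z + d * r z) = u z * k z"
proof -
  obtain U V \<Phi> \<Psi> u where h: "open U" "0 \<in> U" "open V" "0 \<in> V" "\<Phi> 0 = 0" "\<Psi> 0 = 0"
    "\<Phi> ` U = V" "\<And>z. z \<in> U \<Longrightarrow> \<Psi> (\<Phi> z) = z" "\<And>y. y \<in> V \<Longrightarrow> \<Psi> y \<in> U \<and> \<Phi> (\<Psi> y) = y"
    "holo2_on U (\<lambda>z. fst (\<Phi> z))" "holo2_on U (\<lambda>z. snd (\<Phi> z))" "holo2_on U u" "u 0 \<noteq> 0"
    "holo2_on V (\<lambda>z. fst (\<Psi> z))" "holo2_on V (\<lambda>z. snd (\<Psi> z))"
    "\<And>z. z \<in> U \<Longrightarrow> f (\<Phi> z) = u z * k z"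
    using germ_equivE[OF assms] by blast
  obtain a b where ab: "((\<lambda>z. fst (\<Phi> z)) has_derivative lin2 a b) (at 0)" using holo2_onD[OF h(10,2)] .
  obtain c d where cd: "((\<lambda>z. snd (\<Phi> z)) has_derivative lin2 c d) (at 0)" using holo2_onD[OF h(11,2)] .
  obtain a' b' where ab': "((\<lambda>z. fst (\<Psi> z)) has_derivative lin2 a' b') (at (\<Phi> 0))" using holo2_onD[OF h(14,4)] unfolding h(5) .
  obtain c' d' where cd': "((\<lambda>z. snd (\<Psi> z)) has_derivative lin2 c' d') (at (\<Phi> 0))" using holo2_onD[OF h(15,4)] unfolding h(5) .
  have P: "(\<Phi> has_derivative (\<lambda>w. (lin2 a b w, lin2 c d w))) (at 0)" using has_derivative_Pair[OF ab cd] by simp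
  have inv: "((\<lambda>z. s (\<Psi> (\<Phi> z))) has_derivative s) (at 0)" if "s = fst \<or> s = snd" for s :: "complex \<times> complex \<Rightarrow> complex"
  proof -
    have "(s has_derivative s) (at 0)" using that by (auto intro: bounded_linear_imp_has_derivative bounded_linear_fst bounded_linear_snd)
    then show ?thesis by (rule has_derivative_transform_within_open[OF _ h(1,2)]) (use h(8) in simp)
  qed
  have "fst = (\<lambda>w. lin2 a' b' (lin2 a b w, lin2 c d w))" "snd = (\<lambda>w. lin2 c' d' (lin2 a b w, lin2 c d w))"
    using has_derivative_unique[OF inv has_derivative_compose[OF P ab']] has_derivative_unique[OF inv has_derivative_compose[OF P cd']] by simp_all
  then have "a' * a + b' * c = 1" "a' * b + b' * d = 0" "c' * a + d' * c = 0" "c' * b + d' * d = 1"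
    by (metis (no_types, lifting) fst_conv snd_conv mult_zero_right mult_1_right add_0_right add_0_left)+
  then have "(a' * d' - b' * c') * (a * d - b * c) = 1" by algebra
  then have det: "a * d - b * c \<noteq> 0" by auto
  define J where "J = a * d - b * c"
  define p where "p z = (d * fst (\<Phi> z) - b * snd (\<Phi> z)) / J" for z
  define r where "r z = (a * snd (\<Phi> z) - c * fst (\<Phi> z)) / J" for z
  have J: "J \<noteq> 0" using det by (simp add: J_def)
  have recover: "a * p z + b * r z = fst (\<Phi> z)" "c * p z + d * r z = snd (\<Phi> z)" for z
  proof -
    have "(a * (d * x - b * y) + b * (a * y - c * x)) = J * x" "(c * (d * x - b * y) + d * (a * y - c * x)) = J * y" for x y
      by (simp_all add: J_def algebra_simps)
    note e = this
    have "a * p z + b * r z = (a * (d * fst (\<Phi> z) - b * snd (\<Phi> z)) + b * (a * snd (\<Phi> z) - c * fst (\<Phi> z))) / J"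
      by (simp add: p_def r_def add_divide_distrib)
    then show "a * p z + b * r z = fst (\<Phi> z)" using J by (simp add: e)
    have "c * p z + d * r z = (c * (d * fst (\<Phi> z) - b * snd (\<Phi> z)) + d * (a * snd (\<Phi> z) - c * fst (\<Phi> z))) / J"
      by (simp add: p_def r_def add_divide_distrib)
    then show "c * p z + d * r z = snd (\<Phi> z)" using J by (simp add: e)
  qed
  obtain K1 where K1: "\<forall>\<^sub>F z in nhds 0. norm (fst (\<Phi> z) - lin2 a b z) \<le> K1 * norm z ^ 2"
    using holo2_second_order[OF h(10,2) ab] h(5) by auto
  obtain K2 where K2: "\<forall>\<^sub>F z in nhds 0. norm (snd (\<Phi> z) - lin2 c d z) \<le> K2 * norm z ^ 2"
    using holo2_second_order[OF h(11,2) cd] h(5) by auto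
  have comb: "\<exists>K. \<forall>\<^sub>F z in nhds 0. norm (l z) \<le> K * norm z ^ 2"
    if l: "\<And>z. l z = \<alpha> * (fst (\<Phi> z) - lin2 a b z) + \<beta> * (snd (\<Phi> z) - lin2 c d z)" for l \<alpha> \<beta>
  proof (rule exI)
    show "\<forall>\<^sub>F z in nhds 0. norm (l z) \<le> (norm \<alpha> * K1 + norm \<beta> * K2) * norm z ^ 2"
      using K1 K2
    proof eventually_elim
      case (elim z)
      have "norm (l z) \<le> norm \<alpha> * norm (fst (\<Phi> z) - lin2 a b z) + norm \<beta> * norm (snd (\<Phi> z) - lin2 c d z)"
        unfolding l by (metis norm_mult norm_triangle_ineq)
      also have "\<dots> \<le> norm \<alpha> * (K1 * norm z ^ 2) + norm \<beta> * (K2 * norm z ^ 2)"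
        using elim by (intro add_mono mult_left_mono) auto
      finally show ?case by (simp add: algebra_simps)
    qed
  qed
  have "p z - fst z = (d / J) * (fst (\<Phi> z) - lin2 a b z) + (- b / J) * (snd (\<Phi> z) - lin2 c d z)" for z
  proof -
    have "d * lin2 a b z - b * lin2 c d z = J * fst z" by (simp add: J_def algebra_simps)
    then have "fst z = (d * lin2 a b z - b * lin2 c d z) / J" using J by simp
    then show ?thesis unfolding p_def by (simp add: diff_divide_distrib algebra_simps)
  qed
  note bp = comb[OF this]
  have "r z - snd z = (- c / J) * (fst (\<Phi> z) - lin2 a b z) + (a / J) * (snd (\<Phi> z) - lin2 c d z)" for z
  proof -
    have "a * lin2 c d z - c * lin2 a b z = J * snd z" by (simp add: J_def algebra_simps)
    then have "snd z = (a * lin2 c d z - c * lin2 a b z) / J" using J by simp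
    then show ?thesis unfolding r_def by (simp add: diff_divide_distrib algebra_simps)
  qed
  note br = comb[OF this]
  have "isCont u 0" using h(2,12) by (meson holo2_onD has_derivative_continuous)
  moreover have "\<forall>\<^sub>F z in nhds 0. f (a * p z + b * r z, c * p z + d * r z) = u z * k z"
    using eventually_nhds_in_open[OF h(1,2)] by eventually_elim (simp add: recover h(16))
  ultimately show thesis using det h(13) bp br
    by (intro that[where a=a and b=b and c=c and d=d and p=p and r=r and u=u]) auto
qed

lemma E8_arc_filterlim: "filterlim E8_arc (nhds 0) (at 0)" "filterlim (\<lambda>t. (t, 0) :: complex \<times> complex) (nhds 0) (at 0)"
proof -
  have "((\<lambda>t::complex. (- (t ^ 5), t ^ 3)) \<longlongrightarrow> (- (0 ^ 5), 0 ^ 3)) (at 0)" by (intro tendsto_intros)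
  then show "filterlim E8_arc (nhds 0) (at 0)" by (simp add: E8_arc_def[abs_def] zero_prod_def)
  have "((\<lambda>t::complex. (t, 0::complex)) \<longlongrightarrow> (0, 0)) (at 0)" by (intro tendsto_intros)
  then show "filterlim (\<lambda>t. (t, 0) :: complex \<times> complex) (nhds 0) (at 0)" by (simp add: zero_prod_def)
qed

lemma tendsto_of_error:
  fixes x y :: "complex \<Rightarrow> complex"
  assumes "\<forall>\<^sub>F t in at 0. norm (x t - l * t ^ n) \<le> K * norm t ^ m" "n < m"
  shows "((\<lambda>t. x t / t ^ n) \<longlongrightarrow> l) (at 0)"
proof -
  have "((\<lambda>t. x t / t ^ n - l) \<longlongrightarrow> 0) (at 0)"
  proof (rule Lim_null_comparison)
    show "\<forall>\<^sub>F t in at 0. norm (x t / t ^ n - l) \<le> K * norm t ^ (m - n)"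
      using assms(1) eventually_neq_at_within[of "0::complex" 0 UNIV]
    proof eventually_elim
      case (elim t)
      have "x t / t ^ n - l = (x t - l * t ^ n) / t ^ n" using elim by (simp add: field_simps)
      then have "norm (x t / t ^ n - l) = norm (x t - l * t ^ n) / norm t ^ n" by (simp add: norm_divide norm_power)
      also have "\<dots> \<le> K * norm t ^ m / norm t ^ n" using elim by (intro divide_right_mono) auto
      also have "norm t ^ m = norm t ^ (m - n) * norm t ^ n" using assms(2) by (simp flip: power_add)
      finally show ?case using elim by simp
    qed
    have "((\<lambda>t::complex. K * norm t ^ (m - n)) \<longlongrightarrow> K * norm (0::complex) ^ (m - n)) (at 0)" by (intro tendsto_intros)
    then show "((\<lambda>t::complex. K * norm t ^ (m - n)) \<longlongrightarrow> 0) (at 0)" using assms(2) by (simp add: power_0_left)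
  qed
  then show ?thesis by (simp add: LIM_zero_iff)
qed

lemma E8_arc_norm: "norm t < 1 \<Longrightarrow> norm (E8_arc t) \<le> 2 * norm t ^ 3"
proof -
  assume t: "norm t < 1"
  have "norm (E8_arc t) \<le> norm t ^ 5 + norm t ^ 3" unfolding E8_arc_def using norm_Pair_le[of "- (t ^ 5)" "t ^ 3"] by (simp add: norm_power)
  moreover have "norm t ^ 5 \<le> norm t ^ 3" using t by (intro power_decreasing) auto
  ultimately show ?thesis by simp
qed

lemma hom_poly_fun_linear:
  assumes "hom_poly_fun 1 H" obtains \<alpha> \<beta> \<gamma> where "\<And>x. H x = \<alpha> * x$1 + \<beta> * x$2 + \<gamma> * x$3"
proof -
  obtain c where c: "\<And>x. H x = (\<Sum>i\<le>1. \<Sum>j\<le>1 - i. c i j * (x$1)^i * (x$2)^j * (x$3)^(1 - i - j))"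
    using assms unfolding hom_poly_fun_def by blast
  show thesis by (rule that[of "c 1 0" "c 0 1" "c 0 0"]) (simp add: c)
qed

theorem E8_normal_form:
  assumes F: "hom_poly_fun 6 F" "\<And>x. F x = G x * H x" and G: "hom_poly_fun a G" and H: "hom_poly_fun b H" and ab: "a \<ge> 1" "b \<ge> 1" "a + b = 6"
    and t: "has_type F (proj_pt p0) E8"
  shows "\<exists>q h. nform_data q h \<and> (F, nform q h) \<in> proj_equiv"
proof -
  have "\<exists>G H. (\<forall>x. F x = G x * H x) \<and> (\<exists>a b. hom_poly_fun a G \<and> hom_poly_fun b H \<and> b \<ge> 1 \<and> b \<le> a \<and> a + b = 6)"
  proof (cases "b \<le> a")
    case True then show ?thesis using F G H ab by blast
  next
    case False
    have "F x = H x * G x" for x using F(2) by (simp add: mult.commute)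
    moreover have "1 \<le> a \<and> a \<le> b \<and> b + a = 6" using ab False by auto
    ultimately show ?thesis using G H by blast
  qed
  then obtain G H a b where F': "\<And>x. F x = G x * H x" and G: "hom_poly_fun a G" and H: "hom_poly_fun b H" and ab: "b \<ge> 1" "b \<le> a" "a + b = 6"
    by blast
  obtain M where M: "invertible M" "germ_equiv (chart F M) (normal_form E8)" using has_typeE[OF t] by metis
  obtain m11 m12 m21 m22 p r u where lin: "m11 * m22 - m12 * m21 \<noteq> 0" "u 0 \<noteq> 0" "isCont u 0"
    "\<exists>K. \<forall>\<^sub>F z in nhds 0. norm (p z - fst z) \<le> K * norm z ^ 2" "\<exists>K. \<forall>\<^sub>F z in nhds 0. norm (r z - snd z) \<le> K * norm z ^ 2"
    "\<forall>\<^sub>F z in nhds 0. chart F M (m11 * p z + m12 * r z, m21 * p z + m22 * r z) = u z * normal_form E8 z"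
    by (rule germ_equiv_linear_part[OF M(2)])
  \<comment> \<open>\<open>N\<close> carries the linear part of the local change, so that the arc
    acquires the exact leading terms \<open>- t^5\<close> and \<open>t^3\<close>.\<close>
  define N :: "complex^3^3" where "N = vector [vector [1, 0, 0], vector [0, m11, m12], vector [0, m21, m22]]"
  have N: "N *v pt3 x y z = pt3 x (m11 * y + m12 * z) (m21 * y + m22 * z)" for x y z
    by (simp add: vec_eq_iff forall_3 matrix_vector_mult_nth3 N_def vector_3)
  have "det N = m11 * m22 - m12 * m21" by (simp add: det_3 N_def vector_3)
  then have "invertible N" using lin(1) by (simp add: invertible_det_nz)
  then have MN: "invertible (M ** N)" using M(1) invertible_mult by blast
  define G' H' where "G' x = G ((M ** N) *v x)" and "H' x = H ((M ** N) *v x)" for x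
  have G': "hom_poly_fun a G'" and H': "hom_poly_fun b H'" unfolding G'_def H'_def using G H hom_poly_fun_matrix by blast+
  have FN: "F ((M ** N) *v x) = G' x * H' x" for x by (simp add: F' G'_def H'_def)
  have germ: "\<forall>\<^sub>F z in nhds 0. G' (pt3 1 (p z) (r z)) * H' (pt3 1 (p z) (r z)) = u z * normal_form E8 z"
    using lin(6)
  proof eventually_elim
    case (elim z)
    have "(M ** N) *v pt3 1 (p z) (r z) = M *v (N *v pt3 1 (p z) (r z))" by (simp only: matrix_vector_mul_assoc)
    then have "G' (pt3 1 (p z) (r z)) * H' (pt3 1 (p z) (r z)) = chart F M (m11 * p z + m12 * r z, m21 * p z + m22 * r z)"
      by (simp add: chart_def N flip: FN)
    then show ?case using elim by simp
  qed
  obtain K1 K2 where K: "\<forall>\<^sub>F z in nhds 0. norm (p z - fst z) \<le> K1 * norm z ^ 2" "\<forall>\<^sub>F z in nhds 0. norm (r z - snd z) \<le> K2 * norm z ^ 2"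
    using lin(4,5) by blast
  have small: "\<forall>\<^sub>F t in at 0. norm (t::complex) < 1" unfolding eventually_at by (intro exI[of _ 1]) auto
  have err: "\<forall>\<^sub>F t in at 0. norm (l (E8_arc t)) \<le> (4 * \<bar>K\<bar>) * norm t ^ 6"
    if "\<forall>\<^sub>F z in nhds 0. norm (l z) \<le> K * norm z ^ 2" for l :: "complex \<times> complex \<Rightarrow> complex" and K
    using eventually_compose_filterlim[OF that E8_arc_filterlim(1)] small
  proof eventually_elim
    case (elim t)
    have "norm (l (E8_arc t)) \<le> \<bar>K\<bar> * norm (E8_arc t) ^ 2" using elim(1) by (meson abs_ge_self mult_right_mono order_trans zero_le_power2)
    also have "\<dots> \<le> \<bar>K\<bar> * (2 * norm t ^ 3) ^ 2" using E8_arc_norm[OF elim(2)] by (intro mult_left_mono power_mono) auto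
    finally show ?case by (simp add: power_mult_distrib flip: power_mult)
  qed
  have pt: "((\<lambda>t. p (E8_arc t) / t ^ 5) \<longlongrightarrow> -1) (at 0)"
    by (rule tendsto_of_error[where m=6]) (use err[OF K(1)] in \<open>simp_all add: E8_arc_def\<close>)
  have rt: "((\<lambda>t. r (E8_arc t) / t ^ 3) \<longlongrightarrow> 1) (at 0)"
    by (rule tendsto_of_error[where m=6]) (use err[OF K(2)] in \<open>simp_all add: E8_arc_def\<close>)
  have zero: "\<forall>\<^sub>F t in at 0. G' (pt3 1 (p (E8_arc t)) (r (E8_arc t))) * H' (pt3 1 (p (E8_arc t)) (r (E8_arc t))) = 0"
    using eventually_compose_filterlim[OF germ E8_arc_filterlim(1)]
  proof eventually_elim
    case (elim t)
    have "normal_form E8 (E8_arc t) = 0" by (simp add: E8_arc_def normal_form.simps flip: power_mult)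
    then show ?case using elim by simp
  qed
  \<comment> \<open>A second test curve: at the points \<open>(t, 0)\<close> the normal form equals
    \<open>t^3\<close>, so the product of the two factors has order exactly 3.\<close>
  have err1: "\<forall>\<^sub>F t in at 0. norm (l (t, 0)) \<le> K * norm t ^ 2"
    if "\<forall>\<^sub>F z in nhds 0. norm (l z) \<le> K * norm z ^ 2" for l :: "complex \<times> complex \<Rightarrow> complex" and K
    using eventually_compose_filterlim[OF that E8_arc_filterlim(2)] by simp
  have p1: "((\<lambda>t. p (t, 0) / t ^ 1) \<longlongrightarrow> 1) (at 0)"
    by (rule tendsto_of_error[where m=2]) (use err1[OF K(1)] in simp_all)
  have r1: "((\<lambda>t. r (t, 0) / t ^ 1) \<longlongrightarrow> 0) (at 0)"
    by (rule tendsto_of_error[where m=2]) (use err1[OF K(2)] in simp_all)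
  have "(u \<longlongrightarrow> u 0) (nhds 0)" using lin(3) by (metis isCont_def tendsto_at_iff_tendsto_nhds)
  then have u1: "((\<lambda>t. u (t, 0)) \<longlongrightarrow> u 0) (at 0)" using filterlim_compose E8_arc_filterlim(2) by blast
  have germ1: "\<forall>\<^sub>F t in at 0. G' (pt3 1 (p (t, 0)) (r (t, 0))) * H' (pt3 1 (p (t, 0)) (r (t, 0))) / t ^ 3 = u (t, 0)"
    using eventually_compose_filterlim[OF germ E8_arc_filterlim(2)] eventually_neq_at_within[of "0::complex" 0 UNIV]
    by eventually_elim (simp add: normal_form.simps)
  have nz: "G' \<noteq> (\<lambda>_. 0) \<and> H' \<noteq> (\<lambda>_. 0)"
  proof (rule ccontr)
    assume "\<not> ?thesis"
    then have "\<forall>\<^sub>F t in at 0. u (t, 0) = 0" using germ1 by auto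
    then have "((\<lambda>t. u (t, 0)) \<longlongrightarrow> 0) (at 0)" by (rule tendsto_eventually)
    then show False using u1 lin(2) tendsto_unique[OF at_neq_bot] by blast
  qed
  have Hnz: "\<forall>\<^sub>F t in at 0. H' (pt3 1 (p (E8_arc t)) (r (E8_arc t))) \<noteq> 0"
    using arc_nonzero[OF H' _ _ pt rt] nz ab by auto
  have a5: "a = 5"
  proof (rule ccontr)
    assume "a \<noteq> 5"
    then have "\<forall>\<^sub>F t in at 0. G' (pt3 1 (p (E8_arc t)) (r (E8_arc t))) \<noteq> 0"
      using arc_nonzero[OF G' _ _ pt rt] nz ab by auto
    then have "\<forall>\<^sub>F t in at (0::complex). False" using Hnz zero by eventually_elim auto
    then show False by simp
  qed
  then have b1: "b = 1" using ab by simp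
  have z: "\<forall>\<^sub>F t in at 0. G' (pt3 1 (p (E8_arc t)) (r (E8_arc t))) = 0" using Hnz zero by eventually_elim auto
  have G5: "hom_poly_fun 5 G'" and H1: "hom_poly_fun 1 H'" using G' H' a5 b1 by auto
  from arc_quintic[OF G5 conjunct1[OF nz] pt rt z] obtain k and B C :: "nat \<Rightarrow> complex" where
    kG: "k \<noteq> 0 \<and> (\<forall>x. G' x = k * ((x$1)^2 * (x$2)^3 + (x$3)^5) + x$1 * (x$2)^2 * (B 0 * (x$2)^2 + B 1 * x$2 * x$3 + B 2 * (x$3)^2)
     + (C 0 * (x$2)^5 + C 1 * (x$2)^4 * x$3 + C 2 * (x$2)^3 * (x$3)^2 + C 3 * (x$2)^2 * (x$3)^3 + C 4 * x$2 * (x$3)^4))"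
    by (elim exE) (rule that)
  have k: "k \<noteq> 0" and Gf: "G' x = k * ((x$1)^2 * (x$2)^3 + (x$3)^5) + x$1 * (x$2)^2 * (B 0 * (x$2)^2 + B 1 * x$2 * x$3 + B 2 * (x$3)^2)
     + (C 0 * (x$2)^5 + C 1 * (x$2)^4 * x$3 + C 2 * (x$2)^3 * (x$3)^2 + C 3 * (x$2)^2 * (x$3)^3 + C 4 * x$2 * (x$3)^4)" for x
    using conjunct1[OF kG] spec[OF conjunct2[OF kG], of x] .
  obtain \<alpha> \<beta> \<gamma> where Hf: "\<And>x. H' x = \<alpha> * x$1 + \<beta> * x$2 + \<gamma> * x$3"
    by (rule hom_poly_fun_linear[OF H1]) (rule that; assumption)
  \<comment> \<open>If the line passed through the point, the linear factor would raise the order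
    along the second test curve to at least 4.\<close>
  have al: "\<alpha> \<noteq> 0"
  proof
    assume 0: "\<alpha> = 0"
    define P R where "P t = p (t, 0) / t ^ 1" and "R t = r (t, 0) / t ^ 1" for t
    have lim: "((\<lambda>t. (k * (P t ^ 3 + t\<^sup>2 * R t ^ 5) + t * (P t)\<^sup>2 * (B 0 * (P t)\<^sup>2 + B 1 * P t * R t + B 2 * (R t)\<^sup>2)
       + t\<^sup>2 * (C 0 * P t ^ 5 + C 1 * P t ^ 4 * R t + C 2 * P t ^ 3 * (R t)\<^sup>2 + C 3 * (P t)\<^sup>2 * R t ^ 3 + C 4 * P t * R t ^ 4)) * (t * (\<beta> * P t + \<gamma> * R t))) \<longlongrightarrow>
       (k * (1 ^ 3 + 0\<^sup>2 * 0 ^ 5) + 0 * 1\<^sup>2 * (B 0 * 1\<^sup>2 + B 1 * 1 * 0 + B 2 * 0\<^sup>2)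
       + 0\<^sup>2 * (C 0 * 1 ^ 5 + C 1 * 1 ^ 4 * 0 + C 2 * 1 ^ 3 * 0\<^sup>2 + C 3 * 1\<^sup>2 * 0 ^ 3 + C 4 * 1 * 0 ^ 4)) * (0 * (\<beta> * 1 + \<gamma> * 0))) (at 0)"
      using p1[folded P_def] r1[folded R_def] by (intro tendsto_intros)
    have "\<forall>\<^sub>F t in at 0. (k * (P t ^ 3 + t\<^sup>2 * R t ^ 5) + t * (P t)\<^sup>2 * (B 0 * (P t)\<^sup>2 + B 1 * P t * R t + B 2 * (R t)\<^sup>2)
       + t\<^sup>2 * (C 0 * P t ^ 5 + C 1 * P t ^ 4 * R t + C 2 * P t ^ 3 * (R t)\<^sup>2 + C 3 * (P t)\<^sup>2 * R t ^ 3 + C 4 * P t * R t ^ 4)) * (t * (\<beta> * P t + \<gamma> * R t)) = u (t, 0)"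
      using germ1 eventually_neq_at_within[of "0::complex" 0 UNIV]
    proof eventually_elim
      case (elim t)
      have e: "p (t, 0) = t * P t" "r (t, 0) = t * R t" using elim by (simp_all add: P_def R_def)
      have "G' (pt3 1 (t * P t) (t * R t)) * H' (pt3 1 (t * P t) (t * R t)) = t ^ 3 * ((k * (P t ^ 3 + t\<^sup>2 * R t ^ 5) + t * (P t)\<^sup>2 * (B 0 * (P t)\<^sup>2 + B 1 * P t * R t + B 2 * (R t)\<^sup>2)
       + t\<^sup>2 * (C 0 * P t ^ 5 + C 1 * P t ^ 4 * R t + C 2 * P t ^ 3 * (R t)\<^sup>2 + C 3 * (P t)\<^sup>2 * R t ^ 3 + C 4 * P t * R t ^ 4)) * (t * (\<beta> * P t + \<gamma> * R t)))"
        by (simp add: Gf Hf 0 power2_eq_square power3_eq_cube power5_expand algebra_simps)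
      then show ?case using elim unfolding e by simp
    qed
    from Lim_transform_eventually[OF lim this] have "((\<lambda>t. u (t, 0)) \<longlongrightarrow> 0) (at 0)" by simp
    then show False using u1 lin(2) tendsto_unique[OF at_neq_bot] by blast
  qed
  \<comment> \<open>Chosen so that \<open>H' (T x) = x$1\<close>. The other two coordinates are
    kept, and the terms that arise are absorbed into \<open>q\<close> and \<open>h\<close>.\<close>
  define T :: "complex^3^3" where "T = vector [vector [1 / \<alpha>, - \<beta> / \<alpha>, - \<gamma> / \<alpha>], vector [0, 1, 0], vector [0, 0, 1]]"
  have T: "(T *v x)$1 = (x$1 - \<beta> * x$2 - \<gamma> * x$3) / \<alpha>" "(T *v x)$2 = x$2" "(T *v x)$3 = x$3" for x
    using al by (simp_all add: matrix_vector_mult_nth3 T_def vector_3 field_simps)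
  have "det T = 1 / \<alpha>" by (simp add: det_3 T_def vector_3)
  then have iT: "invertible ((M ** N) ** T)" 
    using al by (intro invertible_mult[OF MN]) (simp add: invertible_det_nz)
  \<comment> \<open>Substituting \<open>T\<close> puts \<open>k / \<alpha>^2\<close> in front of
    \<open>(x$1)^2 (x$2)^3\<close>; the factor \<open>e\<close> makes it 1, as in
    \<open>nform\<close>.\<close>
  define e where "e = \<alpha>\<^sup>2 / k"
  have e0: "e \<noteq> 0" using al k by (simp add: e_def)
  define b0 b1 b2 where "b0 = e * B 0 / \<alpha> - 2 * \<beta>" and "b1 = e * B 1 / \<alpha> - 2 * \<gamma>" and "b2 = e * B 2 / \<alpha>"
  define q where "q = [:b0 / 2, b1 / 2, b2 / 2:]"
  define h where "h = [: e * C 0 + \<beta>\<^sup>2 - \<beta> * (e * B 0 / \<alpha>), e * C 1 + 2 * \<beta> * \<gamma> - \<beta> * (e * B 1 / \<alpha>) - \<gamma> * (e * B 0 / \<alpha>),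
     e * C 2 + \<gamma>\<^sup>2 - \<beta> * (e * B 2 / \<alpha>) - \<gamma> * (e * B 1 / \<alpha>), e * C 3 - \<gamma> * (e * B 2 / \<alpha>), e * C 4, e * k :]"
  have data: "nform_data q h"
  proof
    show "degree q \<le> 2" unfolding q_def by (simp add: degree_pCons_eq_if)
    show "degree h = 5" unfolding h_def using e0 k by (simp add: degree_pCons_eq_if)
  qed
  have cq: "coeff q 0 = b0 / 2" "coeff q 1 = b1 / 2" "coeff q 2 = b2 / 2" by (simp_all add: q_def numeral_2_eq_2)
  have ch: "coeff h 0 = e * C 0 + \<beta>\<^sup>2 - \<beta> * (e * B 0 / \<alpha>)" "coeff h 1 = e * C 1 + 2 * \<beta> * \<gamma> - \<beta> * (e * B 1 / \<alpha>) - \<gamma> * (e * B 0 / \<alpha>)"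
     "coeff h 2 = e * C 2 + \<gamma>\<^sup>2 - \<beta> * (e * B 2 / \<alpha>) - \<gamma> * (e * B 1 / \<alpha>)" "coeff h 3 = e * C 3 - \<gamma> * (e * B 2 / \<alpha>)"
     "coeff h 4 = e * C 4" "coeff h 5 = e * k" by (simp_all add: h_def eval_nat_numeral)
  have "nform q h x = e * F (((M ** N) ** T) *v x)" for x
  proof -
    have 1: "F (((M ** N) ** T) *v x) = G' (T *v x) * H' (T *v x)"
      by (simp only: FN[symmetric] matrix_vector_mul_assoc)
    have 2: "H' (T *v x) = x$1" using al by (simp add: Hf T)
    define y where "y = x$1 - \<beta> * x$2 - \<gamma> * x$3"
    have ek: "e * k = \<alpha>\<^sup>2" using k by (simp add: e_def)
    have "e * G' (T *v x) = e * k * ((y / \<alpha>)^2 * (x$2)^3 + (x$3)^5) + y * (x$2)^2 * ((e * B 0 / \<alpha>) * (x$2)^2 + (e * B 1 / \<alpha>) * x$2 * x$3 + (e * B 2 / \<alpha>) * (x$3)^2)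
     + e * (C 0 * (x$2)^5 + C 1 * (x$2)^4 * x$3 + C 2 * (x$2)^3 * (x$3)^2 + C 3 * (x$2)^2 * (x$3)^3 + C 4 * x$2 * (x$3)^4)"
      using al unfolding Gf T y_def[symmetric] by (simp add: field_simps)
    also have "e * k * ((y / \<alpha>)^2 * (x$2)^3 + (x$3)^5) = y^2 * (x$2)^3 + e * k * (x$3)^5"
      using al unfolding ek by (simp add: field_simps)
    finally have 3: "e * G' (T *v x) = y^2 * (x$2)^3 + e * k * (x$3)^5 + y * (x$2)^2 * ((e * B 0 / \<alpha>) * (x$2)^2 + (e * B 1 / \<alpha>) * x$2 * x$3 + (e * B 2 / \<alpha>) * (x$3)^2)
     + e * (C 0 * (x$2)^5 + C 1 * (x$2)^4 * x$3 + C 2 * (x$2)^3 * (x$3)^2 + C 3 * (x$2)^2 * (x$3)^3 + C 4 * x$2 * (x$3)^4)" .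
    define f0 f1 f2 where "f0 = e * B 0 / \<alpha>" and "f1 = e * B 1 / \<alpha>" and "f2 = e * B 2 / \<alpha>"
    have "e * G' (T *v x) = (x$2)^3 * (x$1)^2 + 2 * (x$2)^2 * homog 2 q (x$3) (x$2) * x$1 + homog 5 h (x$3) (x$2)"
      unfolding 3 homog_2 homog_5 cq ch b0_def b1_def b2_def f0_def[symmetric] f1_def[symmetric] f2_def[symmetric] y_def
      by (simp add: power2_eq_square power3_eq_cube power5_expand field_simps)
    then show ?thesis unfolding 1 2 nform_def by (simp add: mult_ac)
  qed
  then have "(F, nform q h) \<in> proj_equiv" unfolding proj_equiv_def using iT e0 by blast
  then show ?thesis using data by blast
qed

section \<open>Solving for the pairs of quintics\<close>

text \<open>Monic polynomials are presented by lists of roots with multiplicities, so that the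
  explicit models can be evaluated by rewriting.\<close>

definition fac :: "(complex \<times> nat) list \<Rightarrow> complex poly" where
  "fac l = prod_list (map (\<lambda>(a, k). [:-a, 1:] ^ k) l)"

lemma fac_simps [simp]: "fac [] = 1" "fac ((a, k) # l) = [:-a, 1:] ^ k * fac l"
  by (simp_all add: fac_def)

lemma fac_nz: "fac l \<noteq> 0"
  by (induction l) auto

definition mult_in :: "(complex \<times> nat) list \<Rightarrow> complex \<Rightarrow> nat" where
  "mult_in l x = (case map_of l x of None \<Rightarrow> 0 | Some k \<Rightarrow> k)"

lemma order_linear_power: "order x ([:-a, 1:] ^ k) = (if x = a then k else 0)" for x a :: complex
  by (auto simp: order_power_n_n intro: order_0I)

lemma order_fac: "distinct (map fst l) \<Longrightarrow> order x (fac l) = mult_in l x"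
proof (induction l)
  case (Cons y l)
  obtain a k where y: "y = (a, k)" by (cases y)
  have n: "map_of l a = None" using Cons.prems by (simp add: y map_of_eq_None_iff)
  have "order x (fac (y # l)) = order x ([:-a, 1:] ^ k) + order x (fac l)"
    unfolding y fac_simps by (rule order_mult) (simp add: fac_nz)
  then show ?case using Cons n by (auto simp: y mult_in_def order_linear_power)
qed (simp add: mult_in_def)

lemma degree_fac: "degree (fac l) = sum_list (map snd l)"
proof (induction l)
  case (Cons y l)
  obtain a k where y: "y = (a, k)" by (cases y)
  show ?case using Cons fac_nz[of l] by (simp add: y degree_mult_eq degree_linear_power)
qed simp

lemma pcompose_power: "pcompose (p ^ n) q = pcompose p q ^ n" for p q :: "complex poly"
  by (induction n) (simp_all add: pcompose_mult pcompose_1)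

lemma pcompose_fac:
  assumes "a \<noteq> 0"
  shows "pcompose (fac l) [:b, a:] = smult (a ^ sum_list (map snd l)) (fac (map (\<lambda>(r, k). ((r - b) / a, k)) l))"
proof (induction l)
  case (Cons y l)
  obtain r k where y: "y = (r, k)" by (cases y)
  have "pcompose [:-r, 1:] [:b, a:] = smult a [:- ((r - b) / a), 1:]" using assms by (simp add: pcompose_pCons field_simps)
  then have "pcompose ([:-r, 1:] ^ k) [:b, a:] = smult (a ^ k) ([:- ((r - b) / a), 1:] ^ k)"
    by (simp only: pcompose_power smult_power)
  then show ?case using Cons by (simp add: y pcompose_mult power_add mult_ac)
qed (simp add: pcompose_1)

text \<open>Affine changes of the coordinate on the base combined with rescaling of the fibre.\<close>
definition affinely_equivalent :: "complex poly \<Rightarrow> complex poly \<Rightarrow> complex poly \<Rightarrow> complex poly \<Rightarrow> bool" where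
  "affinely_equivalent p q p' q' \<longleftrightarrow> (\<exists>a b k. a \<noteq> 0 \<and> k \<noteq> 0 \<and> p' = smult (k\<^sup>2) (pcompose p [:b, a:]) \<and> q' = smult k (pcompose q [:b, a:]))"

text \<open>Since \<open>q^2 - p\<close> scales in the same way as \<open>p\<close>, either of the
  two quintics may be brought to normal form.\<close>

lemma affinely_equivalent_complement:
  assumes "affinely_equivalent p q p' q'" shows "affinely_equivalent (q\<^sup>2 - p) q (q'\<^sup>2 - p') q'"
proof -
  obtain a b k where h: "a \<noteq> 0" "k \<noteq> 0" "p' = smult (k\<^sup>2) (pcompose p [:b, a:])" "q' = smult k (pcompose q [:b, a:])"
    using assms unfolding affinely_equivalent_def by blast
  have "q'\<^sup>2 - p' = smult (k\<^sup>2) (pcompose (q\<^sup>2 - p) [:b, a:])"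
    unfolding h(3,4) by (simp add: pcompose_diff power2_eq_square pcompose_mult smult_diff_right)
  then show ?thesis unfolding affinely_equivalent_def using h by blast
qed

lemma degree_2_eq: "degree q \<le> 2 \<Longrightarrow> q = [:coeff q 0, coeff q 1, coeff q 2:]" for q :: "complex poly"
  by (rule poly_eqI) (auto simp: coeff_pCons coeff_eq_0 split: nat.split simp flip: numeral_2_eq_2)

lemma pcompose_degree_le: "degree q \<le> n \<Longrightarrow> degree (pcompose q [:b, a:]) \<le> n" for q :: "complex poly"
  by (metis degree_pCons_le degree_pcompose degree_0 le_trans mult.right_neutral mult_le_mono2 One_nat_def degree_pCons_eq_if le_refl mult_0_right zero_le)

text \<open>The affine map puts two roots at prescribed places, and \<open>k\<close> with
  \<open>k^2 = 1 / (c a^5)\<close> makes the first quintic monic and the second minus a monic one.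
  What remains is that a difference of two monic quintics is a square, to be solved
  coefficientwise.\<close>

lemma normalize_pair:
  fixes a b c :: complex
  assumes p: "p = smult c (fac l)" "q\<^sup>2 - p = smult (- c) (fac l')" "c \<noteq> 0" "degree q \<le> 2"
    and s: "sum_list (map snd l) = 5" "sum_list (map snd l') = 5" and a: "a \<noteq> 0"
  defines "m \<equiv> map (\<lambda>(r, k). ((r - b) / a, k))"
  shows "\<exists>k q0 q1 q2. k \<noteq> 0 \<and> smult (k\<^sup>2) (pcompose p [:b, a:]) = fac (m l) \<and> smult k (pcompose q [:b, a:]) = [:q0, q1, q2:]
     \<and> fac (m l) - fac (m l') = [:q0, q1, q2:]\<^sup>2"
proof -
  define A where "A = c * a ^ 5"
  have A0: "A \<noteq> 0" using p a by (simp add: A_def)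
  obtain k where k: "k ^ 2 = 1 / A" using complex_root_exists[of 2 "1 / A"] by auto
  have k0: "k \<noteq> 0" using k A0 by auto
  have 1: "smult (k\<^sup>2) (pcompose p [:b, a:]) = fac (m l)"
    unfolding p(1) pcompose_smult pcompose_fac[OF a] s m_def k using A0 by (simp add: A_def)
  have "smult (k\<^sup>2) (pcompose (q\<^sup>2 - p) [:b, a:]) = - fac (m l')"
    unfolding p(2) pcompose_smult pcompose_fac[OF a] s m_def k using A0 by (simp add: A_def)
  then have "smult (k\<^sup>2) (pcompose (q\<^sup>2) [:b, a:]) - fac (m l) = - fac (m l')"
    using 1 by (simp add: pcompose_diff smult_diff_right)
  then have 2: "fac (m l) - fac (m l') = (smult k (pcompose q [:b, a:]))\<^sup>2"
    by (simp add: power2_eq_square pcompose_mult algebra_simps)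
  have "degree (smult k (pcompose q [:b, a:])) \<le> 2" using pcompose_degree_le[OF p(4)] k0 by simp
  from degree_2_eq[OF this] show ?thesis using 1 2 k0 by metis
qed

lemma affinely_equivalentI:
  assumes "a \<noteq> 0" "k \<noteq> 0" "smult (k\<^sup>2) (pcompose p [:b, a:]) = p'" "smult k (pcompose q [:b, a:]) = q' \<or> smult k (pcompose q [:b, a:]) = - q'"
  shows "affinely_equivalent p q p' q'"
proof -
  have "q' = smult k (pcompose q [:b, a:]) \<or> q' = smult (- k) (pcompose q [:b, a:])" using assms(4) by auto
  then show ?thesis unfolding affinely_equivalent_def using assms by (metis neg_equal_0_iff_equal power2_minus)
qed

lemma square_quadratic: "[:q0, q1, q2:]\<^sup>2 = [:q0\<^sup>2, 2 * q0 * q1, q1\<^sup>2 + 2 * q0 * q2, 2 * q1 * q2, q2\<^sup>2:]" for q0 q1 q2 :: complex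
  by (simp add: eval_nat_numeral algebra_simps)

lemma coeffs_eqD:
  assumes "[:a0, a1, a2, a3, a4:] = [:b0, b1, b2, b3, b4:]"
  shows "b0 = a0" "b1 = a1" "b2 = a2" "b3 = a3" "b4 = a4"
  using assms by auto

section \<open>Coefficient comparison for each distribution of multiplicities\<close>

text \<open>The triple root at 0 does not affect the three lowest coefficients, and these determine
  the square root up to sign.\<close>

lemma solve_5_311:
  assumes "fac [(-1, 5)] - fac [(0, 3), (c, 1), (d, 1)] = [:q0, q1, q2:]\<^sup>2"
  shows "[:q0, q1, q2:] = [:1, 5/2, 15/8:] \<or> [:q0, q1, q2:] = - [:1, 5/2, 15/8:]"
proof -
  have lhs: "fac [(-1, 5)] - fac [(0, 3), (c, 1), (d, 1)] = [:1, 5, 10, 10 - c * d, 5 + c + d:]"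
    by (simp add: eval_nat_numeral algebra_simps)
  have e: "q0\<^sup>2 = 1" "2 * q0 * q1 = 5" "q1\<^sup>2 + 2 * q0 * q2 = 10"
    using assms[unfolded lhs square_quadratic] by simp_all
  then consider "q0 = 1" | "q0 = -1" using power2_eq_1_iff by blast
  then show ?thesis
  proof cases
    case 1
    then have "q1 = 5/2" using e(2) by algebra
    then have "q2 = 15/8" using e(3) 1 by algebra
    then show ?thesis using 1 \<open>q1 = 5/2\<close> by simp
  next
    case 2
    then have "q1 = -5/2" using e(2) by algebra
    then have "q2 = -15/8" using e(3) 2 by algebra
    then show ?thesis using 2 \<open>q1 = -5/2\<close> by simp
  qed
qed

text \<open>A common root at 0 forces \<open>q0 = 0\<close>, then \<open>e = q1^2\<close>;
  eliminating \<open>q2\<close> from the last two coefficients leaves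
  \<open>4 q1^2 = 1\<close>.\<close>

lemma solve_5_common:
  assumes "fac [(0, 5)] - fac [(0, 2), (1, 2), (e, 1)] = [:q0, q1, q2:]\<^sup>2"
  shows "[:q0, q1, q2:] = [:0, 1/2, -3/2:] \<or> [:q0, q1, q2:] = - [:0, 1/2, -3/2:]"
proof -
  have lhs: "fac [(0, 5)] - fac [(0, 2), (1, 2), (e, 1)] = [:0, 0, e, - (2 * e + 1), e + 2:]"
    by (simp add: eval_nat_numeral algebra_simps)
  note c = coeffs_eqD[OF assms[unfolded lhs square_quadratic]]
  have q0: "q0 = 0" using c(1) by simp
  then have e: "e = q1\<^sup>2" using c(3) by simp
  have c': "2 * q1 * q2 = - (2 * q1\<^sup>2 + 1)" "q2\<^sup>2 = q1\<^sup>2 + 2" using c(4,5) unfolding e by this+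
  have "4 * q1\<^sup>2 = 1" using c' by algebra
  then have "(2 * q1)\<^sup>2 = 1" "2 * q1 * q2 = - (3 / 2)" using c' by algebra+
  then consider "2 * q1 = 1" "2 * q1 * q2 = - (3 / 2)" | "2 * q1 = -1" "2 * q1 * q2 = - (3 / 2)" using power2_eq_1_iff by blast
  then show ?thesis
  proof cases
    case 1
    then have "q1 = 1 / 2" "q2 = - 3 / 2" by algebra+
    then show ?thesis using q0 by simp
  next
    case 2
    then have "q1 = - 1 / 2" "q2 = 3 / 2" by algebra+
    then show ?thesis using q0 by simp
  qed
qed

text \<open>In terms of \<open>w = 1 / q0^2 = 1 / r\<close> everything reduces to
  \<open>w^2 - 4 w + 8 = 0\<close>, whose two conjugate roots produce two models with the same
  singularities.\<close>

lemma solve_41_41: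
  assumes "fac [(0, 4), (p, 1)] - fac [(1, 4), (r, 1)] = [:q0, q1, q2:]\<^sup>2"
  shows "r \<noteq> 0 \<and> p = 1 - r \<and> q0\<^sup>2 = r \<and> (1 / r = 2 + 2 * \<i> \<or> 1 / r = 2 - 2 * \<i>) \<and>
     [:q0, q1, q2:] = smult q0 [:1, - (1 / r + 4) / 2, (1 / r + 4) / 2:]"
proof -
  have lhs: "fac [(0, 4), (p, 1)] - fac [(1, 4), (r, 1)] = [:r, - (1 + 4 * r), 4 + 6 * r, - (6 + 4 * r), 4 + r - p:]"
    by (simp add: eval_nat_numeral algebra_simps)
  note c = coeffs_eqD[OF assms[unfolded lhs square_quadratic]]
  have r: "r = q0\<^sup>2" using c(1) by simp
  have c': "2 * q0 * q1 = - (1 + 4 * q0\<^sup>2)" "q1\<^sup>2 + 2 * q0 * q2 = 4 + 6 * q0\<^sup>2" "2 * q1 * q2 = - (6 + 4 * q0\<^sup>2)"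
    "q2\<^sup>2 = 4 + q0\<^sup>2 - p" using c unfolding r by auto
  have q0: "q0 \<noteq> 0" using c'(1) by auto
  define w where "w = 1 / q0\<^sup>2"
  have w: "w * q0\<^sup>2 = 1" using q0 by (simp add: w_def)
  have q1: "2 * q1 = - q0 * (w + 4)"
  proof -
    have "q0 * (2 * q1 + q0 * (w + 4)) = 0" using c'(1) w by algebra
    then have "2 * q1 + q0 * (w + 4) = 0" using q0 by simp
    then show ?thesis by algebra
  qed
  have q2: "8 * q2 = q0 * (8 + 8 * w - w\<^sup>2)"
  proof -
    have "q0 * (8 * q2 - q0 * (8 + 8 * w - w\<^sup>2)) = 0" using c'(2) q1 w by algebra
    then have "8 * q2 - q0 * (8 + 8 * w - w\<^sup>2) = 0" using q0 by simp
    then show ?thesis by algebra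
  qed
  have "w\<^sup>2 - 4 * w + 8 = 0" using c'(3) q1 q2 w by algebra
  then have w2: "w\<^sup>2 = 4 * w - 8" by algebra
  have "\<i> * \<i> = -1" by simp
  then have "(w - (2 + 2 * \<i>)) * (w - (2 - 2 * \<i>)) = 0" using w2 by algebra
  then have "w = 2 + 2 * \<i> \<or> w = 2 - 2 * \<i>" by (simp only: mult_eq_0_iff right_minus_eq)
  moreover have "q2 = q0 * ((w + 4) / 2)" using q2 w2 by algebra
  moreover have "q1 = q0 * (- (w + 4) / 2)" using q1 by algebra
  moreover have "p = 1 - q0\<^sup>2" using c'(4) q2 w2 w by algebra
  ultimately show ?thesis using r q0 unfolding r w_def[symmetric] by simp
qed

text \<open>The constant coefficient gives \<open>q0 = s r\<close> with a sign \<open>s\<close>; the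
  next two are linear in \<open>q1\<close> and \<open>q2\<close> unless \<open>r = 0\<close>, the
  case of a common root, and the cubic coefficient then leaves \<open>r = 6\<close>.\<close>

lemma solve_41_32:
  assumes "fac [(0, 4), (p, 1)] - fac [(1, 3), (r, 2)] = [:q0, q1, q2:]\<^sup>2"
  shows "(r = 0 \<and> p = 3/4 \<and> ([:q0, q1, q2:] = [:0, 1, -3/2:] \<or> [:q0, q1, q2:] = - [:0, 1, -3/2:])) \<or>
    (r = 6 \<and> p = 15/16 \<and> ([:q0, q1, q2:] = [:6, -10, 15/4:] \<or> [:q0, q1, q2:] = - [:6, -10, 15/4:]))"
proof -
  have lhs: "fac [(0, 4), (p, 1)] - fac [(1, 3), (r, 2)] = [:r\<^sup>2, - 2 * r - 3 * r\<^sup>2, 1 + 6 * r + 3 * r\<^sup>2, - 3 - 6 * r - r\<^sup>2, 3 + 2 * r - p:]"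
    by (simp add: eval_nat_numeral algebra_simps)
  note c = coeffs_eqD[OF assms[unfolded lhs square_quadratic]]
  show ?thesis
  proof (cases "r = 0")
    case True
    then have q: "q0 = 0" "q1\<^sup>2 = 1" "2 * q1 * q2 = - 3" "q2\<^sup>2 = 3 - p" using c by auto
    then have "q1 = 1 \<or> q1 = - 1" using power2_eq_1_iff by blast
    then show ?thesis
    proof
      assume 1: "q1 = 1"
      have "q2 = - 3 / 2" "p = 3 / 4" using 1 q(3,4) by algebra+
      then show ?thesis using True q(1) 1 by simp
    next
      assume 1: "q1 = - 1"
      have "q2 = 3 / 2" "p = 3 / 4" using 1 q(3,4) by algebra+
      then show ?thesis using True q(1) 1 by simp
    qed
  next
    case False
    obtain s where s: "s = 1 \<or> s = -1" "q0 = s * r" using c(1) by (metis power2_eq_iff mult_1 mult_minus_left)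
    have s2: "s * s = 1" using s by auto
    have "r * (2 * q1 + s * (2 + 3 * r)) = 0" using c(2) s(2) s2 by algebra
    then have q1: "2 * q1 = - s * (2 + 3 * r)" using False by (simp add: add_eq_0_iff2)
    have "r * (8 * q2 - s * (12 + 3 * r)) = 0" using c(3) s(2) s2 q1 by algebra
    then have q2: "8 * q2 = s * (12 + 3 * r)" using False by simp
    have "r * (r - 6) = 0" using c(4) q1 q2 s2 by algebra
    then have r: "r = 6" using False by simp
    have "q1 = s * (- 10)" "q2 = s * (15 / 4)" "q0 = s * 6" using q1 q2 r s(2) by algebra+
    moreover have "p = 15 / 16" using c(5) r \<open>q2 = s * (15 / 4)\<close> s2 by algebra
    moreover have "s = 1 \<or> s = - 1" by (rule s(1))
    ultimately show ?thesis using r by (elim disjE) simp_all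
  qed
qed

lemma solve_32_32_common:
  assumes "fac [(0, 3), (p, 2)] - fac [(0, 3), (r, 2)] = [:q0, q1, q2:]\<^sup>2"
  shows "q0 = 0 \<and> q1 = 0 \<and> q2\<^sup>2 = 2 * (r - p) \<and> (p = r \<or> p = - r)"
proof -
  have lhs: "fac [(0, 3), (p, 2)] - fac [(0, 3), (r, 2)] = [:0, 0, 0, p\<^sup>2 - r\<^sup>2, 2 * (r - p):]"
    by (simp add: eval_nat_numeral algebra_simps)
  note c = coeffs_eqD[OF assms[unfolded lhs square_quadratic]]
  have "q0 = 0" using c(1) by simp
  moreover from this have "q1 = 0" using c(3) by simp
  moreover have "p\<^sup>2 = r\<^sup>2" using c(4) \<open>q1 = 0\<close> by simp
  ultimately show ?thesis using c(5) power2_eq_iff[of p r] by simp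
qed

text \<open>Elimination leaves \<open>(p - 1)^3 (p + 3) = 0\<close> for \<open>r = 0\<close> and
  \<open>(r - 4)^3 (9 r - 4) = 0\<close> otherwise. The solution \<open>p = 1\<close>,
  \<open>r = 4\<close> is kept as an unresolved alternative: after interchanging the quintics and
  reflecting \<open>x\<close> to \<open>1 - x\<close> it becomes the solution \<open>p = -3\<close>,
  \<open>r = 0\<close>.\<close>

lemma solve_32_32:
  assumes "fac [(0, 3), (p, 2)] - fac [(1, 3), (r, 2)] = [:q0, q1, q2:]\<^sup>2" and nz: "p \<noteq> 0" "r \<noteq> 1"
  shows "(r = 0 \<and> p = 1 \<and> ([:q0, q1, q2:] = [:0, -1, 1:] \<or> [:q0, q1, q2:] = - [:0, -1, 1:])) \<or>
    (r = 0 \<and> p = -3 \<and> ([:q0, q1, q2:] = [:0, 1, 3:] \<or> [:q0, q1, q2:] = - [:0, 1, 3:])) \<or> p = 1 \<and> r \<noteq> 0 \<or>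
    (r = 4/9 \<and> p = 5/9 \<and> ([:q0, q1, q2:] = [:4/9, -5/3, 5/3:] \<or> [:q0, q1, q2:] = - [:4/9, -5/3, 5/3:]))"
proof -
  have lhs: "fac [(0, 3), (p, 2)] - fac [(1, 3), (r, 2)] = [:r\<^sup>2, - 2 * r - 3 * r\<^sup>2, 1 + 6 * r + 3 * r\<^sup>2, p\<^sup>2 - 3 - 6 * r - r\<^sup>2, 3 + 2 * r - 2 * p:]"
    by (simp add: eval_nat_numeral algebra_simps)
  note c = coeffs_eqD[OF assms(1)[unfolded lhs square_quadratic]]
  show ?thesis
  proof (cases "r = 0")
    case True
    then have q: "q0 = 0" "q1\<^sup>2 = 1" "2 * q1 * q2 = p\<^sup>2 - 3" "q2\<^sup>2 = 3 - 2 * p" using c by auto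
    have "(p - 1) ^ 3 * (p + 3) = 0" using q(2-4) by algebra
    then have "p = 1 \<or> p = - 3" by (auto simp: add_eq_0_iff2)
    moreover have "q1 = 1 \<or> q1 = - 1" using q(2) power2_eq_1_iff by blast
    moreover have "2 * q2 = p\<^sup>2 - 3" if "q1 = 1" using q(3) that by simp
    moreover have "2 * q2 = 3 - p\<^sup>2" if "q1 = - 1" using q(3) that by algebra
    ultimately consider "p = 1" "q1 = 1" "2 * q2 = - 2" | "p = 1" "q1 = - 1" "2 * q2 = 2"
      | "p = - 3" "q1 = 1" "2 * q2 = 6" | "p = - 3" "q1 = - 1" "2 * q2 = - 6" by force
    then show ?thesis
    proof cases
      case 1 then have "q2 = - 1" by algebra with 1 show ?thesis using True q(1) by simp
    next
      case 2 then have "q2 = 1" by algebra with 2 show ?thesis using True q(1) by simp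
    next
      case 3 then have "q2 = 3" by algebra with 3 show ?thesis using True q(1) by simp
    next
      case 4 then have "q2 = - 3" by algebra with 4 show ?thesis using True q(1) by simp
    qed
  next
    case False
    obtain s where s: "s = 1 \<or> s = -1" "q0 = s * r" using c(1) by (metis power2_eq_iff mult_1 mult_minus_left)
    have s2: "s * s = 1" using s by auto
    have "r * (2 * q1 + s * (2 + 3 * r)) = 0" using c(2) s(2) s2 by algebra
    then have q1: "2 * q1 = - s * (2 + 3 * r)" using False by (simp add: add_eq_0_iff2)
    have "r * (8 * q2 - s * (12 + 3 * r)) = 0" using c(3) s(2) s2 q1 by algebra
    then have q2: "8 * q2 = s * (12 + 3 * r)" using False by simp
    have p: "128 * p = 48 + 56 * r - 9 * r\<^sup>2" using c(5) q2 s2 by algebra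
    have p2: "8 * p\<^sup>2 = 6 * r - r\<^sup>2" using c(4) q1 q2 s2 by algebra
    have "(r - 4) ^ 3 * (9 * r - 4) = 0" using p p2 by algebra
    then have "r = 4 \<or> r = 4 / 9" by (auto simp: field_simps)
    then show ?thesis
    proof
      assume "r = 4"
      then have "128 * p = 128" using p by simp
      then show ?thesis using False by simp
    next
      assume r: "r = 4 / 9"
      have "q1 = s * (- 5 / 3)" "q2 = s * (5 / 3)" "q0 = s * (4 / 9)" using q1 q2 r s(2) by algebra+
      moreover have "p = 5 / 9" using p r by algebra
      moreover have "s = 1 \<or> s = - 1" by (rule s(1))
      ultimately show ?thesis using r by (elim disjE) simp_all
    qed
  qed
qed

text \<open>At a double root the quadratic \<open>Q\<close> touches one of the branches of
  \<open>x^(5/2)\<close>: \<open>Q(u^2) - u^5\<close> has a double root at a suitable square root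
  \<open>u\<close> of \<open>c\<close>, and likewise at \<open>v\<close> for \<open>d\<close>. In
  \<open>s = u + v\<close> and \<open>m = u v\<close> this gives
  \<open>(s^2 - 4 m) (s^2 + m) = 0\<close>, where the first factor is \<open>(u - v)^2\<close> and
  nonzero.\<close>

lemma solve_5_221:
  assumes "[:0, 1:] ^ 5 - fac [(c, 2), (d, 2), (e, 1)] = [:q0, q1, q2:]\<^sup>2" and nz: "c \<noteq> 0" "d \<noteq> 0" "c \<noteq> d"
  shows "\<exists>s. s \<noteq> 0 \<and> [:q0, q1, q2:] = [:s ^ 5 / 2, - 5 * s ^ 3 / 2, 5 * s / 2:]"
proof -
  have ev: "x ^ 5 - (x - c)\<^sup>2 * (x - d)\<^sup>2 * (x - e) = (q0 + q1 * x + q2 * x\<^sup>2)\<^sup>2" for x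
    using arg_cong[OF assms(1), of "\<lambda>p. poly p x"] by (simp add: power2_eq_square algebra_simps)
  have key: "\<exists>u. u\<^sup>2 = x \<and> q0 + q1 * u\<^sup>2 + q2 * u ^ 4 = u ^ 5 \<and> 2 * q1 + 4 * q2 * u\<^sup>2 = 5 * u ^ 3" if x: "x = c \<or> x = d" "x \<noteq> 0" for x
  proof -
    obtain u0 where u0: "u0\<^sup>2 = x" using complex_root_exists[of 2 x] by auto
    define Q where "Q = q0 + q1 * x + q2 * x\<^sup>2"
    have "x ^ 5 = Q\<^sup>2" using ev[of x] x by (auto simp: Q_def)
    then have "Q\<^sup>2 = (u0 ^ 5)\<^sup>2" using u0 by (metis power_mult mult.commute)
    then have "Q = u0 ^ 5 \<or> Q = (- u0) ^ 5" using power2_eq_iff[of Q "u0 ^ 5"] by auto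
    \<comment> \<open>Of the two square roots, the one with \<open>Q = u^5\<close> rather than
      \<open>- u^5\<close> is taken.\<close>
    then obtain u where u: "u\<^sup>2 = x" "Q = u ^ 5" using u0 by (metis power2_minus)
    have u0': "u \<noteq> 0" using u x by auto
    have 1: "5 * x ^ 4 = 2 * Q * (q1 + 2 * q2 * x)"
    proof -
      have "((\<lambda>x. x ^ 5 - (x - c)\<^sup>2 * (x - d)\<^sup>2 * (x - e)) has_field_derivative 5 * x ^ 4) (at x)"
        using x by (auto intro!: derivative_eq_intros)
      moreover have "((\<lambda>x. (q0 + q1 * x + q2 * x\<^sup>2)\<^sup>2) has_field_derivative 2 * Q * (q1 + 2 * q2 * x)) (at x)"
        by (auto intro!: derivative_eq_intros simp: Q_def algebra_simps)
      ultimately show ?thesis unfolding ev by (rule DERIV_unique)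
    qed
    have "u ^ 5 * (2 * q1 + 4 * q2 * u\<^sup>2 - 5 * u ^ 3) = 0" using 1 u by algebra
    then have "2 * q1 + 4 * q2 * u\<^sup>2 = 5 * u ^ 3" using u0' by simp
    moreover have "q0 + q1 * u\<^sup>2 + q2 * u ^ 4 = u ^ 5" using u(2) unfolding Q_def u(1)[symmetric] by (simp flip: power_mult)
    ultimately show ?thesis using u by blast
  qed
  obtain u where u: "u\<^sup>2 = c" "q0 + q1 * u\<^sup>2 + q2 * u ^ 4 = u ^ 5" "2 * q1 + 4 * q2 * u\<^sup>2 = 5 * u ^ 3" using key[of c] nz by auto
  obtain v where v: "v\<^sup>2 = d" "q0 + q1 * v\<^sup>2 + q2 * v ^ 4 = v ^ 5" "2 * q1 + 4 * q2 * v\<^sup>2 = 5 * v ^ 3" using key[of d] nz by auto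
  define s m where "s = u + v" and "m = u * v"
  have uv: "u - v \<noteq> 0" "s \<noteq> 0"
  proof -
    show "u - v \<noteq> 0" using u(1) v(1) nz by auto
    show "s \<noteq> 0" using u(1) v(1) nz unfolding s_def by (metis add_eq_0_iff2 power2_minus)
  qed
  have "(u - v) * (4 * q2 * s - 5 * (s\<^sup>2 - m)) = 0" using u(3) v(3) unfolding s_def m_def by algebra
  then have 1: "4 * q2 * s = 5 * (s\<^sup>2 - m)" using uv by simp
  have 2: "4 * (q1 + q2 * (s\<^sup>2 - 2 * m)) = 5 * (s ^ 3 - 3 * m * s)" using u(3) v(3) unfolding s_def m_def by algebra
  have "(u - v) * (q1 * s + q2 * s * (s\<^sup>2 - 2 * m) - (s ^ 4 - 3 * s\<^sup>2 * m + m\<^sup>2)) = 0" using u(2) v(2) unfolding s_def m_def by algebra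
  then have 3: "q1 * s + q2 * s * (s\<^sup>2 - 2 * m) = s ^ 4 - 3 * s\<^sup>2 * m + m\<^sup>2" using uv by simp
  have "(s\<^sup>2 - 4 * m) * (s\<^sup>2 + m) = 0" using 2 3 by algebra
  moreover have "s\<^sup>2 - 4 * m = (u - v)\<^sup>2" unfolding s_def m_def by (simp add: power2_eq_square algebra_simps)
  ultimately have m: "m = - (s\<^sup>2)" using uv by (simp add: add_eq_0_iff)
  have "s * (2 * q2 - 5 * s) = 0" using 1 m by algebra
  then have q2: "2 * q2 = 5 * s" using uv by simp
  have q1: "2 * q1 = - 5 * s ^ 3" using 2 m q2 by algebra
  have u2: "u\<^sup>2 = s * u + s\<^sup>2" using m unfolding s_def m_def by algebra
  have q0: "2 * q0 = s ^ 5" using u(2) u2 q1 q2 by algebra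
  have "q0 = s ^ 5 / 2" "q1 = - 5 * s ^ 3 / 2" "q2 = 5 * s / 2" using q0 q1 q2 by algebra+
  then show ?thesis using uv by blast
qed

lemma affinely_equivalent_trans:
  assumes "affinely_equivalent p q p' q'" "affinely_equivalent p' q' p'' q''"
  shows "affinely_equivalent p q p'' q''"
proof -
  obtain a b k where 1: "a \<noteq> 0" "k \<noteq> 0" "p' = smult (k\<^sup>2) (pcompose p [:b, a:])" "q' = smult k (pcompose q [:b, a:])"
    using assms(1) unfolding affinely_equivalent_def by blast
  obtain a' b' k' where 2: "a' \<noteq> 0" "k' \<noteq> 0" "p'' = smult (k'\<^sup>2) (pcompose p' [:b', a':])" "q'' = smult k' (pcompose q' [:b', a':])"
    using assms(2) unfolding affinely_equivalent_def by blast
  have "pcompose [:b, a:] [:b', a':] = [:b + a * b', a * a':]" by (simp add: pcompose_pCons)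
  then have c: "pcompose (pcompose r [:b, a:]) [:b', a':] = pcompose r [:b + a * b', a * a':]" for r
    by (metis pcompose_assoc)
  show ?thesis unfolding affinely_equivalent_def
    by (rule exI[of _ "a * a'"], rule exI[of _ "b + a * b'"], rule exI[of _ "k' * k"])
      (use 1 2 in \<open>simp add: pcompose_smult c power_mult_distrib\<close>)
qed

lemma affinely_equivalent_minus: "affinely_equivalent p q p' (- q') \<Longrightarrow> affinely_equivalent p q p' q'"
  unfolding affinely_equivalent_def by (metis neg_equal_0_iff_equal power2_minus smult_minus_left minus_minus)

text \<open>With multiplicities listed in decreasing order, the number of roots leaves only a few
  partitions of 5.\<close>

lemma degree_5_factorization:
  fixes p :: "complex poly"
  assumes "degree p = 5"
  shows "\<exists>l. p = smult (lead_coeff p) (fac l) \<and> distinct (map fst l) \<and> sorted (rev (map snd l)) \<and> (\<forall>k\<in>set (map snd l). k > 0)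
    \<and> length l = card {x. poly p x = 0} \<and> sum_list (map snd l) = 5"
proof -
  have nz: "p \<noteq> 0" using assms by auto
  then have fin: "finite {x. poly p x = 0}" by (rule poly_roots_finite)
  then obtain xs where xs: "set xs = {x. poly p x = 0}" "distinct xs" using finite_distinct_list by blast
  define ys where "ys = rev (sort_key (\<lambda>x. order x p) xs)"
  have ys: "set ys = {x. poly p x = 0}" "distinct ys" using xs by (simp_all add: ys_def)
  define l where "l = map (\<lambda>x. (x, order x p)) ys"
  have f: "map fst l = ys" "map snd l = map (\<lambda>x. order x p) ys" by (simp_all add: l_def comp_def)
  have "p = smult (lead_coeff p) (\<Prod>z\<in>set ys. [:- z, 1:] ^ order z p)"
    using complex_poly_decompose[of p] ys by simp
  also have "(\<Prod>z\<in>set ys. [:- z, 1:] ^ order z p) = fac l"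
    using prod.distinct_set_conv_list[OF ys(2)] by (simp add: l_def fac_def comp_def)
  finally have p: "p = smult (lead_coeff p) (fac l)" .
  then have "degree p = degree (fac l)" using nz by (metis degree_smult_eq leading_coeff_0_iff)
  then have "sum_list (map snd l) = 5" using assms by (simp add: degree_fac)
  moreover have "sorted (rev (map snd l))" unfolding f ys_def by (simp flip: rev_map)
  moreover have "length l = card {x. poly p x = 0}" using ys by (simp add: l_def flip: distinct_card)
  moreover have "\<forall>k\<in>set (map snd l). k > 0" using f ys nz by (auto simp: order_root)
  ultimately show ?thesis using p ys f by metis
qed

lemma quintic_1_root:
  fixes p :: "complex poly"
  assumes "degree p = 5" "card {x. poly p x = 0} = 1"
  shows "\<exists>a. p = smult (lead_coeff p) (fac [(a, 5)])"
proof -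
  obtain l where l: "p = smult (lead_coeff p) (fac l)" "length l = 1" "sum_list (map snd l) = 5"
    using degree_5_factorization[OF assms(1)] assms(2) by metis
  obtain x where "l = [x]" using l(2) by (metis One_nat_def length_0_conv length_Suc_conv)
  then have "l = [(fst x, 5)]" using l(3) by (cases x) simp
  then show ?thesis using l(1) by metis
qed

lemma quintic_2_roots:
  fixes p :: "complex poly"
  assumes "degree p = 5" "card {x. poly p x = 0} = 2"
  shows "\<exists>a b. a \<noteq> b \<and> (p = smult (lead_coeff p) (fac [(a, 4), (b, 1)]) \<or> p = smult (lead_coeff p) (fac [(a, 3), (b, 2)]))"
proof -
  obtain l where l: "p = smult (lead_coeff p) (fac l)" "distinct (map fst l)" "sorted (rev (map snd l))" "\<forall>k\<in>set (map snd l). k > 0"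
     "length l = 2" "sum_list (map snd l) = 5"
    using degree_5_factorization[OF assms(1)] assms(2) by metis
  obtain a k b m where l': "l = [(a, k), (b, m)]" using l(5) by (auto simp: numeral_2_eq_2 length_Suc_conv)
  have km: "k + m = 5" "m \<le> k" "m > 0" "a \<noteq> b" using l l' by auto
  then consider "k = 4" "m = 1" | "k = 3" "m = 2" by linarith
  then show ?thesis using l(1) km(4) unfolding l' by cases blast+
qed

lemma quintic_3_roots:
  fixes p :: "complex poly"
  assumes "degree p = 5" "card {x. poly p x = 0} = 3"
  shows "\<exists>a b c. distinct [a, b, c] \<and>
    (p = smult (lead_coeff p) (fac [(a, 3), (b, 1), (c, 1)]) \<or> p = smult (lead_coeff p) (fac [(a, 2), (b, 2), (c, 1)]))"
proof -
  obtain l where l: "p = smult (lead_coeff p) (fac l)" "distinct (map fst l)" "sorted (rev (map snd l))" "\<forall>k\<in>set (map snd l). k > 0"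
     "length l = 3" "sum_list (map snd l) = 5"
    using degree_5_factorization[OF assms(1)] assms(2) by metis
  obtain a k b m c n where l': "l = [(a, k), (b, m), (c, n)]" using l(5) by (auto simp: numeral_3_eq_3 length_Suc_conv)
  have km: "k + m + n = 5" "m \<le> k" "n \<le> m" "n > 0" "distinct [a, b, c]" using l l' by auto
  then consider "k = 3" "m = 1" "n = 1" | "k = 2" "m = 2" "n = 1" by linarith
  then show ?thesis using l(1) km(5) unfolding l' by cases blast+
qed

lemma normalize_roots:
  fixes a b c :: complex
  assumes p: "p = smult c (fac l)" "q\<^sup>2 - p = smult (- c) (fac l')" "c \<noteq> 0" "degree q \<le> 2"
    and s: "sum_list (map snd l) = 5" "sum_list (map snd l') = 5" and a: "a \<noteq> 0"
    and m: "map (\<lambda>(r, k). ((r - b) / a, k)) l = m" "map (\<lambda>(r, k). ((r - b) / a, k)) l' = m'"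
  obtains q0 q1 q2 where "affinely_equivalent p q (fac m) [:q0, q1, q2:]" "fac m - fac m' = [:q0, q1, q2:]\<^sup>2"
  using normalize_pair[OF p s a, of b] a unfolding m affinely_equivalent_def by metis

section \<open>Normal forms of pairs of quintics\<close>

text \<open>It is left open which of the two quintics is \<open>h\<close>, so that each
  normalisation can be used in both roles.\<close>

locale quintic_pair =
  fixes p q :: "complex poly" and c :: complex and l l' :: "(complex \<times> nat) list"
  assumes p: "p = smult c (fac l)" and qp: "q\<^sup>2 - p = smult (- c) (fac l')" and c: "c \<noteq> 0" and dq: "degree q \<le> 2"
begin

lemma normalize:
  assumes "sum_list (map snd l) = 5" "sum_list (map snd l') = 5" "a \<noteq> 0"
    "map (\<lambda>(r, k). ((r - b) / a, k)) l = m" "map (\<lambda>(r, k). ((r - b) / a, k)) l' = m'"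
  obtains q0 q1 q2 where "affinely_equivalent p q (fac m) [:q0, q1, q2:]" "fac m - fac m' = [:q0, q1, q2:]\<^sup>2"
  using normalize_roots[OF p qp c dq assms that] by simp

lemma affI:
  assumes "affinely_equivalent p q m Q" "Q = r \<or> Q = - r" shows "affinely_equivalent p q m r"
  using assms affinely_equivalent_minus by blast

text \<open>If the quintuple root were the triple one, the square root would be a multiple of
  \<open>x^2\<close>, and the vanishing cubic coefficient would move a simple root onto the triple
  one. Otherwise the two roots can be placed at -1 and 0.\<close>

lemma pair_5_311:
  assumes l: "l = [(a, 5)]" "l' = [(b, 3), (d, 1), (e, 1)]" and ne: "distinct [b, d, e]"
  shows "affinely_equivalent p q (fac [(-1, 5)]) [:1, 5/2, 15/8:]"
proof (cases "a = b")
  case True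
  obtain q0 q1 q2 where "fac [(0, 5)] - fac [(0, 3), (d - a, 1), (e - a, 1)] = [:q0, q1, q2:]\<^sup>2"
    by (rule normalize[of 1 a "[(0, 5)]" "[(0, 3), (d - a, 1), (e - a, 1)]"]) (auto simp: l True)
  moreover have "fac [(0, 5)] - fac [(0, 3), (d - a, 1), (e - a, 1)] = [:0, 0, 0, - (d - a) * (e - a), (d - a) + (e - a):]"
    by (simp add: eval_nat_numeral algebra_simps)
  ultimately have "[:0, 0, 0, - (d - a) * (e - a), (d - a) + (e - a):] = [:q0\<^sup>2, 2 * q0 * q1, q1\<^sup>2 + 2 * q0 * q2, 2 * q1 * q2, q2\<^sup>2:]"
    by (simp only: square_quadratic)
  note c = coeffs_eqD[OF this]
  have "q0 = 0" using c(1) by simp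
  then have "q1 = 0" using c(3) by simp
  then have "(d - a) * (e - a) = 0" using c(4) by algebra
  then have "d - a = 0 \<or> e - a = 0" by (simp only: mult_eq_0_iff)
  then show ?thesis using ne True by force
next
  case False
  obtain q0 q1 q2 where q: "affinely_equivalent p q (fac [(-1, 5)]) [:q0, q1, q2:]"
     "fac [(-1, 5)] - fac [(0, 3), ((d - b) / (b - a), 1), ((e - b) / (b - a), 1)] = [:q0, q1, q2:]\<^sup>2"
    by (rule normalize[of "b - a" b "[(-1, 5)]" "[(0, 3), ((d - b) / (b - a), 1), ((e - b) / (b - a), 1)]"])
      (use False in \<open>auto simp: l field_simps\<close>)
  show ?thesis by (rule affI[OF q(1) solve_5_311[OF q(2)]])
qed

lemma pair_5_common:
  assumes l: "l = [(a, 5)]" "fac l' = fac [(a, 2), (d, 2), (e, 1)]" and ne: "a \<noteq> d"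
  shows "affinely_equivalent p q (fac [(0, 5)]) [:0, 1/2, -3/2:]"
proof -
  interpret n: quintic_pair p q c l "[(a, 2), (d, 2), (e, 1)]"
    using p qp c dq l(2) by unfold_locales auto
  obtain q0 q1 q2 where q: "affinely_equivalent p q (fac [(0, 5)]) [:q0, q1, q2:]"
     "fac [(0, 5)] - fac [(0, 2), (1, 2), ((e - a) / (d - a), 1)] = [:q0, q1, q2:]\<^sup>2"
    by (rule n.normalize[of "d - a" a "[(0, 5)]" "[(0, 2), (1, 2), ((e - a) / (d - a), 1)]"]) (use ne l in auto)
  show ?thesis by (rule affI[OF q(1) solve_5_common[OF q(2)]])
qed

lemma pair_5_221:
  assumes l: "l = [(a, 5)]" "l' = [(b, 2), (d, 2), (e, 1)]" and ne: "distinct [b, d, e]"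
  shows "affinely_equivalent p q (fac [(0, 5)]) [:0, 1/2, -3/2:] \<or> affinely_equivalent p q (fac [(0, 5)]) [:1/2, -5/2, 5/2:]"
proof -
  consider "a = b" | "a = d" | "a \<noteq> b" "a \<noteq> d" by blast
  then show ?thesis
  proof cases
    case 1
    have "fac l' = fac [(a, 2), (d, 2), (e, 1)]" using 1 l by simp
    moreover have "a \<noteq> d" using 1 ne by simp
    ultimately show ?thesis using pair_5_common[OF l(1)] by blast
  next
    case 2
    have "fac l' = fac [(a, 2), (b, 2), (e, 1)]" using 2 l by (simp only: fac_simps mult_ac)
    moreover have "a \<noteq> b" using 2 ne by auto
    ultimately show ?thesis using pair_5_common[OF l(1)] by blast
  next
    case 3
    obtain q0 q1 q2 where q: "affinely_equivalent p q (fac [(0, 5)]) [:q0, q1, q2:]"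
       "fac [(0, 5)] - fac [(b - a, 2), (d - a, 2), (e - a, 1)] = [:q0, q1, q2:]\<^sup>2"
      by (rule normalize[of 1 a "[(0, 5)]" "[(b - a, 2), (d - a, 2), (e - a, 1)]"]) (auto simp: l)
    have "fac [(0, 5)] = [:0, 1:] ^ 5" by simp
    then obtain s where s: "s \<noteq> 0" "[:q0, q1, q2:] = [:s ^ 5 / 2, - 5 * s ^ 3 / 2, 5 * s / 2:]"
      using solve_5_221[of "b - a" "d - a" "e - a" q0 q1 q2] q(2) 3 ne by auto
    \<comment> \<open>The solutions found above form a single orbit: scaling \<open>x\<close> by
      \<open>s^2\<close> with \<open>k = s^(-5)\<close> brings \<open>s\<close> to 1.\<close>
    have "affinely_equivalent (fac [(0, 5)]) [:s ^ 5 / 2, - 5 * s ^ 3 / 2, 5 * s / 2:] (fac [(0, 5)]) [:1/2, -5/2, 5/2:]"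
    proof (rule affinely_equivalentI[of "s\<^sup>2" "1 / s ^ 5" _ 0])
      show "smult ((1 / s ^ 5)\<^sup>2) (pcompose (fac [(0, 5)]) [:0, s\<^sup>2:]) = fac [(0, 5)]"
        using s by (subst pcompose_fac) (auto simp: field_simps simp flip: power_mult)
      show "smult (1 / s ^ 5) (pcompose [:s ^ 5 / 2, - 5 * s ^ 3 / 2, 5 * s / 2:] [:0, s\<^sup>2:]) = [:1/2, -5/2, 5/2:] \<or>
         smult (1 / s ^ 5) (pcompose [:s ^ 5 / 2, - 5 * s ^ 3 / 2, 5 * s / 2:] [:0, s\<^sup>2:]) = - [:1/2, -5/2, 5/2:]"
        using s(1) by (simp add: pcompose_pCons field_simps eval_nat_numeral)
    qed (use s in auto)
    then show ?thesis using q(1) affinely_equivalent_trans unfolding s(2) by blast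
  qed
qed

lemma pair_41_41:
  assumes l: "l = [(a, 4), (b, 1)]" "l' = [(a', 4), (b', 1)]" and ne: "a \<noteq> a'"
  shows "\<exists>\<rho>. (\<rho> = 2 + 2 * \<i> \<or> \<rho> = 2 - 2 * \<i>) \<and>
    affinely_equivalent p q (smult \<rho> (fac [(0, 4), (1 - 1 / \<rho>, 1)])) [:1, - (\<rho> + 4) / 2, (\<rho> + 4) / 2:]"
proof -
  define P r where "P = (b - a) / (a' - a)" and "r = (b' - a) / (a' - a)"
  obtain q0 q1 q2 where q: "affinely_equivalent p q (fac [(0, 4), (P, 1)]) [:q0, q1, q2:]"
     "fac [(0, 4), (P, 1)] - fac [(1, 4), (r, 1)] = [:q0, q1, q2:]\<^sup>2"
    by (rule normalize[of "a' - a" a "[(0, 4), (P, 1)]" "[(1, 4), (r, 1)]"]) (use ne in \<open>auto simp: l P_def r_def\<close>)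
  have s: "r \<noteq> 0" "P = 1 - r" "q0\<^sup>2 = r" "1 / r = 2 + 2 * \<i> \<or> 1 / r = 2 - 2 * \<i>"
    "[:q0, q1, q2:] = smult q0 [:1, - (1 / r + 4) / 2, (1 / r + 4) / 2:]"
    using solve_41_41[OF q(2)] by blast+
  have q0: "q0 \<noteq> 0" using s(1,3) by auto
  define \<rho> where "\<rho> = 1 / r"
  have r: "r = 1 / \<rho>" by (simp add: \<rho>_def)
  \<comment> \<open>Dividing by \<open>q0\<close> makes the constant coefficient 1 at the price of
    the factor \<open>\<rho>\<close>, so that no square root of \<open>r\<close> has to be
    chosen.\<close>
  have k: "(1 / q0)\<^sup>2 = \<rho>" using s(3) by (simp add: \<rho>_def power_divide)
  have "affinely_equivalent (fac [(0, 4), (P, 1)]) [:q0, q1, q2:] (smult \<rho> (fac [(0, 4), (1 - 1 / \<rho>, 1)])) [:1, - (\<rho> + 4) / 2, (\<rho> + 4) / 2:]"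
  proof (rule affinely_equivalentI[of 1 "1 / q0" _ 0])
    show "smult ((1 / q0)\<^sup>2) (pcompose (fac [(0, 4), (P, 1)]) [:0, 1:]) = smult \<rho> (fac [(0, 4), (1 - 1 / \<rho>, 1)])"
      by (simp only: k pcompose_idR s(2) r)
    show "smult (1 / q0) (pcompose [:q0, q1, q2:] [:0, 1:]) = [:1, - (\<rho> + 4) / 2, (\<rho> + 4) / 2:] \<or>
       smult (1 / q0) (pcompose [:q0, q1, q2:] [:0, 1:]) = - [:1, - (\<rho> + 4) / 2, (\<rho> + 4) / 2:]"
      unfolding s(5) pcompose_idR \<rho>_def using q0 by simp
  qed (use q0 in auto)
  then show ?thesis using q(1) affinely_equivalent_trans s(4) unfolding \<rho>_def[symmetric] by blast
qed

lemma pair_41_32: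
  assumes l: "l = [(a, 4), (b, 1)]" "l' = [(a', 3), (b', 2)]" and ne: "a \<noteq> b" "a' \<noteq> b'"
  shows "affinely_equivalent p q (fac [(0, 4), (15/16, 1)]) [:6, -10, 15/4:] \<or> affinely_equivalent p q (fac [(0, 4), (3/4, 1)]) [:0, 1, -3/2:]"
proof (cases "a = a'")
  case True
  define r where "r = (b' - a) / (b - a)"
  obtain q0 q1 q2 where "fac [(0, 4), (1, 1)] - fac [(0, 3), (r, 2)] = [:q0, q1, q2:]\<^sup>2"
    by (rule normalize[of "b - a" a "[(0, 4), (1, 1)]" "[(0, 3), (r, 2)]"]) (use True ne in \<open>auto simp: l r_def\<close>)
  moreover have "fac [(0, 4), (1, 1)] - fac [(0, 3), (r, 2)] = [:0, 0, 0, - r\<^sup>2, 2 * r - 1:]"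
    by (simp add: eval_nat_numeral algebra_simps)
  ultimately have "[:0, 0, 0, - r\<^sup>2, 2 * r - 1:] = [:q0\<^sup>2, 2 * q0 * q1, q1\<^sup>2 + 2 * q0 * q2, 2 * q1 * q2, q2\<^sup>2:]"
    by (simp only: square_quadratic)
  note c = coeffs_eqD[OF this]
  have "q0 = 0" using c(1) by simp
  then have "q1 = 0" using c(3) by simp
  then have "r = 0" using c(4) by simp
  then show ?thesis using ne True by (auto simp: r_def)
next
  case False
  define P r where "P = (b - a) / (a' - a)" and "r = (b' - a) / (a' - a)"
  obtain q0 q1 q2 where q: "affinely_equivalent p q (fac [(0, 4), (P, 1)]) [:q0, q1, q2:]"
     "fac [(0, 4), (P, 1)] - fac [(1, 3), (r, 2)] = [:q0, q1, q2:]\<^sup>2"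
    by (rule normalize[of "a' - a" a "[(0, 4), (P, 1)]" "[(1, 3), (r, 2)]"]) (use False in \<open>auto simp: l P_def r_def\<close>)
  show ?thesis using solve_41_32[OF q(2)]
  proof (elim disjE conjE)
    show ?thesis if "P = 3 / 4" "[:q0, q1, q2:] = [:0, 1, - 3 / 2:]" using q(1) that by simp
    show ?thesis if "P = 3 / 4" "[:q0, q1, q2:] = - [:0, 1, - 3 / 2:]" using affinely_equivalent_minus[OF q(1)[unfolded that]] by simp
    show ?thesis if "P = 15 / 16" "[:q0, q1, q2:] = [:6, - 10, 15 / 4:]" using q(1) that by simp
    show ?thesis if "P = 15 / 16" "[:q0, q1, q2:] = - [:6, - 10, 15 / 4:]" using affinely_equivalent_minus[OF q(1)[unfolded that]] by simp
  qed
qed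

lemma pair_32_32_common:
  assumes l: "l = [(a, 3), (b, 2)]" "l' = [(a, 3), (b', 2)]" and ne: "a \<noteq> b'"
  shows "affinely_equivalent p q (fac [(0, 3), (1, 2)]) 0 \<or> affinely_equivalent p q (fac [(0, 3), (-1, 2)]) [:0, 0, 2:]"
proof -
  define P where "P = (b - a) / (b' - a)"
  obtain q0 q1 q2 where q: "affinely_equivalent p q (fac [(0, 3), (P, 2)]) [:q0, q1, q2:]"
     "fac [(0, 3), (P, 2)] - fac [(0, 3), (1, 2)] = [:q0, q1, q2:]\<^sup>2"
    by (rule normalize[of "b' - a" a "[(0, 3), (P, 2)]" "[(0, 3), (1, 2)]"]) (use ne in \<open>auto simp: l P_def\<close>)
  have s: "q0 = 0" "q1 = 0" "q2\<^sup>2 = 2 * (1 - P)" "P = 1 \<or> P = - 1" using solve_32_32_common[OF q(2)] by blast+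
  from s(4) show ?thesis
  proof
    assume "P = 1"
    then show ?thesis using q(1) s by simp
  next
    assume P: "P = - 1"
    then have "q2\<^sup>2 = 2\<^sup>2" using s(3) by simp
    then have "q2 = 2 \<or> q2 = - 2" by (simp only: power2_eq_iff)
    then have "[:q0, q1, q2:] = [:0, 0, 2:] \<or> [:q0, q1, q2:] = - [:0, 0, 2:]" using s by auto
    then show ?thesis using affI[OF q(1)] unfolding P by blast
  qed
qed

text \<open>The conditions on \<open>b\<close> and \<open>b'\<close> record which roots coincide.
  They are what allows the last alternative to be settled by applying the lemma to the interchanged
  pair.\<close>

lemma pair_32_32_distinct:
  assumes l: "l = [(a, 3), (b, 2)]" "l' = [(a', 3), (b', 2)]" and ne: "a \<noteq> a'" "a \<noteq> b" "a' \<noteq> b'"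
  shows "affinely_equivalent p q (fac [(0, 3), (1, 2)]) [:0, -1, 1:] \<and> b = a' \<or> affinely_equivalent p q (fac [(0, 3), (-3, 2)]) [:0, 1, 3:] \<or>
     affinely_equivalent p q (fac [(0, 3), (5/9, 2)]) [:4/9, -5/3, 5/3:] \<and> b' \<noteq> a \<or> b = a' \<and> b' \<noteq> a"
proof -
  define P r where "P = (b - a) / (a' - a)" and "r = (b' - a) / (a' - a)"
  obtain q0 q1 q2 where q: "affinely_equivalent p q (fac [(0, 3), (P, 2)]) [:q0, q1, q2:]"
     "fac [(0, 3), (P, 2)] - fac [(1, 3), (r, 2)] = [:q0, q1, q2:]\<^sup>2"
    by (rule normalize[of "a' - a" a "[(0, 3), (P, 2)]" "[(1, 3), (r, 2)]"]) (use ne in \<open>auto simp: l P_def r_def\<close>)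
  have nz: "P \<noteq> 0" "r \<noteq> 1" using ne by (auto simp: P_def r_def)
  show ?thesis using solve_32_32[OF q(2) nz]
  proof (elim disjE conjE)
    have b: "b = a'" if "P = 1" using that ne by (simp add: P_def field_simps)
    show ?thesis if "P = 1" "[:q0, q1, q2:] = [:0, -1, 1:]" using q(1) that b by simp
    show ?thesis if "P = 1" "[:q0, q1, q2:] = - [:0, -1, 1:]" using affinely_equivalent_minus[OF q(1)[unfolded that]] b that by simp
    show ?thesis if "P = -3" "[:q0, q1, q2:] = [:0, 1, 3:]" using q(1) that by simp
    show ?thesis if "P = -3" "[:q0, q1, q2:] = - [:0, 1, 3:]" using affinely_equivalent_minus[OF q(1)[unfolded that]] by simp
    have b': "b' \<noteq> a" if "r = 4/9" using that by (auto simp: r_def)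
    show ?thesis if "r = 4/9" "P = 5/9" "[:q0, q1, q2:] = [:4/9, -5/3, 5/3:]" using q(1) that b' by simp
    show ?thesis if "r = 4/9" "P = 5/9" "[:q0, q1, q2:] = - [:4/9, -5/3, 5/3:]" using affinely_equivalent_minus[OF q(1)[unfolded that(2-)]] b'[OF that(1)] by simp
    show ?thesis if "P = 1" "r \<noteq> 0" using that ne by (auto simp: P_def r_def)
  qed
qed

end

section \<open>The eighteen models\<close>

type_synonym model = "complex \<times> (complex \<times> nat) list \<times> (complex \<times> nat) list \<times> complex poly"

text \<open>A model stands for \<open>h = d fac lh\<close> and \<open>q^2 - h = - d fac lg\<close>.
  Total length 4 expresses maximality, and the last conjunct expresses
  \<open>simple_data\<close>.\<close>

definition valid_model :: "model \<Rightarrow> bool" where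
  "valid_model = (\<lambda>(d, lg, lh, q). d \<noteq> 0 \<and> q\<^sup>2 = smult d (fac lh) - smult d (fac lg) \<and> distinct (map fst lg) \<and> distinct (map fst lh)
     \<and> sum_list (map snd lg) = 5 \<and> sum_list (map snd lh) = 5 \<and> degree q \<le> 2 \<and> length lg + length lh = 4
     \<and> (\<forall>k\<in>set (map snd lg) \<union> set (map snd lh). 0 < k) \<and> (\<forall>(x, k)\<in>set lg. 4 \<le> k \<longrightarrow> mult_in lh x < 4))"

definition model_form :: "model \<Rightarrow> complex^3 \<Rightarrow> complex" where
  "model_form = (\<lambda>(d, lg, lh, q). nform q (smult d (fac lh)))"

definition model_sings :: "model \<Rightarrow> sing_type multiset" where
  "model_sings = (\<lambda>(d, lg, lh, q). {#E8#} + mset (map (\<lambda>(x, m). line_type (mult_in lg x) m) lh)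
     + mset (map (\<lambda>(x, k). A (k - 1)) (filter (\<lambda>(x, k). mult_in lh x = 0 \<and> 2 \<le> k) lg)))"

lemma order_smult_fac: "d \<noteq> 0 \<Longrightarrow> distinct (map fst l) \<Longrightarrow> order x (smult d (fac l)) = mult_in l x"
  by (simp add: order_smult order_fac)

lemma mult_in_mem: "distinct (map fst l) \<Longrightarrow> (x, k) \<in> set l \<Longrightarrow> mult_in l x = k"
  by (simp add: mult_in_def map_of_is_SomeI)

lemma mult_in_memD: "mult_in l x \<noteq> 0 \<Longrightarrow> (x, mult_in l x) \<in> set l"
  by (auto simp: mult_in_def map_of_SomeD split: option.splits)

lemma mult_in_pos:
  assumes l: "distinct (map fst l)" "\<forall>k\<in>set (map snd l). 0 < k"
  shows "mult_in l x \<noteq> 0 \<longleftrightarrow> x \<in> set (map fst l)"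
proof
  assume "mult_in l x \<noteq> 0"
  from mult_in_memD[OF this] show "x \<in> set (map fst l)" by (auto simp: image_iff intro: bexI[rotated])
next
  assume "x \<in> set (map fst l)"
  then obtain k where k: "(x, k) \<in> set l" by auto
  then have "k \<in> set (map snd l)" by (auto simp: image_iff intro: bexI[rotated])
  then have "0 < k" using l(2) by blast
  then show "mult_in l x \<noteq> 0" using mult_in_mem[OF l(1) k] by simp
qed

lemma roots_fac:
  assumes "d \<noteq> 0" "distinct (map fst l)" "\<forall>k\<in>set (map snd l). 0 < k"
  shows "{x. poly (smult d (fac l)) x = 0} = set (map fst l)"
proof -
  have "poly (smult d (fac l)) x = 0 \<longleftrightarrow> x \<in> set (map fst l)" for x
    using mult_in_pos[OF assms(2,3)] order_root[of "smult d (fac l)"] order_smult_fac[OF assms(1,2)] assms(1) fac_nz[of l]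
    by (simp only: smult_eq_0_iff simp_thms)
  then show ?thesis by blast
qed

lemma valid_model_nform:
  assumes v: "valid_model (d, lg, lh, q)"
  shows "nform_data q (smult d (fac lh))" "nform_data.simple_data q (smult d (fac lh))"
    "sing_set (model_form (d, lg, lh, q)) = model_sings (d, lg, lh, q)"
    "total_milnor (model_form (d, lg, lh, q)) = 19"
proof -
  define h where "h = smult d (fac lh)"
  have v': "d \<noteq> 0" "q\<^sup>2 = smult d (fac lh) - smult d (fac lg)" "distinct (map fst lg)" "distinct (map fst lh)"
    "sum_list (map snd lg) = 5" "sum_list (map snd lh) = 5" "degree q \<le> 2" "length lg + length lh = 4"
    "\<forall>k\<in>set (map snd lg). 0 < k" "\<forall>k\<in>set (map snd lh). 0 < k" "\<And>x k. (x, k)\<in>set lg \<Longrightarrow> 4 \<le> k \<Longrightarrow> mult_in lh x < 4"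
    using v unfolding valid_model_def by auto
  interpret nform_data q h
    by unfold_locales (use v' in \<open>simp_all add: h_def degree_fac\<close>)
  show "nform_data q (smult d (fac lh))" using nform_data_axioms unfolding h_def .
  have g: "g = smult (- d) (fac lg)" unfolding v'(2) h_def by simp
  have og: "order x g = mult_in lg x" for x unfolding g by (rule order_smult_fac) (use v' in auto)
  have oh: "order x h = mult_in lh x" for x unfolding h_def by (rule order_smult_fac) (use v' in auto)
  have rg: "{x. poly g x = 0} = set (map fst lg)" unfolding g by (rule roots_fac) (use v' in auto)
  have rh: "{x. poly h x = 0} = set (map fst lh)" unfolding h_def by (rule roots_fac) (use v' in auto)
  have s: simple_data unfolding simple_data_def og oh
  proof (intro allI notI)
    fix x assume "4 \<le> mult_in lg x \<and> 4 \<le> mult_in lh x"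
    then show False using v'(11)[OF mult_in_memD[of lg x]] by simp
  qed
  then show "nform_data.simple_data q (smult d (fac lh))" unfolding h_def .
  have F: "F = model_form (d, lg, lh, q)" by (simp add: model_form_def h_def)
  have "card {x. poly g x = 0} + card {x. poly h x = 0} = 4"
    unfolding rg rh using v'(3,4,8) by (metis distinct_card length_map)
  then show "total_milnor (model_form (d, lg, lh, q)) = 19" using total_milnor_nform[OF s] unfolding F by linarith
  have 1: "image_mset (\<lambda>x. line_type (order x g) (order x h)) (mset_set on_line) = mset (map (\<lambda>(x, m). line_type (mult_in lg x) m) lh)"
  proof -
    have "mset_set on_line = mset (map fst lh)" unfolding on_line_def rh by (rule mset_set_set[OF v'(4)])
    moreover have "map (\<lambda>x. line_type (mult_in lg x) (mult_in lh x)) (map fst lh) = map (\<lambda>(x, m). line_type (mult_in lg x) m) lh"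
      using mult_in_mem[OF v'(4)] by (auto simp: split_beta)
    ultimately show ?thesis unfolding og oh by (simp only: mset_map[symmetric])
  qed
  define lo where "lo = filter (\<lambda>(x, k). mult_in lh x = 0 \<and> 2 \<le> k) lg"
  have dlo: "distinct (map fst lo)" unfolding lo_def using v'(3) by (rule distinct_map_filter)
  have 2: "image_mset (\<lambda>x. A (order x g - 1)) (mset_set off_line) = mset (map (\<lambda>(x, k). A (k - 1)) lo)"
  proof -
    have "off_line = set (map fst lo)"
    proof (intro equalityI subsetI)
      fix x assume "x \<in> off_line"
      then have x: "poly h x \<noteq> 0" "2 \<le> mult_in lg x" unfolding off_line_def og by auto
      have "mult_in lh x = 0" using x(1) order_root[of h x] oh by simp
      then have "(x, mult_in lg x) \<in> set lo" unfolding lo_def using mult_in_memD[of lg x] x(2) by auto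
      then show "x \<in> set (map fst lo)" by force
    next
      fix x assume "x \<in> set (map fst lo)"
      then obtain k where k: "(x, k) \<in> set lg" "mult_in lh x = 0" "2 \<le> k" unfolding lo_def by auto
      have "mult_in lg x = k" by (rule mult_in_mem[OF v'(3) k(1)])
      moreover have "poly h x \<noteq> 0" using k(2) order_root[of h x] oh h_nz by simp
      ultimately show "x \<in> off_line" unfolding off_line_def og using k(3) by simp
    qed
    then have "mset_set off_line = mset (map fst lo)" using mset_set_set[OF dlo] by simp
    moreover have "map (\<lambda>x. A (mult_in lg x - 1)) (map fst lo) = map (\<lambda>(x, k). A (k - 1)) lo"
      using mult_in_mem[OF v'(3)] unfolding lo_def by (auto simp: split_beta)
    ultimately show ?thesis unfolding og by (simp only: mset_map[symmetric])
  qed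
  show "sing_set (model_form (d, lg, lh, q)) = model_sings (d, lg, lh, q)"
    using sing_set_nform[OF s] unfolding 1 2 F lo_def by (simp add: model_sings_def)
qed

text \<open>An entry \<open>(c, lp, lq, q)\<close> encodes \<open>p = c fac lp\<close> and
  \<open>q^2 - p = - c fac lq\<close>. The roots with \<open>csqrt (-15)\<close> have sum -95/64 and
  product 5/8, read off from the two highest coefficients in \<open>solve_5_311\<close>; those with
  \<open>csqrt 5\<close> are the squares of the golden ratio and its conjugate, the case
  \<open>s = 1\<close> of \<open>solve_5_221\<close>.\<close>

definition asymmetric_models :: "model list" where
  "asymmetric_models = [
   (1, [(-1, 5)], [(0, 3), ((-95 + 9 * csqrt (-15)) / 128, 1), ((-95 - 9 * csqrt (-15)) / 128, 1)], [:1, 5/2, 15/8:]),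
   (1, [(0, 5)], [((3 + csqrt 5) / 2, 2), ((3 - csqrt 5) / 2, 2), (1/4, 1)], [:1/2, -5/2, 5/2:]),
   (1, [(0, 5)], [(0, 2), (1, 2), (1/4, 1)], [:0, 1/2, -3/2:]),
   (1, [(0, 4), (15/16, 1)], [(1, 3), (6, 2)], [:6, -10, 15/4:]),
   (1, [(0, 4), (3/4, 1)], [(1, 3), (0, 2)], [:0, 1, -3/2:]),
   (1, [(0, 3), (-3, 2)], [(1, 3), (0, 2)], [:0, 1, 3:])]"

text \<open>The parameter is \<open>1 / r\<close> from \<open>solve_41_41\<close>, used for the two
  roots of \<open>\<rho>^2 = 4 \<rho> - 8\<close>.\<close>

definition A7_model :: "complex \<Rightarrow> model" where
  "A7_model \<rho> = (\<rho>, [(0, 4), (1 - 1 / \<rho>, 1)], [(1, 4), (1 / \<rho>, 1)], [:1, - (\<rho> + 4) / 2, (\<rho> + 4) / 2:])"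

definition symmetric_models :: "model list" where
  "symmetric_models = [A7_model (2 + 2 * \<i>), A7_model (2 - 2 * \<i>),
   (1, [(0, 3), (5/9, 2)], [(1, 3), (4/9, 2)], [:4/9, -5/3, 5/3:]),
   (1, [(0, 3), (1, 2)], [(0, 3), (1, 2)], 0),
   (1, [(0, 3), (-1, 2)], [(0, 3), (1, 2)], [:0, 0, 2:]),
   (1, [(0, 3), (1, 2)], [(1, 3), (0, 2)], [:0, -1, 1:])]"

text \<open>Interchanging the two quintics \<open>h\<close> and \<open>q\<^sup>2 - h\<close> turns a model into another one,
  which is isomorphic to the original one exactly for the symmetric models.\<close>
definition models :: "model list" where
  "models = map (\<lambda>(c, lp, lq, q). (- c, lp, lq, q)) (asymmetric_models @ symmetric_models)
     @ map (\<lambda>(c, lp, lq, q). (c, lq, lp, q)) asymmetric_models"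

lemma fac_eq:
  "fac [(-1, 5)] = [:1, 5, 10, 10, 5, 1:]"
  "fac [(a, 5)] = [:- (a ^ 5), 5 * a ^ 4, - 10 * a ^ 3, 10 * a ^ 2, - 5 * a, 1:]"
  "fac [(a, 4), (b, 1)] = [:- (a ^ 4 * b), a ^ 4 + 4 * a ^ 3 * b, - 4 * a ^ 3 - 6 * a ^ 2 * b, 6 * a ^ 2 + 4 * a * b, - 4 * a - b, 1:]"
  "fac [(a, 3), (b, 2)] = [:- (a ^ 3 * b ^ 2), 3 * a ^ 2 * b ^ 2 + 2 * a ^ 3 * b, - 3 * a * b ^ 2 - 6 * a ^ 2 * b - a ^ 3, b ^ 2 + 6 * a * b + 3 * a ^ 2, - 3 * a - 2 * b, 1:]"
  "fac [(0, 3), (a, 1), (b, 1)] = [:0, 0, 0, a * b, - (a + b), 1:]"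
  "fac [(a, 2), (b, 2), (c, 1)] = pcompose [:0, 0, 1:] [:a * b, - (a + b), 1:] * [:- c, 1:]"
  by (simp_all add: eval_nat_numeral algebra_simps pcompose_pCons)

lemma csqrt_prod: "(a + b * csqrt c) * (a - b * csqrt c) = a\<^sup>2 - b\<^sup>2 * c"
  by (simp add: square_diff_square_factored[symmetric] power2_eq_square[symmetric] power_mult_distrib algebra_simps)

text \<open>The irrational roots enter only through their sum and product, and those of the A7
  models only through the quadratic equation for \<open>\<rho>\<close>, so radicals are never
  expanded in the quintics.\<close>

lemma valid_base_models:
  assumes "(c, lp, lq, q) \<in> set (asymmetric_models @ symmetric_models)"
  shows "valid_model (- c, lp, lq, q)"
proof -
  have A7: "valid_model (- c, lp, lq, q)" if "(c, lp, lq, q) = A7_model \<rho>" "\<rho>\<^sup>2 = 4 * \<rho> - 8" for \<rho> c lp lq q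
  proof -
    have r0: "\<rho> \<noteq> 0" using that(2) by auto
    define r where "r = 1 / \<rho>"
    have r: "\<rho> * r = 1" using r0 by (simp add: r_def)
    have "smult (- \<rho>) (fac [(1, 4), (r, 1)]) - smult (- \<rho>) (fac [(0, 4), (1 - r, 1)]) =
       [:\<rho> * r, - \<rho> - 4 * (\<rho> * r), 4 * \<rho> + 6 * (\<rho> * r), - 6 * \<rho> - 4 * (\<rho> * r), 3 * \<rho> + 2 * (\<rho> * r):]"
      unfolding fac_eq by (simp add: algebra_simps)
    also have "\<dots> = [:1, - (\<rho> + 4) / 2, (\<rho> + 4) / 2:]\<^sup>2"
    proof -
      define t where "t = (\<rho> + 4) / 2"
      have rt: "\<rho> = 2 * t - 4" by (simp add: t_def field_simps)
      have tt: "t\<^sup>2 = 6 * t - 10" using that(2) unfolding rt by algebra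
      have "- \<rho> - 4 * 1 = 2 * 1 * (- t)" unfolding rt by simp
      moreover have "4 * \<rho> + 6 * 1 = (- t)\<^sup>2 + 2 * 1 * t" using tt unfolding rt by algebra
      moreover have "- 6 * \<rho> - 4 * 1 = 2 * (- t) * t" using tt unfolding rt by algebra
      moreover have "3 * \<rho> + 2 * 1 = t\<^sup>2" using tt unfolding rt by algebra
      ultimately have "[:1, - \<rho> - 4 * 1, 4 * \<rho> + 6 * 1, - 6 * \<rho> - 4 * 1, 3 * \<rho> + 2 * 1:] = [:1, - t, t:]\<^sup>2"
        by (simp only: square_quadratic one_power2)
      then show ?thesis unfolding r by (simp only: t_def minus_divide_left)
    qed
    finally show ?thesis using that r0 unfolding A7_model_def by (auto simp: valid_model_def r_def mult_in_def simp del: fac_simps)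
  qed
  have rho: "(2 + 2 * \<i>)\<^sup>2 = 4 * (2 + 2 * \<i>) - 8" "(2 - 2 * \<i>)\<^sup>2 = 4 * (2 - 2 * \<i>) - 8"
    by (simp_all add: power2_eq_square algebra_simps)
  have p1: "(- 95 + 9 * csqrt (- 15)) / 128 * ((- 95 - 9 * csqrt (- 15)) / 128) = 5/8"
    using csqrt_prod[of "-95" 9 "-15"] by simp
  have s1: "(- 95 + 9 * csqrt (- 15)) / 128 + (- 95 - 9 * csqrt (- 15)) / 128 = - 95/64" by (simp add: field_simps)
  have p2: "(3 + csqrt 5) / 2 * ((3 - csqrt 5) / 2) = 1" using csqrt_prod[of 3 1 5] by simp
  have s2: "(3 + csqrt 5) / 2 + (3 - csqrt 5) / 2 = 3" by (simp add: field_simps)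
  have v1: "valid_model (- 1, [(-1, 5)], [(0, 3), (a, 1), (b, 1)], [:1, 5/2, 15/8:])"
    if ab: "a * b = 5/8" "a + b = - 95/64" for a b
  proof -
    have "fac [(0, 3), (a, 1), (b, 1)] = [:0, 0, 0, 5/8, 95/64, 1:]" unfolding fac_eq ab by simp
    moreover have "a \<noteq> b"
    proof
      assume "a = b"
      then have "(a + b)\<^sup>2 = 4 * (a * b)" by (simp add: power2_eq_square)
      then show False unfolding ab by (simp add: power2_eq_square)
    qed
    moreover have "a \<noteq> 0" "b \<noteq> 0" using ab(1) by auto
    ultimately show ?thesis by (simp add: valid_model_def mult_in_def fac_eq square_quadratic power2_eq_square del: fac_simps)
  qed
  have v2: "valid_model (- 1, [(0, 5)], [(a, 2), (b, 2), (1/4, 1)], [:1/2, -5/2, 5/2:])"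
    if ab: "a * b = 1" "a + b = 3" for a b
  proof -
    have "fac [(a, 2), (b, 2), (1/4, 1)] = pcompose [:0, 0, 1:] [:1, - 3, 1:] * [:- (1/4), 1:]" unfolding fac_eq ab by simp
    moreover have "a \<noteq> b"
    proof
      assume "a = b"
      then have "(a + b)\<^sup>2 = 4 * (a * b)" by (simp add: power2_eq_square)
      then show False unfolding ab by (simp add: power2_eq_square)
    qed
    moreover have "a \<noteq> 1/4" "b \<noteq> 1/4"
    proof -
      have "(a - 1/4) * (b - 1/4) = a * b - (a + b) / 4 + 1/16" by (simp add: field_simps)
      then have e: "(a - 1/4) * (b - 1/4) = 5/16" unfolding ab by simp
      show "a \<noteq> 1/4" using e by (intro notI) simp
      show "b \<noteq> 1/4" using e by (intro notI) simp
    qed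
    moreover have "a \<noteq> 0" "b \<noteq> 0" using ab(1) by auto
    ultimately show ?thesis by (simp add: valid_model_def mult_in_def fac_eq square_quadratic pcompose_pCons power2_eq_square del: fac_simps)
  qed
  note fac_eval = fac_eq square_quadratic pcompose_pCons power2_eq_square power3_eq_cube power4_eq_xxxx
  show ?thesis
    using assms unfolding asymmetric_models_def symmetric_models_def
    apply (simp only: set_append list.set Un_iff insert_iff empty_iff)
    apply (elim disjE)
    subgoal by (elim Pair_inject) (simp only: v1[OF p1 s1])
    subgoal by (elim Pair_inject) (simp only: v2[OF p2 s2])
    subgoal by (simp add: valid_model_def mult_in_def fac_eval del: fac_simps One_nat_def)
    subgoal by (simp add: valid_model_def mult_in_def fac_eval del: fac_simps One_nat_def)
    subgoal by (simp add: valid_model_def mult_in_def fac_eval del: fac_simps One_nat_def)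
    subgoal by (simp add: valid_model_def mult_in_def fac_eval del: fac_simps One_nat_def)
    subgoal by simp
    subgoal using A7[OF _ rho(1)] by simp
    subgoal using A7[OF _ rho(2)] by simp
    subgoal by (simp add: valid_model_def mult_in_def fac_eval del: fac_simps One_nat_def)
    subgoal by (simp add: valid_model_def mult_in_def fac_eval del: fac_simps One_nat_def)
    subgoal by (simp add: valid_model_def mult_in_def fac_eval del: fac_simps One_nat_def)
    subgoal by (simp add: valid_model_def mult_in_def fac_eval del: fac_simps One_nat_def)
    subgoal by simp
    done
qed

lemma valid_model_swap:
  assumes "valid_model (- c, lp, lq, q)" shows "valid_model (c, lq, lp, q)"
proof -
  have s: "mult_in lp x < 4" if "(x, k) \<in> set lq" "4 \<le> k" for x k
  proof (rule ccontr)
    assume n: "\<not> mult_in lp x < 4"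
    then have "(x, mult_in lp x) \<in> set lp" using mult_in_memD[of lp x] by simp
    then have "mult_in lq x < 4" using assms n unfolding valid_model_def by force
    moreover have "mult_in lq x = k" using mult_in_mem that(1) assms unfolding valid_model_def by auto
    ultimately show False using that(2) by simp
  qed
  show ?thesis using assms s unfolding valid_model_def by auto
qed

lemma valid_models: "m \<in> set models \<Longrightarrow> valid_model m"
  unfolding models_def using valid_base_models valid_model_swap by fastforce

section \<open>Every maximal pair is equivalent to a model\<close>

context nform_data begin

lemma covered_by_complement:
  assumes "(c, lp, lq, q') \<in> set (asymmetric_models @ symmetric_models)" "affinely_equivalent g q (smult c (fac lp)) q'"
  shows "\<exists>(d, lg, lh, q')\<in>set models. affinely_equivalent h q (smult d (fac lh)) q'"
proof -
  have "q'\<^sup>2 = smult (- c) (fac lq) - smult (- c) (fac lp)" using valid_base_models[OF assms(1)] by (simp add: valid_model_def)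
  then have "q'\<^sup>2 - smult c (fac lp) = smult (- c) (fac lq)" by simp
  then have "affinely_equivalent h q (smult (- c) (fac lq)) q'" using affinely_equivalent_complement[OF assms(2)] by simp
  moreover have "(- c, lp, lq, q') \<in> set models" unfolding models_def using assms(1) by force
  ultimately show ?thesis by blast
qed

lemma covered_directly:
  assumes "(c, lp, lq, q') \<in> set asymmetric_models" "affinely_equivalent h q (smult c (fac lp)) q'"
  shows "\<exists>(d, lg, lh, q')\<in>set models. affinely_equivalent h q (smult d (fac lh)) q'"
proof -
  have "(c, lq, lp, q') \<in> set models" unfolding models_def using assms(1) by force
  then show ?thesis using assms(2) by blast
qed

lemma covered_by_g:
  assumes "affinely_equivalent g q (fac lp) q'" "(1, lp, q') \<in> (\<lambda>(c, lp, lq, q). (c, lp, q)) ` set (asymmetric_models @ symmetric_models)"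
  shows "\<exists>(d, lg, lh, q')\<in>set models. affinely_equivalent h q (smult d (fac lh)) q'"
proof -
  obtain lq where "(1, lp, lq, q') \<in> set (asymmetric_models @ symmetric_models)" using assms(2) by auto
  then show ?thesis by (rule covered_by_complement) (use assms(1) in \<open>simp only: smult_1_left\<close>)
qed

lemma covered_by_h:
  assumes "affinely_equivalent h q (fac lp) q'" "(1, lp, q') \<in> (\<lambda>(c, lp, lq, q). (c, lp, q)) ` set asymmetric_models"
  shows "\<exists>(d, lg, lh, q')\<in>set models. affinely_equivalent h q (smult d (fac lh)) q'"
proof -
  obtain lq where "(1, lp, lq, q') \<in> set asymmetric_models" using assms(2) by auto
  then show ?thesis by (rule covered_directly) (use assms(1) in \<open>simp only: smult_1_left\<close>)
qed

lemma lead_coeff_g: "lead_coeff g = - lead_coeff h"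
proof -
  have "degree (q\<^sup>2) \<le> 4" using deg_q degree_power_le[of q 2] by linarith
  then have "coeff (q\<^sup>2) 5 = 0" by (intro coeff_eq_0) simp
  then show ?thesis using deg_g deg_h by simp
qed

lemma model_coverage:
  assumes s: simple_data and n: "card {x. poly g x = 0} + card {x. poly h x = 0} = 4"
  shows "\<exists>(d, lg, lh, q')\<in>set models. affinely_equivalent h q (smult d (fac lh)) q'"
proof -
  note ms = asymmetric_models_def symmetric_models_def A7_model_def
  have pos: "card {x. poly p x = 0} \<noteq> 0" if "degree p = 5" for p :: "complex poly"
    using degree_5_factorization[OF that] by (metis length_0_conv list.map(1) sum_list.Nil zero_neq_numeral)
  define k where "k = lead_coeff h"
  have k: "k \<noteq> 0" unfolding k_def using h_nz by simp
  have lg: "lead_coeff g = - k" unfolding k_def by (rule lead_coeff_g)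
  have pairg: "quintic_pair g q (- k) l l'" if "g = smult (- k) (fac l)" "h = smult k (fac l')" for l l'
  proof (unfold_locales, goal_cases)
    case 2 show ?case using that(2) by (simp del: fac_simps)
  qed (use that k deg_q in auto)
  have pairh: "quintic_pair h q k l' l" if "g = smult (- k) (fac l)" "h = smult k (fac l')" for l l'
  proof (unfold_locales, goal_cases)
    case 2 show ?case by (rule that(1))
  qed (use that k deg_q in auto)
  consider "card {x. poly g x = 0} = 1" "card {x. poly h x = 0} = 3" | "card {x. poly g x = 0} = 3" "card {x. poly h x = 0} = 1"
     | "card {x. poly g x = 0} = 2" "card {x. poly h x = 0} = 2"
    using n pos[OF deg_g] pos[OF deg_h] by linarith
  then show ?thesis
  proof cases
    case 1
    obtain a where a: "g = smult (- k) (fac [(a, 5)])" using quintic_1_root[OF deg_g 1(1)] unfolding lg by blast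
    obtain b d e where b: "distinct [b, d, e]" "h = smult k (fac [(b, 3), (d, 1), (e, 1)]) \<or> h = smult k (fac [(b, 2), (d, 2), (e, 1)])"
      using quintic_3_roots[OF deg_h 1(2)] unfolding k_def by blast
    from b(2) show ?thesis
    proof
      assume "h = smult k (fac [(b, 3), (d, 1), (e, 1)])"
      from quintic_pair.pair_5_311[OF pairg[OF a this] refl refl b(1)]
      show ?thesis by (rule covered_by_g) (simp add: ms)
    next
      assume "h = smult k (fac [(b, 2), (d, 2), (e, 1)])"
      from quintic_pair.pair_5_221[OF pairg[OF a this] refl refl b(1)]
      show ?thesis by (elim disjE) (erule covered_by_g, simp add: ms)+
    qed
  next
    case 2
    obtain a where a: "h = smult k (fac [(a, 5)])" using quintic_1_root[OF deg_h 2(2)] unfolding k_def by blast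
    obtain b d e where b: "distinct [b, d, e]" "g = smult (- k) (fac [(b, 3), (d, 1), (e, 1)]) \<or> g = smult (- k) (fac [(b, 2), (d, 2), (e, 1)])"
      using quintic_3_roots[OF deg_g 2(1)] unfolding lg by blast
    from b(2) show ?thesis
    proof
      assume "g = smult (- k) (fac [(b, 3), (d, 1), (e, 1)])"
      from quintic_pair.pair_5_311[OF pairh[OF this a] refl refl b(1)]
      show ?thesis by (rule covered_by_h) (simp add: ms)
    next
      assume "g = smult (- k) (fac [(b, 2), (d, 2), (e, 1)])"
      from quintic_pair.pair_5_221[OF pairh[OF this a] refl refl b(1)]
      show ?thesis by (elim disjE) (erule covered_by_h, simp add: ms)+
    qed
  next
    case 3
    obtain a b where a: "a \<noteq> b" "g = smult (- k) (fac [(a, 4), (b, 1)]) \<or> g = smult (- k) (fac [(a, 3), (b, 2)])"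
      using quintic_2_roots[OF deg_g 3(1)] unfolding lg by blast
    obtain a' b' where b: "a' \<noteq> b'" "h = smult k (fac [(a', 4), (b', 1)]) \<or> h = smult k (fac [(a', 3), (b', 2)])"
      using quintic_2_roots[OF deg_h 3(2)] unfolding k_def by blast
    from a(2) b(2) show ?thesis
    proof (elim disjE)
      assume *: "g = smult (- k) (fac [(a, 4), (b, 1)])" "h = smult k (fac [(a', 4), (b', 1)])"
      \<comment> \<open>A common quadruple root is exactly what \<open>simple_data\<close>
        forbids.\<close>
      have "a \<noteq> a'"
      proof
        assume "a = a'"
        have "order a (smult (- k) (fac [(a, 4), (b, 1)])) = 4"
          using a(1) k by (subst order_smult_fac) (simp_all add: mult_in_def)
        from trans[OF arg_cong[OF *(1), of "order a"] this] have "order a g = 4" .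
        moreover have "order a (smult k (fac [(a', 4), (b', 1)])) = 4"
          using b(1) k \<open>a = a'\<close> by (subst order_smult_fac) (simp_all add: mult_in_def)
        from trans[OF arg_cong[OF *(2), of "order a"] this] have "order a h = 4" .
        ultimately have "4 \<le> order a g \<and> 4 \<le> order a h" by linarith
        then show False using s unfolding simple_data_def by blast
      qed
      from quintic_pair.pair_41_41[OF pairg[OF *] refl refl this]
      obtain \<rho> where r: "\<rho> = 2 + 2 * \<i> \<or> \<rho> = 2 - 2 * \<i>"
        "affinely_equivalent g q (smult \<rho> (fac [(0, 4), (1 - 1 / \<rho>, 1)])) [:1, - (\<rho> + 4) / 2, (\<rho> + 4) / 2:]" by blast
      have "A7_model \<rho> \<in> set (asymmetric_models @ symmetric_models)" using r(1) by (auto simp: symmetric_models_def)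
      then show ?thesis using covered_by_complement[OF _ r(2)] unfolding A7_model_def by blast
    next
      assume *: "g = smult (- k) (fac [(a, 4), (b, 1)])" "h = smult k (fac [(a', 3), (b', 2)])"
      from quintic_pair.pair_41_32[OF pairg[OF *] refl refl a(1) b(1)]
      show ?thesis by (elim disjE) (erule covered_by_g, simp add: ms)+
    next
      assume *: "g = smult (- k) (fac [(a, 3), (b, 2)])" "h = smult k (fac [(a', 4), (b', 1)])"
      from quintic_pair.pair_41_32[OF pairh[OF *] refl refl b(1) a(1)]
      show ?thesis by (elim disjE) (erule covered_by_h, simp add: ms)+
    next
      assume *: "g = smult (- k) (fac [(a, 3), (b, 2)])" "h = smult k (fac [(a', 3), (b', 2)])"
      show ?thesis
      proof (cases "a = a'")
        case True
        note * = *[folded True]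
        have "a \<noteq> b'" using b(1) True by simp
        from quintic_pair.pair_32_32_common[OF pairg[OF *] refl refl this]
        show ?thesis by (elim disjE) (erule covered_by_g, simp add: ms)+
      next
        case False
        from quintic_pair.pair_32_32_distinct[OF pairg[OF *] refl refl False a(1) b(1)]
        consider "affinely_equivalent g q (fac [(0, 3), (1, 2)]) [:0, -1, 1:]"
          | "affinely_equivalent g q (fac [(0, 3), (-3, 2)]) [:0, 1, 3:]"
          | "affinely_equivalent g q (fac [(0, 3), (5/9, 2)]) [:4/9, -5/3, 5/3:]" | "b = a'" "b' \<noteq> a"
          by argo
        then show ?thesis
        proof cases
          case 1 then show ?thesis by (rule covered_by_g) (simp add: ms)
        next
          case 2 then show ?thesis by (rule covered_by_g) (simp add: ms)
        next
          case 3 then show ?thesis by (rule covered_by_g) (simp add: ms)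
        next
          \<comment> \<open>For the interchanged quintics the coincidence pattern
            \<open>b = a'\<close>, \<open>b' \<noteq> a\<close> rules out every alternative except
            the one with the double root at -3.\<close>
          case 4
          with quintic_pair.pair_32_32_distinct[OF pairh[OF *] refl refl False[symmetric] b(1) a(1)]
          have "affinely_equivalent h q (fac [(0, 3), (-3, 2)]) [:0, 1, 3:]" by argo
          then show ?thesis by (rule covered_by_h) (simp add: ms)
        qed
      qed
    qed
  qed
qed

end

section \<open>Projective equivalence of normal forms\<close>

lemma homog_scale: "homog n p (t * x) (t * z) = t ^ n * homog n p x z"
proof -
  have "coeff p i * (t * x) ^ i * (t * z) ^ (n - i) = t ^ n * (coeff p i * x ^ i * z ^ (n - i))" if "i \<le> n" for i
  proof -
    have "t ^ n = t ^ i * t ^ (n - i)" using that by (simp flip: power_add)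
    then show ?thesis by (simp add: power_mult_distrib mult_ac)
  qed
  then show ?thesis unfolding homog_def sum_distrib_left by (intro sum.cong) auto
qed

lemma homog_zero: "homog n p x 0 = coeff p n * x ^ n"
proof -
  have "homog n p x 0 = (\<Sum>i\<le>n. if i = n then coeff p n * x ^ n else 0)"
    unfolding homog_def by (rule sum.cong) auto
  then show ?thesis by simp
qed

lemma coeff_pcompose_linear:
  fixes p :: "complex poly"
  assumes "degree p \<le> n" "a \<noteq> 0" shows "coeff (pcompose p [:b, a:]) n = coeff p n * a ^ n"
proof (cases "degree p = n")
  case True
  have "degree (pcompose p [:b, a:]) = n" using True assms by (simp add: degree_pcompose)
  moreover have "lead_coeff (pcompose p [:b, a:]) = lead_coeff p * a ^ degree p"
    using lead_coeff_comp[of "[:b, a:]" p] assms by simp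
  ultimately show ?thesis using True by simp
next
  case False
  then have "degree p < n" using assms by simp
  moreover from this have "degree (pcompose p [:b, a:]) < n" using assms by (simp add: degree_pcompose)
  ultimately show ?thesis by (simp add: coeff_eq_0)
qed

lemma homog_pcompose:
  assumes "degree p \<le> n" "a \<noteq> 0"
  shows "homog n (pcompose p [:b, a:]) x z = homog n p (a * x + b * z) z"
proof (cases "z = 0")
  case True
  then show ?thesis using coeff_pcompose_linear[OF assms] by (simp add: homog_zero power_mult_distrib)
next
  case False
  have e: "homog n r u z = z ^ n * poly r (u / z)" if "degree r \<le> n" for r u
    using homog_scale[of n r z "u / z" 1] homog_1[OF that] False by simp
  have "degree (pcompose p [:b, a:]) \<le> n" using pcompose_degree_le[OF assms(1)] .
  then show ?thesis using e assms(1) False by (simp add: poly_pcompose field_simps)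
qed

lemma homog_smult: "homog n (smult k p) x z = k * homog n p x z"
  unfolding homog_def by (simp add: sum_distrib_left mult_ac)

text \<open>Substituting \<open>y / k\<close> into the cubic in \<open>y\<close> and multiplying by
  \<open>k^3\<close> scales \<open>q\<close> by \<open>k\<close> and \<open>h\<close> by
  \<open>k^2\<close>; the affine change of \<open>x\<close> is linear in the homogeneous
  coordinates.\<close>

lemma affinely_equivalent_imp_proj_equiv:
  assumes "affinely_equivalent h q h' q'" "degree h \<le> 5" "degree q \<le> 2"
  shows "(nform q h, nform q' h') \<in> proj_equiv"
proof -
  obtain a b k where 1: "a \<noteq> 0" "k \<noteq> 0" "h' = smult (k\<^sup>2) (pcompose h [:b, a:])" "q' = smult k (pcompose q [:b, a:])"
    using assms(1) unfolding affinely_equivalent_def by blast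
  define M :: "complex^3^3" where "M = vector [vector [1 / k, 0, 0], vector [0, 1, 0], vector [0, b, a]]"
  have M: "M *v v = pt3 (v$1 / k) (v$2) (b * v$2 + a * v$3)" for v
    by (simp add: vec_eq_iff forall_3 matrix_vector_mult_nth3 M_def vector_3)
  have "invertible M" using 1 by (simp add: invertible_det_nz det_3 M_def vector_3)
  moreover have "nform q' h' v = k ^ 3 * nform q h (M *v v)" for v
    unfolding M nform_def pt3_nth 1(3,4) homog_smult homog_pcompose[OF assms(2) 1(1)] homog_pcompose[OF assms(3) 1(1)]
    using 1(2) by (simp add: field_simps eval_nat_numeral)
  ultimately show ?thesis unfolding proj_equiv_def using 1(2) by (auto intro!: exI[of _ M] exI[of _ "k ^ 3"])
qed

section \<open>Reducedness and maximality of the normal forms\<close>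

lemma square_factor_singular:
  assumes G: "hom_poly_fun a G" and H: "hom_poly_fun b H" and F: "\<And>x. F x = (G x)\<^sup>2 * H x" and p: "p \<noteq> 0" "G p = 0"
  shows "singular_at F p"
proof -
  obtain G' where G': "(G has_derivative G') (at p)" using hom_poly_fun_gradient[OF G] unfolding gradient_at_def by blast
  obtain H' where H': "(H has_derivative H') (at p)" using hom_poly_fun_gradient[OF H] unfolding gradient_at_def by blast
  have "((\<lambda>x. (G x * G x) * H x) has_derivative (\<lambda>w. (G p * G p) * H' w + (G p * G' w + G' w * G p) * H p)) (at p)"
    by (intro has_derivative_mult G' H')
  moreover have "F = (\<lambda>x. (G x * G x) * H x)" using F by (auto simp: power2_eq_square)
  ultimately show ?thesis using p unfolding singular_at_def by simp
qed

text \<open>All these lines pass through \<open>(1 : 0 : 1)\<close>, and the value of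
  \<open>G\<close> there is the coefficient of \<open>t^a\<close>. The restriction of
  \<open>G\<close> to each line is thus a nonconstant polynomial.\<close>

lemma hom_poly_fun_root_on_line:
  assumes G: "hom_poly_fun a G" and a: "a \<ge> 1" and nz: "G (pt3 1 0 1) \<noteq> 0"
  shows "\<exists>t. G (pt3 t 1 (t + s)) = 0"
proof -
  define M :: "complex^3^3" where "M = vector [vector [1, 0, 0], vector [0, 1, 0], vector [1, 0, 1]]"
  have M: "M *v pt3 x y z = pt3 x y (x + z)" for x y z
    by (simp add: vec_eq_iff forall_3 matrix_vector_mult_nth3 M_def vector_3)
  obtain c where c: "\<And>x. G (M *v x) = (\<Sum>i\<le>a. \<Sum>j\<le>a - i. c i j * (x$1)^i * (x$2)^j * (x$3)^(a - i - j))"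
    using hom_poly_fun_matrix[OF G, of M] unfolding hom_poly_fun_def by blast
  have "G (pt3 1 0 1) = G (M *v pt3 1 0 0)" by (simp add: M)
  also have "\<dots> = (\<Sum>i\<le>a. if i = a then c a 0 else 0)"
    unfolding c pt3_nth
  proof (rule sum.cong[OF refl])
    fix i assume i: "i \<in> {..a}"
    have "(\<Sum>j\<le>a - i. c i j * 1 ^ i * 0 ^ j * 0 ^ (a - i - j)) = (\<Sum>j\<le>a - i. if j = 0 then (if i = a then c a 0 else 0) else 0)"
      using i by (intro sum.cong) auto
    then show "(\<Sum>j\<le>a - i. c i j * 1 ^ i * 0 ^ j * 0 ^ (a - i - j)) = (if i = a then c a 0 else 0)" by simp
  qed
  finally have c0: "c a 0 \<noteq> 0" using nz by simp
  define p where "p = (\<Sum>i\<le>a. monom (\<Sum>j\<le>a - i. c i j * s ^ (a - i - j)) i)"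
  have "coeff p a = (\<Sum>i\<le>a. if i = a then c a 0 else 0)"
    unfolding p_def coeff_sum by (rule sum.cong) auto
  then have "coeff p a = c a 0" by simp
  then have "degree p > 0" using c0 a le_degree[of p a] by simp
  then obtain t where t: "poly p t = 0" using alg_closed_imp_poly_has_root by blast
  have "G (pt3 t 1 (t + s)) = G (M *v pt3 t 1 s)" by (simp add: M)
  also have "\<dots> = poly p t" unfolding c p_def poly_sum poly_monom pt3_nth
    by (intro sum.cong refl) (simp add: sum_distrib_left sum_distrib_right mult_ac)
  finally show ?thesis using t by auto
qed

context nform_data begin

text \<open>A square factor would have a zero on every line of the pencil, hence would produce
  infinitely many singular points.\<close>

lemma reduced: "reduced_eq F"
  unfolding reduced_eq_def
proof (intro notI, elim exE conjE)
  fix a b G H assume h: "a \<ge> 1" "hom_poly_fun a G" "hom_poly_fun b H" "\<forall>x. F x = (G x)\<^sup>2 * H x"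
  have "F (pt3 1 0 1) \<noteq> 0" using h5 by (simp add: nform_def homog_zero)
  then have "G (pt3 1 0 1) \<noteq> 0" using h(4) by auto
  then have "\<exists>t. G (pt3 t 1 (t + s)) = 0" for s by (rule hom_poly_fun_root_on_line[OF h(2,1)])
  then obtain t where t: "\<And>s. G (pt3 (t s) 1 (t s + s)) = 0" by metis
  have nz: "pt3 x 1 z \<noteq> 0" for x z by (metis pt3_nth(2) zero_index zero_neq_one)
  have "singular_at F (pt3 (t s) 1 (t s + s))" for s
    by (rule square_factor_singular[OF h(2,3) _ nz t]) (use h(4) in blast)
  then have "range (\<lambda>s. proj_pt (pt3 (t s) 1 (t s + s))) \<subseteq> sing_pts F" unfolding sing_pts_singular_at by blast
  then have "finite (range (\<lambda>s. proj_pt (pt3 (t s) 1 (t s + s))))" using finite_sing_pts finite_subset by blast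
  moreover have "inj (\<lambda>s. proj_pt (pt3 (t s) 1 (t s + s)))" by (rule injI) (auto simp: proj_pt_affine_eq)
  ultimately show False using finite_imageD infinite_UNIV_char_0 by blast
qed

lemma maximal_reducible:
  assumes "simple_data" "total_milnor F = 19"
  shows "F \<in> maximal_reducible_E8_sextics"
proof -
  have nz: "F (pt3 1 0 1) \<noteq> 0" using h5 by (simp add: nform_def homog_zero)
  have s: "sextic_eq F" unfolding sextic_eq_def using hom_poly_fun_nform nz by auto
  have v: "hom_poly_fun 1 (\<lambda>v. v $ 1)" using hom_poly_fun_linear_power[OF hom_poly_fun_const[of 1], of 1 1 0 0] by simp
  have "reducible_eq F" unfolding reducible_eq_def 
    by (rule exI[of _ 1], rule exI[of _ 5], rule exI[of _ "\<lambda>v. v $ 1"],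
        rule exI[of _ "\<lambda>v. (v$2)^3 * (v$1)^2 + 2 * (v$2)^2 * homog 2 q (v$3) (v$2) * v$1 + homog 5 h (v$3) (v$2)"])
      (use v hom_poly_fun_cubic_var[of q h] in \<open>simp add: nform_def\<close>)
  then show ?thesis unfolding maximal_reducible_E8_sextics_def
    using s reduced simple_data_imp_simple_sings[OF assms(1)] assms(2) sing_set_nform[OF assms(1)] by simp
qed

text \<open>\<open>line_type\<close> never yields E8; hence every projective equivalence of normal
  forms fixes \<open>(1 : 0 : 0)\<close>.\<close>

lemma E8_point_unique:
  assumes "simple_data" "P \<in> sing_pts F" "has_type F P E8"
  shows "P = proj_pt (pt3 1 0 0)"
proof (rule ccontr)
  assume "P \<noteq> proj_pt (pt3 1 0 0)"
  then consider x where "x \<in> on_line" "P = proj_pt (pt3 0 1 x)" | x where "x \<in> off_line" "P = proj_pt (pt3 (- poly q x) 1 x)"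
    using assms(2) unfolding sing_pts_nform by blast
  then show False
  proof cases
    case 1
    have "line_type (order x g) (order x h) = E8"
      by (rule has_type_unique[OF hom_poly_fun_nform]) (use type_on_line[OF assms(1) 1(1)] assms(3) 1(2) in auto)
    then show False by (auto simp: line_type_def split: if_splits)
  next
    case 2
    have "A (order x g - 1) = E8"
      by (rule has_type_unique[OF hom_poly_fun_nform]) (use type_off_line'[OF 2(1)] assms(3) 2(2) in auto)
    then show False by simp
  qed
qed

end

lemma maximal_reducible_model:
  assumes F: "F \<in> maximal_reducible_E8_sextics"
  shows "\<exists>m\<in>set models. (F, model_form m) \<in> proj_equiv"
proof -
  have h: "hom_poly_fun 6 F" "reducible_eq F" "simple_sings F" "total_milnor F = 19" "E8 \<in># sing_set F"
    using F unfolding maximal_reducible_E8_sextics_def sextic_eq_def by auto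
  obtain P where P: "P \<in># mset_set (sing_pts F)" "(THE t. has_type F P t) = E8" using h(5) unfolding sing_set_def by auto
  then have P': "P \<in> sing_pts F" by (cases "finite (sing_pts F)") auto
  then obtain p where p: "P = proj_pt p" unfolding sing_pts_def by blast
  obtain t where t: "has_type F P t" using h(3) P' unfolding simple_sings_def by blast
  then have "t = E8" using the_has_type[OF h(1), of p t] P(2) p by simp
  then have "has_type F (proj_pt p) E8" using t p by simp
  moreover obtain a b G H where "a \<ge> 1" "b \<ge> 1" "a + b = 6" "hom_poly_fun a G" "hom_poly_fun b H" "\<And>x. F x = G x * H x"
    using h(2) unfolding reducible_eq_def by blast
  ultimately obtain q k where k: "nform_data q k" "(F, nform q k) \<in> proj_equiv"
    using E8_normal_form[OF h(1), of G H a b p] by blast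
  interpret n: nform_data q k by (rule k(1))
  have "simple_sings (nform q k)" by (rule proj_equiv_sing(2)[OF k(2) h(3)])
  then have s: n.simple_data using n.simple_data_iff by blast
  have "total_milnor (nform q k) = 19" using h(4) proj_equiv_sing(1)[OF k(2)] unfolding total_milnor_def by simp
  then have "card {x. poly (q\<^sup>2 - k) x = 0} + card {x. poly k x = 0} = 4" using n.total_milnor_nform[OF s] by linarith
  from n.model_coverage[OF s this] obtain d lg lh q' where m: "(d, lg, lh, q') \<in> set models" "affinely_equivalent k q (smult d (fac lh)) q'"
    by auto
  have "(nform q k, model_form (d, lg, lh, q')) \<in> proj_equiv"
    using affinely_equivalent_imp_proj_equiv[OF m(2)] n.deg_h n.deg_q by (simp add: model_form_def)
  then have "(F, model_form (d, lg, lh, q')) \<in> proj_equiv"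
    using k(2) equiv_proj_equiv unfolding equiv_def trans_def by blast
  then show ?thesis using m(1) by blast
qed

lemma model_maximal_reducible: "m \<in> set models \<Longrightarrow> model_form m \<in> maximal_reducible_E8_sextics"
proof -
  assume "m \<in> set models"
  then have "valid_model m" by (rule valid_models)
  moreover obtain d lg lh q where m: "m = (d, lg, lh, q)" by (cases m)
  ultimately have v: "valid_model (d, lg, lh, q)" by simp
  interpret nform_data q "smult d (fac lh)" by (rule valid_model_nform(1)[OF v])
  show ?thesis using maximal_reducible valid_model_nform(2,4)[OF v] by (simp add: m model_form_def)
qed

section \<open>Equivalences between normal forms\<close>

text \<open>The third difference over 2, 1, 0, -1 is six times the cubic coefficient and annihilates
  the linear side.\<close>

lemma third_difference:
  assumes "\<And>Y::complex. c * (Y * (s * Y\<^sup>2 + t * Y + u)) = v * Y + w"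
  shows "c * s = 0"
proof -
  have "6 * (c * s) = c * (2 * (s * 2\<^sup>2 + t * 2 + u)) - 3 * (c * (1 * (s * 1\<^sup>2 + t * 1 + u))) + 3 * (c * (0 * (s * 0\<^sup>2 + t * 0 + u)))
     - c * ((-1) * (s * (-1)\<^sup>2 + t * (-1) + u))" by (simp add: algebra_simps)
  also have "\<dots> = 0" unfolding assms by (simp add: algebra_simps)
  finally show ?thesis by simp
qed

lemma proj_equiv_imp_affinely_equivalent:
  assumes n1: "nform_data q1 h1" and n2: "nform_data q2 h2" and s1: "nform_data.simple_data q1 h1"
    and e: "(nform q1 h1, nform q2 h2) \<in> proj_equiv"
  shows "affinely_equivalent h1 q1 h2 q2"
proof -
  interpret n1: nform_data q1 h1 by (rule n1)
  interpret n2: nform_data q2 h2 by (rule n2)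
  obtain M N c where h: "c \<noteq> 0" "\<And>x. nform q2 h2 x = c * nform q1 h1 (M *v x)" "\<And>x. nform q1 h1 x = inverse c * nform q2 h2 (N *v x)"
    "invertible M" "invertible N" "\<And>x. M *v (N *v x) = x" "\<And>x. N *v (M *v x) = x"
    by (rule proj_equivE[OF e]) (rule that; assumption)
  have P: "(\<lambda>x. M *v x) ` proj_pt (pt3 1 0 0) = proj_pt (pt3 1 0 0)"
  proof (rule n1.E8_point_unique[OF s1])
    show "(\<lambda>x. M *v x) ` proj_pt (pt3 1 0 0) \<in> sing_pts (nform q1 h1)"
      by (rule sing_pts_pullback[where F = "nform q1 h1" and G = "nform q2 h2" and M = M and N = N and c = c, OF h(2) h(3) h(1) h(6) h(7)]) (simp add: n2.sing_pts_nform)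
    show "has_type (nform q1 h1) ((\<lambda>x. M *v x) ` proj_pt (pt3 1 0 0)) E8"
      by (rule has_type_pullback[where F = "nform q1 h1" and M = M and c = c, OF h(2) h(1) h(4) n2.type_infinity])
  qed
  then obtain m where m: "M *v pt3 1 0 0 = m *s pt3 1 0 0" unfolding proj_pt_image using proj_pt_eqD by blast
  define m12 m13 m22 m23 m32 m33 where "m12 = M$1$2" and "m13 = M$1$3" and "m22 = M$2$2" and "m23 = M$2$3" and "m32 = M$3$2" and "m33 = M$3$3"
  have "M$1$1 = m" "M$2$1 = 0" "M$3$1 = 0"
    using m by (auto simp: vec_eq_iff forall_3 matrix_vector_mult_nth3)
  then have M: "M *v pt3 y z x = pt3 (m * y + m12 * z + m13 * x) (m22 * z + m23 * x) (m32 * z + m33 * x)" for x y z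
    by (simp add: vec_eq_iff forall_3 matrix_vector_mult_nth3 m12_def m13_def m22_def m23_def m32_def m33_def)
  have kernel: "v = 0" if "M *v v = 0" for v using h(7)[of v] that by (metis matrix_vector_mult_0_right)
  have ptz: "pt3 a b d = 0 \<longleftrightarrow> a = 0 \<and> b = 0 \<and> d = 0" for a b d by (simp add: vec_eq_iff forall_3)
  have m0: "m \<noteq> 0" using kernel[of "pt3 1 0 0"] by (auto simp: M ptz)
  \<comment> \<open>On \<open>z = 0\<close> the second sextic is linear in \<open>y\<close>, whereas
    a nonzero \<open>m23\<close> would produce a cubic term.\<close>
  have m23: "m23 = 0"
  proof -
    have 1: "c * (Y * (m23 ^ 3 * Y\<^sup>2 + (2 * m23\<^sup>2 * homog 2 q1 m33 m23) * Y + homog 5 h1 m33 m23)) = (coeff h2 5 / m) * Y + (- coeff h2 5 * m13 / m)" for Y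
    proof -
      have "nform q2 h2 (pt3 ((Y - m13) / m) 0 1) = c * nform q1 h1 (pt3 Y m23 m33)"
        unfolding h(2) M using m0 by simp
      then show ?thesis using m0 by (simp add: nform_def homog_zero field_simps)
    qed
    from third_difference[OF this] show ?thesis using h(1) by simp
  qed
  have m22: "m22 \<noteq> 0"
  proof
    assume "m22 = 0"
    then have "(M *v v) $ 2 = 0" for v using M[of "v$1" "v$2" "v$3"] m23 pt3_eta[of v] by simp
    then have "(pt3 0 1 0) $ 2 = 0" using h(6) by metis
    then show False by simp
  qed
  have m33: "m33 \<noteq> 0"
  proof
    assume "m33 = 0"
    then have "M *v pt3 (- m13) 0 m = 0" unfolding M by (simp add: m23 ptz)
    from kernel[OF this] show False using m0 by (simp add: ptz)
  qed
  define C \<mu> n n' a b where "C = c * m22 ^ 6" and "\<mu> = m / m22" and "n = m12 / m22" and "n' = m13 / m22" and "a = m33 / m22" and "b = m32 / m22"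
  have nz: "C \<noteq> 0" "\<mu> \<noteq> 0" "a \<noteq> 0" using h(1) m0 m22 m33 by (auto simp: C_def \<mu>_def a_def)
  have key: "y * (y\<^sup>2 + 2 * poly q2 x * y + poly h2 x) =
     C * ((\<mu> * y + (n + n' * x)) * ((\<mu> * y + (n + n' * x))\<^sup>2 + 2 * poly q1 (b + a * x) * (\<mu> * y + (n + n' * x)) + poly h1 (b + a * x)))" for x y
  proof -
    have "M *v pt3 y 1 x = m22 *s pt3 (\<mu> * y + (n + n' * x)) 1 (b + a * x)"
      unfolding M pt3_simps using m22 m23 by (simp add: \<mu>_def n_def n'_def a_def b_def field_simps)
    then have "nform q2 h2 (pt3 y 1 x) = C * nform q1 h1 (pt3 (\<mu> * y + (n + n' * x)) 1 (b + a * x))"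
      unfolding h(2) by (simp add: hom_poly_fun_scale[OF hom_poly_fun_nform] C_def)
    then show ?thesis unfolding n1.F_affine n2.F_affine .
  qed
  define L where "L = [:b, a:]"
  define w where "w = [:n, n':]"
  have pL: "poly (pcompose p L) x = poly p (b + a * x)" for p x by (simp add: L_def poly_pcompose mult.commute)
  \<comment> \<open>Setting \<open>y = 0\<close> in \<open>key\<close> makes a product of
    polynomials vanish. Its second factor has degree 5, because \<open>R\<close> of degree at most 3
    cannot cancel the composed quintic, so \<open>w = 0\<close> and the line is preserved.\<close>
  have w0: "w = 0"
  proof -
    define R where "R = w\<^sup>2 + smult 2 (pcompose q1 L) * w"
    have "degree (pcompose q1 L) \<le> 2" unfolding L_def by (rule pcompose_degree_le[OF n1.deg_q])
    moreover have "degree w \<le> 1" by (simp add: w_def)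
    ultimately have "degree (w\<^sup>2) \<le> 3" "degree (smult 2 (pcompose q1 L) * w) \<le> 3"
      using degree_power_le[of w 2] degree_mult_le[of "smult 2 (pcompose q1 L)" w] by simp_all
    then have "degree R \<le> 3" unfolding R_def by (rule degree_add_le)
    moreover have "degree (pcompose h1 L) = 5" using n1.deg_h nz(3) by (simp add: L_def degree_pcompose)
    ultimately have "degree (R + pcompose h1 L) = 5" by (subst degree_add_eq_right) auto
    then have "R + pcompose h1 L \<noteq> 0" by auto
    moreover have "w * (R + pcompose h1 L) = 0"
    proof (rule poly_ext)
      fix x show "poly (w * (R + pcompose h1 L)) x = poly 0 x"
      proof -
        have "(n + n' * x) * ((n + n' * x)\<^sup>2 + 2 * poly q1 (b + a * x) * (n + n' * x) + poly h1 (b + a * x)) = 0"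
          using key[of 0 x] nz(1) by simp
        moreover have "poly w x = n + n' * x" by (simp add: w_def)
        ultimately show ?thesis by (simp only: poly_mult poly_add poly_power poly_smult R_def pL poly_0)
      qed
    qed
    ultimately show ?thesis by simp
  qed
  then have n: "n = 0" "n' = 0" by (simp_all add: w_def)
  have 2: "y\<^sup>2 + 2 * poly q2 x * y + poly h2 x = C * \<mu> * (\<mu>\<^sup>2 * y\<^sup>2 + 2 * poly q1 (b + a * x) * \<mu> * y + poly h1 (b + a * x))" if "y \<noteq> 0" for x y
  proof -
    have "y * (y\<^sup>2 + 2 * poly q2 x * y + poly h2 x) = y * (C * \<mu> * (\<mu>\<^sup>2 * y\<^sup>2 + 2 * poly q1 (b + a * x) * \<mu> * y + poly h1 (b + a * x)))"
      using key[of y x] unfolding n by (simp add: algebra_simps power2_eq_square)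
    then show ?thesis using that by simp
  qed
  have d: "C * \<mu> ^ 3 = 1 \<and> poly q2 x = C * \<mu>\<^sup>2 * poly q1 (b + a * x) \<and> poly h2 x = C * \<mu> * poly h1 (b + a * x)" for x
  proof -
    define A2 A1 A0 where "A2 = 1 - C * \<mu> ^ 3" and "A1 = 2 * (poly q2 x - C * \<mu>\<^sup>2 * poly q1 (b + a * x))" and "A0 = poly h2 x - C * \<mu> * poly h1 (b + a * x)"
    have "A2 * y\<^sup>2 + A1 * y + A0 = 0" if "y \<noteq> 0" for y
      using 2[OF that, of x] by (simp add: A2_def A1_def A0_def algebra_simps power2_eq_square power3_eq_cube)
    \<comment> \<open>A nonzero \<open>y\<close> has been cancelled, so the coefficients are
      compared through three nonzero values.\<close>
    from this[of 1] this[of "-1"] this[of 2] have e: "A2 + A1 + A0 = 0" "A2 - A1 + A0 = 0" "4 * A2 + 2 * A1 + A0 = 0" by (simp_all add: mult.commute)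
    have "2 * A1 = (A2 + A1 + A0) - (A2 - A1 + A0)" by simp
    then have a1: "A1 = 0" unfolding e by simp
    have "3 * A2 = 0" using e(1,3) a1 by algebra
    then have "A2 = 0" by simp
    moreover from this have "A0 = 0" using e(1) a1 by simp
    ultimately show ?thesis using a1 by (simp add: A2_def A1_def A0_def)
  qed
  have c3: "C * \<mu> ^ 3 = 1" using d[of 0] by simp
  have k1: "C * \<mu>\<^sup>2 = 1 / \<mu>" "C * \<mu> = (1 / \<mu>)\<^sup>2" using c3 nz by (simp_all add: field_simps power2_eq_square power3_eq_cube)
  have "q2 = smult (1 / \<mu>) (pcompose q1 L)" by (rule poly_ext) (use d in \<open>simp add: pL k1\<close>)
  moreover have "h2 = smult ((1 / \<mu>)\<^sup>2) (pcompose h1 L)" by (rule poly_ext) (use d in \<open>simp add: pL k1\<close>)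
  moreover have "1 / \<mu> \<noteq> 0" using nz by simp
  ultimately show ?thesis unfolding affinely_equivalent_def L_def using nz(3) by blast
qed

text \<open>An equivalence must carry the quadruple root of \<open>q^2 - h\<close> to that of the
  other model and likewise for \<open>h\<close>. This fixes 0 and 1, so the affine map is the
  identity and the simple roots \<open>1 / \<rho>\<close> would have to agree.\<close>

lemma A7_models_not_equivalent:
  assumes v: "valid_model (- \<rho>, [(0, 4), (1 - 1 / \<rho>, 1)], [(1, 4), (1 / \<rho>, 1)], q)"
    and v': "valid_model (- \<rho>', [(0, 4), (1 - 1 / \<rho>', 1)], [(1, 4), (1 / \<rho>', 1)], q')" and ne: "\<rho> \<noteq> \<rho>'"
  shows "(model_form (- \<rho>, [(0, 4), (1 - 1 / \<rho>, 1)], [(1, 4), (1 / \<rho>, 1)], q),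
    model_form (- \<rho>', [(0, 4), (1 - 1 / \<rho>', 1)], [(1, 4), (1 / \<rho>', 1)], q')) \<notin> proj_equiv"
proof
  let ?h = "smult (- \<rho>) (fac [(1, 4), (1 / \<rho>, 1)])" and ?h' = "smult (- \<rho>') (fac [(1, 4), (1 / \<rho>', 1)])"
  let ?g = "smult \<rho> (fac [(0, 4), (1 - 1 / \<rho>, 1)])" and ?g' = "smult \<rho>' (fac [(0, 4), (1 - 1 / \<rho>', 1)])"
  assume e: "(model_form (- \<rho>, [(0, 4), (1 - 1 / \<rho>, 1)], [(1, 4), (1 / \<rho>, 1)], q),
    model_form (- \<rho>', [(0, 4), (1 - 1 / \<rho>', 1)], [(1, 4), (1 / \<rho>', 1)], q')) \<in> proj_equiv"
  have r: "\<rho> \<noteq> 0" "\<rho>' \<noteq> 0" "1 \<noteq> 1 / \<rho>" "1 \<noteq> 1 / \<rho>'" using v v' by (auto simp: valid_model_def)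
  have g: "q\<^sup>2 - ?h = ?g" "q'\<^sup>2 - ?h' = ?g'" using v v' by (simp_all add: valid_model_def del: fac_simps)
  have "affinely_equivalent ?h q ?h' q'"
    by (rule proj_equiv_imp_affinely_equivalent[OF valid_model_nform(1)[OF v] valid_model_nform(1)[OF v'] valid_model_nform(2)[OF v]])
      (use e in \<open>simp add: model_form_def del: fac_simps\<close>)
  then obtain a b k where 1: "a \<noteq> 0" "k \<noteq> 0" "?h' = smult (k\<^sup>2) (pcompose ?h [:b, a:])" "q' = smult k (pcompose q [:b, a:])"
    unfolding affinely_equivalent_def by blast
  have "?g' = smult (k\<^sup>2) (pcompose ?g [:b, a:])"
    unfolding g[symmetric] 1(4) 1(3) by (simp only: power2_eq_square pcompose_diff pcompose_mult smult_diff_right mult_smult_left mult_smult_right smult_smult)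
  then have g': "?g' = smult (k\<^sup>2 * (\<rho> * a ^ 5)) (fac [((0 - b) / a, 4), ((1 - 1 / \<rho> - b) / a, 1)])"
    unfolding pcompose_smult pcompose_fac[OF 1(1)] by (simp del: fac_simps)
  have h': "?h' = smult (k\<^sup>2 * (- \<rho> * a ^ 5)) (fac [((1 - b) / a, 4), ((1 / \<rho> - b) / a, 1)])"
    using 1(3) unfolding pcompose_smult pcompose_fac[OF 1(1)] by (simp del: fac_simps)
  have "mult_in [(0, 4), (1 - 1 / \<rho>', 1)] x = mult_in [((0 - b) / a, 4), ((1 - 1 / \<rho> - b) / a, 1)] x" for x
  proof -
    have "mult_in [(0, 4), (1 - 1 / \<rho>', 1)] x = order x ?g'" by (rule order_smult_fac[symmetric]) (use r in auto)
    also have "\<dots> = mult_in [((0 - b) / a, 4), ((1 - 1 / \<rho> - b) / a, 1)] x"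
      unfolding g' by (rule order_smult_fac) (use r 1 in \<open>auto simp: field_simps\<close>)
    finally show ?thesis .
  qed
  from this[of 0] have b: "b = 0" using 1(1) r by (auto simp: mult_in_def split: if_splits)
  have o: "mult_in [(1, 4), (1 / \<rho>', 1)] x = mult_in [((1 - b) / a, 4), ((1 / \<rho> - b) / a, 1)] x" for x
  proof -
    have "mult_in [(1, 4), (1 / \<rho>', 1)] x = order x ?h'" by (rule order_smult_fac[symmetric]) (use r in auto)
    also have "\<dots> = mult_in [((1 - b) / a, 4), ((1 / \<rho> - b) / a, 1)] x"
      unfolding h' by (rule order_smult_fac) (use r 1 in \<open>auto simp: field_simps\<close>)
    finally show ?thesis .
  qed
  from o[of 1] have a: "a = 1" using 1(1) r b by (auto simp: mult_in_def split: if_splits)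
  from o[of "1 / \<rho>'"] have "1 / \<rho> = 1 / \<rho>'" using r unfolding a b by (auto simp: mult_in_def split: if_splits)
  then show False using ne r by (simp add: field_simps)
qed

section \<open>Counting the classes\<close>

lemma map_model_sings:
  "map model_sings models =
     [{#E8, A 5, A 4, A 1, A 1#}, {#E8, A 4, A 3, A 3, A 1#}, {#E8, D 7, A 3, A 1#}, {#E8, A 5, A 3, A 3#},
      {#E8, D 6, A 5#}, {#E8, D 5, A 5, A 1#}, {#E8, A 7, A 3, A 1#}, {#E8, A 7, A 3, A 1#},
      {#E8, A 5, A 3, A 2, A 1#}, {#E8, E7, D 4#}, {#E8, E7, A 3, A 1#}, {#E8, D 6, D 5#},
      {#E8, A 9, A 2#}, {#E8, A 9, A 1, A 1#}, {#E8, D 10, A 1#}, {#E8, A 7, A 2, A 1, A 1#},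
      {#E8, D 8, A 2, A 1#}, {#E8, D 6, A 3, A 2#}]"
proof -
  have p1: "(- 95 + 9 * csqrt (- 15)) / 128 * ((- 95 - 9 * csqrt (- 15)) / 128) = 5/8"
    using csqrt_prod[of "-95" 9 "-15"] by simp
  have s1: "(- 95 + 9 * csqrt (- 15)) / 128 + (- 95 - 9 * csqrt (- 15)) / 128 = - 95/64" by (simp add: field_simps)
  have p2: "(3 + csqrt 5) / 2 * ((3 - csqrt 5) / 2) = 1" using csqrt_prod[of 3 1 5] by simp
  have m1: "model_sings (c, [(-1, 5)], [(0, 3), (a, 1), (b, 1)], q) = {#E8, A 5, A 4, A 1, A 1#}"
    "model_sings (c, [(0, 3), (a, 1), (b, 1)], [(-1, 5)], q) = {#E8, A 9, A 2#}"
    if ab: "a * b = 5/8" "a + b = - 95/64" for a b c q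
  proof -
    have "a \<noteq> 0" "b \<noteq> 0" using ab(1) by auto
    moreover have "(a + 1) * (b + 1) = a * b + (a + b) + 1" by (simp add: algebra_simps)
    then have e: "(a + 1) * (b + 1) = 9/64" unfolding ab by simp
    moreover have "a \<noteq> - 1" using e by (intro notI) simp
    moreover have "b \<noteq> - 1" using e by (intro notI) simp
    ultimately show "model_sings (c, [(-1, 5)], [(0, 3), (a, 1), (b, 1)], q) = {#E8, A 5, A 4, A 1, A 1#}"
      "model_sings (c, [(0, 3), (a, 1), (b, 1)], [(-1, 5)], q) = {#E8, A 9, A 2#}"
      by (simp_all add: model_sings_def mult_in_def line_type_def add_mset_commute)
  qed
  have m2: "model_sings (c, [(0, 5)], [(a, 2), (b, 2), (1/4, 1)], q) = {#E8, A 4, A 3, A 3, A 1#}"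
    "model_sings (c, [(a, 2), (b, 2), (1/4, 1)], [(0, 5)], q) = {#E8, A 9, A 1, A 1#}"
    if ab: "a * b = 1" for a b c q
  proof -
    have "a \<noteq> 0" "b \<noteq> 0" using ab(1) by auto
    then show "model_sings (c, [(0, 5)], [(a, 2), (b, 2), (1/4, 1)], q) = {#E8, A 4, A 3, A 3, A 1#}"
      "model_sings (c, [(a, 2), (b, 2), (1/4, 1)], [(0, 5)], q) = {#E8, A 9, A 1, A 1#}"
      by (simp_all add: model_sings_def mult_in_def line_type_def add_mset_commute)
  qed
  have m7: "model_sings (c, [(0, 4), (1 - 1 / \<rho>, 1)], [(1, 4), (1 / \<rho>, 1)], q) = {#E8, A 7, A 3, A 1#}"
    if "\<rho> \<noteq> 0" "\<rho> \<noteq> 1" for c \<rho> q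
    using that by (simp add: model_sings_def mult_in_def line_type_def add_mset_commute)
  have r: "2 + 2 * \<i> \<noteq> 0" "2 + 2 * \<i> \<noteq> 1" "2 - 2 * \<i> \<noteq> 0" "2 - 2 * \<i> \<noteq> 1" by (simp_all add: complex_eq_iff)
  show ?thesis
    unfolding models_def asymmetric_models_def symmetric_models_def A7_model_def
    apply (simp only: append.simps list.map prod.case m1[OF p1 s1] m2[OF p2] m7[OF r(1,2)] m7[OF r(3,4)])
    apply (simp add: model_sings_def mult_in_def line_type_def add_mset_commute)
    done
qed

text \<open>Summed over a multiset, the code is a decimal number whose digits are multiplicities,
  which reduces distinctness of the listed sets to arithmetic. E8 contributes 0 since each listed
  set contains it once.\<close>

definition type_code :: "sing_type \<Rightarrow> nat" where
  "type_code t = (case t of A n \<Rightarrow> 10 ^ n | D n \<Rightarrow> 10 ^ (n + 10) | E7 \<Rightarrow> 10 ^ 25 | _ \<Rightarrow> 0)"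

lemma sing_set_class:
  assumes "m \<in> set models" "F \<in> proj_equiv `` {model_form m}" shows "sing_set F = model_sings m"
proof -
  have "valid_model m" using valid_models assms(1) .
  then have "sing_set (model_form m) = model_sings m" using valid_model_nform(3) by (cases m) blast
  moreover have "(model_form m, F) \<in> proj_equiv" using assms(2) by blast
  ultimately show ?thesis using proj_equiv_sing(1) by metis
qed

lemma model_form_in_class: "model_form m \<in> proj_equiv `` {model_form m}"
  using equiv_proj_equiv by (meson UNIV_I equiv_class_self)

text \<open>\<open>rest\<close> omits the entry with index 7, the second A7 model. The 17 remaining
  models differ in their singularities, and the omitted one could only be equivalent to its
  conjugate at index 6.\<close>

lemma card_model_classes: "card ((\<lambda>m. proj_equiv `` {model_form m}) ` set models) = 18"
proof -
  define cls where "cls m = proj_equiv `` {model_form m}" for m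
  define rest where "rest = take 7 models @ drop 8 models"
  define n :: "complex \<Rightarrow> model" where
    "n \<rho> = (- \<rho>, [(0, 4), (1 - 1 / \<rho>, 1)], [(1, 4), (1 / \<rho>, 1)], [:1, - (\<rho> + 4) / 2, (\<rho> + 4) / 2:])" for \<rho>
  have sets: "set models = insert (n (2 - 2 * \<i>)) (set rest)" "n (2 + 2 * \<i>) \<in> set rest"
    unfolding rest_def models_def asymmetric_models_def symmetric_models_def A7_model_def n_def
    by (simp_all only: append.simps list.map prod.case numeral_eq_Suc pred_numeral_simps take_Suc_Cons drop_Suc_Cons take_0 drop_0) auto
  have S: "cls m = cls m' \<Longrightarrow> model_sings m = model_sings m'" if "m \<in> set models" "m' \<in> set models" for m m'
    using sing_set_class[OF that(1)] sing_set_class[OF that(2)] model_form_in_class[of m] unfolding cls_def by metis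
  have "map model_sings rest = take 7 (map model_sings models) @ drop 8 (map model_sings models)"
    by (simp add: rest_def take_map drop_map)
  then have "distinct (map (\<lambda>M. \<Sum>t\<in>#M. type_code t) (map model_sings rest))"
    unfolding map_model_sings by (simp add: type_code_def)
  then have d: "distinct (map model_sings rest)" by (simp only: distinct_map[of _ "map model_sings rest"])
  then have inj: "inj_on model_sings (set rest)" "distinct rest" by (simp_all add: distinct_map)
  have rm: "m \<in> set models" if "m \<in> set rest" for m using that sets(1) by blast
  have "inj_on cls (set rest)" using S rm inj(1) unfolding inj_on_def by blast
  then have "card (cls ` set rest) = length rest" using inj(2) by (simp add: card_image distinct_card)
  moreover have "length rest = 17" unfolding rest_def using arg_cong[OF map_model_sings, of length] by simp
  moreover have "cls (n (2 - 2 * \<i>)) \<notin> cls ` set rest"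
  proof
    assume "cls (n (2 - 2 * \<i>)) \<in> cls ` set rest"
    then obtain m where m: "m \<in> set rest" "cls (n (2 - 2 * \<i>)) = cls m" by blast
    have n2: "n (2 - 2 * \<i>) \<in> set models" "n (2 + 2 * \<i>) \<in> set models" using sets by blast+
    have "model_sings (n (2 - 2 * \<i>)) = model_sings m" using S[OF n2(1) rm[OF m(1)] m(2)] .
    moreover have "model_sings (n (2 - 2 * \<i>)) = model_sings (n (2 + 2 * \<i>))"
    proof -
      have "models ! 6 = n (2 + 2 * \<i>)" "models ! 7 = n (2 - 2 * \<i>)"
        unfolding models_def asymmetric_models_def symmetric_models_def A7_model_def n_def by simp_all
      moreover have "map model_sings models ! 6 = map model_sings models ! 7" unfolding map_model_sings by simp
      moreover have "length models = 18" using arg_cong[OF map_model_sings, of length] by simp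
      ultimately show ?thesis by simp
    qed
    ultimately have "m = n (2 + 2 * \<i>)" using inj(1) m(1) sets(2) unfolding inj_on_def by metis
    then have "cls (n (2 + 2 * \<i>)) = cls (n (2 - 2 * \<i>))" using m(2) by simp
    then have "(model_form (n (2 + 2 * \<i>)), model_form (n (2 - 2 * \<i>))) \<in> proj_equiv"
      using model_form_in_class[of "n (2 - 2 * \<i>)"] unfolding cls_def by blast
    moreover have "2 + 2 * \<i> \<noteq> 2 - 2 * \<i>" by (simp add: complex_eq_iff)
    ultimately show False using A7_models_not_equivalent valid_models[OF n2(2)] valid_models[OF n2(1)] unfolding n_def by blast
  qed
  ultimately have "card (insert (cls (n (2 - 2 * \<i>))) (cls ` set rest)) = 18" by simp
  then show ?thesis unfolding sets(1) cls_def by simp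
qed

theorem theorem1p1p2:
  shows "card (maximal_reducible_E8_sextics // proj_equiv) = 18 \<and>
    sing_set ` maximal_reducible_E8_sextics =
     { {#E8, A 5, A 3, A 3#},
       {#E8, A 7, A 3, A 1#},
       {#E8, A 7, A 2, A 1, A 1#},
       {#E8, A 5, A 4, A 1, A 1#},
       {#E8, A 5, A 3, A 2, A 1#},
       {#E8, A 4, A 3, A 3, A 1#},
       {#E8, A 9, A 2#},
       {#E8, A 9, A 1, A 1#},
       {#E8, D 8, A 2, A 1#},
       {#E8, D 7, A 3, A 1#},
       {#E8, D 6, A 3, A 2#},
       {#E8, D 10, A 1#},
       {#E8, D 6, A 5#},
       {#E8, D 5, A 5, A 1#},
       {#E8, E7, A 3, A 1#},
       {#E8, D 6, D 5#},
       {#E8, E7, D 4#} }"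
proof (rule conjI)
  have "maximal_reducible_E8_sextics // proj_equiv = (\<lambda>m. proj_equiv `` {model_form m}) ` set models"
  proof (intro equalityI subsetI)
    fix X assume "X \<in> maximal_reducible_E8_sextics // proj_equiv"
    then obtain F where F: "F \<in> maximal_reducible_E8_sextics" "X = proj_equiv `` {F}" by (rule quotientE)
    obtain m where m: "m \<in> set models" "(F, model_form m) \<in> proj_equiv" using maximal_reducible_model[OF F(1)] by blast
    have "X = proj_equiv `` {model_form m}" unfolding F(2) by (rule equiv_class_eq[OF equiv_proj_equiv m(2)])
    then show "X \<in> (\<lambda>m. proj_equiv `` {model_form m}) ` set models" using m(1) by (rule image_eqI)
  next
    fix X assume "X \<in> (\<lambda>m. proj_equiv `` {model_form m}) ` set models"
    then obtain m where m: "m \<in> set models" "X = proj_equiv `` {model_form m}" by (rule imageE)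
    show "X \<in> maximal_reducible_E8_sextics // proj_equiv" unfolding m(2) by (rule quotientI[OF model_maximal_reducible[OF m(1)]])
  qed
  then show "card (maximal_reducible_E8_sextics // proj_equiv) = 18" using card_model_classes by simp
next
  have "sing_set ` maximal_reducible_E8_sextics = set (map model_sings models)"
  proof (intro equalityI subsetI)
    fix X assume "X \<in> sing_set ` maximal_reducible_E8_sextics"
    then obtain F where F: "F \<in> maximal_reducible_E8_sextics" "X = sing_set F" by blast
    obtain m where m: "m \<in> set models" "(F, model_form m) \<in> proj_equiv" using maximal_reducible_model[OF F(1)] by blast
    have "X = model_sings m"
      unfolding F(2) proj_equiv_sing(1)[OF m(2)] by (rule sing_set_class[OF m(1) model_form_in_class])
    with m(1) show "X \<in> set (map model_sings models)" by simp
  next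
    fix X assume "X \<in> set (map model_sings models)"
    then obtain m where m: "m \<in> set models" "X = model_sings m" by auto
    then have "X = sing_set (model_form m)" using sing_set_class[OF m(1) model_form_in_class] by simp
    then show "X \<in> sing_set ` maximal_reducible_E8_sextics" using model_maximal_reducible[OF m(1)] by blast
  qed
  also have "\<dots> = { {#E8, A 5, A 3, A 3#},
       {#E8, A 7, A 3, A 1#},
       {#E8, A 7, A 2, A 1, A 1#},
       {#E8, A 5, A 4, A 1, A 1#},
       {#E8, A 5, A 3, A 2, A 1#},
       {#E8, A 4, A 3, A 3, A 1#},
       {#E8, A 9, A 2#},
       {#E8, A 9, A 1, A 1#},
       {#E8, D 8, A 2, A 1#},
       {#E8, D 7, A 3, A 1#},
       {#E8, D 6, A 3, A 2#},
       {#E8, D 10, A 1#},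
       {#E8, D 6, A 5#},
       {#E8, D 5, A 5, A 1#},
       {#E8, E7, A 3, A 1#},
       {#E8, D 6, D 5#},
       {#E8, E7, D 4#} }"
    unfolding map_model_sings by (intro equalityI; simp only: list.set insert_subset insert_iff simp_thms empty_subsetI)
  finally show "sing_set ` maximal_reducible_E8_sextics = \<dots>" .
qed

end
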